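(* Let $M>0$, let $K_1,K_2$ satisfy $$K_1\in C^4(\overline{\Omega'}\times\overline{\Omega'}),\ \|K_1\|_{C^4(\overline{\Omega'}\times\overline{\Omega'})}<M,\qquad K_2\in C^4(\overline\Omega\times\overline\Omega),\ \|K_2\|_{C^4(\overline\Omega\times\overline\Omega)}<M,$$ and let $a\in C^3(\overline\Omega)$, $s\in C^{2,1}(\overline Q_T)$ with $\|a\|_{C^3(\overline\Omega)}<M$, $\|s\|_{C^{2,1}(\overline Q_T)}<M$. Assume that there exist two vector functions $(u_i,m_i,b_i)\in Y_1(M)\times Y_2(M)$, $i=1,2$, such that $(u_i,m_i)$ satisfies the mean field games system (MFGS) of the context with $b=b_i$, and $$\begin{aligned}&u_i(x,0)=p_i(x),\quad m_i(x,0)=q_i(x),\quad x\in\Omega,\\&u_i(x,T)=F_i(x),\quad m_i(x,T)=G_i(x),\quad x\in\Omega,\\&u_i|_{S_T}=f_{0,i},\quad \partial_nu_i|_{S_T}=f_{1,i},\quad m_i|_{S_T}=g_{0,i},\quad \partial_nm_i|_{S_T}=g_{1,i}.\end{aligned}$$ Assume that the lateral Cauchy data are incomplete: $f_{0,i},f_{1,i},g_{0,i},g_{1,i}$ are known on $S_T\setminus\Gamma_T^-$ and unknown on $\Gamma_T^-$. Let $\delta\in(0,1)$ be a number characterizing the level of the error in the data, i.e. $$\begin{aligned}&\|p_1-p_2\|_{H^4(\Omega)}<\delta,\quad\|q_1-q_2\|_{H^3(\Omega)}<\delta,\quad\|F_1-F_2\|_{H^4(\Omega)}<\delta,\quad\|G_1-G_2\|_{H^3(\Omega)}<\delta,\\&\|\partial_tf_{0,1}-\partial_tf_{0,2}\|_{H^{2,1}(S_T\setminus\Gamma_T^-)}<\delta,\quad\|\partial_tf_{1,1}-\partial_tf_{1,2}\|_{H^{1,0}(S_T\setminus\Gamma_T^-)}<\delta,\\&\|\partial_tg_{0,1}-\partial_tg_{0,2}\|_{H^{2,1}(S_T\setminus\Gamma_T^-)}<\delta,\quad\|\partial_tg_{1,1}-\partial_tg_{1,2}\|_{H^{1,0}(S_T\setminus\Gamma_T^-)}<\delta.\end{aligned}$$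 In addition, assume that there exists a number $c>0$ such that $$\min_{(x,t)\in\overline Q_T}\Big|\int_{\Omega'}K_1(\overline x,\overline y)\,m_2(x_1,\overline y,t)\,d\overline y+\int_{x_1}^{A_1}\Big(\int_{\Omega'}K_2(x,y_1,\overline y)\,m_2(y_1,\overline y,t)\,d\overline y\Big)dy_1\Big|\ge c.$$ Let $\gamma\in(0,2A_1)$. Then there exist a sufficiently small number $\delta_0=\delta_0(M,c,\gamma,\Omega,T)\in(0,1)$ and a number $B=B(M,c,\gamma,\Omega,T)>0$, both depending only on the listed parameters, and a certain number $\alpha\in(0,1)$ (independent of $\delta$), such that for all $\delta\in(0,\delta_0)$ the following Hölder stability estimates are valid: $$\|\partial_t^ju_1-\partial_t^ju_2\|_{H^{2,1}(Q_{\gamma T})}\le B\delta^\alpha,\qquad\|\partial_t^jm_1-\partial_t^jm_2\|_{H^{2,1}(Q_{\gamma T})}\le B\delta^\alpha,\qquad j=0,1,$$ $$\|b_1-b_2\|_{L_2(\Omega_\gamma)}\le B\delta^\alpha.$$ In particular, the coefficient inverse problem with incomplete data (determine $b$ from $p,q,F,G$ on $\Omega$ and $f_0,f_1,g_0,g_1$ on $S_T\setminus\Gamma_T^-$) has at most one solution: if these data coincide for $i=1,2$, then $b_1=b_2$ in $\Omega$.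
   Context: Let $n\ge1$, $A_1,\dots,A_n>0$, $T>0$. For $x=(x_1,\dots,x_n)$ write $\overline x=(x_2,\dots,x_n)$. Put $\Omega=\{x:-A_i<x_i<A_i,\ i=1,\dots,n\}$, $\Omega'=\{\overline x:-A_i<x_i<A_i,\ i=2,\dots,n\}$, $Q_T=\Omega\times(0,T)$, $S_T=\partial\Omega\times(0,T)$; $\Gamma^\pm=\{x\in\partial\Omega:x_1=\pm A_1\}$, $\Gamma_T^\pm=\Gamma^\pm\times(0,T)$; $\partial_i^\pm\Omega_T=\{x\in\partial\Omega:x_i=\pm A_i\}\times(0,T)$ (so $\partial_1^\pm\Omega_T=\Gamma_T^\pm$). For $\gamma\in(0,2A_1)$, $\Omega_\gamma=\{x\in\Omega:x_1\in(-A_1+\gamma,A_1)\}$, $Q_{\gamma T}=\Omega_\gamma\times(0,T)$. $\partial_n$ is the outward normal derivative. All functions are real valued. (MFGS) The mean field games system with coefficient $b$ is, in $Q_T$, $$\begin{aligned}&u_t+\Delta u-\tfrac{a(x)}{2}|\nabla u|^2+b(x)\Big[\int_{\Omega'}K_1(\overline x,\overline y)m(x_1,\overline y,t)\,d\overline y+\int_{x_1}^{A_1}\Big(\int_{\Omega'}K_2(x,y_1,\overline y)m(y_1,\overline y,t)\,d\overline y\Big)dy_1\Big]+s(x,t)m=0,\\&m_t-\Delta m-\operatorname{div}\big(a(x)\,m\,\nabla u\big)=0.\end{aligned}$$ (This is the system with global interaction term $\int_\Omega K(x,y)m(y,t)\,dy$ for the kernel $K(x,y)=b(x)\{\delta(x_1-y_1)K_1(\overline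 x,\overline y)+H(y_1-x_1)K_2(x,y)\}$, with $\delta(\cdot)$ the delta function and $H$ the Heaviside function.) Spaces: $\|u\|_{C^{2k,k}(\overline Q_T)}=\max_{|\alpha|+2m\le2k}\|D_x^\alpha\partial_t^mu\|_{C(\overline Q_T)}$; $\|u\|^2_{H^{2k,k}(Q)}=\sum_{|\alpha|+2m\le2k}\|D^\alpha_x\partial_t^mu\|^2_{L_2(Q)}$ for $Q=Q_T$ or $Q_{\gamma T}$. On faces, $$\|u\|^2_{H^{2,1}(\partial_i^\pm\Omega_T)}=\sum_{j\ne i}\|u_{x_j}\|^2_{L_2(\partial_i^\pm\Omega_T)}+\sum_{(j,s)\ne(i,i)}\|u_{x_jx_s}\|^2_{L_2(\partial_i^\pm\Omega_T)}+\sum_{j=0}^1\|\partial_t^ju\|^2_{L_2(\partial_i^\pm\Omega_T)},$$ $$\|u\|^2_{H^{1,0}(\partial_i^\pm\Omega_T)}=\sum_{j\ne i}\|u_{x_j}\|^2_{L_2(\partial_i^\pm\Omega_T)}+\|u\|^2_{L_2(\partial_i^\pm\Omega_T)}.$$ Squared norms over $S_T\setminus\Gamma_T^-$ are sums of squared norms over all faces except $\Gamma_T^-$. When the $H^{2,1}$ norm is applied to Dirichlet data, the derivatives in it are those of the underlying function $u_i$ (or $m_i$), so mixed normal-tangential derivatives are tangential derivatives of the Neumann data. Sets: $Y_1(M)=\{(u,m):u,m\in C^{6,3}(\overline Q_T),\ \|u\|_{C^{6,3}(\overline Q_T)}<M,\ \|m\|_{C^{6,3}(\overline Q_T)}<M\}$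 and $Y_2(M)=\{b\in C^4(\overline\Omega):\|b\|_{C^4(\overline\Omega)}<M\}$. *)

theory Defs
  imports "HOL-Analysis.Analysis" "HOL-Library.Multiset"
begin

section \<open>Classical partial derivatives, \<open>C\<close> and Sobolev norms\<close>

text \<open>Partial derivative along \<open>v\<close>, relative to the set \<open>S\<close>: it only uses the values of \<open>f\<close> on \<open>S\<close>
  and is one-sided at boundary points of a closed box.\<close>

definition pd :: "'a::real_normed_vector set \<Rightarrow> 'a \<Rightarrow> ('a \<Rightarrow> real) \<Rightarrow> 'a \<Rightarrow> real" where
  "pd S v f z = vector_derivative (\<lambda>h. f (z + h *\<^sub>R v)) (at 0 within {h. z + h *\<^sub>R v \<in> S})"

definition has_pd :: "'a::real_normed_vector set \<Rightarrow> 'a \<Rightarrow> ('a \<Rightarrow> real) \<Rightarrow> bool" where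
  "has_pd S v f \<longleftrightarrow>
     (\<forall>z\<in>S. (\<lambda>h. f (z + h *\<^sub>R v)) differentiable (at 0 within {h. z + h *\<^sub>R v \<in> S}))"

definition pds :: "'a::real_normed_vector set \<Rightarrow> 'a list \<Rightarrow> ('a \<Rightarrow> real) \<Rightarrow> 'a \<Rightarrow> real" where
  "pds S vs f = foldr (pd S) vs f"

text \<open>\<open>D\<close> is the set of coordinate directions and \<open>w\<close> the order attached to each of them
  (2 for time in the parabolic classes, otherwise 1). The set \<open>S\<close> is a closed box below, where
  requiring one-sided derivatives up to the boundary is the same as requiring that the derivatives in
  the interior extend continuously.\<close>

definition C_class :: "'a::real_normed_vector set \<Rightarrow> 'a set \<Rightarrow> ('a \<Rightarrow> nat) \<Rightarrow> nat \<Rightarrow> ('a \<Rightarrow> real) set" where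
  "C_class S D w k = {f.
     (\<forall>vs. set vs \<subseteq> D \<and> (\<Sum>v\<leftarrow>vs. w v) \<le> k \<longrightarrow> continuous_on S (pds S vs f)) \<and>
     (\<forall>v vs. set (v # vs) \<subseteq> D \<and> (\<Sum>v\<leftarrow>v # vs. w v) \<le> k \<longrightarrow> has_pd S v (pds S vs f))}"

text \<open>A multi-index is a multiset of coordinate directions. The order in which the derivatives are
  taken is immaterial for the functions the norms are applied to.\<close>

definition multi_indices :: "'a set \<Rightarrow> ('a \<Rightarrow> nat) \<Rightarrow> nat \<Rightarrow> 'a multiset set" where
  "multi_indices D w k = {\<alpha>. set_mset \<alpha> \<subseteq> D \<and> (\<Sum>v\<in>#\<alpha>. w v) \<le> k}"

definition mpd :: "'a::real_normed_vector set \<Rightarrow> 'a multiset \<Rightarrow> ('a \<Rightarrow> real) \<Rightarrow> 'a \<Rightarrow> real" where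
  "mpd S \<alpha> f = pds S (SOME vs. mset vs = \<alpha>) f"

definition C_norm :: "'a::real_normed_vector set \<Rightarrow> 'a set \<Rightarrow> ('a \<Rightarrow> nat) \<Rightarrow> nat \<Rightarrow> ('a \<Rightarrow> real) \<Rightarrow> real" where
  "C_norm S D w k f = (MAX \<alpha>\<in>multi_indices D w k. SUP z\<in>S. \<bar>mpd S \<alpha> f z\<bar>)"

definition L2_sq :: "'a measure \<Rightarrow> 'a set \<Rightarrow> ('a \<Rightarrow> real) \<Rightarrow> real" where
  "L2_sq \<mu> S f = (LINT z:S|\<mu>. (f z)\<^sup>2)"

definition L2_norm :: "'a::euclidean_space set \<Rightarrow> ('a \<Rightarrow> real) \<Rightarrow> real" where
  "L2_norm S f = sqrt (L2_sq lborel S f)"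

definition H_norm :: "'a::euclidean_space set \<Rightarrow> ('a \<Rightarrow> nat) \<Rightarrow> nat \<Rightarrow> ('a \<Rightarrow> real) \<Rightarrow> real" where
  "H_norm S w k f = sqrt (\<Sum>\<alpha>\<in>multi_indices Basis w k. L2_sq lborel S (mpd S \<alpha> f))"

abbreviation isotropic :: "'a \<Rightarrow> nat" where
  "isotropic \<equiv> \<lambda>_. 1"

definition parabolic :: "'a::zero \<times> real \<Rightarrow> nat" where
  "parabolic v = (if snd v = 0 then 1 else 2)"

section \<open>Geometry\<close>

text \<open>The index \<open>\<iota>\<close> is the one of the coordinate \<open>x\<^sub>1\<close>. The space of the remaining
  coordinates, which is a single point if \<open>n = 1\<close>, is identified with the hyperplane
  \<open>x\<^sub>1 = 0\<close>: the point \<open>bar \<iota> x\<close> stands for \<open>(x\<^sub>2, \<dots>, x\<^sub>n)\<close>, and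
  \<open>y + r *\<^sub>R axis \<iota> 1\<close> for \<open>(r, y)\<close>.\<close>

definition Omega :: "real^'n::finite \<Rightarrow> (real^'n) set" where
  "Omega A = {x. \<forall>i. - A$i < x$i \<and> x$i < A$i}"

definition Omega' :: "real^'n::finite \<Rightarrow> 'n \<Rightarrow> (real^'n) set" where
  "Omega' A \<iota> = {y. y$\<iota> = 0 \<and> (\<forall>i. i \<noteq> \<iota> \<longrightarrow> - A$i < y$i \<and> y$i < A$i)}"

definition bar :: "'n \<Rightarrow> real^'n \<Rightarrow> real^'n" where
  "bar \<iota> x = (\<chi> i. if i = \<iota> then 0 else x$i)"

definition Omega_gamma :: "real^'n::finite \<Rightarrow> 'n \<Rightarrow> real \<Rightarrow> (real^'n) set" where
  "Omega_gamma A \<iota> \<gamma> = {x \<in> Omega A. - A$\<iota> + \<gamma> < x$\<iota> \<and> x$\<iota> < A$\<iota>}"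

definition Q_T :: "real^'n::finite \<Rightarrow> real \<Rightarrow> ((real^'n) \<times> real) set" where
  "Q_T A T = Omega A \<times> {0<..<T}"

definition Q_gammaT :: "real^'n::finite \<Rightarrow> 'n \<Rightarrow> real \<Rightarrow> real \<Rightarrow> ((real^'n) \<times> real) set" where
  "Q_gammaT A \<iota> \<gamma> T = Omega_gamma A \<iota> \<gamma> \<times> {0<..<T}"

definition S_T :: "real^'n::finite \<Rightarrow> real \<Rightarrow> ((real^'n) \<times> real) set" where
  "S_T A T = frontier (Omega A) \<times> {0<..<T}"

definition Gamma_minus_T :: "real^'n::finite \<Rightarrow> 'n \<Rightarrow> real \<Rightarrow> ((real^'n) \<times> real) set" where
  "Gamma_minus_T A \<iota> T = {x \<in> frontier (Omega A). x$\<iota> = - A$\<iota>} \<times> {0<..<T}"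

text \<open>The lateral face \<open>x\<^sub>i = \<sigma> A\<^sub>i\<close> with \<open>\<sigma> = \<plusminus>1\<close>, without the edges of the box: these
  have measure zero in the face, and the outward normal is not defined on them.\<close>

definition face_T :: "real^'n::finite \<Rightarrow> real \<Rightarrow> 'n \<Rightarrow> real \<Rightarrow> ((real^'n) \<times> real) set" where
  "face_T A T i \<sigma> =
     {x. x$i = \<sigma> * A$i \<and> (\<forall>j. j \<noteq> i \<longrightarrow> - A$j < x$j \<and> x$j < A$j)} \<times> {0<..<T}"

definition known_faces :: "'n \<Rightarrow> ('n \<times> real) set" where
  "known_faces \<iota> = (UNIV \<times> {-1, 1}) - {(\<iota>, -1)}"

text \<open>The \<open>(n-1)\<close>-dimensional Lebesgue measure of the hyperplane \<open>x\<^sub>i = r\<close>; for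
  \<open>n = 1\<close> it is the Dirac measure at \<open>r\<close>.\<close>

definition hyperplane_measure :: "'n::finite \<Rightarrow> real \<Rightarrow> (real^'n) measure" where
  "hyperplane_measure i r =
     distr (PiM (UNIV - {i}) (\<lambda>_. lborel)) borel (\<lambda>y. \<chi> j. if j = i then r else y j)"

definition dx :: "'n::finite \<Rightarrow> (real^'n) \<times> real" where
  "dx i = (axis i 1, 0)"

definition dt :: "(real^'n) \<times> real" where
  "dt = (0, 1)"

definition K1_dirs :: "'n::finite \<Rightarrow> ((real^'n) \<times> (real^'n)) set" where
  "K1_dirs \<iota> = {v \<in> Basis. fst v $ \<iota> = 0 \<and> snd v $ \<iota> = 0}"

section \<open>Norms on the lateral boundary\<close>

text \<open>Here \<open>v\<close> is defined on the closure of \<open>Q_T\<close>, so the mixed derivatives with one normal direction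
  make sense. For Dirichlet data, \<open>v\<close> is the function underlying the data.\<close>

definition H21_face_sq :: "real^'n::finite \<Rightarrow> real \<Rightarrow> 'n \<Rightarrow> real \<Rightarrow> ((real^'n) \<times> real \<Rightarrow> real) \<Rightarrow> real" where
  "H21_face_sq A T i \<sigma> v =
     (let Q = closure (Q_T A T);
          N = L2_sq (hyperplane_measure i (\<sigma> * A$i) \<Otimes>\<^sub>M lborel) (face_T A T i \<sigma>)
      in (\<Sum>j\<in>UNIV - {i}. N (pd Q (dx j) v))
       + (\<Sum>(j, s)\<in>UNIV - {(i, i)}. N (pd Q (dx s) (pd Q (dx j) v)))
       + (\<Sum>j\<in>{0, 1}. N ((pd Q dt ^^ j) v)))"

text \<open>Here \<open>g\<close> need only be defined on the face.\<close>

definition H10_face_sq :: "real^'n::finite \<Rightarrow> real \<Rightarrow> 'n \<Rightarrow> real \<Rightarrow> ((real^'n) \<times> real \<Rightarrow> real) \<Rightarrow> real" where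
  "H10_face_sq A T i \<sigma> g =
     (let S = face_T A T i \<sigma>;
          N = L2_sq (hyperplane_measure i (\<sigma> * A$i) \<Otimes>\<^sub>M lborel) S
      in (\<Sum>j\<in>UNIV - {i}. N (pd S (dx j) g)) + N g)"

definition dirichlet_t_dist :: "real^'n::finite \<Rightarrow> real \<Rightarrow> 'n \<Rightarrow>
    ((real^'n) \<times> real \<Rightarrow> real) \<Rightarrow> ((real^'n) \<times> real \<Rightarrow> real) \<Rightarrow> real" where
  "dirichlet_t_dist A T \<iota> v1 v2 =
     (let Q = closure (Q_T A T)
      in sqrt (\<Sum>(i, \<sigma>)\<in>known_faces \<iota>. H21_face_sq A T i \<sigma> (\<lambda>z. pd Q dt v1 z - pd Q dt v2 z)))"

definition neumann_t_dist :: "real^'n::finite \<Rightarrow> real \<Rightarrow> 'n \<Rightarrow>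
    ((real^'n) \<times> real \<Rightarrow> real) \<Rightarrow> ((real^'n) \<times> real \<Rightarrow> real) \<Rightarrow> real" where
  "neumann_t_dist A T \<iota> g1 g2 =
     sqrt (\<Sum>(i, \<sigma>)\<in>known_faces \<iota>.
       H10_face_sq A T i \<sigma> (\<lambda>z. pd (face_T A T i \<sigma>) dt g1 z - pd (face_T A T i \<sigma>) dt g2 z))"

section \<open>The mean field games system and the inverse problem\<close>

definition interaction :: "real^'n::finite \<Rightarrow> 'n \<Rightarrow> ((real^'n) \<times> (real^'n) \<Rightarrow> real) \<Rightarrow>
    ((real^'n) \<times> (real^'n) \<Rightarrow> real) \<Rightarrow> ((real^'n) \<times> real \<Rightarrow> real) \<Rightarrow> real^'n \<Rightarrow> real \<Rightarrow> real" where
  "interaction A \<iota> K1 K2 m x t =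
     (LINT y:Omega' A \<iota>|hyperplane_measure \<iota> 0.
        K1 (bar \<iota> x, y) * m (y + x$\<iota> *\<^sub>R axis \<iota> 1, t))
   + (LINT r:{x$\<iota>..A$\<iota>}|lborel.
        (LINT y:Omega' A \<iota>|hyperplane_measure \<iota> 0.
           K2 (x, y + r *\<^sub>R axis \<iota> 1) * m (y + r *\<^sub>R axis \<iota> 1, t)))"

definition solves_MFGS :: "real^'n::finite \<Rightarrow> real \<Rightarrow> 'n \<Rightarrow> ((real^'n) \<times> (real^'n) \<Rightarrow> real) \<Rightarrow>
    ((real^'n) \<times> (real^'n) \<Rightarrow> real) \<Rightarrow> (real^'n \<Rightarrow> real) \<Rightarrow> ((real^'n) \<times> real \<Rightarrow> real) \<Rightarrow>
    (real^'n \<Rightarrow> real) \<Rightarrow> ((real^'n) \<times> real \<Rightarrow> real) \<Rightarrow> ((real^'n) \<times> real \<Rightarrow> real) \<Rightarrow> bool" where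
  "solves_MFGS A T \<iota> K1 K2 a s b u m \<longleftrightarrow>
     (let Q = Q_T A T in \<forall>(x, t)\<in>Q.
        pd Q dt u (x, t) + (\<Sum>i\<in>UNIV. pd Q (dx i) (pd Q (dx i) u) (x, t))
          - a x / 2 * (\<Sum>i\<in>UNIV. (pd Q (dx i) u (x, t))\<^sup>2)
          + b x * interaction A \<iota> K1 K2 m x t + s (x, t) * m (x, t) = 0
      \<and> pd Q dt m (x, t) - (\<Sum>i\<in>UNIV. pd Q (dx i) (pd Q (dx i) m) (x, t))
          - (\<Sum>i\<in>UNIV. pd Q (dx i) (\<lambda>z. a (fst z) * m z * pd Q (dx i) u z) (x, t)) = 0)"

definition Y1 :: "real^'n::finite \<Rightarrow> real \<Rightarrow> real \<Rightarrow>
    (((real^'n) \<times> real \<Rightarrow> real) \<times> ((real^'n) \<times> real \<Rightarrow> real)) set" where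
  "Y1 A T M = {(u, m).
     u \<in> C_class (closure (Q_T A T)) Basis parabolic 6 \<and>
     m \<in> C_class (closure (Q_T A T)) Basis parabolic 6 \<and>
     C_norm (closure (Q_T A T)) Basis parabolic 6 u < M \<and>
     C_norm (closure (Q_T A T)) Basis parabolic 6 m < M}"

definition Y2 :: "real^'n::finite \<Rightarrow> real \<Rightarrow> (real^'n \<Rightarrow> real) set" where
  "Y2 A M = {b \<in> C_class (closure (Omega A)) Basis isotropic 4.
     C_norm (closure (Omega A)) Basis isotropic 4 b < M}"

definition admissible_coefficients :: "real^'n::finite \<Rightarrow> real \<Rightarrow> 'n \<Rightarrow> real \<Rightarrow>
    ((real^'n) \<times> (real^'n) \<Rightarrow> real) \<Rightarrow> ((real^'n) \<times> (real^'n) \<Rightarrow> real) \<Rightarrow> (real^'n \<Rightarrow> real) \<Rightarrow>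
    ((real^'n) \<times> real \<Rightarrow> real) \<Rightarrow> bool" where
  "admissible_coefficients A T \<iota> M K1 K2 a s \<longleftrightarrow>
     K1 \<in> C_class (closure (Omega' A \<iota>) \<times> closure (Omega' A \<iota>)) (K1_dirs \<iota>) isotropic 4 \<and>
     C_norm (closure (Omega' A \<iota>) \<times> closure (Omega' A \<iota>)) (K1_dirs \<iota>) isotropic 4 K1 < M \<and>
     K2 \<in> C_class (closure (Omega A) \<times> closure (Omega A)) Basis isotropic 4 \<and>
     C_norm (closure (Omega A) \<times> closure (Omega A)) Basis isotropic 4 K2 < M \<and>
     a \<in> C_class (closure (Omega A)) Basis isotropic 3 \<and>
     C_norm (closure (Omega A)) Basis isotropic 3 a < M \<and>
     s \<in> C_class (closure (Q_T A T)) Basis parabolic 2 \<and>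
     C_norm (closure (Q_T A T)) Basis parabolic 2 s < M"

definition has_data :: "real^'n::finite \<Rightarrow> real \<Rightarrow> ((real^'n) \<times> real \<Rightarrow> real) \<Rightarrow>
    (real^'n \<Rightarrow> real) \<Rightarrow> (real^'n \<Rightarrow> real) \<Rightarrow>
    ((real^'n) \<times> real \<Rightarrow> real) \<Rightarrow> ((real^'n) \<times> real \<Rightarrow> real) \<Rightarrow> bool" where
  "has_data A T v v\<^sub>0 v\<^sub>T d\<^sub>0 d\<^sub>1 \<longleftrightarrow>
     (\<forall>x\<in>Omega A. v (x, 0) = v\<^sub>0 x \<and> v (x, T) = v\<^sub>T x) \<and>
     (\<forall>z\<in>S_T A T. v z = d\<^sub>0 z) \<and>
     (\<forall>i. \<forall>\<sigma>\<in>{-1, 1}. \<forall>z\<in>face_T A T i \<sigma>. \<sigma> * pd (closure (Q_T A T)) (dx i) v z = d\<^sub>1 z)"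

end

(* The difference of two solutions is differentiated in time, v = d/dt (u1 - u2), w = d/dt (m1 - m2), and both
   heat operators are treated by one Carleman estimate with the time-independent weight exp (mu y^2),
   y = x1 + A1 + 1. The unknown b1 - b2 is eliminated by evaluating the equation for u at t = 0, where
   |m2-interaction| >= c, so it is controlled by v (., 0); the Volterra part of the interaction integrates over y1 >= x1
   and is therefore bounded in the weighted norm. The boundary terms of v at t = 0, T do not vanish,
   but v + (b1 - b2) g is small there, g being the interaction of m2; multiplying v by a factor r interpolating in time
   between 1 and g (., 0) / g (., T) makes the values at both ends almost equal, which is all the estimate needs.
   Choosing mu proportional to log (1 / error) gives the Hoelder rate in L2. Interpolation between an L2 bound and the a priori
   C^6 bounds turns small L2 norms into small sup norms of all derivatives involved, so only the lowest-order
   terms of the data norms are used. *)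
theory Submission
  imports Defs
begin

text \<open>The two equations run in opposite time directions, and the second contains the Laplacian
  of u, which is of the order of its principal part. A weight depending on x1 alone serves both
  directions (\<open>sg\<close> is 1 or -1) and commutes with time derivatives, but it does not
  decay at t = 0 and t = T, so the contributions of the two ends have to cancel. The Laplacian of v
  is exchanged for the time derivative of v by means of the first equation. For that derivative,
  which the trace of v at t = 0 costs as well, the Carleman estimate offers only the factor 1 / mu.
  The loss is one power of mu on the right side, harmless against the gain exp (-4 gam mu) on x1 >=
  -A1 + gam. On the unknown face x1 = -A1 the functions are merely bounded, but there the weight has
  its minimum; this decides the shape of \<open>Rem\<close>. All constants have to be fixed before
  the two solutions are, which is why most lemmas have existential constants in front of universally
  quantified functions.\<close>

notation abs (\<open>|_|\<close>)

abbreviation Sum_UNIV (binder \<open>SS \<close> 10) where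
 "Sum_UNIV f \<equiv> sum f UNIV"

section \<open>Directional derivatives relative to a set\<close>

abbreviation "at_line S v z \<equiv> at (0::real) within {h. z + h *\<^sub>R v : S}"

text \<open>A relation in place of the function \<open>pd\<close>: sums, products and compositions
  can be differentiated without first showing existence or uniqueness of a limit. Where the line
  through \<open>z\<close> meets \<open>S\<close> only in \<open>z\<close> it holds for every
  \<open>f'\<close>, so the way back to \<open>pd\<close> goes through a limit point, see
  \<open>pd_hpd\<close>.\<close>

definition hpd :: "'a::real_normed_vector set => 'a => ('a => real) => ('a => real) => bool" where
 "hpd S v f f' \<longleftrightarrow>
   (ALL z:S. ((%h. f (z + h *\<^sub>R v)) has_real_derivative f' z) (at_line S v z))"

lemma hpdD:
 "hpd S v f f' ==> z : S ==>
   ((%h. f (z + h *\<^sub>R v)) has_real_derivative f' z) (at_line S v z)"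
 by (simp add: hpd_def)

lemma hpd_const [simp]: "hpd S v (%_. c) (%_. 0)"
 by (simp add: hpd_def)

lemma hpd_add: "hpd S v f f' ==> hpd S v g g' ==> hpd S v (%z. f z + g z) (%z. f' z + g' z)"
 by (auto simp: hpd_def intro!: DERIV_add)

lemma hpd_diff: "hpd S v f f' ==> hpd S v g g' ==> hpd S v (%z. f z - g z) (%z. f' z - g' z)"
 by (auto simp: hpd_def intro!: DERIV_diff)

lemma hpd_minus: "hpd S v f f' ==> hpd S v (%z. - f z) (%z. - f' z)"
 by (auto simp: hpd_def intro!: DERIV_minus)

lemma hpd_mult:
 assumes "hpd S v f f'" "hpd S v g g'"
 shows "hpd S v (%z. f z * g z) (%z. f' z * g z + f z * g' z)"
 unfolding hpd_def
proof
 fix z assume "z : S"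
 from DERIV_mult[OF hpdD[OF assms(1) this] hpdD[OF assms(2) this]]
 show "((%h. f (z + h *\<^sub>R v) * g (z + h *\<^sub>R v)) has_real_derivative f' z * g z + f z * g' z)
   (at_line S v z)"
  by (simp add: mult.commute)
qed

lemma hpd_cmult: "hpd S v f f' ==> hpd S v (%z. c * f z) (%z. c * f' z)"
 using hpd_mult[OF hpd_const[of S v c]] by simp

lemma hpd_sum:
 assumes "!!i. i : I ==> hpd S v (f i) (f' i)"
 shows "hpd S v (%z. \<Sum>i\<in>I. f i z) (%z. \<Sum>i\<in>I. f' i z)"
 unfolding hpd_def by (auto intro!: DERIV_sum hpdD assms)

lemma hpd_power2:
 assumes "hpd S v f f'"
 shows "hpd S v (%z. (f z)^2) (%z. 2 * f z * f' z)"
 using hpd_mult[OF assms assms] by (simp add: power2_eq_square algebra_simps)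

lemma hpd_divide:
 assumes "hpd S v f f'" "hpd S v g g'" "!!z. z : S ==> g z ~= 0"
 shows "hpd S v (%z. f z / g z) (%z. (f' z * g z - f z * g' z) / (g z * g z))"
 unfolding hpd_def
proof
 fix z assume z: "z : S"
 from DERIV_divide[OF hpdD[OF assms(1) z] hpdD[OF assms(2) z]] assms(3)[OF z]
 show "((%h. f (z + h *\<^sub>R v) / g (z + h *\<^sub>R v)) has_real_derivative
   (f' z * g z - f z * g' z) / (g z * g z)) (at_line S v z)"
  by simp
qed

lemma hpd_chain:
 assumes "hpd S v f f'" "!!z. z : S ==> (k has_real_derivative k' (f z)) (at (f z))"
 shows "hpd S v (%z. k (f z)) (%z. k' (f z) * f' z)"
 unfolding hpd_def
proof
 fix z assume z: "z : S"
 from assms(2)[OF z] have "(k has_real_derivative k' (f z)) (at (f (z + 0 *\<^sub>R v)))" by simp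
 from DERIV_chain2[OF this hpdD[OF assms(1) z]]
 show "((%h. k (f (z + h *\<^sub>R v))) has_real_derivative k' (f z) * f' z)
   (at_line S v z)" .
qed

lemma hpd_cong:
 assumes "hpd S v f f'" "!!z. z : S ==> f z = g z" "!!z. z : S ==> f' z = g' z"
 shows "hpd S v g g'"
 unfolding hpd_def
proof
 fix z assume z: "z : S"
 have "((%h. f (z + h *\<^sub>R v)) has_real_derivative g' z) (at_line S v z)"
  using hpdD[OF assms(1) z] assms(3)[OF z] by simp
 then show "((%h. g (z + h *\<^sub>R v)) has_real_derivative g' z) (at_line S v z)"
  by (rule has_field_derivative_transform_within[where d=1]) (use z assms(2) in auto)
qed

lemma hpd_cong1: "hpd S v f f' ==> (!!z. z : S ==> f' z = g' z) ==> hpd S v f g'"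
 by (erule hpd_cong) auto

lemma hpd_subset: "hpd S v f f' ==> R \<subseteq> S ==> hpd R v f f'"
 unfolding hpd_def by (blast intro: DERIV_subset)

lemma has_pd_hpd: "has_pd S v f ==> hpd S v f (pd S v f)"
 unfolding has_pd_def hpd_def pd_def has_real_derivative_iff_has_vector_derivative
 by (blast intro: vector_derivative_works[THEN iffD1])

lemma pd_hpd:
 assumes "hpd S v f f'" "z : S" "0 islimpt {h. z + h *\<^sub>R v : S}"
 shows "pd S v f z = f' z"
 unfolding pd_def
 using hpdD[OF assms(1,2)] assms(3)
 by (intro vector_derivative_within) (auto simp: has_real_derivative_iff_has_vector_derivative trivial_limit_within)

text \<open>Two functions that agree on \<open>S\<close> have the same candidates for a derivative,
  so the choice inside \<open>vector_derivative\<close> picks the same one, even where no derivative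
  exists.\<close>

lemma pd_cong:
 assumes "!!z. z : S ==> f z = g z" "z : S"
 shows "pd S v f z = pd S v g z"
proof -
 have *: "((%h. g (z + h *\<^sub>R v)) has_vector_derivative d) (at_line S v z)"
  if "((%h. f (z + h *\<^sub>R v)) has_vector_derivative d) (at_line S v z)"
   "!!z. z : S ==> f z = g z" for f g :: "'a => real" and d
  using that(1) by (rule has_vector_derivative_transform_within[where d=1]) (use assms that in auto)
 have "((%h. f (z + h *\<^sub>R v)) has_vector_derivative d) (at_line S v z) =
  ((%h. g (z + h *\<^sub>R v)) has_vector_derivative d) (at_line S v z)" for d
  using *[of f d g] *[of g d f] assms(1) by auto
 then show ?thesis unfolding pd_def vector_derivative_def by simp
qed

section \<open>Coordinate lines in a box\<close>

text \<open>A coordinate is replaced rather than incremented: along a line \<open>f\<close> becomes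
  a function on the fixed interval between the two faces of the box, to which calculus in one
  variable applies.\<close>

definition upd :: "'a::euclidean_space => real => 'a => 'a" where
 "upd i s z = z + (s - z \<bullet> i) *\<^sub>R i"

lemma upd_inner: "i : Basis ==> j : Basis ==> upd i s z \<bullet> j = (if j = i then s else z \<bullet> j)"
 by (auto simp: upd_def inner_add_left inner_Basis)

lemma upd_self [simp]: "upd i (z \<bullet> i) z = z"
 by (simp add: upd_def)

lemma upd_upd [simp]: "i : Basis ==> upd i s (upd i r z) = upd i s z"
 by (simp add: upd_def algebra_simps inner_add_left)

lemma upd_cbox: "i : Basis ==> z : cbox a b ==> a \<bullet> i <= s ==> s <= b \<bullet> i ==> upd i s z : cbox a b"
 by (auto simp: mem_box upd_inner)

lemma upd_add: "i : Basis ==> upd i s z + h *\<^sub>R i = upd i (s + h) z"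
 by (simp add: upd_def algebra_simps)

lemma upd_cbox_iff:
 "i : Basis ==> z : cbox a b ==> upd i s z : cbox a b \<longleftrightarrow> s : {a \<bullet> i..b \<bullet> i}"
 using upd_inner[of i i s z] by (auto simp: upd_cbox) (auto simp: mem_box)

lemma continuous_on_upd [continuous_intros]:
 "continuous_on S f ==> continuous_on S g ==> continuous_on S (%x. upd i (f x) (g x))"
 unfolding upd_def by (intro continuous_intros)

lemma hpd_line:
 assumes "hpd (cbox a b) i f f'" "i : Basis" "z : cbox a b" "s : {a \<bullet> i..b \<bullet> i}"
 shows "((%s. f (upd i s z)) has_real_derivative f' (upd i s z)) (at s within {a \<bullet> i..b \<bullet> i})"
proof -
 have m: "upd i s z : cbox a b" using assms by (auto intro: upd_cbox)
 have 1: "{h. upd i s z + h *\<^sub>R i : cbox a b} = {h. s + h : {a \<bullet> i..b \<bullet> i}}"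
  using assms by (simp add: upd_add upd_cbox_iff)
 have 2: "(+) s ` {h. s + h : {a \<bullet> i..b \<bullet> i}} = {a \<bullet> i..b \<bullet> i}"
  by (auto simp: image_iff) (metis add.commute diff_add_cancel)
 have "((%h. f (upd i (s + h) z)) has_real_derivative f' (upd i s z))
   (at 0 within {h. s + h : {a \<bullet> i..b \<bullet> i}})"
  using hpdD[OF assms(1) m] unfolding 1 unfolding upd_add[OF assms(2)] .
 then have "((%s. f (upd i s z)) has_real_derivative f' (upd i s z))
   (at (s + 0) within (+) s ` {h. s + h : {a \<bullet> i..b \<bullet> i}})"
  by (subst DERIV_at_within_shift)
 then show ?thesis unfolding 2 by simp
qed

lemma islimpt_cbox_line:
 assumes "i : Basis" "z : cbox a b" "a \<bullet> i < b \<bullet> i"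
 shows "0 islimpt {h. z + h *\<^sub>R i : cbox a b}"
proof -
 have "{h. z + h *\<^sub>R i : cbox a b} = {h. z \<bullet> i + h : {a \<bullet> i..b \<bullet> i}}"
  using upd_add[OF assms(1), of "z \<bullet> i" z] assms by (simp add: upd_cbox_iff)
 also have "... = {a \<bullet> i - z \<bullet> i..b \<bullet> i - z \<bullet> i}" by auto
 finally have *: "{h. z + h *\<^sub>R i : cbox a b} = {a \<bullet> i - z \<bullet> i..b \<bullet> i - z \<bullet> i}" .
 have "a \<bullet> i <= z \<bullet> i" "z \<bullet> i <= b \<bullet> i" using assms by (auto simp: mem_box)
 then show ?thesis unfolding * using assms(3) by (simp add: islimpt_Icc)
qed

lemma hpd_unique:
 assumes "hpd (cbox a b) i f f'" "hpd (cbox a b) i f f''" "i : Basis" "z : cbox a b" "a \<bullet> i < b \<bullet> i"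
 shows "f' z = f'' z"
 using pd_hpd[OF assms(1) assms(4) islimpt_cbox_line] pd_hpd[OF assms(2) assms(4) islimpt_cbox_line] assms
 by simp

lemma hpd_mvt:
 assumes "hpd (cbox a b) i f f'" "i : Basis" "z : cbox a b" "a \<bullet> i <= s" "s < t" "t <= b \<bullet> i"
 obtains \<xi> where "s < \<xi>" "\<xi> < t" "f (upd i t z) - f (upd i s z) = (t - s) * f' (upd i \<xi> z)"
proof -
 have "EX \<xi>:{s<..<t}. f (upd i t z) - f (upd i s z) = f' (upd i \<xi> z) * (t - s)"
 proof (rule mvt_simple[OF \<open>s < t\<close>])
  fix x assume x: "s <= x" "x <= t"
  have "((%s. f (upd i s z)) has_real_derivative f' (upd i x z)) (at x within {a \<bullet> i..b \<bullet> i})"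
   by (rule hpd_line[OF assms(1,2,3)]) (use x assms in auto)
  then have "((%s. f (upd i s z)) has_real_derivative f' (upd i x z)) (at x within {s..t})"
   by (rule DERIV_subset) (use assms in auto)
  then show "((%s. f (upd i s z)) has_derivative (*) (f' (upd i x z))) (at x within {s..t})"
   by (simp add: has_field_derivative_def)
 qed
 then show ?thesis using that by (auto simp: mult.commute)
qed

lemma hpd_Lipschitz_line:
 assumes "hpd (cbox a b) i f f'" "i : Basis" "z : cbox a b" "s : {a \<bullet> i..b \<bullet> i}"
  "!!z. z : cbox a b ==> |f' z| <= M"
 shows "|f (upd i s z) - f z| <= M * |s - z \<bullet> i|"
proof -
 have zi: "z \<bullet> i : {a \<bullet> i..b \<bullet> i}" using assms(2,3) by (auto simp: mem_box)
 have up: "upd i \<xi> z : cbox a b" if "min s (z \<bullet> i) <= \<xi>" "\<xi> <= max s (z \<bullet> i)" for \<xi>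
  by (rule upd_cbox) (use that zi assms in auto)
 consider "s < z \<bullet> i" | "s = z \<bullet> i" | "z \<bullet> i < s" by linarith
 then show ?thesis
 proof cases
  case 1
  obtain \<xi> where x: "s < \<xi>" "\<xi> < z \<bullet> i" "f (upd i (z \<bullet> i) z) - f (upd i s z) = (z \<bullet> i - s) * f' (upd i \<xi> z)"
   by (rule hpd_mvt[OF assms(1,2,3) _ 1]) (use assms zi in auto)
  then have "|f (upd i s z) - f z| = |z \<bullet> i - s| * |f' (upd i \<xi> z)|"
   unfolding abs_minus_commute[of "f (upd i s z)"] upd_self abs_mult[symmetric] by simp
  also have "... <= |z \<bullet> i - s| * M" by (intro mult_left_mono assms(5) up) (use x in auto)
  finally show ?thesis by (simp add: abs_minus_commute mult.commute)
 next
  case 2 then show ?thesis by simp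
 next
  case 3
  obtain \<xi> where x: "z \<bullet> i < \<xi>" "\<xi> < s" "f (upd i s z) - f (upd i (z \<bullet> i) z) = (s - z \<bullet> i) * f' (upd i \<xi> z)"
   by (rule hpd_mvt[OF assms(1,2,3) _ 3]) (use assms zi in auto)
  then have "|f (upd i s z) - f z| = |s - z \<bullet> i| * |f' (upd i \<xi> z)|"
   by (simp add: abs_mult)
  also have "... <= |s - z \<bullet> i| * M" by (intro mult_left_mono assms(5) up) (use x in auto)
  finally show ?thesis by (simp add: mult.commute)
 qed
qed

text \<open>The point is moved one coordinate at a time. The intermediate points \<open>p B\<close>,
  with the coordinates in \<open>B\<close> already exchanged, stay in the box, and each move costs
  at most \<open>M * dist z' z\<close>; hence the factor \<open>DIM('a)\<close>.\<close>

lemma hpd_Lipschitz: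
 fixes f :: "'a::euclidean_space => real"
 assumes "!!i. i : Basis ==> hpd (cbox a b) i f (f' i)"
  "!!i z. i : Basis ==> z : cbox a b ==> |f' i z| <= M" "z : cbox a b" "z' : cbox a b"
 shows "|f z' - f z| <= M * DIM('a) * dist z' z"
proof -
 define p where "p B = (\<Sum>i\<in>Basis. (if i : B then z' \<bullet> i else z \<bullet> i) *\<^sub>R i)" for B
 have pi: "p B \<bullet> i = (if i : B then z' \<bullet> i else z \<bullet> i)" if "i : Basis" for i B
  using that by (simp add: p_def)
 have pc: "p B : cbox a b" for B using assms(3,4) by (auto simp: mem_box pi)
 have pu: "p (insert i B) = upd i (z' \<bullet> i) (p B)" if "i : Basis" for i B
  by (rule euclidean_eqI) (use that in \<open>auto simp: upd_inner pi\<close>)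
 have "|f (p B) - f (p {})| <= M * card B * dist z' z" if "B \<subseteq> Basis" for B
  using finite_subset[OF that finite_Basis] that
 proof (induction B rule: finite_induct)
  case (insert i B)
  have i: "i : Basis" using insert by auto
  have "M >= 0" using assms(2)[OF i assms(3)] by linarith
  have "|f (p (insert i B)) - f (p B)| <= M * |z' \<bullet> i - p B \<bullet> i|"
   unfolding pu[OF i]
   by (rule hpd_Lipschitz_line[OF assms(1)[OF i] i pc]) (use assms(2,4) i in \<open>auto simp: mem_box\<close>)
  also have "|z' \<bullet> i - p B \<bullet> i| = |(z' - z) \<bullet> i|" using i insert by (simp add: pi inner_diff_left)
  also have "M * ... <= M * dist z' z"
   using \<open>M >= 0\<close> Basis_le_norm[OF i, of "z' - z"] by (simp add: dist_norm mult_left_mono)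
  finally have "|f (p (insert i B)) - f (p B)| <= M * dist z' z" .
  moreover have "|f (p B) - f (p {})| <= M * card B * dist z' z" using insert by auto
  moreover have "M * card (insert i B) * dist z' z = M * dist z' z + M * card B * dist z' z"
   using insert by (simp add: algebra_simps)
  ultimately show ?case by linarith
 qed auto
 from this[of Basis] have "|f (p Basis) - f (p {})| <= M * DIM('a) * dist z' z" by simp
 moreover have "p Basis = z'" "p {} = z" by (rule euclidean_eqI; simp add: pi)+
 ultimately show ?thesis by simp
qed

lemma hpd_bound_diff:
 assumes "hpd (cbox a b) i f f'" "i : Basis" "z : cbox a b" "s : {a \<bullet> i..b \<bullet> i}" "s < t" "t <= b \<bullet> i"
  "!!\<xi>. s <= \<xi> ==> \<xi> <= t ==> |f' (upd i \<xi> z) - L| <= e"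
 shows "|f (upd i t z) - f (upd i s z) - (t - s) * L| <= (t - s) * e"
proof -
 obtain \<xi> where x: "s < \<xi>" "\<xi> < t" "f (upd i t z) - f (upd i s z) = (t - s) * f' (upd i \<xi> z)"
  by (rule hpd_mvt[OF assms(1,2,3) _ assms(5)]) (use assms in auto)
 have "|f (upd i t z) - f (upd i s z) - (t - s) * L| = (t - s) * |f' (upd i \<xi> z) - L|"
  unfolding x(3) using assms(5) by (simp add: abs_mult right_diff_distrib[symmetric])
 also have "... <= (t - s) * e" by (intro mult_left_mono assms(7)) (use x in auto)
 finally show ?thesis .
qed

lemma upd_commute: "i : Basis ==> j : Basis ==> i ~= j ==> upd i s (upd j t z) = upd j t (upd i s z)"
 by (rule euclidean_eqI) (auto simp: upd_inner)

text \<open>The mean value theorem in direction \<open>i\<close>, for the difference of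
  \<open>f\<close> over a step in direction \<open>j\<close>, followed by
  \<open>hpd_bound_diff\<close> in direction \<open>j\<close>. Exchanging \<open>i\<close> and
  \<open>j\<close> leaves the second difference unchanged but brings in the other mixed
  derivative.\<close>

lemma hpd_second_difference:
 assumes fi: "hpd (cbox a b) i f fi" and fij: "hpd (cbox a b) j fi fij"
  and ij: "i : Basis" "j : Basis" "i ~= j" and p: "p : cbox a b"
  and h: "h > 0" "p \<bullet> i + h <= b \<bullet> i" "p \<bullet> j + h <= b \<bullet> j"
  and L: "!!x y. x : {p \<bullet> i..p \<bullet> i + h} ==> y : {p \<bullet> j..p \<bullet> j + h} ==>
   |fij (upd i x (upd j y p)) - L| <= e"
 shows "|f (upd i (p \<bullet> i + h) (upd j (p \<bullet> j + h) p)) - f (upd i (p \<bullet> i + h) p)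
   - f (upd j (p \<bullet> j + h) p) + f p - h * (h * L)| <= h * (h * e)"
proof -
 let ?s = "p \<bullet> i" and ?t = "p \<bullet> j"
 define q where "q = upd j (?t + h) p"
 have pij: "a \<bullet> i <= ?s" "a \<bullet> j <= ?t" using p ij by (auto simp: mem_box)
 have q: "q : cbox a b" unfolding q_def by (rule upd_cbox) (use ij p pij h in auto)
 define F where "F x = f (upd i x q) - f (upd i x p)" for x
 define F' where "F' x = fi (upd i x q) - fi (upd i x p)" for x
 have B: "|F' x - h * L| <= h * e" if "x : {?s..?s+h}" for x
 proof -
  have m: "upd i x p : cbox a b" by (rule upd_cbox) (use that pij h ij p in auto)
  have "|fi (upd j (?t+h) (upd i x p)) - fi (upd j ?t (upd i x p)) - (?t + h - ?t) * L| <= (?t + h - ?t) * e"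
   by (rule hpd_bound_diff[OF fij ij(2) m])
     (use that pij h ij L in \<open>auto simp: upd_commute[of i j, symmetric]\<close>)
  moreover have "upd j ?t (upd i x p) = upd i x p" using ij by (simp add: upd_commute[symmetric])
  ultimately show ?thesis using ij by (simp add: F'_def q_def upd_commute)
 qed
 have "EX \<xi>:{?s<..<?s+h}. F (?s + h) - F ?s = F' \<xi> * (?s + h - ?s)"
 proof (rule mvt_simple)
  fix x assume x: "?s <= x" "x <= ?s + h"
  have "(F has_real_derivative F' x) (at x within {a \<bullet> i..b \<bullet> i})"
   unfolding F_def F'_def by (intro DERIV_diff hpd_line[OF fi ij(1)] q p) (use x pij h in auto)
  then have "(F has_real_derivative F' x) (at x within {?s..?s+h})"
   by (rule DERIV_subset) (use pij h in auto)
  then show "(F has_derivative (*) (F' x)) (at x within {?s..?s+h})"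
   by (simp add: has_field_derivative_def)
 qed (use h in auto)
 then obtain \<xi> where x: "?s < \<xi>" "\<xi> < ?s + h" "F (?s + h) - F ?s = h * F' \<xi>" by (auto simp: mult.commute)
 have "|F (?s + h) - F ?s - h * (h * L)| = h * |F' \<xi> - h * L|"
  unfolding x(3) using h by (simp add: abs_mult right_diff_distrib[symmetric])
 also have "... <= h * (h * e)" using x B[of \<xi>] h by (intro mult_left_mono) auto
 finally have *: "|F (?s + h) - F ?s - h * (h * L)| <= h * (h * e)" .
 have "upd i ?s q = q" using ij upd_self[of i q] by (simp add: q_def upd_inner)
 then have "F ?s = f q - f p" by (simp add: F_def)
 then show ?thesis using * by (simp add: F_def q_def algebra_simps)
qed

text \<open>Both mixed derivatives equal the limit of the same second difference quotient over a small square;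
  the square is chosen inside the box, so that boundary points need no separate treatment.\<close>

lemma hpd_Schwarz:
 fixes f :: "'a::euclidean_space => real"
 assumes fi: "hpd (cbox a b) i f fi" and fj: "hpd (cbox a b) j f fj"
  and fij: "hpd (cbox a b) j fi fij" and fji: "hpd (cbox a b) i fj fji"
  and cont: "continuous_on (cbox a b) fij" "continuous_on (cbox a b) fji"
  and ij: "i : Basis" "j : Basis" and lt: "a \<bullet> i < b \<bullet> i" "a \<bullet> j < b \<bullet> j" and z: "z : cbox a b"
 shows "fij z = fji z"
proof (cases "i = j")
 case True
 have eq: "fi z = fj z" if "z : cbox a b" for z
  using hpd_unique[OF fi fj[folded True] ij(1) that lt(1)] .
 have "hpd (cbox a b) i fi fji" by (rule hpd_cong[OF fji]) (use eq in auto)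
 then show ?thesis using hpd_unique[OF fij[folded True] _ ij(1) z lt(1)] by blast
next
 case False
 have "|fij z - fji z| <= 2 * e" if "e > 0" for e
 proof -
  obtain d1 where d1: "d1 > 0" "!!x. x : cbox a b ==> dist x z < d1 ==> dist (fij x) (fij z) < e"
   using cont(1) z \<open>e > 0\<close> unfolding continuous_on_iff by blast
  obtain d2 where d2: "d2 > 0" "!!x. x : cbox a b ==> dist x z < d2 ==> dist (fji x) (fji z) < e"
   using cont(2) z \<open>e > 0\<close> unfolding continuous_on_iff by blast
  \<comment> \<open>Points of the square lie within \<open>4 * h\<close> of \<open>z\<close>: up to
    \<open>2 * h\<close> in each direction, because the corner is itself moved by up to
    \<open>h\<close>. One fifth makes the comparison strict.\<close>
  define h where "h = min (min (d1 / 5) (d2 / 5)) (min (b \<bullet> i - a \<bullet> i) (b \<bullet> j - a \<bullet> j))"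
  have h: "h > 0" "h <= d1 / 5" "h <= d2 / 5" "h <= b \<bullet> i - a \<bullet> i" "h <= b \<bullet> j - a \<bullet> j"
   unfolding h_def using d1(1) d2(1) lt by linarith+
  have zi: "z \<bullet> i : {a \<bullet> i..b \<bullet> i}" "z \<bullet> j : {a \<bullet> j..b \<bullet> j}" using z ij by (auto simp: mem_box)
  define s where "s = min (z \<bullet> i) (b \<bullet> i - h)"
  define t where "t = min (z \<bullet> j) (b \<bullet> j - h)"
  have s: "a \<bullet> i <= s" "s + h <= b \<bullet> i" "|s - z \<bullet> i| <= h" using zi h by (auto simp: s_def)
  have t: "a \<bullet> j <= t" "t + h <= b \<bullet> j" "|t - z \<bullet> j| <= h" using zi h by (auto simp: t_def)
  define p where "p = upd i s (upd j t z)"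
  have p: "p : cbox a b" unfolding p_def by (intro upd_cbox z ij) (use s t h in auto)
  have pij: "p \<bullet> i = s" "p \<bullet> j = t" using ij False by (auto simp: p_def upd_inner)
  have P: "upd i x (upd j y p) = upd i x (upd j y z)" for x y
   by (rule euclidean_eqI) (use ij False in \<open>auto simp: p_def upd_inner\<close>)
  have m: "upd i x (upd j y z) : cbox a b" if "x : {s..s+h}" "y : {t..t+h}" for x y
   by (intro upd_cbox z ij) (use that s t h in auto)
  have d: "dist (upd i x (upd j y z)) z <= 4 * h" if "x : {s..s+h}" "y : {t..t+h}" for x y
  proof -
   have "upd i x (upd j y z) - z = (x - z \<bullet> i) *\<^sub>R i + (y - z \<bullet> j) *\<^sub>R j"
    using False ij by (simp add: upd_def algebra_simps inner_add_left inner_Basis)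
   then have "dist (upd i x (upd j y z)) z <= |x - z \<bullet> i| + |y - z \<bullet> j|"
    using ij norm_triangle_ineq[of "(x - z \<bullet> i) *\<^sub>R i" "(y - z \<bullet> j) *\<^sub>R j"] by (simp add: dist_norm)
   also have "... <= 4 * h" using that s t unfolding atLeastAtMost_iff by linarith
   finally show ?thesis .
  qed
  have "|f (upd i (p \<bullet> i + h) (upd j (p \<bullet> j + h) p)) - f (upd i (p \<bullet> i + h) p)
   - f (upd j (p \<bullet> j + h) p) + f p - h * (h * fij z)| <= h * (h * e)"
  proof (rule hpd_second_difference[OF fi fij ij(1,2) False p h(1)])
   fix x y assume xy: "x : {p \<bullet> i..p \<bullet> i + h}" "y : {p \<bullet> j..p \<bullet> j + h}"
   have "dist (fij (upd i x (upd j y z))) (fij z) < e"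
    using d[of x y] xy h d1(1) by (intro d1(2) m) (auto simp: pij)
   then show "|fij (upd i x (upd j y p)) - fij z| <= e" unfolding P dist_real_def by linarith
  qed (use pij s t in auto)
  moreover have "|f (upd j (p \<bullet> j + h) (upd i (p \<bullet> i + h) p)) - f (upd j (p \<bullet> j + h) p)
   - f (upd i (p \<bullet> i + h) p) + f p - h * (h * fji z)| <= h * (h * e)"
  proof (rule hpd_second_difference[OF fj fji ij(2,1) False[symmetric] p h(1)])
   fix y x assume xy: "y : {p \<bullet> j..p \<bullet> j + h}" "x : {p \<bullet> i..p \<bullet> i + h}"
   have "dist (fji (upd i x (upd j y z))) (fji z) < e"
    using d[of x y] xy h d2(1) by (intro d2(2) m) (auto simp: pij)
   then show "|fji (upd j y (upd i x p)) - fji z| <= e"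
    unfolding upd_commute[OF ij(2,1) False[symmetric]] P dist_real_def by linarith
  qed (use pij s t in auto)
  ultimately have "|h * (h * fij z) - h * (h * fji z)| <= h * (h * e) + h * (h * e)"
   unfolding upd_commute[OF ij(2,1) False[symmetric]] by linarith
  also have "h * (h * fij z) - h * (h * fji z) = h * h * (fij z - fji z)" by (simp add: algebra_simps)
  also have "h * (h * e) + h * (h * e) = h * h * (2 * e)" by simp
  finally show ?thesis using h(1) by (simp add: abs_mult)
 qed
 from this[of "|fij z - fji z| / 4"] show ?thesis by (cases "fij z = fji z") auto
qed

section \<open>Integration along coordinate lines\<close>

text \<open>Averaging over the fibres in direction \<open>i\<close>: the swap \<open>(z, s) \<mapsto> (upd i s z, z \<bullet> i)\<close> preserves
  the volume. This replaces integrals over the faces of a box by integrals over the box.\<close>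

lemma integral_fiber:
 fixes h :: "'a::euclidean_space => real"
 assumes i: "i : Basis" and cont: "continuous_on (cbox a b) h"
 shows "integral (cbox a b) (%z. integral {a \<bullet> i..b \<bullet> i} (%s. h (upd i s z)))
  = integral (cbox a b) h * measure lborel {a \<bullet> i..b \<bullet> i}"
proof -
 define g where "g = (%p::'a \<times> real. (upd i (snd p) (fst p), fst p \<bullet> i))"
 have gg: "g (g p) = p" for p using i by (simp add: g_def upd_inner)
 have mem: "g p : cbox (g u) (g v) \<longleftrightarrow> p : cbox u v" for p u v
 proof -
  have "(ALL j:Basis. upd i (snd u) (fst u) \<bullet> j <= upd i (snd p) (fst p) \<bullet> j &
    upd i (snd p) (fst p) \<bullet> j <= upd i (snd v) (fst v) \<bullet> j) \<longleftrightarrow>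
   (snd u <= snd p & snd p <= snd v) &
   (ALL j:Basis - {i}. fst u \<bullet> j <= fst p \<bullet> j & fst p \<bullet> j <= fst v \<bullet> j)"
   using i by (auto simp: upd_inner)
  moreover have "(ALL j:Basis. fst u \<bullet> j <= fst p \<bullet> j & fst p \<bullet> j <= fst v \<bullet> j) \<longleftrightarrow>
   (fst u \<bullet> i <= fst p \<bullet> i & fst p \<bullet> i <= fst v \<bullet> i) &
   (ALL j:Basis - {i}. fst u \<bullet> j <= fst p \<bullet> j & fst p \<bullet> j <= fst v \<bullet> j)"
   using i by auto
  ultimately show ?thesis
   by (cases p; cases u; cases v) (auto simp: g_def mem_box cbox_Pair_eq)
 qed
 have im: "g ` cbox u v = cbox (g u) (g v)" for u v
 proof -
  have "p : g ` cbox u v" if "p : cbox (g u) (g v)" for p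
   using mem[of "g p" u v] that gg[of p] by (metis image_eqI)
  moreover have "g p : cbox (g u) (g v)" if "p : cbox u v" for p using mem that by blast
  ultimately show ?thesis by blast
 qed
 have ct: "measure lborel (g ` cbox u v) = 1 * measure lborel (cbox u v)" for u v
 proof (cases "cbox u v = {}")
  case False
  then have ne: "cbox (g u) (g v) ~= {}" using im by (metis image_is_empty)
  have *: "measure lborel (cbox (c, r) (d, s)) = (\<Prod>j\<in>Basis - {i}. (d - c) \<bullet> j) * ((d - c) \<bullet> i * (s - r))"
   if "cbox (c, r) (d, s) ~= {}" for c d :: 'a and r s :: real
  proof -
   have 1: "cbox c d ~= {}" "r <= s" using that by (auto simp: cbox_Pair_eq)
   have "measure lborel (cbox c d) = (\<Prod>j\<in>Basis. (d - c) \<bullet> j)" using 1 by (simp add: content_cbox_if inner_diff_left)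
   also have "... = (d - c) \<bullet> i * (\<Prod>j\<in>Basis - {i}. (d - c) \<bullet> j)" using i by (simp add: prod.remove)
   finally show ?thesis using 1 by (simp add: content_Pair)
  qed
  have "measure lborel (cbox (g u) (g v)) = measure lborel (cbox u v)"
   using *[of "fst u" "snd u" "fst v" "snd v"] *[of "fst (g u)" "snd (g u)" "fst (g v)" "snd (g v)"] False ne i
   by (simp add: g_def inner_diff_left upd_inner)
  then show ?thesis using im by simp
 qed simp
 define K where "K = cbox (a, a \<bullet> i) (b, b \<bullet> i)"
 have gK: "g ` K = K" unfolding K_def im by (simp add: g_def)
 have c1: "continuous_on K (%p. h (fst p))"
  unfolding K_def by (intro continuous_on_compose2[OF cont] continuous_intros) (auto simp: cbox_Pair_eq)
 have c2: "continuous_on K (%p. h (upd i (snd p) (fst p)))"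
  unfolding K_def by (intro continuous_on_compose2[OF cont] continuous_intros) (auto simp: cbox_Pair_eq intro!: upd_cbox i)
 have "((%p. h (fst p)) has_integral integral K (%p. h (fst p))) K"
  using integrable_continuous[OF c1[unfolded K_def]] by (simp add: K_def integrable_integral)
 from has_integral_twiddle[where r=1 and g=g and h=g and a="(a, a \<bullet> i)" and b="(b, b \<bullet> i)", folded K_def, OF _ gg gg _ _ _ ct this]
 have "((%p. h (fst (g p))) has_integral integral K (%p. h (fst p))) K"
  using im gK by (auto simp: g_def upd_def intro!: continuous_intros)
 then have "integral K (%p. h (upd i (snd p) (fst p))) = integral K (%p. h (fst p))"
  by (simp add: g_def integral_unique)
 moreover have "integral K (%p. h (fst p)) = integral (cbox a b) (%z. measure lborel {a \<bullet> i..b \<bullet> i} * h z)"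
  using integral_prod_continuous[OF c1[unfolded K_def]] unfolding K_def by simp
 moreover have "integral K (%p. h (upd i (snd p) (fst p))) = integral (cbox a b) (%z. integral {a \<bullet> i..b \<bullet> i} (%s. h (upd i s z)))"
  using integral_prod_continuous[OF c2[unfolded K_def]] unfolding K_def by simp
 ultimately show ?thesis by (simp add: mult.commute)
qed

text \<open>The divergence theorem in one direction. The boundary enters without a surface measure,
  as the integral over the whole box of the difference between the values on the two faces, divided
  by the length of the edge.\<close>

lemma integral_hpd:
 fixes F :: "'a::euclidean_space => real"
 assumes F: "hpd (cbox a b) i F f" and i: "i : Basis" "a \<bullet> i < b \<bullet> i" and cont: "continuous_on (cbox a b) f"
 shows "integral (cbox a b) f
  = integral (cbox a b) (%z. F (upd i (b \<bullet> i) z) - F (upd i (a \<bullet> i) z)) / (b \<bullet> i - a \<bullet> i)"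
proof -
 have "integral {a \<bullet> i..b \<bullet> i} (%s. f (upd i s z)) = F (upd i (b \<bullet> i) z) - F (upd i (a \<bullet> i) z)"
  if "z : cbox a b" for z
  by (rule integral_unique, rule fundamental_theorem_of_calculus)
   (use hpd_line[OF F i(1) that] i in \<open>auto simp: has_real_derivative_iff_has_vector_derivative\<close>)
 then have "integral (cbox a b) (%z. F (upd i (b \<bullet> i) z) - F (upd i (a \<bullet> i) z)) =
   integral (cbox a b) (%z. integral {a \<bullet> i..b \<bullet> i} (%s. f (upd i s z)))"
  by (intro integral_cong) auto
 then show ?thesis using integral_fiber[OF i(1) cont] i by simp
qed

lemma integral_hpd_bound:
 fixes F :: "'a::euclidean_space => real"
 assumes F: "hpd (cbox a b) i F f" and i: "i : Basis" "a \<bullet> i < b \<bullet> i"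
  and cont: "continuous_on (cbox a b) f" "continuous_on (cbox a b) F"
  and B: "!!z. z : cbox a b ==> |F (upd i (b \<bullet> i) z) - F (upd i (a \<bullet> i) z)| <= B"
 shows "|integral (cbox a b) f| <= B * (measure lborel (cbox a b) / (b \<bullet> i - a \<bullet> i))"
proof -
 have c: "continuous_on (cbox a b) (%z. F (upd i s z))" if "s : {a \<bullet> i..b \<bullet> i}" for s
  by (intro continuous_on_compose2[OF cont(2)] continuous_intros) (use that i in \<open>auto intro: upd_cbox\<close>)
 have "norm (integral (cbox a b) (%z. F (upd i (b \<bullet> i) z) - F (upd i (a \<bullet> i) z)))
   <= integral (cbox a b) (%z. B)"
  by (rule integral_norm_bound_integral)
   (use i B in \<open>auto intro!: integrable_continuous continuous_intros c\<close>)
 then show ?thesis unfolding integral_hpd[OF F i cont(1)] using i by (simp add: abs_divide divide_right_mono mult.commute)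
qed

section \<open>Interpolation\<close>

text \<open>Interpolation of Landau type: a difference quotient with step \<open>h\<close> has size
  at most \<open>2 * e / h\<close> and differs from the derivative by at most \<open>M * h\<close>.
  Of the forward and the backward step from \<open>z\<close> one stays in the box as long as
  \<open>h\<close> is at most half the edge.\<close>

lemma hpd_interpolate:
 fixes f :: "'a::euclidean_space => real"
 assumes f: "hpd (cbox a b) i f f'" "hpd (cbox a b) i f' f''" and i: "i : Basis" "a \<bullet> i < b \<bullet> i"
  and e: "0 <= e" "e <= 1" and small: "!!z. z : cbox a b ==> |f z| <= e"
  and M: "!!z. z : cbox a b ==> |f'' z| <= M" and z: "z : cbox a b"
 shows "|f' z| <= (4 / (b \<bullet> i - a \<bullet> i) + M * (b \<bullet> i - a \<bullet> i)) * sqrt e"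
proof -
 define l where "l = b \<bullet> i - a \<bullet> i"
 have l: "l > 0" using i by (simp add: l_def)
 have M0: "M >= 0" using M[OF z] by linarith
 have zi: "z \<bullet> i : {a \<bullet> i..b \<bullet> i}" using z i by (auto simp: mem_box)
 have *: "h * |f' z| <= 2 * e + h * (M * h)" if h: "0 < h" "h <= l / 2" for h
 proof (cases "z \<bullet> i + h <= b \<bullet> i")
  case True
  have "|f (upd i (z \<bullet> i + h) z) - f (upd i (z \<bullet> i) z) - (z \<bullet> i + h - z \<bullet> i) * f' z| <= (z \<bullet> i + h - z \<bullet> i) * (M * h)"
  proof (rule hpd_bound_diff[OF f(1) i(1) z zi])
   fix x assume x: "z \<bullet> i <= x" "x <= z \<bullet> i + h"
   have "|f' (upd i x z) - f' z| <= M * |x - z \<bullet> i|"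
    by (rule hpd_Lipschitz_line[OF f(2) i(1) z _ M]) (use x zi True in auto)
   also have "... <= M * h" using x M0 by (intro mult_left_mono) auto
   finally show "|f' (upd i x z) - f' z| <= M * h" .
  qed (use True h in auto)
  moreover have "|f (upd i (z \<bullet> i + h) z)| <= e" "|f z| <= e"
   by (intro small upd_cbox i z; use True h zi in simp)+
  moreover have "h * |f' z| = |h * f' z|" using h by (simp add: abs_mult)
  ultimately show ?thesis by auto
 next
  case False
  have lo: "a \<bullet> i <= z \<bullet> i - h" using False h zi by (simp add: l_def)
  have "|f (upd i (z \<bullet> i) z) - f (upd i (z \<bullet> i - h) z) - (z \<bullet> i - (z \<bullet> i - h)) * f' z| <= (z \<bullet> i - (z \<bullet> i - h)) * (M * h)"
  proof (rule hpd_bound_diff[OF f(1) i(1) z])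
   fix x assume x: "z \<bullet> i - h <= x" "x <= z \<bullet> i"
   have "|f' (upd i x z) - f' z| <= M * |x - z \<bullet> i|"
    by (rule hpd_Lipschitz_line[OF f(2) i(1) z _ M]) (use x zi lo in auto)
   also have "... <= M * h" using x M0 by (intro mult_left_mono) auto
   finally show "|f' (upd i x z) - f' z| <= M * h" .
  qed (use lo zi h in auto)
  moreover have "|f (upd i (z \<bullet> i - h) z)| <= e" "|f z| <= e"
   by (intro small upd_cbox i z; use lo h zi in simp)+
  moreover have "h * |f' z| = |h * f' z|" using h by (simp add: abs_mult)
  ultimately show ?thesis by auto
 qed
 show ?thesis
 proof (cases "e = 0")
  case True
  have "|f' z| <= 0"
  proof (rule ccontr)
   assume "\<not> |f' z| <= 0"
   then have p: "|f' z| > 0" by simp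
   \<comment> \<open>For \<open>e = 0\<close> there is no optimal step. Any step that keeps
     \<open>M * h\<close> below half of the supposed value of the derivative gives a
     contradiction.\<close>
   define h where "h = min (l / 2) ( |f' z| / (2 * (M + 1)))"
   have "|f' z| / (2 * (M + 1)) > 0" using p M0 by simp
   then have h: "0 < h" "h <= l / 2" "h <= |f' z| / (2 * (M + 1))" using l unfolding h_def by linarith+
   have "|f' z| <= M * h" using *[OF h(1,2)] h(1) True by (simp add: mult.commute)
   also have "... <= (M + 1) * ( |f' z| / (2 * (M + 1)))" using h M0 by (intro mult_mono) auto
   also have "... = |f' z| / 2" using M0 by (simp add: field_simps)
   finally show False using p by simp
  qed
  then show ?thesis using True by simp
 next
  case False
  \<comment> \<open>The balance between \<open>2 * e / h\<close> and \<open>M * h\<close>;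
    \<open>e <= 1\<close> keeps the step within half the edge.\<close>
  define h where "h = sqrt e * (l / 2)"
  have "sqrt e > 0" "sqrt e <= 1" using e False by auto
  then have h: "0 < h" "h <= l / 2" using l by (auto simp: h_def mult_le_cancel_right1)
  have "|f' z| <= (2 * e + h * (M * h)) / h" using *[OF h] h(1) by (simp add: field_simps)
  also have "... = 2 * e / h + M * h" using h by (simp add: field_simps)
  also have "2 * e / h = 4 / l * sqrt e"
   using l \<open>sqrt e > 0\<close> e by (simp add: h_def field_simps)
  also have "M * h <= M * l * sqrt e"
   using M0 l e by (simp add: h_def mult_left_mono)
  finally show ?thesis by (simp add: l_def algebra_simps)
 qed
qed

text \<open>A Lipschitz function keeps half of its value \<open>s\<close> at \<open>z\<close> on a
  piece of radius proportional to \<open>s\<close>, whose measure is at least of order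
  \<open>s ^ d\<close>; its squared norm is therefore at least of order \<open>s ^ (d + 2)\<close>.
  The measure is general because space-time boxes, time slices and lateral faces are all treated in
  this way.\<close>

lemma sup_le_L2:
 fixes f :: "'a::metric_space => real"
 assumes lip: "!!z z'. z : S ==> z' : S ==> |f z' - f z| <= L * dist z' z"
  and bd: "!!z. z : S ==> |f z| <= M" and pos: "L >= 0" "M > 0" "\<rho>\<^sub>0 > 0" "\<kappa> > 0"
  and mu: "!!z \<rho>. z : S ==> 0 < \<rho> ==> \<rho> <= \<rho>\<^sub>0 ==>
   EX U:sets mu. U \<subseteq> S & (ALL z':U. dist z' z <= \<rho>) & \<kappa> * \<rho> ^ d <= measure mu U & emeasure mu U < \<infinity>"
  and int: "set_integrable mu S (%z. (f z)^2)" and z: "z : S"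
 shows "|f z| ^ (d + 2) <= 4 / \<kappa> * (max (M / \<rho>\<^sub>0) (2 * L)) ^ d * L2_sq mu S f"
proof (cases "f z = 0")
 case True
 have "L2_sq mu S f >= 0" unfolding L2_sq_def set_lebesgue_integral_def by (intro integral_nonneg_AE) auto
 then show ?thesis using True pos by (auto intro!: mult_nonneg_nonneg)
next
 case False
 define s where "s = |f z|"
 \<comment> \<open>Both demands on the radius \<open>s / N\<close> are built into \<open>N\<close>:
   as \<open>s <= M\<close>, the radius stays below \<open>\<rho>\<^sub>0\<close>, and the Lipschitz
   bound loses at most \<open>s / 2\<close> over it.\<close>
 define N where "N = max (M / \<rho>\<^sub>0) (2 * L)"
 have s: "s > 0" "s <= M" using False bd[OF z] by (auto simp: s_def)
 have N: "N > 0" "N >= M / \<rho>\<^sub>0" "N >= 2 * L" using pos by (auto simp: N_def less_max_iff_disj)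
 define r where "r = s / N"
 have "M <= N * \<rho>\<^sub>0" using N(2) pos by (simp add: field_simps)
 then have r: "0 < r" "r <= \<rho>\<^sub>0" using s N by (auto simp: r_def field_simps)
 have Lr: "L * r <= s / 2" using N s by (simp add: r_def field_simps)
 obtain U where U: "U : sets mu" "U \<subseteq> S" "!!z'. z' : U ==> dist z' z <= r"
   "\<kappa> * r ^ d <= measure mu U" "emeasure mu U < \<infinity>"
  using mu[OF z r] by blast
 have ge: "(s / 2)^2 <= (f z')^2" if "z' : U" for z'
 proof -
  have "|f z' - f z| <= L * r"
   using lip[OF z, of z'] U that pos by (meson mult_left_mono order_trans subsetD)
  then have "s / 2 <= |f z'|" using Lr unfolding s_def by linarith
  then show ?thesis using s by (metis power2_abs power_mono less_imp_le half_gt_zero)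
 qed
 have "(s / 2)^2 * measure mu U = (LINT z:U|mu. (s / 2)^2)"
  using U by (simp add: set_lebesgue_integral_def)
 also have "... <= L2_sq mu S f"
  unfolding L2_sq_def set_lebesgue_integral_def
 proof (rule integral_mono)
  show "integrable mu (%x. indicator U x *\<^sub>R (s / 2)^2)"
   using U by (intro integrable_mult_indicator integrable_scaleR_left) (auto intro: integrable_real_indicator)
 qed (use int U ge in \<open>auto simp: set_integrable_def indicator_def\<close>)
 finally have "(s / 2)^2 * (\<kappa> * r ^ d) <= L2_sq mu S f"
  using U(4) by (meson mult_left_mono order_trans zero_le_power2)
 moreover have "s ^ (d + 2) = 4 / \<kappa> * N ^ d * ((s / 2)^2 * (\<kappa> * r ^ d))"
  using N pos by (simp add: r_def power_divide power_add field_simps power2_eq_square)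
 moreover have "4 / \<kappa> * N ^ d >= 0" using N pos by simp
 ultimately show ?thesis unfolding s_def[symmetric] N_def[symmetric]
  by (metis mult_left_mono)
qed

section \<open>Functions with parabolic regularity\<close>

lemma dx_Basis [simp]: "dx i : Basis"
 by (simp add: dx_def Basis_prod_def axis_in_Basis_iff Basis_real_def)

lemma dt_Basis [simp]: "dt : Basis"
 by (simp add: dt_def Basis_prod_def)

lemma inner_dx [simp]: "z \<bullet> dx i = fst z $ i"
 by (cases z) (simp add: dx_def inner_axis)

lemma inner_dt [simp]: "z \<bullet> dt = snd z"
 by (cases z) (simp add: dt_def)

lemma dx_neq_dt [simp]: "dx i ~= dt" "dt ~= dx i"
 by (auto simp: dx_def dt_def)

lemma dx_inj [simp]: "dx i = dx j \<longleftrightarrow> i = j"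
 by (auto simp: dx_def axis_eq_axis)

lemma Basis_cases:
 fixes b :: "(real^'n::finite) \<times> real"
 assumes "b : Basis"
 obtains i where "b = dx i" | "b = dt"
 using assms by (auto simp: Basis_prod_def Basis_vec_def dx_def dt_def)

lemma snd_upd_dx [simp]: "snd (upd (dx i) s z) = snd z"
 by (cases z) (simp add: upd_def dx_def)

lemma fst_upd_dx_nth: "fst (upd (dx i) s z) $ j = (if j = i then s else fst z $ j)"
 by (cases z) (simp add: upd_def dx_def inner_axis, simp add: axis_def)

lemma upd_dt: "upd dt s z = (fst z, s)"
 by (cases z) (simp add: upd_def dt_def)

lemma hpd_dx_coord: "hpd Q (dx i) (%z. fst z $ j) (%_. if j = i then 1 else 0)"
 unfolding hpd_def by (auto simp: dx_def axis_def intro!: derivative_eq_intros)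

lemma hpd_dt_coord: "hpd Q dt (%z. fst z $ j) (%_. 0)"
 unfolding hpd_def by (auto simp: dt_def)

lemma hpd_dx_time: "hpd Q (dx i) snd (%_. 0)"
 unfolding hpd_def by (auto simp: dx_def)

lemma hpd_dt_time: "hpd Q dt snd (%_. 1)"
 unfolding hpd_def by (auto simp: dt_def intro!: derivative_eq_intros)

text \<open>Two derivatives in space and one in time, with all derivative functions as arguments, so
  that those of a product are again explicit. \<open>Dt i\<close> serves both orders of the mixed
  derivative in space and time; the symmetry of \<open>DD\<close> is used when the fluxes of the
  Carleman estimate are differentiated.\<close>

definition c21 where
 "c21 Q V Vt D DD Dt \<longleftrightarrow>
   hpd Q dt V Vt & continuous_on Q V & continuous_on Q Vt &
   (ALL i. hpd Q (dx i) V (D i) & hpd Q (dx i) Vt (Dt i) & hpd Q dt (D i) (Dt i) &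
    continuous_on Q (D i) & continuous_on Q (Dt i)) &
   (ALL i j. hpd Q (dx j) (D i) (DD i j) & continuous_on Q (DD i j) & (ALL z:Q. DD i j z = DD j i z))"

lemma c21D:
 assumes "c21 Q V Vt D DD Dt"
 shows "hpd Q dt V Vt" "hpd Q (dx i) V (D i)" "hpd Q (dx i) Vt (Dt i)" "hpd Q dt (D i) (Dt i)"
  "hpd Q (dx j) (D i) (DD i j)" "continuous_on Q V" "continuous_on Q Vt"
  "continuous_on Q (D i)" "continuous_on Q (Dt i)" "continuous_on Q (DD i j)"
  "z : Q ==> DD i j z = DD j i z"
 using assms unfolding c21_def by blast+

lemma c21_mult:
 assumes "c21 Q V Vt D DD Dt" "c21 Q V' Vt' D' DD' Dt'"
 shows "c21 Q (%z. V z * V' z) (%z. Vt z * V' z + V z * Vt' z)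
  (%i z. D i z * V' z + V z * D' i z)
  (%i j z. DD i j z * V' z + D i z * D' j z + D j z * D' i z + V z * DD' i j z)
  (%i z. Dt i z * V' z + D i z * Vt' z + Vt z * D' i z + V z * Dt' i z)"
 unfolding c21_def
proof (intro conjI allI ballI)
 note d = c21D[OF assms(1)] and d' = c21D[OF assms(2)]
 show "DD i j z * V' z + D i z * D' j z + D j z * D' i z + V z * DD' i j z =
   DD j i z * V' z + D j z * D' i z + D i z * D' j z + V z * DD' j i z" if "z : Q" for i j z
  using d(11)[of z i j] d'(11)[of z i j] that by simp
 show "hpd Q (dx i) (%z. Vt z * V' z + V z * Vt' z)
   (%z. Dt i z * V' z + D i z * Vt' z + Vt z * D' i z + V z * Dt' i z)" for i
  by (rule hpd_cong1[OF hpd_add[OF hpd_mult[OF d(3) d'(2)] hpd_mult[OF d(2) d'(3)]]]) simp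
 show "hpd Q dt (%z. D i z * V' z + V z * D' i z)
   (%z. Dt i z * V' z + D i z * Vt' z + Vt z * D' i z + V z * Dt' i z)" for i
  by (rule hpd_cong1[OF hpd_add[OF hpd_mult[OF d(4) d'(1)] hpd_mult[OF d(1) d'(4)]]]) simp
 show "hpd Q (dx j) (%z. D i z * V' z + V z * D' i z)
   (%z. DD i j z * V' z + D i z * D' j z + D j z * D' i z + V z * DD' i j z)" for i j
  by (rule hpd_cong1[OF hpd_add[OF hpd_mult[OF d(5) d'(2)] hpd_mult[OF d(2) d'(5)]]]) simp
qed (intro hpd_mult continuous_intros c21D[OF assms(1)] c21D[OF assms(2)])+

section \<open>The Carleman estimate\<close>

text \<open>The sum \<open>dv\<close> of divergences is \<open>2 S A - 8 mu W\<^sub>1\<^sup>2 - 2 mu \<beta>\<^sup>2 W\<^sup>2\<close>, where \<open>S\<close> and \<open>A\<close> are the symmetric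
  and the antisymmetric part of the conjugated operator \<open>L\<close>, minus \<open>2 mu\<close> times the divergences from
  integrating \<open>W L\<close> by parts; the latter provide the tangential part of the gradient.\<close>

lemma carleman_algebra:
 fixes lap Wt W1 W s cross cr \<beta> mu y Y sg :: real
 defines "L \<equiv> sg * Wt + lap - \<beta> * W1 - 2 * mu * W + \<beta>^2 / 4 * W"
  and "dv \<equiv> 2 * sg * (lap * Wt + cross) - 8 * mu * W1^2 - 2 * \<beta> * (lap * W1 + cr)
   - 6 * mu * (lap * W + s) + (4 * mu * s + 2 * \<beta> * cr - 3 * mu * \<beta>^2 * W^2 - \<beta>^3 / 2 * W * W1
   + 4 * mu^2 * W^2 + 2 * mu * \<beta> * W * W1)
   + sg * (- 2 * cross + \<beta>^2 / 2 * W * Wt - 2 * mu * W * Wt)"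
 assumes "\<beta> = 4 * mu * y" "1 <= y" "y <= Y" "mu >= 1" "sg^2 = 1"
 shows "Wt^2 / (6 * mu * Y^2) + 2 * mu * s + 21 * mu^3 * W^2 <= 2 * L^2 - dv"
proof -
 define S where "S = lap + \<beta>^2 / 4 * W"
 define N where "N = sg * Wt - \<beta> * W1 - 2 * mu * W"
 \<comment> \<open>As \<open>L = S + N\<close>, the difference of \<open>2 * L^2\<close> and
   \<open>2 * S * N\<close> is \<open>L^2 + S^2 + N^2\<close>, and the product of \<open>W\<close>
   and \<open>L\<close> that is left over completes the first square.\<close>
 have eq: "2 * L^2 - dv = (L + mu * W)^2 - mu^2 * W^2 + S^2 + N^2 + 8 * mu * W1^2 + 3 / 2 * mu * \<beta>^2 * W^2 + 2 * mu * s"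
  unfolding L_def dv_def S_def N_def by (simp add: power2_eq_square power3_eq_cube algebra_simps)
 have Y: "Y >= 1" using assms by simp
 have l3: "mu^2 * W^2 <= mu^3 * W^2" using assms by (intro mult_right_mono power_increasing) auto
 have "mu * \<beta>^2 * W^2 = 16 * (mu^3 * W^2) * y^2"
  unfolding assms by (simp add: power2_eq_square power3_eq_cube)
 moreover have "16 * (mu^3 * W^2) * 1 <= 16 * (mu^3 * W^2) * y^2" using assms by (intro mult_left_mono) auto
 ultimately have b: "16 * (mu^3 * W^2) <= mu * \<beta>^2 * W^2" by linarith
 \<comment> \<open>The positive terms contain no square of \<open>Wt\<close>. It is recovered from
   \<open>N\<close>, whose other parts are dominated by the squares of \<open>W1\<close> and
   \<open>W\<close>; this costs a factor \<open>mu\<close>.\<close>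
 have "sg * (N + \<beta> * W1 + 2 * mu * W) = sg^2 * Wt" unfolding N_def by (simp add: power2_eq_square algebra_simps)
 then have "Wt^2 = (sg * (N + \<beta> * W1 + 2 * mu * W))^2" using assms by simp
 also have "... = (N + \<beta> * W1 + 2 * mu * W)^2" using assms by (simp add: power_mult_distrib)
 also have "... <= 3 * (N^2 + \<beta>^2 * W1^2 + 4 * mu^2 * W^2)"
  using sum_squares_ge_zero[of "N - \<beta> * W1" "\<beta> * W1 - 2 * mu * W"] zero_le_power2[of "N - 2 * mu * W"]
  by (simp add: power2_eq_square algebra_simps)
 also have "... <= 6 * mu * Y^2 * (N^2 / 2 + 8 * mu * W1^2 + 2 * mu^3 * W^2)"
 proof -
  have Y2: "Y^2 >= 1" "y^2 <= Y^2" using Y assms by (auto intro: power_mono)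
  then have lY: "mu * Y^2 >= 1" using assms mult_mono[of 1 mu 1 "Y^2"] by simp
  have "1 * N^2 <= (mu * Y^2) * N^2" by (rule mult_right_mono[OF lY]) simp
  then have 1: "3 * N^2 <= 3 * mu * Y^2 * N^2" by simp
  have 2: "\<beta>^2 * W1^2 <= 16 * mu^2 * Y^2 * W1^2"
   unfolding assms power_mult_distrib using Y2 by (intro mult_right_mono mult_mono) auto
  have "mu^2 * 1 <= (mu * mu^3) * Y^2"
   using assms Y2 power_increasing[of 2 4 mu] by (intro mult_mono) (auto simp flip: power_Suc)
  then have 3: "mu^2 * W^2 <= (mu * mu^3) * Y^2 * W^2" by (intro mult_right_mono) auto
  have "16 * mu^2 * Y^2 * W1^2 >= 0" by simp
  have eq2: "6 * mu * Y^2 * (N^2 / 2 + 8 * mu * W1^2 + 2 * mu^3 * W^2) =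
   3 * mu * Y^2 * N^2 + 48 * mu^2 * Y^2 * W1^2 + 12 * ((mu * mu^3) * Y^2 * W^2)"
   by (simp add: algebra_simps power2_eq_square[of mu])
  have "3 * (N^2 + \<beta>^2 * W1^2 + 4 * mu^2 * W^2) = 3 * N^2 + 3 * (\<beta>^2 * W1^2) + 12 * (mu^2 * W^2)" by simp
  also have "... <= 3 * mu * Y^2 * N^2 + 3 * (16 * mu^2 * Y^2 * W1^2) + 12 * ((mu * mu^3) * Y^2 * W^2)"
   by (intro add_mono mult_left_mono 1 2 3) auto
  finally show ?thesis unfolding eq2 by (simp add: mult.assoc)
 qed
 finally have "Wt^2 / (6 * mu * Y^2) <= N^2 / 2 + 8 * mu * W1^2 + 2 * mu^3 * W^2"
  using assms Y by (simp add: pos_divide_le_eq mult.commute)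
 moreover have "0 <= (L + mu * W)^2" "0 <= S^2" "0 <= N^2" by auto
 moreover have "mu^3 * W^2 >= 0" using assms by simp
 \<comment> \<open>Of \<open>3 / 2 * 16 = 24\<close> units of \<open>mu^3 * W^2\<close>, one is
   spent on \<open>mu^2 * W^2\<close> and two on the bound for \<open>Wt\<close>; 21 remain.\<close>
 ultimately show ?thesis unfolding eq using b l3 by linarith
qed

locale space_time_box =
 fixes A :: "real^'n::finite" and T :: real and i0 :: 'n
 assumes A_pos: "A $ i > 0" and T_pos: "T > 0"
begin

definition Q where "Q = cbox (- A, 0::real) (A, T)"
text \<open>Shifted so that the face with unknown data is \<open>yw z = 1\<close>, the minimum over
  \<open>Q\<close>. The maximum is \<open>Y\<close>.\<close>

definition yw where "yw z = fst z $ i0 + A $ i0 + 1" for z :: "(real^'n) \<times> real"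
definition Y where "Y = 2 * A $ i0 + 1"

lemma Q_Times: "Q = cbox (- A) A \<times> {0..T}"
 by (simp add: Q_def cbox_Pair_eq)

lemma mem_Q: "z : Q \<longleftrightarrow> (ALL i. - A $ i <= fst z $ i & fst z $ i <= A $ i) & 0 <= snd z & snd z <= T"
 by (cases z) (auto simp: Q_Times mem_box_cart)

lemma Y_ge: "Y >= 1" using A_pos[of i0] by (simp add: Y_def)

lemma yw_bounds: "z : Q ==> 1 <= yw z & yw z <= Y"
 unfolding mem_Q yw_def Y_def by (auto simp: add.commute dest!: spec[of _ i0])

lemma Q_integrable: "continuous_on Q f ==> (f :: _ => real) integrable_on Q"
 unfolding Q_def by (rule integrable_continuous)

lemma hpd_yw_dx: "hpd Q (dx i) yw (%_. if i = i0 then 1 else 0)"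
 unfolding yw_def using hpd_add[OF hpd_add[OF hpd_dx_coord[of Q i i0] hpd_const] hpd_const] by (auto elim: hpd_cong)

lemma hpd_yw_dt: "hpd Q dt yw (%_. 0)"
 unfolding yw_def using hpd_add[OF hpd_add[OF hpd_dt_coord[of Q i0] hpd_const] hpd_const] by (auto elim: hpd_cong)

lemma continuous_on_yw [continuous_intros]: "continuous_on S yw"
 unfolding yw_def by (intro continuous_intros)

definition vol where "vol = measure lborel Q"

text \<open>The pointwise inequality is integrated, and the divergences turn into values on opposite
  faces. The lateral fluxes are quadratic in quantities bounded by \<open>H\<close>. In time only
  differences of squares between \<open>T\<close> and 0 remain, hence the product of the global
  bound \<open>H'\<close> and the gap \<open>h\<close>.\<close>

lemma carleman_conjugated:
 "EX C>0. ALL W Wt D DD Dt mu sg H H' h.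
   c21 Q W Wt D DD Dt & mu >= 1 & sg^2 = 1 &
   (ALL i j. ALL z:Q. |fst z $ i| = A $ i --> |W z| <= H & |Wt z| <= H & |D j z| <= H) &
   (ALL j. ALL z:Q. |W z| <= H' & |D j z| <= H') &
   (ALL j. ALL z:Q. |W (fst z, T) - W (fst z, 0)| <= h & |D j (fst z, T) - D j (fst z, 0)| <= h) -->
   integral Q (%z. (Wt z)^2 / (6 * mu * Y^2) + 2 * mu * (SS j. (D j z)^2) + 21 * mu^3 * (W z)^2)
   <= 2 * integral Q (%z. (sg * Wt z + (SS j. DD j j z) - 4 * mu * yw z * D i0 z
     - 2 * mu * W z + (4 * mu * yw z)^2 / 4 * W z)^2) + C * mu^3 * (H^2 + H' * h)"
proof -
 define n where "n = real CARD('n)"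
 \<comment> \<open>The sum of the six coefficients in the bound of \<open>P i\<close>, every power
   of \<open>mu\<close> being estimated by \<open>mu^3\<close>.\<close>
 define p where "p = 8 + 12 * Y + 4 * Y * n + 16 * Y^3"
 define C where "C = (SS i. 2 * p * (vol / (2 * A $ i))) + (2 * n + 8 * Y^2 + 2) * (vol / T) + 1"
 have n: "n >= 0" by (simp add: n_def)
 have p: "p >= 0" using Y_ge n by (simp add: p_def)
 have C: "C > 0" unfolding C_def using p n A_pos T_pos
  by (intro add_nonneg_pos add_nonneg_nonneg sum_nonneg mult_nonneg_nonneg divide_nonneg_nonneg) (auto simp: vol_def less_imp_le)
 show ?thesis
 proof (intro exI[of _ C] conjI C allI impI, elim conjE)
  fix W Wt :: "(real^'n) \<times> real => real" and D Dt :: "'n => (real^'n) \<times> real => real" and DD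
   and mu sg H H' h :: real
  assume c: "c21 Q W Wt D DD Dt" and lam: "mu >= 1" and sg: "sg^2 = 1"
   and lat: "ALL i j. ALL z:Q. |fst z $ i| = A $ i --> |W z| <= H & |Wt z| <= H & |D j z| <= H"
   and glob: "ALL j. ALL z:Q. |W z| <= H' & |D j z| <= H'"
   and ends: "ALL j. ALL z:Q. |W (fst z, T) - W (fst z, 0)| <= h & |D j (fst z, T) - D j (fst z, 0)| <= h"
  note d = c21D[OF c]
  note dc = d(6-10)
  define \<beta> where "\<beta> z = 4 * mu * yw z" for z
  define s where "s z = (SS j. D j z * D j z)" for z
  define L where "L z = sg * Wt z + (SS j. DD j j z) - \<beta> z * D i0 z - 2 * mu * W z + (\<beta> z)^2 / 4 * W z" for z
  \<comment> \<open>\<open>P i\<close> is the flux in direction \<open>dx i\<close> and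
    \<open>R\<close> the flux in time. The primed functions are their derivatives and add up to the
    expression \<open>dv\<close> of \<open>carleman_algebra\<close>.\<close>
  define P where "P i z = (2 * sg) * (D i z * Wt z) - 2 * (\<beta> z * (D i z * D i0 z)) - (6 * mu) * (W z * D i z)
   + (if i = i0 then 1 else 0) * (\<beta> z * s z - 1 / 4 * (\<beta> z * (\<beta> z * (\<beta> z * (W z * W z)))) + mu * (\<beta> z * (W z * W z)))" for i z
  define P' where "P' i z = (2 * sg) * (DD i i z * Wt z + D i z * Dt i z)
   - 2 * ((if i = i0 then 4 * mu else 0) * (D i z * D i0 z) + \<beta> z * (DD i i z * D i0 z + D i z * DD i i0 z))
   - (6 * mu) * (D i z * D i z + W z * DD i i z)
   + (if i = i0 then 1 else 0) * (4 * mu * s z + \<beta> z * (SS j. 2 * (D j z * DD j i0 z))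
    - 3 * mu * (\<beta> z)^2 * (W z)^2 - (\<beta> z)^3 / 2 * W z * D i0 z + 4 * mu^2 * (W z)^2 + 2 * mu * \<beta> z * W z * D i0 z)" for i z
  define R where "R z = sg * (- s z + 1 / 4 * (\<beta> z * (\<beta> z * (W z * W z))) - mu * (W z * W z))" for z
  define R' where "R' z = sg * (- (SS j. 2 * (D j z * Dt j z)) + (\<beta> z)^2 / 2 * W z * Wt z - 2 * mu * W z * Wt z)" for z
  have b1: "hpd Q (dx i) \<beta> (%z. if i = i0 then 4 * mu else 0)" for i
   unfolding \<beta>_def by (rule hpd_cong1[OF hpd_cmult[OF hpd_yw_dx]]) simp
  have b2: "hpd Q dt \<beta> (%z. 0)"
   unfolding \<beta>_def by (rule hpd_cong1[OF hpd_cmult[OF hpd_yw_dt]]) simp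
  have bc: "continuous_on Q \<beta>" unfolding \<beta>_def by (intro continuous_intros)
  have s1: "hpd Q (dx i) s (%z. SS j. 2 * (D j z * DD j i z))" for i
   unfolding s_def by (rule hpd_cong1[OF hpd_sum[OF hpd_mult[OF d(5) d(5)]]]) (simp add: algebra_simps)
  have s2: "hpd Q dt s (%z. SS j. 2 * (D j z * Dt j z))"
   unfolding s_def by (rule hpd_cong1[OF hpd_sum[OF hpd_mult[OF d(4) d(4)]]]) (simp add: algebra_simps)
  have sc: "continuous_on Q s" unfolding s_def by (intro continuous_intros dc)
  have hP: "hpd Q (dx i) (P i) (P' i)" for i
  proof -
   have "hpd Q (dx i) (P i) (%z. (2 * sg) * (DD i i z * Wt z + D i z * Dt i z)
    - 2 * ((if i = i0 then 4 * mu else 0) * (D i z * D i0 z) + \<beta> z * (DD i i z * D i0 z + D i z * DD i0 i z))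
    - (6 * mu) * (D i z * D i z + W z * DD i i z)
    + (if i = i0 then 1 else 0) * ((if i = i0 then 4 * mu else 0) * s z + \<beta> z * (SS j. 2 * (D j z * DD j i z))
    - 1 / 4 * ((if i = i0 then 4 * mu else 0) * (\<beta> z * (\<beta> z * (W z * W z))) + \<beta> z * ((if i = i0 then 4 * mu else 0) * (\<beta> z * (W z * W z)) + \<beta> z * ((if i = i0 then 4 * mu else 0) * (W z * W z) + \<beta> z * (D i z * W z + W z * D i z))))
    + mu * ((if i = i0 then 4 * mu else 0) * (W z * W z) + \<beta> z * (D i z * W z + W z * D i z))))"
    unfolding P_def by (intro hpd_add hpd_diff hpd_cmult hpd_mult d b1 s1)
   then show ?thesis
    by (rule hpd_cong1) (use d(11)[of _ i i0] in \<open>auto simp: P'_def algebra_simps power2_eq_square power3_eq_cube\<close>)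
  qed
  have hR: "hpd Q dt R R'"
  proof -
   have "hpd Q dt R (%z. sg * (- (SS j. 2 * (D j z * Dt j z)) + 1 / 4 * (0 * (\<beta> z * (W z * W z)) + \<beta> z * (0 * (W z * W z) + \<beta> z * (Wt z * W z + W z * Wt z)))
     - mu * (Wt z * W z + W z * Wt z)))"
    unfolding R_def by (intro hpd_add hpd_diff hpd_cmult hpd_mult hpd_minus d b2 s2)
   then show ?thesis by (rule hpd_cong1) (simp add: R'_def algebra_simps power2_eq_square)
  qed
  have cP: "continuous_on Q (P i)" "continuous_on Q (P' i)" "continuous_on Q R" "continuous_on Q R'" "continuous_on Q L" for i
   unfolding P_def P'_def R_def R'_def L_def by (auto intro!: continuous_intros dc bc sc)
  have point: "(Wt z)^2 / (6 * mu * Y^2) + 2 * mu * s z + 21 * mu^3 * (W z)^2 <= 2 * (L z)^2 - ((SS i. P' i z) + R' z)"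
   if z: "z : Q" for z
  proof -
   have e: "(SS i. (if i = i0 then c else 0) * g i) = c * g i0" for g :: "'n => real" and c
    by (subst sum.cong[OF refl, where h="%i. if i = i0 then c * g i0 else 0"]) auto
   define lap where "lap = (SS i. DD i i z)"
   define cross where "cross = (SS i. D i z * Dt i z)"
   define cr where "cr = (SS i. D i z * DD i i0 z)"
   have Peq0: "(SS i. P' i z) = 2 * sg * (lap * Wt z + cross) - 2 * (4 * mu * (D i0 z)^2 + \<beta> z * (lap * D i0 z + cr))
    - 6 * mu * (s z + W z * lap) + (4 * mu * s z + \<beta> z * (2 * cr)
    - 3 * mu * (\<beta> z)^2 * (W z)^2 - (\<beta> z)^3 / 2 * W z * D i0 z + 4 * mu^2 * (W z)^2 + 2 * mu * \<beta> z * W z * D i0 z)"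
    unfolding P'_def sum.distrib sum_subtractf sum_distrib_left[symmetric] e lap_def cross_def cr_def s_def
    by (simp add: sum.distrib sum_distrib_left sum_distrib_right e power2_eq_square)
   have Peq: "(SS i. P' i z) = 2 * sg * (lap * Wt z + cross) - 8 * mu * (D i0 z)^2 - 2 * \<beta> z * (lap * D i0 z + cr)
    - 6 * mu * (lap * W z + s z) + (4 * mu * s z + 2 * \<beta> z * cr
    - 3 * mu * (\<beta> z)^2 * (W z)^2 - (\<beta> z)^3 / 2 * W z * D i0 z + 4 * mu^2 * (W z)^2 + 2 * mu * \<beta> z * W z * D i0 z)"
    unfolding Peq0 by (simp add: algebra_simps)
   have Req: "R' z = sg * (- 2 * cross + (\<beta> z)^2 / 2 * W z * Wt z - 2 * mu * W z * Wt z)"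
    unfolding R'_def cross_def sum_distrib_left[symmetric] by simp
   have Leq: "L z = sg * Wt z + lap - \<beta> z * D i0 z - 2 * mu * W z + (\<beta> z)^2 / 4 * W z"
    by (simp add: L_def lap_def)
   show ?thesis unfolding Peq Req Leq
    apply (rule carleman_algebra[of "\<beta> z" mu "yw z"])
    subgoal by (simp add: \<beta>_def)
    subgoal using yw_bounds[OF z] by simp
    subgoal using yw_bounds[OF z] by simp
    subgoal using lam .
    subgoal using sg .
    done
  qed
  have "integral Q (%z. (Wt z)^2 / (6 * mu * Y^2) + 2 * mu * s z + 21 * mu^3 * (W z)^2)
   <= integral Q (%z. 2 * (L z)^2 - ((SS i. P' i z) + R' z))"
   by (rule integral_le) (use lam Y_ge in \<open>auto intro!: Q_integrable continuous_intros point cP dc sc\<close>)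
  also have "... = 2 * integral Q (%z. (L z)^2) - ((SS i. integral Q (P' i)) + integral Q R')"
   using cP
   by (simp add: integral_diff integral_add integral_sum Q_integrable continuous_intros)
  also have "... <= 2 * integral Q (%z. (L z)^2) + ((SS i. |integral Q (P' i)| ) + |integral Q R'| )"
   using sum_abs[of "%i. integral Q (P' i)" UNIV] by linarith
  also have "(SS i. |integral Q (P' i)| ) + |integral Q R'| <= C * mu^3 * (H^2 + H' * h)"
  proof -
   have Q0: "(0, 0) : Q" using A_pos T_pos by (auto simp: mem_Q less_imp_le)
   have H0: "H' >= 0" "h >= 0" using glob ends Q0 abs_ge_zero by (meson order_trans)+
   have lp: "mu >= 0" "mu <= mu^3" "mu^2 <= mu^3" "1 <= mu^3"
    using lam power_increasing[of 1 3 mu] power_increasing[of 2 3 mu] by auto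
   have bb: "0 <= \<beta> z" "\<beta> z <= 4 * mu * Y" if "z : Q" for z
    using yw_bounds[OF that] lam unfolding \<beta>_def by (auto intro!: mult_left_mono)
   have sb: "|s z| <= n * B^2" if "!!j. |D j z| <= B" for z B
   proof -
    have "s z <= (\<Sum>j\<in>(UNIV::'n set). B^2)" unfolding s_def
     using power_mono[OF that abs_ge_zero, of _ 2] by (intro sum_mono) (simp add: power2_eq_square)
    moreover have "s z >= 0" unfolding s_def by (intro sum_nonneg) simp
    ultimately show ?thesis by (simp add: n_def)
   qed
   have Pb: "|P i z| <= p * (mu^3 * H^2)" if z: "z : Q" and f: "|fst z $ k| = A $ k" for i k z
   proof -
    have w: "|W z| <= H" "|Wt z| <= H" "|D j z| <= H" for j using lat z f by blast+
    have H: "H >= 0" using w(1) by linarith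
    have pr: "|a * b| <= H^2" if "|a| <= H" "|b| <= H" for a b
     using that H by (simp add: abs_mult power2_eq_square mult_mono)
    have bp: "|\<beta> z * a| <= 4 * mu * Y * B" if "|a| <= B" for a B
     using that bb[OF z] by (simp add: abs_mult mult_mono)
    have sg1: "|sg| = 1" using sg by (auto simp: power2_eq_1_iff)
    have gen: "|a1 - a2 - a3 + k * (a4 - a5 + a6)| <= b1 + b2 + b3 + b4 + b5 + b6"
     if "|a1| <= b1" "|a2| <= b2" "|a3| <= b3" "|a4| <= b4" "|a5| <= b5" "|a6| <= b6" "k = 0 \<or> k = 1"
     for a1 a2 a3 a4 a5 a6 b1 b2 b3 b4 b5 b6 k :: real
    proof -
     have "- b1 <= a1" "a1 <= b1" "- b2 <= a2" "a2 <= b2" "- b3 <= a3" "a3 <= b3"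
      "- b4 <= a4" "a4 <= b4" "- b5 <= a5" "a5 <= b5" "- b6 <= a6" "a6 <= b6"
      using that by (simp_all only: abs_le_iff) linarith+
     then show ?thesis using that(7) unfolding abs_le_iff by auto
    qed
    have 1: "|(2 * sg) * (D i z * Wt z)| <= 2 * H^2" using pr[OF w(3) w(2), of i] sg1 by (simp add: abs_mult)
    have 2: "|2 * (\<beta> z * (D i z * D i0 z))| <= 2 * (4 * mu * Y * H^2)" using bp[OF pr[OF w(3) w(3)], of i i0] by simp
    have 3: "|(6 * mu) * (W z * D i z)| <= 6 * mu * H^2" using pr[OF w(1) w(3), of i] lam by (simp add: abs_mult)
    have 4: "|\<beta> z * s z| <= 4 * mu * Y * (n * H^2)" by (intro bp sb w)
    have 5: "|1 / 4 * (\<beta> z * (\<beta> z * (\<beta> z * (W z * W z))))| <= 1/4 * (4 * mu * Y * (4 * mu * Y * (4 * mu * Y * H^2)))"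
     using bp[OF bp[OF bp[OF pr[OF w(1) w(1)]]]] by (simp add: mult_ac)
    have 6: "|mu * (\<beta> z * (W z * W z))| <= mu * (4 * mu * Y * H^2)"
     using bp[OF pr[OF w(1) w(1)]] lam by (simp add: abs_mult)
    have "|P i z| <= 2 * H^2 + 2 * (4 * mu * Y * H^2) + 6 * mu * H^2 + 4 * mu * Y * (n * H^2)
      + 1/4 * (4 * mu * Y * (4 * mu * Y * (4 * mu * Y * H^2))) + mu * (4 * mu * Y * H^2)"
     unfolding P_def by (intro gen 1 2 3 4 5 6) auto
    also have "... = (2 * 1 + 8 * Y * mu + 6 * mu + 4 * Y * n * mu + 16 * Y^3 * mu^3 + 4 * Y * mu^2) * H^2"
     by (simp add: algebra_simps power3_eq_cube power2_eq_square)
    also have "... <= (2 * mu^3 + 8 * Y * mu^3 + 6 * mu^3 + 4 * Y * n * mu^3 + 16 * Y^3 * mu^3 + 4 * Y * mu^3) * H^2"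
     using lp Y_ge n by (intro mult_right_mono add_mono mult_left_mono) auto
    also have "... = p * (mu^3 * H^2)" by (simp add: p_def algebra_simps)
    finally show ?thesis .
   qed
   have upq: "upd (dx i) s z : Q" if "z : Q" "- A $ i <= s" "s <= A $ i" for i s z
    using that unfolding Q_def by (intro upd_cbox) auto
   have I: "|integral Q (P' i)| <= 2 * p * (vol / (2 * A $ i)) * (mu^3 * H^2)" for i
   proof -
    have "|integral Q (P' i)| <= (2 * (p * (mu^3 * H^2))) * (measure lborel Q / ((A, T) \<bullet> dx i - (- A, 0) \<bullet> dx i))"
     unfolding Q_def
    proof (rule integral_hpd_bound[OF hP[unfolded Q_def]], goal_cases)
     case (5 z)
     then have z: "z : Q" by (simp add: Q_def)
     have "|P i (upd (dx i) (A $ i) z)| <= p * (mu^3 * H^2)" "|P i (upd (dx i) (- A $ i) z)| <= p * (mu^3 * H^2)"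
      using A_pos[of i] by (intro Pb[of _ i] upq z; simp add: fst_upd_dx_nth)+
     then show ?case by simp
    qed (use A_pos[of i] cP in \<open>auto simp: Q_def\<close>)
    then show ?thesis by (simp add: vol_def algebra_simps)
   qed
   have J: "|integral Q R'| <= (2 * n + 8 * Y^2 + 2) * (vol / T) * (mu^3 * (H' * h))"
   proof -
    have "|integral Q R'| <= ((2 * n + 8 * Y^2 + 2) * (mu^3 * (H' * h))) * (measure lborel Q / ((A, T) \<bullet> dt - (- A, 0) \<bullet> dt))"
     unfolding Q_def
    proof (rule integral_hpd_bound[OF hR[unfolded Q_def]], goal_cases)
     case (5 z)
     then have z: "z : Q" by (simp add: Q_def)
     define z0 where "z0 = (fst z, 0::real)"
     define zT where "zT = (fst z, T)"
     have zz: "z0 : Q" "zT : Q" using z T_pos by (auto simp: mem_Q z0_def zT_def)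
     have sq: "|f zT * f zT - f z0 * f z0| <= 2 * (H' * h)" if "|f zT| <= H'" "|f z0| <= H'" "|f zT - f z0| <= h" for f :: "_ => real"
     proof -
      have "|f zT * f zT - f z0 * f z0| = |f zT + f z0| * |f zT - f z0|" by (simp add: abs_mult[symmetric] algebra_simps)
      also have "... <= (2 * H') * h" using that H0 by (intro mult_mono) auto
      finally show ?thesis by simp
     qed
     have W: "|W zT * W zT - W z0 * W z0| <= 2 * (H' * h)"
      using glob zz ends z by (intro sq) (auto simp: z0_def zT_def)
     have "|s zT - s z0| <= (\<Sum>j\<in>(UNIV::'n set). 2 * (H' * h))"
      unfolding s_def sum_subtractf[symmetric]
      by (intro order_trans[OF sum_abs] sum_mono sq) (use glob zz ends z in \<open>auto simp: z0_def zT_def\<close>)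
     then have S: "|s zT - s z0| <= 2 * n * (H' * h)" by (simp add: n_def)
     \<comment> \<open>The coefficients of \<open>R\<close> do not depend on time. This is what
       turns the values at the two ends into differences of squares.\<close>
     have beq: "\<beta> zT = \<beta> z0" by (simp add: \<beta>_def yw_def zT_def z0_def)
     have "\<beta> z0 * \<beta> z0 <= (4 * mu * Y) * (4 * mu * Y)" using bb[OF zz(1)] by (intro mult_mono) auto
     then have b2: "\<beta> z0 * \<beta> z0 <= 16 * mu^2 * Y^2" by (simp add: power2_eq_square algebra_simps)
     have B: "|\<beta> z0 * \<beta> z0 * (W zT * W zT - W z0 * W z0)| <= (16 * mu^2 * Y^2) * (2 * (H' * h))"
      unfolding abs_mult[of "\<beta> z0 * \<beta> z0"] using W b2 by (intro mult_mono) auto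
     have E: "|mu * (W zT * W zT - W z0 * W z0)| <= mu * (2 * (H' * h))"
      unfolding abs_mult[of mu] using W lam by (intro mult_mono) auto
     have "R zT - R z0 = sg * (- (s zT - s z0) + 1/4 * (\<beta> z0 * \<beta> z0 * (W zT * W zT - W z0 * W z0)) - mu * (W zT * W zT - W z0 * W z0))"
      unfolding R_def beq by (simp add: algebra_simps)
     moreover have "|sg| = 1" using sg by (auto simp: power2_eq_1_iff)
     ultimately have "|R zT - R z0| = |- (s zT - s z0) + 1/4 * (\<beta> z0 * \<beta> z0 * (W zT * W zT - W z0 * W z0)) - mu * (W zT * W zT - W z0 * W z0)|"
      by (simp add: abs_mult)
     also have "... <= 2 * n * (H' * h) + 1/4 * ((16 * mu^2 * Y^2) * (2 * (H' * h))) + mu * (2 * (H' * h))"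
      using S B E by linarith
     also have "... = (2 * n * 1 + 8 * Y^2 * mu^2 + 2 * mu) * (H' * h)" by (simp add: algebra_simps)
     also have "... <= (2 * n * mu^3 + 8 * Y^2 * mu^3 + 2 * mu^3) * (H' * h)"
      using lp Y_ge n H0 by (intro mult_right_mono add_mono mult_left_mono) auto
     finally show ?case by (simp add: upd_dt z0_def zT_def algebra_simps)
    qed (use T_pos cP in \<open>auto simp: Q_def\<close>)
    then show ?thesis by (simp add: vol_def algebra_simps)
   qed
   have "(SS i. |integral Q (P' i)| ) + |integral Q R'| <=
    (SS i. 2 * p * (vol / (2 * A $ i)) * (mu^3 * H^2)) + (2 * n + 8 * Y^2 + 2) * (vol / T) * (mu^3 * (H' * h))"
    by (intro add_mono sum_mono I J)
   also have "... = (SS i. 2 * p * (vol / (2 * A $ i))) * (mu^3 * H^2) + (2 * n + 8 * Y^2 + 2) * (vol / T) * (mu^3 * (H' * h))"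
    by (simp only: sum_distrib_right)
   also have "... <= C * (mu^3 * H^2) + C * (mu^3 * (H' * h))"
   proof (intro add_mono mult_right_mono)
    have "(SS i. 2 * p * (vol / (2 * A $ i))) >= 0" "(2 * n + 8 * Y^2 + 2) * (vol / T) >= 0"
     using p n A_pos T_pos
     by (auto intro!: sum_nonneg mult_nonneg_nonneg divide_nonneg_nonneg add_nonneg_nonneg simp: vol_def less_imp_le)
    then show "(SS i. 2 * p * (vol / (2 * A $ i))) <= C" "(2 * n + 8 * Y^2 + 2) * (vol / T) <= C"
     unfolding C_def by linarith+
   qed (use lp H0 lam in auto)
   finally show ?thesis by (simp add: algebra_simps)
  qed
  finally show "integral Q (%z. (Wt z)^2 / (6 * mu * Y^2) + 2 * mu * (SS j. (D j z)^2) + 21 * mu^3 * (W z)^2)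
   <= 2 * integral Q (%z. (sg * Wt z + (SS j. DD j j z) - 4 * mu * yw z * D i0 z
     - 2 * mu * W z + (4 * mu * yw z)^2 / 4 * W z)^2) + C * mu^3 * (H^2 + H' * h)"
   by (simp add: L_def \<beta>_def s_def power2_eq_square)
 qed
qed

end

section \<open>Weighted energies and the Carleman estimate in the original unknowns\<close>

lemma sum_list_squared_le: "(\<Sum>x\<leftarrow>xs. x)^2 <= length xs * (\<Sum>x\<leftarrow>xs. x^2)" for xs :: "real list"
proof (induction xs)
 case (Cons x xs)
 define S q where "S = sum_list xs" and "q = (\<Sum>x\<leftarrow>xs. x^2)"
 show ?case
 proof (cases "xs = []")
  case False
  define n where "n = real (length xs)"
  have n: "n > 0" using False by (simp add: n_def)
  have IH: "S^2 / n <= q" using Cons n by (simp add: S_def q_def n_def field_simps)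
  have "(n * x - S)^2 / n >= 0" using n by simp
  also have "(n * x - S)^2 / n = n * x^2 - 2 * x * S + S^2 / n"
   using n by (simp add: field_simps power2_eq_square)
  finally have "2 * x * S <= n * x^2 + q" using IH by linarith
  moreover have "S^2 <= n * q" using Cons by (simp add: S_def q_def n_def)
  moreover have "(x + S)^2 = x^2 + 2 * x * S + S^2" by (simp add: power2_eq_square algebra_simps)
  ultimately have "(x + S)^2 <= (n + 1) * (x^2 + q)" by (simp add: algebra_simps)
  then show ?thesis by (simp add: S_def q_def n_def algebra_simps)
 qed simp
qed simp

definition gr :: "('n::finite => 'a => real) => 'a => real" where
 "gr D z = sqrt (SS i. (D i z)^2)"

lemma gr_nonneg [simp]: "gr D z >= 0"
 by (simp add: gr_def sum_nonneg)

lemma gr_squared: "(gr D z)^2 = (SS i. (D i z)^2)"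
 by (simp add: gr_def sum_nonneg)

lemma abs_le_gr: "|D i z| <= gr D z" for D :: "'n::finite => 'a => real"
 unfolding gr_def by (rule real_le_rsqrt) (simp add: member_le_sum[of i UNIV "%i. (D i z)^2"])

lemma continuous_on_gr [continuous_intros]:
 "(!!i. continuous_on S (D i)) ==> continuous_on S (gr D)" for D :: "'n::finite => 'a::topological_space => real"
 unfolding gr_def by (intro continuous_intros)

context space_time_box
begin

definition E where "E mu z = exp (mu * (yw z)^2)"

definition en where "en mu f = integral Q (%z. (E mu z)^2 * (f z)^2)"

lemma continuous_on_E [continuous_intros]: "continuous_on S (E mu)"
 unfolding E_def by (intro continuous_intros)

lemma E_pos [simp]: "E mu z > 0" "0 <= E mu z" "E mu z ~= 0"
 by (simp_all add: E_def)

lemma en_nonneg [simp]: "en mu f >= 0"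
proof (cases "(%z. (E mu z)^2 * (f z)^2) integrable_on Q")
 case True then show ?thesis unfolding en_def by (intro integral_nonneg) auto
next
 case False then show ?thesis unfolding en_def by (simp add: not_integrable_integral)
qed

lemma en_sum_list:
 assumes "!!g. g : set gs ==> continuous_on Q g"
 shows "integral Q (%z. (E mu z)^2 * (\<Sum>g\<leftarrow>gs. (g z)^2)) = (\<Sum>g\<leftarrow>gs. en mu g)
  & continuous_on Q (%z. \<Sum>g\<leftarrow>gs. (g z)^2)"
 using assms
proof (induction gs)
 case (Cons g gs)
 have IH: "integral Q (%z. (E mu z)^2 * (\<Sum>g\<leftarrow>gs. (g z)^2)) = (\<Sum>g\<leftarrow>gs. en mu g)"
  "continuous_on Q (%z. \<Sum>g\<leftarrow>gs. (g z)^2)" using Cons by auto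
 have c: "continuous_on Q g" using Cons by auto
 have "integral Q (%z. (E mu z)^2 * (g z)^2 + (E mu z)^2 * (\<Sum>g\<leftarrow>gs. (g z)^2)) = en mu g + (\<Sum>g\<leftarrow>gs. en mu g)"
  unfolding IH(1)[symmetric] unfolding en_def
  by (intro integral_add Q_integrable continuous_intros c IH(2))
 then show ?case using c IH(2) by (simp add: distrib_left continuous_intros)
qed simp

text \<open>Passes from a pointwise bound by finitely many functions to a bound of energies. The
  factor \<open>length gs\<close> is the price of Cauchy-Schwarz for the sum.\<close>

lemma en_le_list:
 assumes f: "continuous_on Q f" and gs: "!!g. g : set gs ==> continuous_on Q g" and K: "K >= 0"
  and le: "!!z. z : Q ==> |f z| <= K * (\<Sum>g\<leftarrow>gs. |g z| )"
 shows "en mu f <= K^2 * length gs * (\<Sum>g\<leftarrow>gs. en mu g)"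
proof -
 note c = en_sum_list[OF gs, of gs]
 have "en mu f <= integral Q (%z. (K^2 * length gs) * ((E mu z)^2 * (\<Sum>g\<leftarrow>gs. (g z)^2)))"
  unfolding en_def
 proof (rule integral_le)
  fix z assume z: "z : Q"
  have "(f z)^2 <= (K * (\<Sum>g\<leftarrow>gs. |g z| ))^2" using power_mono[OF le[OF z], of 2] by simp
  also have "... = K^2 * (\<Sum>x\<leftarrow>map (%g. |g z| ) gs. x)^2" by (simp add: power_mult_distrib)
  also have "... <= K^2 * (length gs * (\<Sum>g\<leftarrow>gs. (g z)^2))"
   using sum_list_squared_le[of "map (%g. |g z| ) gs"] by (intro mult_left_mono) (auto simp: comp_def)
  finally have "(E mu z)^2 * (f z)^2 <= (E mu z)^2 * (K^2 * (length gs * (\<Sum>g\<leftarrow>gs. (g z)^2)))"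
   by (intro mult_left_mono) auto
  then show "(E mu z)^2 * (f z)^2 <= (K^2 * length gs) * ((E mu z)^2 * (\<Sum>g\<leftarrow>gs. (g z)^2))"
   by (simp add: mult_ac)
 qed (use c in \<open>auto intro!: Q_integrable continuous_intros f\<close>)
 then show ?thesis using c by simp
qed

lemma en_const_le: "en mu (%_. c) <= vol * (exp (2 * mu * Y^2) * c^2)" if "mu >= 0"
proof -
 have "en mu (%_. c) <= integral Q (%z. exp (2 * mu * Y^2) * c^2)"
  unfolding en_def
 proof (rule integral_le)
  fix z assume z: "z : Q"
  have "(yw z)^2 <= Y^2" using yw_bounds[OF z] by (intro power_mono) auto
  then have "(E mu z)^2 <= exp (2 * mu * Y^2)" using that
   by (simp add: E_def power2_eq_square exp_add[symmetric] mult_left_mono)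
  then show "(E mu z)^2 * c^2 <= exp (2 * mu * Y^2) * c^2" by (intro mult_right_mono) auto
 qed (auto intro!: Q_integrable continuous_intros)
 then show ?thesis by (simp add: Q_def vol_def mult_ac)
qed

lemma c21_E:
 "c21 Q (E mu) (%_. 0) (%i z. (if i = i0 then 2 * mu else 0) * (yw z * E mu z))
   (%i j z. if i = i0 & j = i0 then (4 * mu^2 * (yw z)^2 + 2 * mu) * E mu z else 0) (%_ _. 0)"
proof -
 have 1: "hpd Q (dx i) (E mu) (%z. (if i = i0 then 2 * mu else 0) * (yw z * E mu z))" for i
  unfolding E_def
  by (rule hpd_cong1[OF hpd_chain[where k=exp and k'=exp, OF hpd_cmult[OF hpd_power2[OF hpd_yw_dx]]]])
    (auto intro!: derivative_eq_intros)
 have 2: "hpd Q dt (E mu) (%z. 0)"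
  unfolding E_def
  by (rule hpd_cong1[OF hpd_chain[where k=exp and k'=exp, OF hpd_cmult[OF hpd_power2[OF hpd_yw_dt]]]])
    (auto intro!: derivative_eq_intros)
 show ?thesis
  unfolding c21_def
 proof (intro conjI allI ballI)
  show "hpd Q (dx j) (%z. (if i = i0 then 2 * mu else 0) * (yw z * E mu z))
   (%z. if i = i0 & j = i0 then (4 * mu^2 * (yw z)^2 + 2 * mu) * E mu z else 0)" for i j
   by (rule hpd_cong1[OF hpd_cmult[OF hpd_mult[OF hpd_yw_dx 1]]]) (simp add: algebra_simps power2_eq_square)
  show "hpd Q dt (%z. (if i = i0 then 2 * mu else 0) * (yw z * E mu z)) (%z. 0)" for i
   by (rule hpd_cong1[OF hpd_cmult[OF hpd_mult[OF hpd_yw_dt 2]]]) simp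
  show "continuous_on Q (%z. if i = i0 & j = i0 then (4 * mu^2 * (yw z)^2 + 2 * mu) * E mu z else 0)" for i j
   by (cases "i = i0 & j = i0") (auto intro!: continuous_intros)
  show "hpd Q (dx i) (E mu) (%z. (if i = i0 then 2 * mu else 0) * (yw z * E mu z))" for i by (rule 1)
  show "hpd Q dt (E mu) (%z. 0)" by (rule 2)
  show "continuous_on Q (%z. (if i = i0 then 2 * mu else 0) * (yw z * E mu z))" for i
   by (intro continuous_intros)
 qed (auto intro: continuous_intros)
qed

text \<open>The lateral faces with data, taken closed: an edge that such a face shares with the
  unknown face is included. A lateral point outside \<open>known\<close> therefore has x1 =
  -A1.\<close>

definition known where
 "known z \<longleftrightarrow> (EX i. fst z $ i = A $ i \<or> (i ~= i0 & fst z $ i = - A $ i))"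

text \<open>\<open>exp (2 * mu)\<close> is the squared weight on the unknown face, where nothing is
  small; the other summand is the largest squared weight times the error in the data. The power
  \<open>mu^5\<close> is made of \<open>mu^3\<close> from \<open>carleman_conjugated\<close> and
  \<open>mu^2\<close> from differentiating the weight in the boundary values.\<close>

definition Rem where "Rem mu eps = mu^5 * (exp (2 * mu) + exp (2 * mu * Y^2) * eps)"

abbreviation carleman_hyp where
 "carleman_hyp M V Vt D DD Dt mu sg eps \<equiv>
   c21 Q V Vt D DD Dt & mu >= 1 & sg^2 = 1 & 0 <= eps & eps <= M &
   (ALL j. ALL z:Q. |V z| <= M & |Vt z| <= M & |D j z| <= M) &
   (ALL j. ALL z:Q. known z --> |V z| <= eps & |Vt z| <= eps & |D j z| <= eps) &
   (ALL j. ALL z:Q. |V (fst z, T) - V (fst z, 0)| <= eps & |D j (fst z, T) - D j (fst z, 0)| <= eps)"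

text \<open>This is \<open>carleman_conjugated\<close> for the product of \<open>V\<close> with the
  weight. Only the first power of \<open>eps\<close> comes out, because at the ends of the time
  interval a small gap multiplies a value that is merely bounded.\<close>

lemma carleman:
 assumes M: "M >= 1"
 shows "EX C>0. ALL V Vt D DD Dt mu sg eps.
   carleman_hyp M V Vt D DD Dt mu sg eps -->
   en mu Vt / mu + mu * en mu (gr D) + mu^3 * en mu V
   <= C * (en mu (%z. sg * Vt z + (SS j. DD j j z)) + Rem mu eps)"
proof -
 from carleman_conjugated obtain C0 where C0: "C0 > 0" and car0: "!!W Wt D DD Dt mu sg H H' h.
   c21 Q W Wt D DD Dt & mu >= 1 & sg^2 = 1 &
   (ALL i j. ALL z:Q. |fst z $ i| = A $ i --> |W z| <= H & |Wt z| <= H & |D j z| <= H) &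
   (ALL j. ALL z:Q. |W z| <= H' & |D j z| <= H') &
   (ALL j. ALL z:Q. |W (fst z, T) - W (fst z, 0)| <= h & |D j (fst z, T) - D j (fst z, 0)| <= h) ==>
   integral Q (%z. (Wt z)^2 / (6 * mu * Y^2) + 2 * mu * (SS j. (D j z)^2) + 21 * mu^3 * (W z)^2)
   <= 2 * integral Q (%z. (sg * Wt z + (SS j. DD j j z) - 4 * mu * yw z * D i0 z
     - 2 * mu * W z + (4 * mu * yw z)^2 / 4 * W z)^2) + C0 * mu^3 * (H^2 + H' * h)"
  by (elim exE conjE) (rule that, assumption, elim allE impE, assumption+)
 have car: "c21 Q W Wt D DD Dt ==> mu >= 1 ==> sg^2 = 1 ==>
   (!!i j z. z:Q ==> |fst z $ i| = A $ i ==> |W z| <= H & |Wt z| <= H & |D j z| <= H) ==>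
   (!!j z. z:Q ==> |W z| <= H' & |D j z| <= H') ==>
   (!!j z. z:Q ==> |W (fst z, T) - W (fst z, 0)| <= h & |D j (fst z, T) - D j (fst z, 0)| <= h) ==>
   integral Q (%z. (Wt z)^2 / (6 * mu * Y^2) + 2 * mu * (SS j. (D j z)^2) + 21 * mu^3 * (W z)^2)
   <= 2 * integral Q (%z. (sg * Wt z + (SS j. DD j j z) - 4 * mu * yw z * D i0 z
     - 2 * mu * W z + (4 * mu * yw z)^2 / 4 * W z)^2) + C0 * mu^3 * (H^2 + H' * h)"
  for W Wt D DD Dt mu sg H H' h
  by (rule car0) blast
 define K where "K = 14 * Y^2 + 1"
 define C where "C = K * (2 + C0 * (27 * Y^2 * M^2))"
 have Y: "Y >= 1" "Y^2 >= 1" using Y_ge by auto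
 have K: "K > 0" unfolding K_def using Y(2) by linarith
 have C: "C > 0" unfolding C_def using K C0 Y M by (intro mult_pos_pos add_pos_pos) auto
 show ?thesis
 proof (intro exI[of _ C] conjI C allI impI, elim conjE)
  fix V Vt :: "(real^'n) \<times> real => real" and D Dt :: "'n => (real^'n) \<times> real => real" and DD
   and mu sg eps :: real
  assume c: "c21 Q V Vt D DD Dt" and mu: "mu >= 1" and sg: "sg^2 = 1" and eps: "0 <= eps" "eps <= M"
   and glob: "ALL j. ALL z:Q. |V z| <= M & |Vt z| <= M & |D j z| <= M"
   and lat: "ALL j. ALL z:Q. known z --> |V z| <= eps & |Vt z| <= eps & |D j z| <= eps"
   and ends: "ALL j. ALL z:Q. |V (fst z, T) - V (fst z, 0)| <= eps & |D j (fst z, T) - D j (fst z, 0)| <= eps"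
  note dc = c21D(6-10)[OF c]
  define e1 where "e1 = exp mu"
  define eY where "eY = exp (mu * Y^2)"
  have e: "e1 > 0" "eY > 0" by (auto simp: e1_def eY_def)
  define W where "W z = E mu z * V z" for z
  define k where "k i z = (if i = i0 then 2 * mu else 0) * yw z" for i z
  define DW where "DW i z = E mu z * (k i z * V z + D i z)" for i z
  define DDW where "DDW i j z = (if i = i0 & j = i0 then (4 * mu^2 * (yw z)^2 + 2 * mu) * E mu z else 0) * V z
   + k i z * E mu z * D j z + k j z * E mu z * D i z + E mu z * DD i j z" for i j z
  have "c21 Q W (%z. E mu z * Vt z) DW DDW (%i z. k i z * E mu z * Vt z + E mu z * Dt i z)"
  proof -
   have a: "DW = (%i z. (if i = i0 then 2 * mu else 0) * (yw z * E mu z) * V z + E mu z * D i z)"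
    by (intro ext) (simp add: DW_def k_def algebra_simps)
   have b: "DDW = (%i j z. (if i = i0 & j = i0 then (4 * mu^2 * (yw z)^2 + 2 * mu) * E mu z else 0) * V z +
     (if i = i0 then 2 * mu else 0) * (yw z * E mu z) * D j z + (if j = i0 then 2 * mu else 0) * (yw z * E mu z) * D i z + E mu z * DD i j z)"
    by (intro ext) (simp add: DDW_def k_def)
   have d: "(%i z. k i z * E mu z * Vt z + E mu z * Dt i z) =
     (%i z. 0 * V z + (if i = i0 then 2 * mu else 0) * (yw z * E mu z) * Vt z + 0 * D i z + E mu z * Dt i z)"
    by (intro ext) (simp add: k_def)
   have e: "(%z. E mu z * Vt z) = (%z. 0 * V z + E mu z * Vt z)" by simp
   show ?thesis unfolding a b d W_def e by (rule c21_mult[OF c21_E c])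
  qed
  note cW = this
  have kb: "0 <= k i z" "k i z <= 2 * mu * Y" if "z : Q" for i z
   using yw_bounds[OF that] mu Y by (auto simp: k_def intro: mult_left_mono)
  have EY: "E mu z <= eY" if "z : Q" for z
   using yw_bounds[OF that] mu unfolding E_def eY_def by (auto intro!: mult_left_mono power_mono)
  have mY: "1 <= mu * Y" using mu Y mult_mono[of 1 mu 1 Y] by simp
  have bd: "|E mu z * f| <= 3 * mu * Y * (b * B)" "|E mu z * (k i z * f + g)| <= 3 * mu * Y * (b * B)"
   if "z : Q" "E mu z <= b" "|f| <= B" "|g| <= B" for z f g b B i
  proof -
   have B: "B >= 0" "b >= 0" using that E_pos(2)[of mu z] by linarith+
   have m3: "1 * (b * B) <= 3 * mu * Y * (b * B)" using mY B by (intro mult_right_mono) auto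
   have "|E mu z * f| <= b * B" unfolding abs_mult using that B by (intro mult_mono) auto
   then show "|E mu z * f| <= 3 * mu * Y * (b * B)" using m3 by simp
   have "|k i z * f| <= (2 * mu * Y) * B" unfolding abs_mult using kb[OF that(1), of i] that mu Y by (intro mult_mono) auto
   then have "|k i z * f + g| <= (2 * mu * Y) * B + 1 * B" using that by linarith
   also have "... <= (2 * mu * Y) * B + (mu * Y) * B" using mult_right_mono[OF mY B(1)] by (rule add_left_mono)
   also have "... = 3 * mu * Y * B" by simp
   finally have "|E mu z * (k i z * f + g)| <= b * (3 * mu * Y * B)"
    unfolding abs_mult[of "E mu z"] using that B by (intro mult_mono) auto
   then show "|E mu z * (k i z * f + g)| <= 3 * mu * Y * (b * B)" by (simp add: mult_ac)
  qed
  define H where "H = 3 * mu * Y * (e1 * M + eY * eps)"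
  define H' where "H' = 3 * mu * Y * (eY * M)"
  define h where "h = 3 * mu * Y * (eY * eps)"
  have Hge: "3 * mu * Y * (e1 * M) <= H" "3 * mu * Y * (eY * eps) <= H"
   unfolding H_def using mu Y e eps M by (auto intro!: mult_left_mono)
  have main: "integral Q (%z. (E mu z * Vt z)^2 / (6 * mu * Y^2) + 2 * mu * (SS j. (DW j z)^2) + 21 * mu^3 * (W z)^2)
   <= 2 * integral Q (%z. (sg * (E mu z * Vt z) + (SS j. DDW j j z) - 4 * mu * yw z * DW i0 z
     - 2 * mu * W z + (4 * mu * yw z)^2 / 4 * W z)^2) + C0 * mu^3 * (H^2 + H' * h)"
  proof (rule car[OF cW mu sg])
   fix i j z assume z: "z : Q" and fz: "|fst z $ i| = A $ i"
   show "|W z| <= H & |E mu z * Vt z| <= H & |DW j z| <= H"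
   proof (cases "known z")
    case True
    have v: "|V z| <= eps" "|Vt z| <= eps" "|D j z| <= eps" using lat z True by blast+
    show ?thesis unfolding W_def DW_def
     using bd(1)[OF z EY[OF z] v(1) v(1)] bd(1)[OF z EY[OF z] v(2) v(1)] bd(2)[OF z EY[OF z] v(1) v(3), of j] Hge
     by linarith
   next
    case False
    \<comment> \<open>A lateral point without data lies on the unknown face. The weight there is
      only \<open>e1\<close>, so the crude bound \<open>M\<close> is affordable.\<close>
    then have "fst z $ i0 = - A $ i0" using fz unfolding known_def by (smt (verit))
    then have "E mu z <= e1" by (simp add: E_def yw_def e1_def)
    note b = bd[OF z this]
    have v: "|V z| <= M" "|Vt z| <= M" "|D j z| <= M" using glob z by blast+
    show ?thesis unfolding W_def DW_def
     using b(1)[OF v(1) v(1)] b(1)[OF v(2) v(1)] b(2)[OF v(1) v(3), of j] Hge by linarith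
   qed
  next
   fix j z assume z: "z : Q"
   have v: "|V z| <= M" "|D j z| <= M" using glob z by blast+
   show "|W z| <= H' & |DW j z| <= H'" unfolding W_def DW_def H'_def
    using bd(1)[OF z EY[OF z] v(1) v(1)] bd(2)[OF z EY[OF z] v(1) v(2), of j] by linarith
   have zz: "(fst z, 0) : Q" "(fst z, T) : Q" using z T_pos by (auto simp: mem_Q)
   have eq: "E mu (fst z, T) = E mu (fst z, 0)" "k j (fst z, T) = k j (fst z, 0)"
    by (simp_all add: E_def yw_def k_def)
   have v: "|V (fst z, T) - V (fst z, 0)| <= eps" "|D j (fst z, T) - D j (fst z, 0)| <= eps" using ends z by blast+
   have "W (fst z, T) - W (fst z, 0) = E mu (fst z, 0) * (V (fst z, T) - V (fst z, 0))"
    "DW j (fst z, T) - DW j (fst z, 0) = E mu (fst z, 0) * (k j (fst z, 0) * (V (fst z, T) - V (fst z, 0)) + (D j (fst z, T) - D j (fst z, 0)))"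
    unfolding W_def DW_def eq by (simp_all add: algebra_simps)
   then show "|W (fst z, T) - W (fst z, 0)| <= h & |DW j (fst z, T) - DW j (fst z, 0)| <= h"
    unfolding h_def using bd(1)[OF zz(1) EY[OF zz(1)] v(1) v(1)] bd(2)[OF zz(1) EY[OF zz(1)] v, of j] by simp
  qed
  \<comment> \<open>The operator in \<open>carleman_conjugated\<close> is the heat operator
    conjugated by the weight: applied to \<open>W\<close> it gives \<open>E\<close> times the heat
    operator applied to \<open>V\<close>.\<close>
  have L: "(sg * (E mu z * Vt z) + (SS j. DDW j j z) - 4 * mu * yw z * DW i0 z
     - 2 * mu * W z + (4 * mu * yw z)^2 / 4 * W z)^2 = (E mu z)^2 * (sg * Vt z + (SS j. DD j j z))^2" for z
  proof -
   have *: "DDW j j z = (if j = i0 then (4 * mu^2 * (yw z)^2 + 2 * mu) * E mu z * V z + 4 * mu * yw z * E mu z * D i0 z else 0)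
     + E mu z * DD j j z" for j
    by (simp add: DDW_def k_def algebra_simps)
   have "(SS j. DDW j j z) = (4 * mu^2 * (yw z)^2 + 2 * mu) * E mu z * V z + 4 * mu * yw z * E mu z * D i0 z
     + E mu z * (SS j. DD j j z)"
    unfolding * sum.distrib sum_distrib_left[symmetric] by simp
   then have "sg * (E mu z * Vt z) + (SS j. DDW j j z) - 4 * mu * yw z * DW i0 z
     - 2 * mu * W z + (4 * mu * yw z)^2 / 4 * W z = E mu z * (sg * Vt z + (SS j. DD j j z))"
    by (simp add: DW_def W_def k_def algebra_simps power2_eq_square)
   then show ?thesis by (simp add: power_mult_distrib)
  qed
  have HH: "C0 * mu^3 * (H^2 + H' * h) <= C0 * (27 * Y^2 * M^2) * Rem mu eps"
  proof -
   have sq: "e1^2 = exp (2 * mu)" "eY^2 = exp (2 * mu * Y^2)"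
    by (simp_all add: e1_def eY_def power2_eq_square exp_add[symmetric])
   have M2: "M <= M^2" "1 <= M^2" using M mult_mono[of 1 M 1 M] by (auto simp: power2_eq_square)
   have a: "(e1 * M + eY * eps)^2 <= 2 * (e1^2 * M^2) + 2 * (eY^2 * eps^2)"
    using zero_le_power2[of "e1 * M - eY * eps"] by (simp add: power2_eq_square algebra_simps)
   have "eps^2 <= M * eps" using eps by (simp add: power2_eq_square mult_right_mono)
   also have "... <= M^2 * eps" using M2 eps by (intro mult_right_mono) auto
   finally have b: "eY^2 * eps^2 <= eY^2 * (M^2 * eps)" by (intro mult_left_mono) auto
   have d: "eY^2 * (M * eps) <= eY^2 * (M^2 * eps)" using M2 eps by (intro mult_left_mono mult_right_mono) auto
   have "H^2 + H' * h = 9 * mu^2 * Y^2 * ((e1 * M + eY * eps)^2 + eY^2 * (M * eps))"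
    unfolding H_def H'_def h_def by (simp add: power2_eq_square algebra_simps)
   also have "... <= 9 * mu^2 * Y^2 * (3 * (M^2 * (exp (2 * mu) + exp (2 * mu * Y^2) * eps)))"
   proof (intro mult_left_mono)
    have "0 <= e1^2 * M^2" by simp
    then have "(e1 * M + eY * eps)^2 + eY^2 * (M * eps) <= 3 * (e1^2 * M^2) + 3 * (eY^2 * (M^2 * eps))"
     using a b d by linarith
    then show "(e1 * M + eY * eps)^2 + eY^2 * (M * eps) <= 3 * (M^2 * (exp (2 * mu) + exp (2 * mu * Y^2) * eps))"
     unfolding sq by (simp add: algebra_simps)
   qed simp
   finally have "C0 * mu^3 * (H^2 + H' * h) <= C0 * mu^3 * (9 * mu^2 * Y^2 * (3 * (M^2 * (exp (2 * mu) + exp (2 * mu * Y^2) * eps))))"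
    using C0 mu by (intro mult_left_mono) auto
   also have "... = C0 * (27 * Y^2 * M^2) * ((mu^3 * mu^2) * (exp (2 * mu) + exp (2 * mu * Y^2) * eps))"
    by (simp only: mult_ac)
   also have "mu^3 * mu^2 = mu^5" by (simp flip: power_add)
   finally show ?thesis by (simp add: Rem_def)
  qed
  have "en mu Vt / mu + mu * en mu (gr D) + mu^3 * en mu V =
   integral Q (%z. (E mu z)^2 * (Vt z)^2 / mu + mu * ((E mu z)^2 * (gr D z)^2) + mu^3 * ((E mu z)^2 * (V z)^2))"
   unfolding en_def using mu dc
   by (simp add: integral_add Q_integrable continuous_intros)
  also have "... <= integral Q (%z. K * ((E mu z * Vt z)^2 / (6 * mu * Y^2) + 2 * mu * (SS j. (DW j z)^2) + 21 * mu^3 * (W z)^2))"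
  proof (rule integral_le)
   fix z assume z: "z : Q"
   define a where "a = (E mu z * Vt z)^2 / (6 * mu * Y^2)"
   define b where "b = mu * (SS j. (DW j z)^2)"
   define w where "w = mu^3 * (W z)^2"
   have nn: "a >= 0" "b >= 0" "w >= 0" unfolding a_def b_def w_def using mu
    by (auto intro!: divide_nonneg_nonneg mult_nonneg_nonneg sum_nonneg)
   have 1: "(E mu z)^2 * (Vt z)^2 / mu = 6 * Y^2 * a" using mu Y by (simp add: a_def power_mult_distrib)
   have 2: "mu * ((E mu z)^2 * (gr D z)^2) <= 2 * b + 8 * Y^2 * w"
   proof -
    have p: "(E mu z * D i z)^2 <= 2 * (DW i z)^2 + (if i = i0 then 8 * mu^2 * Y^2 * (W z)^2 else 0)" for i
    proof (cases "i = i0")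
     case True
     have eq: "E mu z * D i z = DW i z - k i z * W z" by (simp add: DW_def W_def algebra_simps)
     have "(E mu z * D i z)^2 <= 2 * (DW i z)^2 + 2 * ((k i z)^2 * (W z)^2)"
      unfolding eq using zero_le_power2[of "DW i z + k i z * W z"] by (simp add: power2_eq_square algebra_simps)
     also have "(k i z)^2 <= (2 * mu * Y)^2" using kb[OF z] by (intro power_mono)
     finally show ?thesis using True by (simp add: mult_right_mono power_mult_distrib)
    next
     case False
     then have "DW i z = E mu z * D i z" by (simp add: DW_def k_def)
     then show ?thesis using False by simp
    qed
    have "(E mu z)^2 * (gr D z)^2 = (SS i. (E mu z * D i z)^2)"
     by (simp add: gr_squared sum_distrib_left power_mult_distrib)
    also have "... <= (SS i. 2 * (DW i z)^2 + (if i = i0 then 8 * mu^2 * Y^2 * (W z)^2 else 0))"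
     by (intro sum_mono p)
    also have "... = 2 * (SS i. (DW i z)^2) + 8 * mu^2 * Y^2 * (W z)^2"
     by (simp add: sum.distrib sum_distrib_left)
    finally have "mu * ((E mu z)^2 * (gr D z)^2) <= mu * (2 * (SS i. (DW i z)^2) + 8 * mu^2 * Y^2 * (W z)^2)"
     using mu by (intro mult_left_mono) auto
    then show ?thesis by (simp add: b_def w_def algebra_simps power2_eq_square power3_eq_cube)
   qed
   have 3: "mu^3 * ((E mu z)^2 * (V z)^2) = w" by (simp add: w_def W_def power_mult_distrib)
   have "6 * Y^2 * a + (2 * b + 8 * Y^2 * w) + w <= K * (a + 2 * b + 21 * w)"
   proof -
    have "Y^2 * a >= 0" "Y^2 * b >= 0" "Y^2 * w >= 0" using nn by auto
    then show ?thesis using nn unfolding K_def by (simp add: algebra_simps)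
   qed
   then have "(E mu z)^2 * (Vt z)^2 / mu + mu * ((E mu z)^2 * (gr D z)^2) + mu^3 * ((E mu z)^2 * (V z)^2)
    <= K * (a + 2 * b + 21 * w)" using 1 2 3 by linarith
   then show "(E mu z)^2 * (Vt z)^2 / mu + mu * ((E mu z)^2 * (gr D z)^2) + mu^3 * ((E mu z)^2 * (V z)^2)
    <= K * ((E mu z * Vt z)^2 / (6 * mu * Y^2) + 2 * mu * (SS j. (DW j z)^2) + 21 * mu^3 * (W z)^2)"
    unfolding a_def b_def w_def by (simp only: mult.assoc)
  qed (use mu Y c21D(6-10)[OF cW] dc in \<open>auto intro!: Q_integrable continuous_intros\<close>)
  also have "... = K * integral Q (%z. (E mu z * Vt z)^2 / (6 * mu * Y^2) + 2 * mu * (SS j. (DW j z)^2) + 21 * mu^3 * (W z)^2)"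
   by simp
  also have "... <= K * (2 * en mu (%z. sg * Vt z + (SS j. DD j j z)) + C0 * (27 * Y^2 * M^2) * Rem mu eps)"
   using main HH K unfolding L en_def by (intro mult_left_mono) linarith+
  also have "... <= C * (en mu (%z. sg * Vt z + (SS j. DD j j z)) + Rem mu eps)"
  proof -
   have "0 <= Rem mu eps" unfolding Rem_def using mu eps by (intro mult_nonneg_nonneg add_nonneg_nonneg) auto
   moreover have "0 <= en mu (%z. sg * Vt z + (SS j. DD j j z))" by simp
   moreover have "0 <= C0 * (27 * Y^2 * M^2)" using C0 by simp
   ultimately have "2 * en mu (%z. sg * Vt z + (SS j. DD j j z)) + C0 * (27 * Y^2 * M^2) * Rem mu eps <=
    (2 + C0 * (27 * Y^2 * M^2)) * (en mu (%z. sg * Vt z + (SS j. DD j j z)) + Rem mu eps)"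
    by (simp add: distrib_left distrib_right)
   then show ?thesis unfolding C_def mult.assoc[of K] using K by (intro mult_left_mono) auto
  qed
  finally show "en mu Vt / mu + mu * en mu (gr D) + mu^3 * en mu V
   <= C * (en mu (%z. sg * Vt z + (SS j. DD j j z)) + Rem mu eps)" .
 qed
qed

end

lemma gr_le_sum: "gr D z <= (SS i. |D i z| )"
 using L2_set_le_sum_abs[of "%i. D i z" UNIV] by (simp add: gr_def L2_set_def)

lemma gr_le:
 fixes D :: "'n::finite => 'a => real" and B :: real
 assumes "!!i. |D i z| <= B" shows "gr D z <= CARD('n) * B"
 using sum_mono[of UNIV "%i. |D i z|" "%_. B"] assms gr_le_sum[of D z] by simp

context space_time_box
begin

lemma Rem_nonneg: "mu >= 0 ==> eps >= 0 ==> Rem mu eps >= 0"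
 unfolding Rem_def by (intro mult_nonneg_nonneg add_nonneg_nonneg) auto

abbreviation carleman_mult_hyp where
 "carleman_mult_hyp M mu\<^sub>0 v vt vi vij vti r rt ri rij rti mu sg eps \<equiv>
   c21 Q v vt vi vij vti & c21 Q r rt ri rij rti & mu >= mu\<^sub>0 & sg^2 = 1 & 0 <= eps & eps <= M &
   (ALL j. ALL z:Q. |v z| <= M & |vt z| <= M & |vi j z| <= M) &
   (ALL i j. ALL z:Q. 1 <= M * |r z| & |r z| <= M & |rt z| <= M & |ri j z| <= M & |rij i j z| <= M) &
   (ALL j. ALL z:Q. known z --> |v z| <= eps & |vt z| <= eps & |vi j z| <= eps) &
   (ALL j. ALL z:Q. |v (fst z, T) * r (fst z, T) - v (fst z, 0) * r (fst z, 0)| <= eps &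
    |(vi j (fst z, T) * r (fst z, T) + v (fst z, T) * ri j (fst z, T)) -
     (vi j (fst z, 0) * r (fst z, 0) + v (fst z, 0) * ri j (fst z, 0))| <= eps)"

text \<open>The factor \<open>r\<close> is chosen later so that \<open>v r\<close> has almost equal values at the two ends of the time
  interval, although neither \<open>v (\<cdot>, 0)\<close> nor \<open>v (\<cdot>, T)\<close> is known.\<close>

lemma carleman_mult:
 assumes M: "M >= 1"
 shows "EX C>0. EX mu\<^sub>0>=1. ALL v vt vi vij vti r rt ri rij rti mu sg eps.
   carleman_mult_hyp M mu\<^sub>0 v vt vi vij vti r rt ri rij rti mu sg eps -->
   en mu vt / mu + mu * en mu (gr vi) + mu^3 * en mu v
   <= C * (en mu (%z. sg * vt z + (SS j. vij j j z)) + Rem mu eps)"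
proof -
 have M2: "2 * M^2 >= 1" "M^2 >= M" "M^2 >= 1" "M <= M^3" "M^3 >= 1"
  using M power_increasing[of 1 2 M] power_increasing[of 1 3 M] by auto
 from carleman[OF M2(1)] obtain C1 where C1: "C1 > 0" and car0: "!!V Vt D DD Dt mu sg eps.
   carleman_hyp (2 * M^2) V Vt D DD Dt mu sg eps
   ==>
   en mu Vt / mu + mu * en mu (gr D) + mu^3 * en mu V
   <= C1 * (en mu (%z. sg * Vt z + (SS j. DD j j z)) + Rem mu eps)"
  by (elim exE conjE) (rule that, assumption, elim allE impE, assumption+)
 define n where "n = real CARD('n)"
 have n: "n >= 1" unfolding n_def by (simp add: Suc_leI)
 define K1 where "K1 = 2 * (n + 1) * M"
 define K4 where "K4 = 2 * (M^3)^2 + 2 * (n * M^3)^2 + M^2"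
 define B where "B = K4 * C1 * (K1^2 * 3)"
 define C where "C = 2 * B + 4 * M * (K4 * C1)"
 have K4: "K4 > 0" unfolding K4_def using M by (intro add_nonneg_pos) auto
 have B: "B >= 0" unfolding B_def using K4 C1 by auto
 have C: "C > 0" unfolding C_def using B K4 C1 M by (intro add_nonneg_pos mult_pos_pos) auto
 show ?thesis
 \<comment> \<open>The factor \<open>r\<close> produces lower-order terms, at most \<open>B\<close>
   times the energies of \<open>v\<close> and of its gradient. For \<open>mu >= 2 * B\<close> they
   take up no more than half of the left side.\<close>
 proof (rule exI[of _ C], intro conjI C, rule exI[of _ "max 1 (2 * B)"], intro conjI allI impI, simp, elim conjE)
  fix v vt r rt :: "(real^'n) \<times> real => real" and vi vti ri rti :: "'n => (real^'n) \<times> real => real" and vij rij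
   and mu sg eps :: real
  assume cv: "c21 Q v vt vi vij vti" and cr: "c21 Q r rt ri rij rti" and mu0: "mu >= max 1 (2 * B)"
   and sg: "sg^2 = 1" and eps: "0 <= eps" "eps <= M"
   and glob: "ALL j. ALL z:Q. |v z| <= M & |vt z| <= M & |vi j z| <= M"
   and rb: "ALL i j. ALL z:Q. 1 <= M * |r z| & |r z| <= M & |rt z| <= M & |ri j z| <= M & |rij i j z| <= M"
   and lat: "ALL j. ALL z:Q. known z --> |v z| <= eps & |vt z| <= eps & |vi j z| <= eps"
   and ends: "ALL j. ALL z:Q. |v (fst z, T) * r (fst z, T) - v (fst z, 0) * r (fst z, 0)| <= eps &
    |(vi j (fst z, T) * r (fst z, T) + v (fst z, T) * ri j (fst z, T)) -
     (vi j (fst z, 0) * r (fst z, 0) + v (fst z, 0) * ri j (fst z, 0))| <= eps"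
  note dv = c21D(6-10)[OF cv] and dr = c21D(6-10)[OF cr]
  have mu: "mu >= 1" "mu >= 2 * B" using mu0 by auto
  define V where "V z = v z * r z" for z
  define Vt where "Vt z = vt z * r z + v z * rt z" for z
  define D where "D i z = vi i z * r z + v z * ri i z" for i z
  define DD where "DD i j z = vij i j z * r z + vi i z * ri j z + vi j z * ri i z + v z * rij i j z" for i j z
  define op where "op z = sg * vt z + (SS j. vij j j z)" for z
  define OP where "OP z = sg * Vt z + (SS j. DD j j z)" for z
  have cV: "c21 Q V Vt D DD (%i z. vti i z * r z + vi i z * rt z + vt z * ri i z + v z * rti i z)"
   unfolding V_def Vt_def D_def DD_def by (rule c21_mult[OF cv cr])
  note dV = c21D(6-10)[OF cV]
  have rr: "1 <= M * |r z|" "|r z| <= M" "|rt z| <= M" "|ri j z| <= M" "|rij i j z| <= M" if "z : Q" for i j z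
   using rb that by blast+
  have sg1: "|sg| = 1" using sg by (auto simp: power2_eq_1_iff)
  have pr: "|a * b| <= x * M" if "|a| <= x" "|b| <= M" for a b x
   using that M unfolding abs_mult by (intro mult_mono) auto
  have pr2: "|a * b + c * d| <= 2 * (x * M)" if "|a| <= x" "|b| <= M" "|c| <= x" "|d| <= M" for a b c d x
   using pr[OF that(1,2)] pr[OF that(3,4)] by linarith
  have "en mu Vt / mu + mu * en mu (gr D) + mu^3 * en mu V <= C1 * (en mu OP + Rem mu (2 * M * eps))"
   unfolding OP_def
  proof (rule car0[of V Vt D DD], intro conjI allI ballI impI)
   show "c21 Q V Vt D DD (%i z. vti i z * r z + vi i z * rt z + vt z * ri i z + v z * rti i z)" by (rule cV)
   show "mu >= 1" "sg^2 = 1" "0 <= 2 * M * eps" using mu sg M eps by auto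
   show "2 * M * eps <= 2 * M^2" using eps M by (simp add: power2_eq_square)
  next
   fix j z assume z: "z : Q"
   have g: "|v z| <= M" "|vt z| <= M" "|vi j z| <= M" using glob z by blast+
   show "|V z| <= 2 * M^2" using pr[OF g(1) rr(2)[OF z]] M2 by (simp add: V_def power2_eq_square)
   show "|Vt z| <= 2 * M^2" using pr2[OF g(2) rr(2)[OF z] g(1) rr(3)[OF z]] by (simp add: Vt_def power2_eq_square)
   show "|D j z| <= 2 * M^2" using pr2[OF g(3) rr(2)[OF z] g(1) rr(4)[OF z]] by (simp add: D_def power2_eq_square)
  next
   fix j z assume z: "z : Q" and k: "known z"
   have g: "|v z| <= eps" "|vt z| <= eps" "|vi j z| <= eps" using lat z k by blast+
   have "0 <= eps * M" using eps M by simp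
   moreover have "2 * M * eps = eps * M + eps * M" by simp
   ultimately show "|V z| <= 2 * M * eps" using pr[OF g(1) rr(2)[OF z]] unfolding V_def by linarith
   show "|Vt z| <= 2 * M * eps" using pr2[OF g(2) rr(2)[OF z] g(1) rr(3)[OF z]] by (simp add: Vt_def mult_ac)
   show "|D j z| <= 2 * M * eps" using pr2[OF g(3) rr(2)[OF z] g(1) rr(4)[OF z]] by (simp add: D_def mult_ac)
  next
   fix j z assume z: "z : Q"
   have "1 * eps <= 2 * M * eps" using eps M by (intro mult_right_mono) auto
   moreover have "|V (fst z, T) - V (fst z, 0)| <= eps" "|D j (fst z, T) - D j (fst z, 0)| <= eps"
    unfolding V_def D_def using ends z by blast+
   ultimately show "|V (fst z, T) - V (fst z, 0)| <= 2 * M * eps" "|D j (fst z, T) - D j (fst z, 0)| <= 2 * M * eps"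
    by linarith+
  qed
  note main = this
  have e1: "en mu OP <= K1^2 * 3 * (en mu op + en mu v + en mu (gr vi))"
  proof -
   have "en mu OP <= K1^2 * length [op, v, gr vi] * (\<Sum>g\<leftarrow>[op, v, gr vi]. en mu g)"
   proof (rule en_le_list)
    fix z assume z: "z : Q"
    have dsum: "(SS j. DD j j z) = r z * (SS j. vij j j z) + 2 * (SS j. vi j z * ri j z) + v z * (SS j. rij j j z)"
     by (simp add: DD_def sum.distrib sum_distrib_left mult_ac)
    have OPeq: "OP z = op z * r z + v z * (sg * rt z) + v z * (SS j. rij j j z) + 2 * (SS j. vi j z * ri j z)"
     unfolding OP_def op_def dsum Vt_def by (simp add: algebra_simps)
    have a: "|op z * r z| <= |op z| * M" by (rule pr) (use rr[OF z] in auto)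
    have b: "|v z * (sg * rt z)| <= |v z| * M" by (rule pr) (use rr[OF z] sg1 in \<open>auto simp: abs_mult\<close>)
    have "|SS j. rij j j z| <= (\<Sum>j\<in>(UNIV::'n set). M)" by (rule order_trans[OF sum_abs sum_mono]) (use rr[OF z] in auto)
    then have c: "|v z * (SS j. rij j j z)| <= |v z| * (n * M)" unfolding abs_mult n_def by (intro mult_left_mono) auto
    have "|SS j. vi j z * ri j z| <= (\<Sum>j\<in>(UNIV::'n set). gr vi z * M)"
     by (rule order_trans[OF sum_abs sum_mono], rule pr[OF abs_le_gr]) (use rr[OF z] in auto)
    then have d: "|SS j. vi j z * ri j z| <= n * (gr vi z * M)" by (simp add: n_def)
    have "|OP z| <= |op z| * M + |v z| * M + |v z| * (n * M) + 2 * (n * (gr vi z * M))"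
     unfolding OPeq using a b c d by linarith
    also have "... = M * |op z| + (n + 1) * M * |v z| + 2 * n * M * gr vi z" by (simp add: algebra_simps)
    also have "... <= K1 * |op z| + K1 * |v z| + K1 * gr vi z"
     unfolding K1_def using M n by (intro add_mono mult_right_mono) (auto simp: algebra_simps)
    finally show "|OP z| <= K1 * (\<Sum>g\<leftarrow>[op, v, gr vi]. |g z| )" by (simp add: algebra_simps)
   qed (use M n in \<open>auto simp: OP_def op_def K1_def intro!: continuous_intros dv dV\<close>)
   then show ?thesis by (simp add: algebra_simps)
  qed
  have vV: "|v z| <= M * |V z|" if z: "z : Q" for z
   using mult_left_mono[OF rr(1)[OF z], of "|v z|"] by (simp add: V_def abs_mult mult_ac)
  \<comment> \<open>Division by \<open>r\<close> is controlled by \<open>1 <= M * |r z|\<close>. A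
    derivative of \<open>v\<close> is recovered from the same derivative of the product and from
    \<open>V\<close> itself.\<close>
  have rev: "|a| <= M^3 * ( |a * r z + v z * b| + |V z| )" if z: "z : Q" and b: "|b| <= M" for a b z
  proof -
   have "|a| * 1 <= |a| * (M * |r z| )" using rr(1)[OF z] by (intro mult_left_mono) auto
   also have "... = M * |(a * r z + v z * b) - v z * b|" by (simp add: abs_mult mult_ac)
   also have "... <= M * ( |a * r z + v z * b| + |v z| * M)"
    using M pr[OF order_refl b, of "v z"] by (intro mult_left_mono) linarith+
   also have "... <= M * ( |a * r z + v z * b| + (M * |V z| ) * M)"
    using M vV[OF z] by (intro mult_left_mono add_left_mono mult_right_mono) auto
   also have "... = M * |a * r z + v z * b| + M^3 * |V z|" by (simp add: algebra_simps power3_eq_cube)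
   also have "... <= M^3 * |a * r z + v z * b| + M^3 * |V z|" using M2 by (intro add_right_mono mult_right_mono) auto
   finally show ?thesis by (simp add: algebra_simps)
  qed
  have f1: "en mu v <= M^2 * en mu V"
   using en_le_list[of v "[V]" M mu] vV dv dV M by simp
  have f2: "en mu vt <= 2 * (M^3)^2 * (en mu Vt + en mu V)"
  proof -
   have "en mu vt <= (M^3)^2 * length [Vt, V] * (\<Sum>g\<leftarrow>[Vt, V]. en mu g)"
   proof (rule en_le_list)
    fix z assume z: "z : Q"
    show "|vt z| <= M^3 * (\<Sum>g\<leftarrow>[Vt, V]. |g z| )"
     using rev[OF z rr(3)[OF z], of "vt z"] by (simp add: Vt_def)
   qed (use M dv dV in auto)
   then show ?thesis by (simp add: algebra_simps)
  qed
  have f3: "en mu (gr vi) <= 2 * (n * M^3)^2 * (en mu (gr D) + en mu V)"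
  proof -
   have "en mu (gr vi) <= (n * M^3)^2 * length [gr D, V] * (\<Sum>g\<leftarrow>[gr D, V]. en mu g)"
   proof (rule en_le_list)
    fix z assume z: "z : Q"
    have "|vi i z| <= M^3 * (gr D z + |V z| )" for i
    proof -
     have "|vi i z| <= M^3 * ( |D i z| + |V z| )"
      using rev[OF z rr(4)[OF z], of "vi i z"] by (simp add: D_def)
     also have "... <= M^3 * (gr D z + |V z| )" using M abs_le_gr[of D i z] by (intro mult_left_mono) auto
     finally show ?thesis .
    qed
    then show "|gr vi z| <= n * M^3 * (\<Sum>g\<leftarrow>[gr D, V]. |g z| )"
     using gr_le[of vi z] by (simp add: n_def mult.assoc)
   qed (use M n dv dV in \<open>auto intro!: continuous_intros\<close>)
   then show ?thesis by (simp add: algebra_simps)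
  qed
  define LV where "LV = en mu Vt / mu + mu * en mu (gr D) + mu^3 * en mu V"
  define Lv where "Lv = en mu vt / mu + mu * en mu (gr vi) + mu^3 * en mu v"
  have m3: "1 / mu <= mu^3" "mu <= mu^3" "mu^3 >= 0" "1 / mu >= 0"
   using mu power_increasing[of 1 3 mu] one_le_power[of mu 3] by (auto intro: order_trans[of _ 1])
  have LL: "Lv <= K4 * LV"
  proof -
   define p q where "p = 2 * (M^3)^2" and "q = 2 * (n * M^3)^2"
   have pq: "p >= 0" "q >= 0" "K4 = p + q + M^2" by (auto simp: p_def q_def K4_def)
   have "Lv <= (p * (en mu Vt + en mu V)) / mu + mu * (q * (en mu (gr D) + en mu V)) + mu^3 * (M^2 * en mu V)"
    unfolding Lv_def p_def q_def using f1 f2 f3 mu m3 by (intro add_mono divide_right_mono mult_left_mono) auto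
   also have "... = p * (en mu Vt / mu) + q * (mu * en mu (gr D)) + (p * (1 / mu) + q * mu + M^2 * mu^3) * en mu V"
    using mu by (simp add: field_simps)
   also have "... <= K4 * (en mu Vt / mu) + K4 * (mu * en mu (gr D)) + (p * mu^3 + q * mu^3 + M^2 * mu^3) * en mu V"
    using pq mu m3 by (intro add_mono mult_right_mono mult_left_mono) auto
   also have "... = K4 * LV" unfolding pq LV_def by (simp add: algebra_simps)
   finally show ?thesis .
  qed
  have "Rem mu (2 * M * eps) <= 2 * M * Rem mu eps"
  proof -
   have "exp (2 * mu) <= 2 * M * exp (2 * mu)" using M by simp
   then have "Rem mu (2 * M * eps) <= mu^5 * (2 * M * (exp (2 * mu) + exp (2 * mu * Y^2) * eps))"
    unfolding Rem_def using mu by (intro mult_left_mono) (auto simp: algebra_simps)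
   also have "... = 2 * M * Rem mu eps" by (simp add: Rem_def)
   finally show ?thesis .
  qed
  then have "Lv <= K4 * (C1 * (K1^2 * 3 * (en mu op + en mu v + en mu (gr vi)) + 2 * M * Rem mu eps))"
   using order_trans[OF LL mult_left_mono[OF main[folded LV_def]]] e1 K4 C1
   by (smt (verit, ccfv_SIG) mult_left_mono)
  also have "... = B * en mu op + B * en mu v + B * en mu (gr vi) + 2 * M * (K4 * C1) * Rem mu eps"
   by (simp add: B_def algebra_simps)
  also have "... <= B * en mu op + (mu^3 / 2) * en mu v + (mu / 2) * en mu (gr vi) + 2 * M * (K4 * C1) * Rem mu eps"
   using mu m3 K4 C1 M Rem_nonneg[of mu eps] eps by (intro add_mono mult_right_mono) auto
  finally have "Lv <= B * en mu op + (mu^3 / 2) * en mu v + (mu / 2) * en mu (gr vi) + 2 * M * (K4 * C1) * Rem mu eps" .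
  moreover have "(mu^3 / 2) * en mu v + (mu / 2) * en mu (gr vi) <= Lv / 2"
  proof -
   have "Lv / 2 = en mu vt / mu / 2 + (mu^3 / 2) * en mu v + (mu / 2) * en mu (gr vi)"
    unfolding Lv_def by (simp add: add_divide_distrib)
   moreover have "en mu vt / mu / 2 >= 0" using mu by simp
   ultimately show ?thesis by linarith
  qed
  ultimately have "Lv <= B * en mu op + Lv / 2 + 2 * M * (K4 * C1) * Rem mu eps" by linarith
  then have "Lv <= 2 * B * en mu op + 4 * M * (K4 * C1) * Rem mu eps" by (simp add: field_simps)
  also have "... <= C * en mu op + C * Rem mu eps"
   unfolding C_def using B K4 C1 M Rem_nonneg[of mu eps] mu eps by (intro add_mono mult_right_mono) auto
  finally show "en mu vt / mu + mu * en mu (gr vi) + mu^3 * en mu v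
   <= C * (en mu (%z. sg * vt z + (SS j. vij j j z)) + Rem mu eps)"
   by (simp add: Lv_def op_def[abs_def] algebra_simps)
 qed
qed

end

section \<open>The energy estimate for the coupled system\<close>

lemma le_mult_ge_one: "x <= c * x" if "1 <= c" "0 <= x" for x c :: real
 using mult_right_mono[OF that] by simp

text \<open>The coupled estimates are closed with energies as plain numbers: \<open>a0\<close>,
  \<open>a1\<close>, \<open>tt\<close> belong to v, its gradient and its time derivative,
  \<open>w0\<close>, \<open>w1\<close> to w and its gradient, \<open>B\<close> to b1 - b2 and
  \<open>V0\<close> to the trace of v at time 0; \<open>G\<close> is the remainder. The trace
  inequality has a free parameter \<open>k\<close>. With \<open>k\<close> of order \<open>mu\<close>
  its part \<open>tt / k\<close> is absorbed by \<open>tt / mu\<close>, and afterwards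
  \<open>k = 1\<close> is good enough. Since \<open>tt\<close> itself is bounded only with a factor
  \<open>mu\<close>, the same factor appears in the result.\<close>

lemma energy_algebra:
 fixes C T :: real
 assumes C: "C >= 1" and T: "T > 0"
 shows "EX C'>0. EX mu\<^sub>0>=1. ALL a0 a1 tt w0 w1 G B V0 mu. mu >= mu\<^sub>0 &
   0 <= a0 & 0 <= a1 & 0 <= tt & 0 <= w0 & 0 <= w1 & 0 <= G & 0 <= B &
   tt / mu + mu * a1 + mu^3 * a0 <= C * (a0 + a1 + w0 + G + B) &
   B <= C * (V0 + G) & (ALL k>0. V0 <= a0 + T * (k * a0 + tt / k)) &
   mu * w1 + mu^3 * w0 <= C * (w0 + w1 + a0 + a1 + tt + G + B) --> a0 + w0 <= C' * (mu * G)"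
proof -
 \<comment> \<open>Makes \<open>C^2 * T / \<kappa>\<close> at most one half, so that half of
   \<open>b = tt / mu\<close> survives the absorption.\<close>
 define \<kappa> where "\<kappa> = 2 * C^2 * T + 1"
 define L where "L = C + C^2 + C^2 * T * \<kappa>"
 define L2 where "L2 = C * ((1 + 2 * T) * (2 * L) + 1)"
 define L3 where "L3 = C * (2 + 6 * L + L2)"
 define mu\<^sub>0 where "mu\<^sub>0 = 1 + 2 * L + 2 * L3"
 define C' where "C' = 2 * L3 + 2 * L * (2 * L3 + 1)"
 have k0: "\<kappa> > 0" using C T by (simp add: \<kappa>_def add_nonneg_pos)
 have L: "L >= 1" unfolding L_def using C T k0 by (intro order_trans[OF C]) simp
 have L2: "L2 >= 0" unfolding L2_def using C T L by (intro mult_nonneg_nonneg add_nonneg_nonneg) auto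
 have L3: "L3 >= 0" unfolding L3_def using C L L2 by (intro mult_nonneg_nonneg add_nonneg_nonneg) auto
 have C': "C' > 0" unfolding C'_def using L L3 by (intro add_nonneg_pos mult_pos_pos) auto
 have mu0: "mu\<^sub>0 >= 1" unfolding mu\<^sub>0_def using L L3 by simp
 show ?thesis
 proof (rule exI[of _ C'], intro conjI C', rule exI[of _ mu\<^sub>0], intro conjI allI impI mu0, elim conjE)
  fix a0 a1 tt w0 w1 G B V0 mu :: real
  assume mu1: "mu >= mu\<^sub>0" and nn: "0 <= a0" "0 <= a1" "0 <= tt" "0 <= w0" "0 <= w1" "0 <= G" "0 <= B"
   and A: "tt / mu + mu * a1 + mu^3 * a0 <= C * (a0 + a1 + w0 + G + B)"
   and Bq: "B <= C * (V0 + G)" and V: "ALL k>0. V0 <= a0 + T * (k * a0 + tt / k)"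
   and W: "mu * w1 + mu^3 * w0 <= C * (w0 + w1 + a0 + a1 + tt + G + B)"
  have mu: "mu >= 1" "mu >= 2 * L" "mu >= 2 * L3" using mu1 L L3 unfolding mu\<^sub>0_def by linarith+
  have sq: "2 * L * mu <= mu^3" "2 * L3 * mu <= mu^3" "mu <= mu^3" "1 <= mu^3"
  proof -
   have *: "mu * mu <= mu^3" using mu power_increasing[of 2 3 mu] by (simp add: power2_eq_square)
   show "2 * L * mu <= mu^3" "2 * L3 * mu <= mu^3"
    using mu by (auto intro: order_trans[OF mult_right_mono *])
   show "mu <= mu^3" "1 <= mu^3" using mu power_increasing[of 1 3 mu] by auto
  qed
  define b where "b = tt / mu"
  have b: "b >= 0" "tt = mu * b" using nn mu by (auto simp: b_def)
  have "V0 <= a0 + T * (\<kappa> * mu * a0 + tt / (\<kappa> * mu))" using V k0 mu by simp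
  also have "tt / (\<kappa> * mu) = b / \<kappa>" using mu k0 by (simp add: b_def)
  finally have V1: "V0 <= a0 + T * \<kappa> * (mu * a0) + T / \<kappa> * b" by (simp add: algebra_simps)
  have CB: "C * B <= C^2 * (V0 + G)" using mult_left_mono[OF Bq, of C] C by (simp add: power2_eq_square mult.assoc)
  have "C^2 * V0 <= C^2 * (a0 + T * \<kappa> * (mu * a0) + T / \<kappa> * b)" using V1 by (intro mult_left_mono) auto
  also have "... = C^2 * a0 + C^2 * T * \<kappa> * (mu * a0) + C^2 * T / \<kappa> * b" by (simp add: algebra_simps)
  also have "C^2 * T / \<kappa> * b <= 1 / 2 * b" using b k0 by (intro mult_right_mono) (auto simp: \<kappa>_def field_simps)
  finally have V2: "C^2 * V0 <= C^2 * a0 + C^2 * T * \<kappa> * (mu * a0) + b / 2" by simp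
  have ma: "a0 <= mu * a0" using mu nn by (intro le_mult_ge_one)
  have "b + mu * a1 + mu^3 * a0 <= C * (a0 + a1 + w0 + G) + C * B" using A by (simp add: b_def algebra_simps)
  also have "... <= C * (a0 + a1 + w0 + G) + (C^2 * a0 + C^2 * T * \<kappa> * (mu * a0) + b / 2 + C^2 * G)"
   using CB V2 by (simp add: algebra_simps)
  also have "... <= C * (mu * a0 + a1 + w0 + G) + (C^2 * (mu * a0) + C^2 * T * \<kappa> * (mu * a0) + b / 2 + C^2 * G)"
   using ma C T k0 mu by (intro add_mono mult_left_mono) auto
  also have "... = L * (mu * a0) + C * a1 + C * w0 + (C + C^2) * G + b / 2" by (simp add: L_def algebra_simps)
  also have "... <= L * (mu * a0) + L * a1 + L * w0 + L * G + b / 2"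
   using nn C T k0 by (intro add_mono mult_right_mono order_refl) (auto simp: L_def)
  also have "L * (mu * a0) <= mu^3 / 2 * a0" using mult_right_mono[OF sq(1) nn(1)] by simp
  also have "L * a1 <= mu / 2 * a1" using mu nn by (intro mult_right_mono) auto
  finally have "b / 2 + mu / 2 * a1 + mu^3 / 2 * a0 <= L * w0 + L * G" by (simp add: algebra_simps)
  then have R: "b + mu * a1 + mu^3 * a0 <= 2 * L * (w0 + G)" by (simp add: algebra_simps)
  have pa: "mu * a1 >= a1" "mu^3 * a0 >= a0" "mu * a1 >= 0" "mu^3 * a0 >= 0"
   using mu sq nn by (auto intro!: le_mult_ge_one)
  define P where "P = w0 + G"
  have P: "P >= 0" "P <= mu * P" using nn mu by (auto simp: P_def intro!: le_mult_ge_one)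
  have a: "a0 <= 2 * L * P" "a1 <= 2 * L * P" "b <= 2 * L * P" using R pa b nn unfolding P_def by linarith+
  have LP: "2 * L * P <= 2 * L * (mu * P)" using P L by (intro mult_left_mono) auto
  have a': "a0 <= 2 * L * (mu * P)" "a1 <= 2 * L * (mu * P)" using a LP by linarith+
  have tt: "tt <= 2 * L * (mu * P)"
   using mult_left_mono[OF a(3), of mu] mu unfolding b(2) by (simp add: mult_ac)
  have "B <= L2 * (mu * P)"
  proof -
   \<comment> \<open>The second use of the trace inequality. There is nothing left to absorb, all
     energies of v being bounded by \<open>mu * P\<close> already.\<close>
   have "V0 <= a0 + T * (1 * a0 + tt / 1)" using V by (meson zero_less_one)
   also have "... <= 2 * L * (mu * P) + T * (2 * L * (mu * P) + 2 * L * (mu * P))"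
    using a' tt T by (intro add_mono mult_left_mono) auto
   also have "... = (1 + 2 * T) * (2 * L) * (mu * P)" by (simp add: algebra_simps)
   finally have "V0 + G <= ((1 + 2 * T) * (2 * L) + 1) * (mu * P)" using P nn by (simp add: P_def algebra_simps)
   then have "C * (V0 + G) <= C * (((1 + 2 * T) * (2 * L) + 1) * (mu * P))" using C by (intro mult_left_mono) auto
   then show ?thesis using Bq by (simp add: L2_def mult.assoc)
  qed
  moreover have "w0 + G <= mu * P" using P by (simp add: P_def)
  ultimately have "w0 + w1 + a0 + a1 + tt + G + B <= w1 + mu * P + 3 * (2 * L * (mu * P)) + L2 * (mu * P)"
   using a' tt by linarith
  then have "C * (w0 + w1 + a0 + a1 + tt + G + B) <= C * (w1 + mu * P + 3 * (2 * L * (mu * P)) + L2 * (mu * P))"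
   using C by (intro mult_left_mono) auto
  also have "... = C * w1 + C * (1 + 6 * L + L2) * (mu * P)" by (simp add: algebra_simps)
  also have "... <= L3 * w1 + L3 * (mu * P)"
  proof (intro add_mono mult_right_mono)
   have "C * 1 <= C * (2 + 6 * L + L2)" using C L L2 by (intro mult_left_mono) auto
   then show "C <= L3" by (simp add: L3_def)
   show "C * (1 + 6 * L + L2) <= L3" unfolding L3_def using C by (intro mult_left_mono) auto
  qed (use nn P mu in auto)
  also have "... <= mu * w1 + L3 * (mu * w0) + L3 * (mu * G)"
  proof -
   have "L3 * w1 <= mu * w1" using mu nn L3 by (intro mult_right_mono) auto
   then show ?thesis by (simp add: P_def algebra_simps)
  qed
  \<comment> \<open>The factor \<open>mu\<close> lost in \<open>tt\<close> does no harm here,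
    because the left side carries \<open>mu^3\<close>.\<close>
  also have "L3 * (mu * w0) <= mu^3 / 2 * w0" using mult_right_mono[OF sq(2) nn(4)] by simp
  finally have "mu^3 * w0 <= 2 * L3 * (mu * G)" using W by simp
  moreover have "w0 <= mu^3 * w0" using sq nn by (intro le_mult_ge_one)
  ultimately have w: "w0 <= 2 * L3 * (mu * G)" by linarith
  have mG: "G <= mu * G" using mu nn by (intro le_mult_ge_one)
  have "a0 <= 2 * L * (w0 + G)" using a by (simp add: P_def)
  also have "... <= 2 * L * (2 * L3 * (mu * G) + mu * G)" using w mG L by (intro mult_left_mono) auto
  finally show "a0 + w0 <= C' * (mu * G)" using w by (simp add: C'_def algebra_simps)
 qed
qed

context space_time_box
begin

lemma E_time: "E mu (x, t) = E mu (x, t')"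
 by (simp add: E_def yw_def)

lemma Q_time: "z : Q ==> t : {0..T} ==> (fst z, t) : Q"
 by (auto simp: mem_Q)

lemma en_gr: "en mu (gr D) = (SS i. en mu (D i))"
 if "!!i. continuous_on Q (D i)" for D :: "'n => (real^'n) \<times> real => real"
proof -
 have "en mu (gr D) = integral Q (%z. SS i. (E mu z)^2 * (D i z)^2)"
  unfolding en_def gr_squared by (simp add: sum_distrib_left)
 also have "... = (SS i. en mu (D i))"
  unfolding en_def by (rule integral_sum) (auto intro!: Q_integrable continuous_intros that)
 finally show ?thesis .
qed

text \<open>The fundamental theorem of calculus for (T - t) E^2 v^2, which vanishes at t = T and
  yields the trace at t = 0. Being two-sided, the bound estimates the trace by the energies of
  \<open>v\<close> and \<open>vt\<close>, and also, in \<open>en_Volterra\<close>, an energy by the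
  trace and the energy of the time derivative.\<close>

lemma en_initial:
 assumes v: "hpd Q dt v vt" "continuous_on Q v" "continuous_on Q vt" and k: "k > 0"
 shows "|en mu (%z. v (fst z, 0)) - en mu v| <= T * (k * en mu v + en mu vt / k)"
proof -
 define F where "F z = (T - snd z) * ((E mu z)^2 * (v z)^2)" for z
 define f where "f z = - ((E mu z)^2 * (v z)^2) + (T - snd z) * ((E mu z)^2 * (2 * v z * vt z))" for z
 have hF: "hpd Q dt F f"
  unfolding F_def f_def
  by (rule hpd_cong1[OF hpd_mult[OF hpd_diff[OF hpd_const hpd_dt_time]
    hpd_mult[OF hpd_power2[OF c21D(1)[OF c21_E]] hpd_power2[OF v(1)]]]]) simp
 have cf: "continuous_on Q f" unfolding f_def by (intro continuous_intros v)
 have c0: "continuous_on Q (%z. v (fst z, 0))"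
  by (intro continuous_on_compose2[OF v(2)] continuous_intros) (auto intro: Q_time simp: T_pos less_imp_le)
 have "integral Q f = integral Q (%z. F (upd dt ((A, T) \<bullet> dt) z) - F (upd dt ((- A, 0) \<bullet> dt) z)) / ((A, T) \<bullet> dt - (- A, 0) \<bullet> dt)"
  unfolding Q_def by (rule integral_hpd[OF hF[unfolded Q_def]]) (use T_pos cf[unfolded Q_def] in auto)
 also have "... = integral Q (%z. (- T) * ((E mu z)^2 * (v (fst z, 0))^2)) / T"
 proof -
  have "F (upd dt ((A, T) \<bullet> dt) z) - F (upd dt ((- A, 0) \<bullet> dt) z) = (- T) * ((E mu z)^2 * (v (fst z, 0))^2)" for z
   using E_time[of mu "fst z" 0 "snd z"] by (simp add: F_def upd_dt)
  then show ?thesis by simp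
 qed
 also have "... = - en mu (%z. v (fst z, 0))" using T_pos by (simp add: en_def)
 finally have "integral Q f = - en mu (%z. v (fst z, 0))" .
 moreover have "integral Q f = - en mu v + integral Q (%z. (T - snd z) * ((E mu z)^2 * (2 * v z * vt z)))"
  unfolding f_def en_def
  by (subst integral_add) (auto intro!: Q_integrable continuous_intros v)
 moreover have "|integral Q (%z. (T - snd z) * ((E mu z)^2 * (2 * v z * vt z)))| <=
   integral Q (%z. T * k * ((E mu z)^2 * (v z)^2) + T / k * ((E mu z)^2 * (vt z)^2))"
  unfolding real_norm_def[symmetric]
 proof (rule integral_norm_bound_integral)
  fix z assume z: "z : Q"
  have "(k * |v z| - |vt z| )^2 / k >= 0" using k by simp
  also have "(k * |v z| - |vt z| )^2 / k = k * (v z)^2 + (vt z)^2 / k - 2 * |v z| * |vt z|"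
   using k by (simp add: field_simps power2_eq_square)
  finally have *: "2 * |v z| * |vt z| <= k * (v z)^2 + (vt z)^2 / k" by simp
  have "norm ((T - snd z) * ((E mu z)^2 * (2 * v z * vt z))) = (T - snd z) * ((E mu z)^2 * (2 * |v z| * |vt z| ))"
   using z by (simp add: abs_mult mem_Q)
  also have "... <= T * ((E mu z)^2 * (k * (v z)^2 + (vt z)^2 / k))"
   using z * T_pos by (intro mult_mono mult_left_mono) (auto simp: mem_Q)
  finally show "norm ((T - snd z) * ((E mu z)^2 * (2 * v z * vt z))) <= T * k * ((E mu z)^2 * (v z)^2) + T / k * ((E mu z)^2 * (vt z)^2)"
   by (simp add: algebra_simps)
 qed (use k in \<open>auto intro!: Q_integrable continuous_intros v\<close>)
 moreover have "integral Q (%z. T * k * ((E mu z)^2 * (v z)^2) + T / k * ((E mu z)^2 * (vt z)^2)) = T * (k * en mu v + en mu vt / k)"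
  unfolding en_def using k
  by (subst integral_add) (auto intro!: Q_integrable continuous_intros v simp: algebra_simps)
 ultimately show ?thesis by linarith
qed

lemma en_const_Rem: "en mu (%_. eps) <= vol * M * Rem mu eps" if "mu >= 1" "0 <= eps" "eps <= M"
proof -
 have v: "vol >= 0" by (simp add: vol_def)
 have "en mu (%_. eps) <= vol * (exp (2 * mu * Y^2) * eps^2)" using that by (intro en_const_le) auto
 also have "... <= vol * (exp (2 * mu * Y^2) * (M * eps))"
  using that v by (intro mult_left_mono) (auto simp: power2_eq_square mult_right_mono)
 also have "... = vol * M * (1 * (0 + exp (2 * mu * Y^2) * eps))" by simp
 also have "... <= vol * M * Rem mu eps"
  unfolding Rem_def using that v by (intro mult_left_mono mult_mono add_mono) auto
 finally show ?thesis .
qed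

text \<open>The choice \<open>k = 1 / (2 * T)\<close> in \<open>en_initial\<close> leaves half of
  the energy of \<open>U\<close> on the left. In this way the differences of u and m are recovered
  from their time derivatives; as the weight does not depend on time, no power of \<open>mu\<close>
  is lost.\<close>

lemma en_Volterra:
 assumes U: "hpd Q dt U f" "continuous_on Q U" "continuous_on Q f"
  and ini: "!!z. z : Q ==> |U (fst z, 0)| <= eps" and eps: "mu >= 1" "0 <= eps" "eps <= M"
 shows "en mu U <= 2 * vol * M * Rem mu eps + 4 * T^2 * en mu f"
proof -
 have "|en mu (%z. U (fst z, 0)) - en mu U| <= T * (1 / (2 * T) * en mu U + en mu f / (1 / (2 * T)))"
  by (rule en_initial[OF U]) (use T_pos in simp)
 also have "... = en mu U / 2 + 2 * T^2 * en mu f" using T_pos by (simp add: field_simps power2_eq_square)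
 finally have "en mu U <= 2 * en mu (%z. U (fst z, 0)) + 4 * T^2 * en mu f" by linarith
 also have "en mu (%z. U (fst z, 0)) <= en mu (%_. eps)"
 proof -
  have "continuous_on Q (%z. U (fst z, 0))"
   by (intro continuous_on_compose2[OF U(2)] continuous_intros) (auto intro: Q_time simp: T_pos less_imp_le)
  then show ?thesis
   using en_le_list[of "%z. U (fst z, 0)" "[%_. eps]" 1 mu] ini eps by simp
 qed
 also note en_const_Rem[OF eps]
 finally show ?thesis by simp
qed

lemma c21_one: "c21 Q (%_. 1) (%_. 0) (%_ _. 0) (%_ _ _. 0) (%_ _. 0)"
 unfolding c21_def by simp

text \<open>What the energy estimate uses of the two solutions. \<open>U\<close> and
  \<open>m\<close> stand for the differences themselves, \<open>v\<close> and \<open>w\<close> for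
  their time derivatives, \<open>Jw\<close> and \<open>Jm\<close> for the interactions of
  \<open>w\<close> and \<open>m\<close>, and \<open>bt\<close> for the difference of the
  coefficients. The last inequality has \<open>vt\<close> on its right side instead of a Laplacian
  of \<open>v\<close>: the first equation has been used to exchange them.\<close>

abbreviation energy_hyp where
 "energy_hyp M mu\<^sub>0 v vt vi vij vti w wt wi wij wti r rt ri rij rti U Ui m mi Jw Jm bt mu eps \<equiv>
   mu >= mu\<^sub>0 & 0 <= eps & eps <= M &
   c21 Q v vt vi vij vti & c21 Q w wt wi wij wti & c21 Q r rt ri rij rti &
   (ALL j. ALL z:Q. |v z| <= M & |vt z| <= M & |vi j z| <= M & |w z| <= M & |wt z| <= M & |wi j z| <= M) &
   (ALL i j. ALL z:Q. 1 <= M * |r z| & |r z| <= M & |rt z| <= M & |ri j z| <= M & |rij i j z| <= M) &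
   (ALL j. ALL z:Q. known z --> |v z| <= eps & |vt z| <= eps & |vi j z| <= eps &
    |w z| <= eps & |wt z| <= eps & |wi j z| <= eps) &
   (ALL j. ALL z:Q. |v (fst z, T) * r (fst z, T) - v (fst z, 0) * r (fst z, 0)| <= eps &
    |(vi j (fst z, T) * r (fst z, T) + v (fst z, T) * ri j (fst z, T)) -
     (vi j (fst z, 0) * r (fst z, 0) + v (fst z, 0) * ri j (fst z, 0))| <= eps &
    |w (fst z, T) - w (fst z, 0)| <= eps & |wi j (fst z, T) - wi j (fst z, 0)| <= eps) &
   hpd Q dt U v & hpd Q dt m w & (ALL j. hpd Q dt (Ui j) (vi j) & hpd Q dt (mi j) (wi j)) &
   continuous_on Q U & continuous_on Q m & (ALL j. continuous_on Q (Ui j) & continuous_on Q (mi j)) &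
   (ALL j. ALL z:Q. |U (fst z, 0)| <= eps & |m (fst z, 0)| <= eps & |Ui j (fst z, 0)| <= eps & |mi j (fst z, 0)| <= eps) &
   continuous_on Q Jw & continuous_on Q Jm & continuous_on Q bt &
   en mu Jw <= M * en mu w & en mu Jm <= M * en mu m &
   (ALL z:Q. |vt z + (SS j. vij j j z)| <=
    M * ( |v z| + gr vi z + gr Ui z + |Jw z| + |w z| + |m z| + |bt z| )) &
   (ALL z:Q. |bt z| <= M * ( |v (fst z, 0)| + eps)) &
   (ALL z:Q. |wt z - (SS j. wij j j z)| <=
    M * ( |w z| + gr wi z + |v z| + gr vi z + |vt z| + |U z| + gr Ui z + |m z| + gr mi z + |Jw z| + |Jm z| + |bt z| ))"

lemma energy_estimate:
 assumes M: "M >= 1"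
 shows "EX C>0. EX mu\<^sub>0>=1. ALL v vt vi vij vti w wt wi wij wti r rt ri rij rti U Ui m mi Jw Jm bt mu eps.
   energy_hyp M mu\<^sub>0 v vt vi vij vti w wt wi wij wti r rt ri rij rti U Ui m mi Jw Jm bt mu eps --> en mu v + en mu w <= C * (mu * Rem mu eps)"
proof -
 from carleman_mult[OF M] obtain C1 mu1 where C1: "C1 > 0" "mu1 >= 1" and car0: "!!v vt vi vij vti r rt ri rij rti mu sg eps.
   carleman_mult_hyp M mu1 v vt vi vij vti r rt ri rij rti mu sg eps
   ==>
   en mu vt / mu + mu * en mu (gr vi) + mu^3 * en mu v
   <= C1 * (en mu (%z. sg * vt z + (SS j. vij j j z)) + Rem mu eps)"
  by (elim exE conjE) (rule that, assumption, assumption, elim allE impE, assumption+)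
 define k5 where "k5 = 2 * vol * M + 4 * T^2 + 1"
 define n where "n = real CARD('n)"
 define k6 where "k6 = (n + 1) * k5 + M * k5 + M + 1"
 \<comment> \<open>12 is the length of the longer list of lower-order terms, and 6 the highest
   multiplicity with which a quantity of \<open>energy_algebra\<close> occurs once all terms are
   expressed by them.\<close>
 define C where "C = C1 * (M^2 * 12 * (6 * k6) + 1) + 2 * M^2 * (vol * M + 1) + 1"
 have v0: "vol >= 0" by (simp add: vol_def)
 have k5: "k5 >= 1" "k5 >= 2 * vol * M" "k5 >= 4 * T^2" unfolding k5_def using v0 M by auto
 have n: "n >= 0" by (simp add: n_def)
 have k6: "k6 >= 1" "k6 >= (n + 1) * k5" "k6 >= M * k5" "k6 >= M" unfolding k6_def using k5 n M by (auto intro!: add_nonneg_nonneg)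
 have C: "C >= 1" unfolding C_def using C1 M k6 v0 by (auto intro!: add_nonneg_nonneg mult_nonneg_nonneg)
 from energy_algebra[OF C T_pos] obtain C' mu2 where C': "C' > 0" "mu2 >= 1" and alg: "!!a0 a1 tt w0 w1 G B V0 mu. mu >= mu2 &
   0 <= a0 & 0 <= a1 & 0 <= tt & 0 <= w0 & 0 <= w1 & 0 <= G & 0 <= B &
   tt / mu + mu * a1 + mu^3 * a0 <= C * (a0 + a1 + w0 + G + B) &
   B <= C * (V0 + G) & (ALL k>0. V0 <= a0 + T * (k * a0 + tt / k)) &
   mu * w1 + mu^3 * w0 <= C * (w0 + w1 + a0 + a1 + tt + G + B) ==> a0 + w0 <= C' * (mu * G)"
  by (elim exE conjE) (rule that, assumption, assumption, elim allE impE, assumption+)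
 show ?thesis
 proof (rule exI[of _ C'], intro conjI C', rule exI[of _ "max mu1 mu2"], intro conjI allI impI, use C1 in simp, elim conjE)
  fix v vt w wt r rt U m Jw Jm bt :: "(real^'n) \<times> real => real"
   and vi vti wi wti ri rti Ui mi :: "'n => (real^'n) \<times> real => real" and vij wij rij and mu eps :: real
  assume mu0: "mu >= max mu1 mu2" and eps: "0 <= eps" "eps <= M"
   and cv: "c21 Q v vt vi vij vti" and cw: "c21 Q w wt wi wij wti" and cr: "c21 Q r rt ri rij rti"
   and glob: "ALL j. ALL z:Q. |v z| <= M & |vt z| <= M & |vi j z| <= M & |w z| <= M & |wt z| <= M & |wi j z| <= M"
   and rb: "ALL i j. ALL z:Q. 1 <= M * |r z| & |r z| <= M & |rt z| <= M & |ri j z| <= M & |rij i j z| <= M"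
   and lat: "ALL j. ALL z:Q. known z --> |v z| <= eps & |vt z| <= eps & |vi j z| <= eps &
    |w z| <= eps & |wt z| <= eps & |wi j z| <= eps"
   and ends: "ALL j. ALL z:Q. |v (fst z, T) * r (fst z, T) - v (fst z, 0) * r (fst z, 0)| <= eps &
    |(vi j (fst z, T) * r (fst z, T) + v (fst z, T) * ri j (fst z, T)) -
     (vi j (fst z, 0) * r (fst z, 0) + v (fst z, 0) * ri j (fst z, 0))| <= eps &
    |w (fst z, T) - w (fst z, 0)| <= eps & |wi j (fst z, T) - wi j (fst z, 0)| <= eps"
   and hU: "hpd Q dt U v" and hm: "hpd Q dt m w" and hUi: "ALL j. hpd Q dt (Ui j) (vi j) & hpd Q dt (mi j) (wi j)"
   and cU: "continuous_on Q U" and cm: "continuous_on Q m" and cUi: "ALL j. continuous_on Q (Ui j) & continuous_on Q (mi j)"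
   and ini: "ALL j. ALL z:Q. |U (fst z, 0)| <= eps & |m (fst z, 0)| <= eps & |Ui j (fst z, 0)| <= eps & |mi j (fst z, 0)| <= eps"
   and cJ: "continuous_on Q Jw" "continuous_on Q Jm" "continuous_on Q bt"
   and J: "en mu Jw <= M * en mu w" "en mu Jm <= M * en mu m"
   and e1: "ALL z:Q. |vt z + (SS j. vij j j z)| <=
    M * ( |v z| + gr vi z + gr Ui z + |Jw z| + |w z| + |m z| + |bt z| )"
   and e2: "ALL z:Q. |bt z| <= M * ( |v (fst z, 0)| + eps)"
   and e3: "ALL z:Q. |wt z - (SS j. wij j j z)| <=
    M * ( |w z| + gr wi z + |v z| + gr vi z + |vt z| + |U z| + gr Ui z + |m z| + gr mi z + |Jw z| + |Jm z| + |bt z| )"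
  note dv = c21D(6-10)[OF cv] and dw = c21D(6-10)[OF cw]
  have cUi': "continuous_on Q (Ui j)" "continuous_on Q (mi j)" for j using cUi by blast+
  have mu: "mu >= mu1" "mu >= mu2" "mu >= 1" using mu0 C1 by auto
  define G where "G = Rem mu eps"
  have G: "G >= 0" unfolding G_def using mu eps by (intro Rem_nonneg) auto
  have vk: "en mu Z <= k5 * (en mu f + G)" if "hpd Q dt Z f" "continuous_on Q Z" "continuous_on Q f"
   "!!z. z : Q ==> |Z (fst z, 0)| <= eps" for Z f
  proof -
   have "en mu Z <= 2 * vol * M * G + 4 * T^2 * en mu f"
    unfolding G_def by (rule en_Volterra[OF that]) (use mu eps in auto)
   also have "... <= k5 * G + k5 * en mu f" using k5 G by (intro add_mono mult_right_mono) auto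
   finally show ?thesis by (simp add: algebra_simps)
  qed
  have vkgr: "en mu (gr Z) <= (n + 1) * k5 * (en mu (gr f) + G)" if "!!j. hpd Q dt (Z j) (f j)" "!!j. continuous_on Q (Z j)"
   "!!j. continuous_on Q (f j)" "!!j z. z : Q ==> |Z j (fst z, 0)| <= eps" for Z f :: "'n => (real^'n) \<times> real => real"
  proof -
   have "en mu (gr Z) <= (SS j. k5 * (en mu (f j) + G))"
    unfolding en_gr[OF that(2)] by (intro sum_mono vk that)
   also have "... = k5 * (en mu (gr f) + n * G)"
    by (simp add: en_gr[OF that(3)] sum_distrib_left sum.distrib n_def algebra_simps)
   also have "... <= k5 * ((n + 1) * en mu (gr f) + (n + 1) * G)"
    using k5 G n by (intro mult_left_mono add_mono le_mult_ge_one mult_right_mono) auto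
   finally show ?thesis by (simp add: algebra_simps)
  qed
  define a0 a1 tt w0 w1 B V0 where "a0 = en mu v" and "a1 = en mu (gr vi)" and "tt = en mu vt"
   and "w0 = en mu w" and "w1 = en mu (gr wi)" and "B = en mu bt" and "V0 = en mu (%z. v (fst z, 0))"
  note defs = a0_def a1_def tt_def w0_def w1_def B_def V0_def
  have nn: "0 <= a0" "0 <= a1" "0 <= tt" "0 <= w0" "0 <= w1" "0 <= B" by (simp_all add: defs)
  have kk: "k5 <= k6" using le_mult_ge_one[of "n + 1" k5] k6(2) n k5 by linarith
  have up: "c * (x + G) <= k6 * (x + G)" if "c <= k6" "x >= 0" for c x
   using that G by (intro mult_right_mono) auto
  have s1: "en mu U <= k6 * (a0 + G)"
   unfolding a0_def by (rule order_trans[OF vk[OF hU cU dv(1)] up[OF kk]]) (use ini in auto)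
  have s2: "en mu m <= k5 * (w0 + G)"
   unfolding w0_def by (rule vk[OF hm cm dw(1)]) (use ini in auto)
  have s2': "en mu m <= k6 * (w0 + G)" by (rule order_trans[OF s2 up[OF kk]]) (use nn in auto)
  have s3: "en mu (gr Ui) <= k6 * (a1 + G)"
   unfolding a1_def by (rule order_trans[OF vkgr up[OF k6(2)]]) (use hUi cUi dv ini in auto)
  have s4: "en mu (gr mi) <= k6 * (w1 + G)"
   unfolding w1_def by (rule order_trans[OF vkgr up[OF k6(2)]]) (use hUi cUi dw ini in auto)
  have s5: "en mu Jm <= k6 * (w0 + G)"
  proof -
   have "en mu Jm <= M * (k5 * (w0 + G))" using J(2) s2 M by (meson mult_left_mono order_trans zero_le_one)
   also have "... = (M * k5) * (w0 + G)" by simp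
   also have "... <= k6 * (w0 + G)" by (rule up[OF k6(3) nn(4)])
   finally show ?thesis .
  qed
  have s6: "en mu Jw <= k6 * (w0 + G)"
  proof -
   have "M * w0 <= k6 * w0" using k6(4) nn by (intro mult_right_mono) auto
   moreover have "0 <= k6 * G" using G k6(1) by simp
   ultimately show ?thesis using J(1) unfolding w0_def by (simp add: distrib_left)
  qed
  have k1: "x <= k6 * x" if "x >= 0" for x using that k6(1) by (intro le_mult_ge_one)
  have A: "tt / mu + mu * a1 + mu^3 * a0 <= C * (a0 + a1 + w0 + G + B)"
  proof -
   have "tt / mu + mu * a1 + mu^3 * a0 <= C1 * (en mu (%z. 1 * vt z + (SS j. vij j j z)) + G)"
    unfolding defs G_def
    by (rule car0[of v vt vi vij vti r rt ri rij rti]) (use cv cr mu eps glob rb lat ends in auto)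
   also have "en mu (%z. 1 * vt z + (SS j. vij j j z)) <= M^2 * length [v, gr vi, gr Ui, Jw, w, m, bt] * (\<Sum>g\<leftarrow>[v, gr vi, gr Ui, Jw, w, m, bt]. en mu g)"
    by (rule en_le_list) (use dv dw cUi' cJ cm M e1 in \<open>auto intro!: continuous_intros simp: add.assoc\<close>)
   also have "... <= M^2 * 12 * (6 * k6 * (a0 + a1 + w0 + G + B))"
   proof (intro mult_mono)
    have "(\<Sum>g\<leftarrow>[v, gr vi, gr Ui, Jw, w, m, bt]. en mu g) <= k6 * a0 + k6 * a1 + k6 * (a1 + G) + k6 * (w0 + G) + k6 * w0 + k6 * (w0 + G) + k6 * B"
     using k1[OF nn(1)] k1[OF nn(2)] k1[OF nn(4)] k1[OF nn(6)] s2' s3 s6 by (simp add: defs)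
    also have "... = k6 * (a0 + 2 * a1 + 3 * w0 + 3 * G + B)" by (simp add: algebra_simps)
    also have "... <= k6 * (6 * (a0 + a1 + w0 + G + B))" using nn G k6 by (intro mult_left_mono) auto
    finally show "(\<Sum>g\<leftarrow>[v, gr vi, gr Ui, Jw, w, m, bt]. en mu g) <= 6 * k6 * (a0 + a1 + w0 + G + B)" by (simp add: mult.left_commute mult.assoc)
   qed (use M in \<open>auto intro!: sum_list_nonneg\<close>)
   finally have "tt / mu + mu * a1 + mu^3 * a0 <= C1 * (M^2 * 12 * (6 * k6 * (a0 + a1 + w0 + G + B)) + G)"
    using C1 by simp
   also have "... <= C1 * (M^2 * 12 * (6 * k6 * (a0 + a1 + w0 + G + B)) + (a0 + a1 + w0 + G + B))"
    using C1 nn by (intro mult_left_mono) auto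
   also have "... = C1 * (M^2 * 12 * (6 * k6) + 1) * (a0 + a1 + w0 + G + B)" by (simp add: algebra_simps)
   also have "... <= C * (a0 + a1 + w0 + G + B)"
    unfolding C_def using v0 M nn G by (intro mult_right_mono) auto
   finally show ?thesis .
  qed
  have W: "mu * w1 + mu^3 * w0 <= C * (w0 + w1 + a0 + a1 + tt + G + B)"
  proof -
   define S where "S = w0 + w1 + a0 + a1 + tt + G + B"
   have S: "S >= 0" "G <= S" using nn G by (auto simp: S_def)
   have "mu * w1 + mu^3 * w0 <= en mu wt / mu + mu * w1 + mu^3 * w0" using mu by simp
   \<comment> \<open>The equation for \<open>w\<close> runs forward in time, hence
     \<open>sg = -1\<close>. The values of \<open>w\<close> at the two ends almost agree by
     hypothesis, so the factor is the constant 1.\<close>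
   also have "... <= C1 * (en mu (%z. (-1) * wt z + (SS j. wij j j z)) + G)"
    unfolding defs G_def
    by (rule car0[of w wt wi wij wti "%_. 1" "%_. 0" "%_ _. 0" "%_ _ _. 0" "%_ _. 0"])
     (use cw c21_one mu eps glob M lat ends in auto)
   also have "en mu (%z. (-1) * wt z + (SS j. wij j j z)) <= M^2 * length [w, gr wi, v, gr vi, vt, U, gr Ui, m, gr mi, Jw, Jm, bt]
     * (\<Sum>g\<leftarrow>[w, gr wi, v, gr vi, vt, U, gr Ui, m, gr mi, Jw, Jm, bt]. en mu g)"
   proof (rule en_le_list)
    fix z assume z: "z : Q"
    have "|(-1) * wt z + (SS j. wij j j z)| = |wt z - (SS j. wij j j z)|" by simp
    then show "|(-1) * wt z + (SS j. wij j j z)| <= M * (\<Sum>g\<leftarrow>[w, gr wi, v, gr vi, vt, U, gr Ui, m, gr mi, Jw, Jm, bt]. |g z| )"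
     using e3[rule_format, OF z] by (simp add: add.assoc)
   qed (use dv dw cUi' cJ cm cU M in \<open>auto intro!: continuous_intros\<close>)
   also have "... <= M^2 * 12 * (6 * k6 * S)"
   proof (intro mult_mono)
    have "(\<Sum>g\<leftarrow>[w, gr wi, v, gr vi, vt, U, gr Ui, m, gr mi, Jw, Jm, bt]. en mu g) <=
      k6 * w0 + k6 * w1 + k6 * a0 + k6 * a1 + k6 * tt + k6 * (a0 + G) + k6 * (a1 + G) + k6 * (w0 + G) + k6 * (w1 + G)
      + k6 * (w0 + G) + k6 * (w0 + G) + k6 * B"
     using k1[OF nn(1)] k1[OF nn(2)] k1[OF nn(3)] k1[OF nn(4)] k1[OF nn(5)] k1[OF nn(6)] s1 s2' s3 s4 s5 s6 by (simp add: defs)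
    also have "... = k6 * (4 * w0 + 2 * w1 + 2 * a0 + 2 * a1 + tt + 6 * G + B)" by (simp add: algebra_simps)
    also have "... <= k6 * (6 * S)" using nn G k6 by (intro mult_left_mono) (auto simp: S_def)
    finally show "(\<Sum>g\<leftarrow>[w, gr wi, v, gr vi, vt, U, gr Ui, m, gr mi, Jw, Jm, bt]. en mu g) <= 6 * k6 * S" by (simp add: mult.left_commute mult.assoc)
   qed (use M in \<open>auto intro!: sum_list_nonneg\<close>)
   finally have "mu * w1 + mu^3 * w0 <= C1 * (M^2 * 12 * (6 * k6 * S) + G)" using C1 by simp
   also have "... <= C1 * (M^2 * 12 * (6 * k6 * S) + S)" using C1 S by (intro mult_left_mono) auto
   also have "... = C1 * (M^2 * 12 * (6 * k6) + 1) * S" by (simp add: algebra_simps)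
   also have "... <= C * S" unfolding C_def using v0 M S by (intro mult_right_mono) auto
   finally show ?thesis by (simp add: S_def)
  qed
  have Bq: "B <= C * (V0 + G)"
  proof -
   have cv0: "continuous_on Q (%z. v (fst z, 0))"
    by (intro continuous_on_compose2[OF dv(1)] continuous_intros) (auto intro: Q_time simp: T_pos less_imp_le)
   define gs :: "((real^'n) \<times> real => real) list" where "gs = [%z. v (fst z, 0), %_. eps]"
   have "B <= M^2 * length gs * (\<Sum>g\<leftarrow>gs. en mu g)"
    unfolding B_def gs_def by (rule en_le_list) (use cv0 cJ e2 M eps in auto)
   also have "... <= M^2 * 2 * (V0 + vol * M * G)"
    using en_const_Rem[OF mu(3) eps] by (simp add: gs_def V0_def G_def mult_left_mono)
   also have "... <= M^2 * 2 * ((vol * M + 1) * (V0 + G))"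
   proof -
    have "0 <= vol * M * V0" "0 <= G" using v0 M G by (auto simp: V0_def)
    then show ?thesis by (intro mult_left_mono) (auto simp: algebra_simps)
   qed
   also have "... = 2 * M^2 * (vol * M + 1) * (V0 + G)" by simp
   also have "... <= C * (V0 + G)"
    unfolding C_def using C1 M k6 G by (intro mult_right_mono) (auto simp: V0_def intro!: add_nonneg_nonneg mult_nonneg_nonneg)
   finally show ?thesis .
  qed
  have V: "ALL k>0. V0 <= a0 + T * (k * a0 + tt / k)"
   using en_initial[OF c21D(1)[OF cv] dv(1,2), of _ mu] unfolding V0_def a0_def tt_def by (smt (verit))
  show "en mu v + en mu w <= C' * (mu * Rem mu eps)"
   using alg[of mu a0 a1 tt w0 w1 G B V0] mu nn G A Bq V W unfolding a0_def w0_def G_def by blast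
 qed
qed

end

section \<open>Families of partial derivatives\<close>

definition ok :: "'a set => ('a => nat) => nat => 'a list => bool" where
 "ok D w k vs \<longleftrightarrow> set vs \<subseteq> D & (\<Sum>v\<leftarrow>vs. w v) <= k"

text \<open>\<open>F vs\<close> is the iterated derivative of \<open>F []\<close> along the directions \<open>vs\<close>, the last one being taken first.\<close>

definition fam :: "'a::real_normed_vector set => 'a set => ('a => nat) => nat => ('a list => 'a => real) => bool" where
 "fam S D w k F \<longleftrightarrow>
   (ALL v vs. ok D w k (v # vs) --> hpd S v (F vs) (F (v # vs))) &
   (ALL vs. ok D w k vs --> continuous_on S (F vs))"

lemma fam_hpd: "fam S D w k F ==> ok D w k (v # vs) ==> hpd S v (F vs) (F (v # vs))"
 by (simp add: fam_def)

lemma fam_cont: "fam S D w k F ==> ok D w k vs ==> continuous_on S (F vs)"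
 by (simp add: fam_def)

lemma ok_Cons: "ok D w k (v # vs) ==> ok D w k vs"
 by (auto simp: ok_def)

lemma sum_list_eq_sum_mset: "(\<Sum>v\<leftarrow>vs. w v) = (\<Sum>v\<in>#mset vs. (w v :: nat))"
 by (simp only: mset_map[symmetric] sum_mset_sum_list)

lemma ok_mset:
 assumes "mset vs = mset vs'" "ok D w k vs"
 shows "ok D w k vs'"
 using assms mset_eq_setD[OF assms(1)] unfolding ok_def sum_list_eq_sum_mset by simp

lemma C_class_fam: "f : C_class S D w k ==> fam S D w k (%vs. pds S vs f)"
 unfolding C_class_def fam_def ok_def pds_def using has_pd_hpd by (simp, blast)

lemma fam_diff: "fam S D w k F ==> fam S D w k G ==> fam S D w k (%vs z. F vs z - G vs z)"
 unfolding fam_def by (simp add: hpd_diff continuous_on_diff)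

lemma fam_shift:
 assumes "fam S D w k F" "ok D w j ws" "i + j <= k"
 shows "fam S D w i (%vs. F (vs @ ws))"
proof -
 have "ok D w k (vs @ ws)" if "ok D w i vs" for vs using that assms by (auto simp: ok_def)
 from this[of "v # vs" for v vs] this show ?thesis using assms(1) unfolding fam_def by auto
qed

text \<open>Induction on the length. If the lists start with different directions \<open>x\<close>
  and \<open>y\<close>, the induction hypothesis moves \<open>y\<close> to the front of
  \<open>xs\<close> and \<open>x\<close> to the front of \<open>ys\<close>, with a common rest
  \<open>zs\<close>, and \<open>hpd_Schwarz\<close> exchanges the two.\<close>

lemma fam_perm:
 fixes F :: "'a::euclidean_space list => 'a => real"
 assumes F: "fam (cbox a b) D w k F" and D: "D \<subseteq> Basis" "!!i. i : D ==> a \<bullet> i < b \<bullet> i"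
  and "ok D w k vs" "mset vs = mset vs'" "z : cbox a b"
 shows "F vs z = F vs' z"
 using assms(4-6)
proof (induction "length vs" arbitrary: vs vs' z rule: less_induct)
 case less
 show ?case
 proof (cases vs)
  case Nil then show ?thesis using less by simp
 next
  case (Cons x xs)
  then obtain y ys where vs': "vs' = y # ys" using less.prems by (cases vs') auto
  have okv': "ok D w k vs'" using ok_mset less.prems by blast
  have xy: "x : D" "y : D" using less.prems okv' by (auto simp: Cons vs' ok_def)
  have okx: "ok D w k xs" "ok D w k ys" using ok_Cons less.prems(1) okv' unfolding Cons vs' by metis+
  note hx = fam_hpd[OF F less.prems(1)[unfolded Cons]] and hy = fam_hpd[OF F okv'[unfolded vs']]
  have uq: "f' z = f'' z" if "hpd (cbox a b) x f f'" "hpd (cbox a b) x f f''" for f f' f''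
   using hpd_unique[OF that] xy D less.prems by auto
  show ?thesis
  proof (cases "x = y")
   case True
   then have m: "mset xs = mset ys" using less.prems by (simp add: Cons vs')
   have "F xs q = F ys q" if "q : cbox a b" for q
    using less.hyps[OF _ okx(1) m that] by (simp add: Cons)
   then have "hpd (cbox a b) x (F ys) (F (x # xs))" by (rule hpd_cong[OF hx]) auto
   then show ?thesis using uq[OF _ hy[folded True]] by (simp add: Cons vs' True)
  next
   case False
   define zs where "zs = remove1 y xs"
   have "y : set xs" using less.prems(2) False by (metis Cons list.set_intros(1) mset_eq_setD set_ConsD vs')
   then have m1: "mset xs = mset (y # zs)" by (simp add: zs_def)
   have m2: "mset ys = mset (x # zs)" using less.prems(2) m1 unfolding Cons vs' by simp
   have oky: "ok D w k (y # zs)" "ok D w k (x # zs)" using ok_mset[OF m1] ok_mset[OF m2] okx by blast+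
   have len: "length ys = length xs" using mset_eq_length[OF less.prems(2)] by (simp add: Cons vs')
   have e1: "F xs q = F (y # zs) q" if "q : cbox a b" for q
    using less.hyps[OF _ okx(1) m1 that] by (simp add: Cons)
   have e2: "F ys q = F (x # zs) q" if "q : cbox a b" for q
    using less.hyps[OF _ okx(2) m2 that] by (simp add: Cons len)
   have h1: "hpd (cbox a b) x (F (y # zs)) (F vs)"
    unfolding Cons by (rule hpd_cong[OF hx]) (use e1 in auto)
   have h2: "hpd (cbox a b) y (F (x # zs)) (F vs')"
    unfolding vs' by (rule hpd_cong[OF hy]) (use e2 in auto)
   have "F vs' z = F vs z"
    by (rule hpd_Schwarz[OF fam_hpd[OF F oky(2)] fam_hpd[OF F oky(1)] h2 h1])
     (use xy D less.prems fam_cont[OF F] okv' in auto)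
   then show ?thesis by simp
  qed
 qed
qed

lemma finite_multi_indices:
 assumes "finite D" "!!v. v : D ==> w v >= 1"
 shows "finite (multi_indices D w k)"
proof -
 have "multi_indices D w k \<subseteq> mset ` {vs. set vs \<subseteq> D & length vs <= k}"
 proof
  fix \<alpha> assume a: "\<alpha> : multi_indices D w k"
  obtain vs where vs: "mset vs = \<alpha>" using ex_mset by blast
  then have "set vs \<subseteq> D" "(\<Sum>v\<leftarrow>vs. w v) <= k" using a unfolding multi_indices_def sum_list_eq_sum_mset by auto
  moreover from this(1) have "length vs <= (\<Sum>v\<leftarrow>vs. w v)"
  proof (induction vs)
   case (Cons v vs)
   then show ?case using assms(2)[of v] by simp
  qed simp
  ultimately show "\<alpha> : mset ` {vs. set vs \<subseteq> D & length vs <= k}" using vs by auto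
 qed
 then show ?thesis using finite_lists_length_le[OF assms(1)] by (meson finite_imageI finite_subset)
qed

lemma mpd_eq_pds: "EX vs. mset vs = \<alpha> & mpd S \<alpha> f = pds S vs f"
 unfolding mpd_def by (rule exI[of _ "SOME vs. mset vs = \<alpha>"]) (simp add: someI_ex[OF ex_mset])

lemma multi_indices_ok: "mset vs : multi_indices D w k \<longleftrightarrow> ok D w k vs"
proof -
 have "(\<Sum>v\<in>#mset vs. w v) = (\<Sum>v\<leftarrow>vs. w v)" by (rule sum_list_eq_sum_mset[symmetric])
 then show ?thesis unfolding multi_indices_def ok_def mem_Collect_eq set_mset_mset by presburger
qed

text \<open>\<open>mpd\<close> takes the derivatives in an order chosen by \<open>SOME\<close>;
  \<open>fam_perm\<close> transfers the bound to every other order.\<close>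

lemma C_norm_bound:
 fixes f :: "'a::euclidean_space => real"
 assumes f: "f : C_class (cbox a b) D w k" and D: "D \<subseteq> Basis" "!!i. i : D ==> a \<bullet> i < b \<bullet> i"
  "!!v. v : D ==> w v >= 1"
  and M: "C_norm (cbox a b) D w k f < M" and vs: "ok D w k vs" and z: "z : cbox a b"
 shows "|pds (cbox a b) vs f z| <= M"
proof -
 note F = C_class_fam[OF f]
 have finD: "finite D" by (rule finite_subset[OF D(1) finite_Basis])
 obtain vs' where vs': "mset vs' = mset vs" "mpd (cbox a b) (mset vs) f = pds (cbox a b) vs' f"
  using mpd_eq_pds[of "mset vs" "cbox a b" f] by (elim exE conjE) (rule that)
 have ok': "ok D w k vs'" using ok_mset[OF vs'(1)[symmetric] vs] .
 have bdd: "bdd_above ((%z. |pds (cbox a b) vs' f z| ) ` cbox a b)"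
  by (rule bounded_imp_bdd_above[OF compact_imp_bounded[OF
    compact_continuous_image[OF continuous_on_rabs[OF fam_cont[OF F ok']] compact_cbox]]])
 have "|pds (cbox a b) vs f z| = |mpd (cbox a b) (mset vs) f z|"
  using fam_perm[OF F D(1,2) vs vs'(1)[symmetric] z] vs' by simp
 also have "... <= (SUP z\<in>cbox a b. |mpd (cbox a b) (mset vs) f z| )"
  using bdd z unfolding vs'(2) by (intro cSUP_upper)
 also have "... <= C_norm (cbox a b) D w k f"
  unfolding C_norm_def using finite_multi_indices[OF finD D(3)] vs by (intro Max_ge) (auto simp: multi_indices_ok)
 finally show ?thesis using M by simp
qed

lemma open_islimpt:
 fixes z v :: "'a::real_normed_vector"
 assumes "open S" "z : S"
 shows "0 islimpt {h::real. z + h *\<^sub>R v : S}"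
proof -
 have "open ((%h::real. z + h *\<^sub>R v) -` S)"
  by (rule open_vimage[OF assms(1)]) (intro continuous_intros)
 then have "open {h::real. z + h *\<^sub>R v : S}" by (simp add: vimage_def)
 then have "0 : interior {h::real. z + h *\<^sub>R v : S}" using assms by (simp add: interior_open)
 then show ?thesis by (rule interior_limit_point)
qed

text \<open>Derivatives relative to an open subset agree with those relative to the closed box. The
  system and the norms in the conclusion are written with the former, the estimates up to the
  boundary with the latter.\<close>

lemma pds_fam:
 assumes F: "fam R D w k F" and S: "open S" "S \<subseteq> R" and f: "!!z. z : S ==> f z = F [] z"
  and "ok D w k vs" "z : S"
 shows "pds S vs f z = F vs z"
 using assms(5,6)
proof (induction vs arbitrary: z)
 case Nil then show ?case using f by (simp add: pds_def)
next
 case (Cons v vs)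
 have "pds S (v # vs) f z = pd S v (pds S vs f) z" by (simp add: pds_def)
 also have "... = pd S v (F vs) z"
  by (rule pd_cong) (use Cons.IH[OF ok_Cons[OF Cons.prems(1)]] Cons.prems(2) in auto)
 also have "... = F (v # vs) z"
  by (rule pd_hpd[OF hpd_subset[OF fam_hpd[OF F Cons.prems(1)] S(2)] Cons.prems(2) open_islimpt[OF S(1) Cons.prems(2)]])
 finally show ?case .
qed

lemma parabolic_dx [simp]: "parabolic (dx i) = 1"
 by (simp add: parabolic_def dx_def)

lemma parabolic_dt [simp]: "parabolic dt = 2"
 by (simp add: parabolic_def dt_def)

lemma parabolic_ge: "parabolic v >= 1"
 by (simp add: parabolic_def)

abbreviation okp :: "nat => ((real^'n::finite) \<times> real) list => bool" where
 "okp \<equiv> ok Basis parabolic"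

text \<open>The chain rule for a map that carries the direction \<open>v\<close> to the direction
  \<open>w\<close>. It covers time slices, shifts along the x1-axis and functions of x regarded as
  functions of (x, t).\<close>

lemma hpd_affine:
 assumes "hpd R w f f'" "!!z. z : S ==> \<phi> z : R"
  "!!z h. z : S ==> z + h *\<^sub>R v : S ==> \<phi> (z + h *\<^sub>R v) = \<phi> z + h *\<^sub>R w"
 shows "hpd S v (%z. f (\<phi> z)) (%z. f' (\<phi> z))"
 unfolding hpd_def
proof
 fix z assume z: "z : S"
 have sub: "{h. z + h *\<^sub>R v : S} \<subseteq> {h. \<phi> z + h *\<^sub>R w : R}" using assms(2,3) z by fastforce
 have "((%h. f (\<phi> z + h *\<^sub>R w)) has_real_derivative f' (\<phi> z)) (at_line S v z)"
  using DERIV_subset[OF hpdD[OF assms(1) assms(2)[OF z]] sub] .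
 then show "((%h. f (\<phi> (z + h *\<^sub>R v))) has_real_derivative f' (\<phi> z)) (at_line S v z)"
  by (rule has_field_derivative_transform_within[where d=1]) (use z assms(3) in auto)
qed

lemma hpd_trivial:
 assumes "!!z h. z : S ==> z + h *\<^sub>R v : S ==> f (z + h *\<^sub>R v) = f z"
 shows "hpd S v f (%_. 0)"
 unfolding hpd_def
proof
 fix z assume z: "z : S"
 have "((%h. f z) has_real_derivative 0) (at_line S v z)" by simp
 then show "((%h. f (z + h *\<^sub>R v)) has_real_derivative 0) (at_line S v z)"
  by (rule has_field_derivative_transform_within[where d=1]) (use z assms in auto)
qed

lemma hpdI:
 assumes "!!z e. z : S ==> e > 0 ==>
  EX d>0. ALL h. |h| < d --> z + h *\<^sub>R v : S --> |f (z + h *\<^sub>R v) - f z - h * f' z| <= e * |h|"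
 shows "hpd S v f f'"
 unfolding hpd_def
proof
 fix z assume z: "z : S"
 have bl: "bounded_linear (%h. f' z * h)" by (rule bounded_linear_mult_right)
 show "((%h. f (z + h *\<^sub>R v)) has_real_derivative f' z) (at_line S v z)"
  unfolding has_field_derivative_def has_derivative_within_alt
 proof (intro conjI bl allI impI)
  fix e :: real assume "e > 0"
  then obtain d where d: "d > 0" "!!h. |h| < d ==> z + h *\<^sub>R v : S ==> |f (z + h *\<^sub>R v) - f z - h * f' z| <= e * |h|"
   using assms[OF z] by blast
  then show "EX d>0. ALL y:{h. z + h *\<^sub>R v : S}. norm (y - 0) < d -->
    norm (f (z + y *\<^sub>R v) - f (z + 0 *\<^sub>R v) - f' z * (y - 0)) <= e * norm (y - 0)"
   by (intro exI[of _ d]) (auto simp: mult.commute)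
 qed
qed

lemma hpd_remainder:
 fixes z :: "'a::euclidean_space"
 assumes f: "hpd (cbox a b) i f f'" and i: "i : Basis" and z: "z : cbox a b" "z + h *\<^sub>R i : cbox a b"
  and L: "!!x. x : cbox a b ==> dist x z <= |h| ==> |f' x - L| <= e"
 shows "|f (z + h *\<^sub>R i) - f z - h * L| <= e * |h|"
proof -
 have e: "e >= 0" using L[OF z(1)] by simp
 have zh: "z + h *\<^sub>R i = upd i (z \<bullet> i + h) z" using upd_add[OF i, of "z \<bullet> i" z h] by simp
 have m: "z \<bullet> i : {a \<bullet> i..b \<bullet> i}" "z \<bullet> i + h : {a \<bullet> i..b \<bullet> i}"
  using z i unfolding mem_box by (auto simp: inner_add_left)
 have L': "|f' (upd i \<xi> z) - L| <= e" if "|\<xi> - z \<bullet> i| <= |h|" "\<xi> : {a \<bullet> i..b \<bullet> i}" for \<xi>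
 proof (rule L)
  show "upd i \<xi> z : cbox a b" using that i z by (intro upd_cbox) auto
  show "dist (upd i \<xi> z) z <= |h|" using that i by (simp add: dist_norm upd_def)
 qed
 consider "h < 0" | "h = 0" | "h > 0" by linarith
 then show ?thesis
 proof cases
  case 1
  have "|f (upd i (z \<bullet> i) z) - f (upd i (z \<bullet> i + h) z) - (z \<bullet> i - (z \<bullet> i + h)) * L| <= (z \<bullet> i - (z \<bullet> i + h)) * e"
   by (rule hpd_bound_diff[OF f i z(1)]) (use 1 m L' in auto)
  then show ?thesis unfolding zh using 1 by (simp add: abs_minus_commute algebra_simps)
 next
  case 2 then show ?thesis by simp
 next
  case 3
  have "|f (upd i (z \<bullet> i + h) z) - f (upd i (z \<bullet> i) z) - (z \<bullet> i + h - z \<bullet> i) * L| <= (z \<bullet> i + h - z \<bullet> i) * e"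
   by (rule hpd_bound_diff[OF f i z(1)]) (use 3 m L' in auto)
  then show ?thesis unfolding zh using 3 by (simp add: algebra_simps)
 qed
qed

text \<open>Differentiation along a diagonal, by the argument that continuous partial derivatives
  imply differentiability. It is called for because x1 enters the interaction in several places at
  once.\<close>

lemma hpd_add_direction:
 fixes f :: "'a::euclidean_space => real"
 assumes i: "hpd (cbox a b) i f fi" and j: "hpd (cbox a b) j f fj"
  and ij: "i : Basis" "j : Basis" "i ~= j" and c: "continuous_on (cbox a b) fi"
 shows "hpd (cbox a b) (i + j) f (%z. fi z + fj z)"
proof (rule hpdI)
 fix z and e :: real assume z: "z : cbox a b" and e: "e > 0"
 obtain d1 where d1: "d1 > 0" "!!x. x : cbox a b ==> dist x z < d1 ==> dist (fi x) (fi z) < e / 2"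
  using c z e unfolding continuous_on_iff by (meson half_gt_zero)
 have "((%h. f (z + h *\<^sub>R j)) has_derivative (%h. fj z * h)) (at 0 within {h. z + h *\<^sub>R j : cbox a b})"
  using hpdD[OF j z] by (simp add: has_field_derivative_def)
 then obtain d2 where d2: "d2 > 0" "!!h. z + h *\<^sub>R j : cbox a b ==> |h| < d2 ==>
   |f (z + h *\<^sub>R j) - f z - fj z * h| <= e / 2 * |h|"
 proof -
  assume "((%h. f (z + h *\<^sub>R j)) has_derivative (%h. fj z * h)) (at 0 within {h. z + h *\<^sub>R j : cbox a b})"
  then have "ALL e>0. EX d>0. ALL y:{h. z + h *\<^sub>R j : cbox a b}. norm (y - 0) < d -->
    norm (f (z + y *\<^sub>R j) - f (z + 0 *\<^sub>R j) - fj z * (y - 0)) <= e * norm (y - 0)"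
   unfolding has_derivative_within_alt by blast
  then obtain d where "d > 0" "ALL y:{h. z + h *\<^sub>R j : cbox a b}. norm (y - 0) < d -->
    norm (f (z + y *\<^sub>R j) - f (z + 0 *\<^sub>R j) - fj z * (y - 0)) <= e / 2 * norm (y - 0)"
   using half_gt_zero[OF e] by blast
  then show ?thesis by (intro that[of d]) auto
 qed
 show "EX d>0. ALL h. |h| < d --> z + h *\<^sub>R (i + j) : cbox a b -->
   |f (z + h *\<^sub>R (i + j)) - f z - h * (fi z + fj z)| <= e * |h|"
 proof (intro exI[of _ "min (d1 / 2) d2"] conjI allI impI)
  fix h assume h: "|h| < min (d1 / 2) d2" and zh: "z + h *\<^sub>R (i + j) : cbox a b"
  \<comment> \<open>The intermediate point stays in the box because each of its coordinates is one
    of \<open>z\<close> or one of the end point.\<close>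
  have zj: "z + h *\<^sub>R j : cbox a b"
   unfolding mem_box
  proof
   fix k :: 'a assume k: "k : Basis"
   show "a \<bullet> k <= (z + h *\<^sub>R j) \<bullet> k & (z + h *\<^sub>R j) \<bullet> k <= b \<bullet> k"
    using z[unfolded mem_box, rule_format, OF k] zh[unfolded mem_box, rule_format, OF k] ij k
    by (cases "k = j") (auto simp: inner_add_left inner_Basis split: if_splits)
  qed
  have eq: "z + h *\<^sub>R (i + j) = (z + h *\<^sub>R j) + h *\<^sub>R i" by (simp add: algebra_simps)
  have "|f ((z + h *\<^sub>R j) + h *\<^sub>R i) - f (z + h *\<^sub>R j) - h * fi z| <= e / 2 * |h|"
  proof (rule hpd_remainder[OF i ij(1) zj])
   fix x assume x: "x : cbox a b" "dist x (z + h *\<^sub>R j) <= |h|"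
   have "dist x z <= dist x (z + h *\<^sub>R j) + dist (z + h *\<^sub>R j) z" by (rule dist_triangle)
   also have "... <= |h| + |h|" using x ij by (simp add: dist_norm)
   finally have "dist x z < d1" using h by simp
   then show "|fi x - fi z| <= e / 2" using d1(2)[OF x(1)] by (simp add: dist_real_def)
  qed (use zh eq in simp)
  moreover have "|f (z + h *\<^sub>R j) - f z - fj z * h| <= e / 2 * |h|" using d2(2)[OF zj] h by simp
  moreover have "e * |h| = e / 2 * |h| + e / 2 * |h|" by simp
  moreover have "h * (fi z + fj z) = h * fi z + fj z * h" by (simp add: algebra_simps)
  ultimately show "|f (z + h *\<^sub>R (i + j)) - f z - h * (fi z + fj z)| <= e * |h|"
   unfolding eq by linarith
 qed (use d1 d2 in auto)
qed

context space_time_box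
begin

lemma Q_nondegenerate: "i : Basis ==> (- A, 0::real) \<bullet> i < (A, T) \<bullet> i"
 using A_pos T_pos by (auto elim!: Basis_cases)

lemma closure_Q_T: "closure (Q_T A T) = Q"
proof -
 have "Omega A = box (- A) A" by (auto simp: Omega_def mem_box_cart)
 moreover have "box (- A) A ~= {}" using A_pos by (auto simp: box_ne_empty Basis_vec_def inner_axis)
 ultimately show ?thesis using T_pos
  by (simp add: Q_T_def closure_Times Q_Times)
qed

text \<open>Order 3 is what the mixed derivative in one space direction and time requires, since
  time counts twice.\<close>

lemma fam_c21:
 assumes F: "fam Q Basis parabolic 3 F"
 shows "c21 Q (F []) (F [dt]) (%i. F [dx i]) (%i j. F [dx j, dx i]) (%i. F [dx i, dt])"
proof -
 have o: "okp 3 [dt]" "okp 3 [dx i]" "okp 3 [dx j, dx i]" "okp 3 [dx i, dt]" "okp 3 [dt, dx i]" "okp 3 []" for i j :: 'n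
  by (auto simp: ok_def)
 note P = fam_perm[OF F[unfolded Q_def] order_refl Q_nondegenerate, folded Q_def]
 show ?thesis
  unfolding c21_def
 proof (intro conjI allI ballI)
  show "hpd Q dt (F [dx i]) (F [dx i, dt])" for i
   by (rule hpd_cong1[OF fam_hpd[OF F o(5)]]) (rule P, auto intro: o)
  show "F [dx j, dx i] z = F [dx i, dx j] z" if "z : Q" for i j z
   by (rule P) (use that in \<open>auto intro: o\<close>)
 qed (intro fam_hpd[OF F] fam_cont[OF F] o)+
qed

end

section \<open>Integrals depending on a parameter\<close>

lemma set_integrable_continuous_compact:
 fixes f :: "'b::euclidean_space => real"
 assumes f: "continuous_on Yc f" "compact Yc" and W: "W : sets \<nu>" "W \<subseteq> Yc"
  and nu: "sets \<nu> = sets borel" "emeasure \<nu> W < \<infinity>"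
 shows "set_integrable \<nu> W f"
proof -
 obtain B where B: "!!y. y : Yc ==> |f y| <= B"
  using compact_imp_bounded[OF compact_continuous_image[OF f]] by (auto simp: bounded_iff)
 have m: "(%y. indicator W y *\<^sub>R f y) : borel_measurable \<nu>"
  using borel_measurable_continuous_on_indicator[of W f] W nu continuous_on_subset[OF f(1) W(2)]
  by (simp add: measurable_cong_sets[OF nu(1) refl])
 have "integrable \<nu> (%y. indicator W y *\<^sub>R B)"
  using W nu by (intro integrable_scaleR_left) (auto intro: integrable_real_indicator)
 then show ?thesis unfolding set_integrable_def
  by (rule Bochner_Integration.integrable_bound[OF _ m]) (use B W in \<open>auto simp: indicator_def intro!: AE_I2 order_trans[OF B abs_ge_self]\<close>)
qed

lemma set_integral_bound:
 fixes f :: "'b => real"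
 assumes W: "W : sets \<nu>" "emeasure \<nu> W < \<infinity>" and B: "!!y. y : W ==> |f y| <= B" "B >= 0"
 shows "|LINT y:W|\<nu>. f y| <= B * measure \<nu> W"
proof (cases "set_integrable \<nu> W f")
 case True
 have "|LINT y:W|\<nu>. f y| <= (LINT y|\<nu>. |indicator W y *\<^sub>R f y| )"
  unfolding set_lebesgue_integral_def by (rule integral_abs_bound)
 also have "... <= (LINT y|\<nu>. indicator W y *\<^sub>R B)"
 proof (rule integral_mono)
  show "integrable \<nu> (%y. |indicator W y *\<^sub>R f y| )" using True unfolding set_integrable_def by (rule integrable_abs)
  show "integrable \<nu> (%y. indicator W y *\<^sub>R B)"
   using W by (intro integrable_scaleR_left) (auto intro: integrable_real_indicator)
 qed (use B in \<open>auto simp: indicator_def\<close>)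
 also have "... = B * measure \<nu> W" using W by simp
 finally show ?thesis .
next
 case False
 then have "(LINT y:W|\<nu>. f y) = 0"
  unfolding set_integrable_def set_lebesgue_integral_def by (rule not_integrable_integral_eq)
 then show ?thesis using B by simp
qed

text \<open>The integral of \<open>(f y - c)^2\<close> is nonnegative when \<open>c\<close> is the
  mean of \<open>f\<close>. A set of measure zero has no mean and is treated separately.\<close>

lemma set_integral_Cauchy_Schwarz:
 fixes f :: "'b::euclidean_space => real"
 assumes f: "continuous_on Yc f" "compact Yc" and W: "W : sets \<nu>" "W \<subseteq> Yc"
  and nu: "sets \<nu> = sets borel" "emeasure \<nu> W < \<infinity>"
 shows "(LINT y:W|\<nu>. f y)^2 <= measure \<nu> W * (LINT y:W|\<nu>. (f y)^2)"
proof -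
 define m I where "m = measure \<nu> W" and "I = (LINT y:W|\<nu>. f y)"
 note si = set_integrable_continuous_compact[OF _ f(2) W nu]
 have cs: "set_integrable \<nu> W (%y. (f y)^2)" "set_integrable \<nu> W f" "set_integrable \<nu> W (%y. c)" for c :: real
  by (intro si continuous_intros f)+
 show ?thesis
 proof (cases "m = 0")
  case True
  have "|I| <= 0"
  proof -
   obtain B where B: "!!y. y : Yc ==> |f y| <= B"
    using compact_imp_bounded[OF compact_continuous_image[OF f]] by (auto simp: bounded_iff)
   have "|I| <= max B 0 * measure \<nu> W" unfolding I_def
    by (rule set_integral_bound) (use B W nu in \<open>auto intro: max.coboundedI1\<close>)
   then show ?thesis using True by (simp add: m_def)
  qed
  then show ?thesis using True by (simp add: I_def m_def)
 next
  case False
  then have m: "m > 0" by (simp add: m_def less_le)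
  define c where "c = I / m"
  have "0 <= (LINT y:W|\<nu>. (f y - c)^2)"
   unfolding set_lebesgue_integral_def by (intro integral_nonneg_AE) auto
  also have "(LINT y:W|\<nu>. (f y - c)^2) = (LINT y:W|\<nu>. (f y)^2 - 2 * c * f y + c^2)"
   by (simp add: power2_diff algebra_simps)
  also have "... = (LINT y:W|\<nu>. (f y)^2) - 2 * c * I + c^2 * m"
  proof -
   have i: "set_integrable \<nu> W (%y. 2 * c * f y)" using cs(2) by (rule set_integrable_mult_right)
   have "(LINT y:W|\<nu>. (f y)^2 - 2 * c * f y + c^2) = (LINT y:W|\<nu>. (f y)^2) - (LINT y:W|\<nu>. 2 * c * f y) + (LINT y:W|\<nu>. c^2)"
    using set_integral_add(2)[OF set_integral_diff(1)[OF cs(1) i] cs(3)] set_integral_diff(2)[OF cs(1) i] by simp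
   moreover have "(LINT y:W|\<nu>. c^2) = c^2 * m" using W nu by (simp add: set_lebesgue_integral_def m_def)
   moreover have "(LINT y:W|\<nu>. 2 * c * f y) = 2 * c * I" unfolding I_def by (rule set_integral_mult_right)
   ultimately show ?thesis by simp
  qed
  also have "... = (LINT y:W|\<nu>. (f y)^2) - I^2 / m" using m by (simp add: c_def field_simps power2_eq_square)
  finally have "I^2 / m <= (LINT y:W|\<nu>. (f y)^2)" by simp
  then show ?thesis using m by (simp add: I_def m_def field_simps)
 qed
qed

text \<open>Uniform continuity on the compact product. Continuity and differentiability in the
  parameter then pass to the integral through a bound that is uniform in the variable of
  integration.\<close>

lemma uniform_in_parameter:
 fixes k :: "'a::euclidean_space \<times> 'b::euclidean_space => real"
 assumes "continuous_on (X \<times> Yc) k" "compact X" "compact Yc" "e > 0"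
 shows "EX d>0. ALL x:X. ALL x':X. ALL y:Yc. dist x' x < d --> |k (x', y) - k (x, y)| <= e"
proof -
 have "uniformly_continuous_on (X \<times> Yc) k"
  by (intro compact_uniformly_continuous compact_Times assms)
 then obtain d where d: "d > 0" "!!p q. p : X \<times> Yc ==> q : X \<times> Yc ==> dist q p < d ==> dist (k q) (k p) < e"
  unfolding uniformly_continuous_on_def using assms(4) by blast
 show ?thesis
 proof (intro exI[of _ d] conjI d(1) ballI impI)
  fix x x' y assume "x : X" "x' : X" "y : Yc" "dist x' x < d"
  then have "dist (k (x', y)) (k (x, y)) < e" by (intro d(2)) (auto simp: dist_Pair_Pair)
  then show "|k (x', y) - k (x, y)| <= e" by (simp add: dist_real_def)
 qed
qed

lemma slice_continuous: "continuous_on (X \<times> Yc) k ==> x : X ==> continuous_on Yc (%y. k (x, y))"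
 by (intro continuous_on_compose2[of "X \<times> Yc" k Yc "%y. (x, y)"] continuous_intros) auto

lemma param_continuous:
 fixes k :: "'a::euclidean_space \<times> 'b::euclidean_space => real"
 assumes k: "continuous_on (X \<times> Yc) k" "compact X" "compact Yc" and W: "W : sets \<nu>" "W \<subseteq> Yc"
  and nu: "sets \<nu> = sets borel" "emeasure \<nu> W < \<infinity>"
 shows "continuous_on X (%x. LINT y:W|\<nu>. k (x, y))"
 unfolding continuous_on_iff
proof (intro ballI allI impI)
 fix x and e :: real assume x: "x : X" and e: "e > 0"
 define m where "m = measure \<nu> W"
 have m: "m >= 0" by (simp add: m_def)
 define e' where "e' = e / (2 * (m + 1))"
 have "0 < e * m + e * 2" using e m by (intro add_nonneg_pos) auto
 then have e': "e' > 0" "e' * m < e" using e m by (auto simp: e'_def field_simps)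
 obtain d where d: "d > 0" "ALL x:X. ALL x':X. ALL y:Yc. dist x' x < d --> |k (x', y) - k (x, y)| <= e'"
  using uniform_in_parameter[OF k e'(1)] by (elim exE conjE)
 note si = set_integrable_continuous_compact[OF slice_continuous[OF k(1)] k(3) W nu]
 show "EX d>0. ALL x':X. dist x' x < d --> dist (LINT y:W|\<nu>. k (x', y)) (LINT y:W|\<nu>. k (x, y)) < e"
 proof (intro exI[of _ d] conjI ballI impI d(1))
  fix x' assume x': "x' : X" "dist x' x < d"
  have "(LINT y:W|\<nu>. k (x', y)) - (LINT y:W|\<nu>. k (x, y)) = (LINT y:W|\<nu>. k (x', y) - k (x, y))"
   by (rule set_integral_diff(2)[symmetric]) (intro si x x'(1))+
  also have "|...| <= e' * m" unfolding m_def
   by (rule set_integral_bound) (use d(2) x x' W nu e' in auto)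
  finally show "dist (LINT y:W|\<nu>. k (x', y)) (LINT y:W|\<nu>. k (x, y)) < e" using e'(2) by (simp add: dist_real_def)
 qed
qed

lemma param_hpd:
 fixes k :: "'a::euclidean_space \<times> 'b::euclidean_space => real"
 assumes k: "continuous_on (cbox a b \<times> Yc) k" and k': "continuous_on (cbox a b \<times> Yc) k'" and Yc: "compact Yc"
  and h: "!!y. y : Yc ==> hpd (cbox a b) i (%x. k (x, y)) (%x. k' (x, y))" and i: "i : Basis"
  and W: "W : sets \<nu>" "W \<subseteq> Yc" and nu: "sets \<nu> = sets borel" "emeasure \<nu> W < \<infinity>"
 shows "hpd (cbox a b) i (%x. LINT y:W|\<nu>. k (x, y)) (%x. LINT y:W|\<nu>. k' (x, y))"
proof (rule hpdI)
 fix z and e :: real assume z: "z : cbox a b" and e: "e > 0"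
 define m where "m = measure \<nu> W"
 have m: "m >= 0" by (simp add: m_def)
 define e' where "e' = e / (m + 1)"
 have e': "e' > 0" "e' * m <= e" using e m by (auto simp: e'_def field_simps)
 obtain d where d: "d > 0" "ALL x:cbox a b. ALL x':cbox a b. ALL y:Yc. dist x' x < d --> |k' (x', y) - k' (x, y)| <= e'"
  using uniform_in_parameter[OF k' compact_cbox Yc e'(1)] by (elim exE conjE)
 note si = set_integrable_continuous_compact[OF slice_continuous[OF k] Yc W nu]
 note si' = set_integrable_continuous_compact[OF slice_continuous[OF k'] Yc W nu]
 show "EX d>0. ALL h. |h| < d --> z + h *\<^sub>R i : cbox a b -->
  |(LINT y:W|\<nu>. k (z + h *\<^sub>R i, y)) - (LINT y:W|\<nu>. k (z, y)) - h * (LINT y:W|\<nu>. k' (z, y))| <= e * |h|"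
 proof (intro exI[of _ d] conjI allI impI d(1))
  fix h assume h1: "|h| < d" and zh: "z + h *\<^sub>R i : cbox a b"
  have "(LINT y:W|\<nu>. k (z + h *\<^sub>R i, y)) - (LINT y:W|\<nu>. k (z, y)) - h * (LINT y:W|\<nu>. k' (z, y))
   = (LINT y:W|\<nu>. k (z + h *\<^sub>R i, y) - k (z, y) - h * k' (z, y))"
   using si[OF zh] si[OF z] si'[OF z]
   by (simp add: set_integral_diff set_integrable_mult_right)
  also have "|...| <= (e' * |h| ) * m" unfolding m_def
  proof (rule set_integral_bound)
   fix y assume "y : W"
   then have y: "y : Yc" using W by auto
   show "|k (z + h *\<^sub>R i, y) - k (z, y) - h * k' (z, y)| <= e' * |h|"
    by (rule hpd_remainder[OF h[OF y] i z zh]) (use d(2) z y h1 in auto)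
  qed (use W nu e' in auto)
  also have "... = (e' * m) * |h|" by simp
  also have "... <= e * |h|" using e'(2) by (intro mult_right_mono) auto
  finally show "|(LINT y:W|\<nu>. k (z + h *\<^sub>R i, y)) - (LINT y:W|\<nu>. k (z, y)) - h * (LINT y:W|\<nu>. k' (z, y))| <= e * |h|" .
 qed
qed

section \<open>The hyperplane measure\<close>

lemma hyperplane_map_measurable [measurable]:
 "(%y. \<chi> j. if j = i then r else y j) : borel_measurable (PiM (UNIV - {i}) (%_::'n::finite. lborel :: real measure))"
proof (rule borel_measurable_euclidean_space[THEN iffD2], rule ballI)
 fix b :: "real^'n" assume "b : Basis"
 then obtain j where b: "b = axis j 1" using axis_inverse by blast
 show "(%y. (\<chi> j. if j = i then r else y j) \<bullet> b) : borel_measurable (PiM (UNIV - {i}) (%_::'n. lborel :: real measure))"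
  by (cases "j = i") (simp_all add: b inner_axis)
qed

lemma sets_hyperplane_measure [simp]: "sets (hyperplane_measure i r) = sets borel"
 by (simp add: hyperplane_measure_def)

lemma rectangle_borel:
 "(!!j. I j : sets borel) ==> {x::real^'n::finite. ALL j:J. x $ j : I j} : sets borel"
proof -
 assume [measurable]: "!!j. I j : sets borel"
 have "{x : space borel. ALL j:J. (x::real^'n) $ j : I j} : sets borel" by measurable
 then show ?thesis by simp
qed

lemma emeasure_hyperplane_rectangle:
 fixes R :: "(real^'n::finite) set"
 assumes I: "!!j. I j : sets borel" and R: "R : sets borel"
  "!!x. x $ i = r ==> x : R \<longleftrightarrow> (ALL j. j ~= i --> x $ j : I j)"
 shows "emeasure (hyperplane_measure i r) R = (\<Prod>j\<in>UNIV - {i}. emeasure lborel (I j))"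
proof -
 interpret product_sigma_finite "%_::'n. lborel :: real measure" by standard
 have mem: "(\<chi> j. if j = i then r else y j) : R \<longleftrightarrow> (ALL j. j ~= i --> y j : I j)" for y
  by (subst R(2)) auto
 have eq: "(%y. \<chi> j. if j = i then r else y j) -` R \<inter> space (PiM (UNIV - {i}) (%_::'n. lborel :: real measure))
  = PiE (UNIV - {i}) I"
  unfolding set_eq_iff Int_iff vimage_eq mem by (auto simp: space_PiM PiE_iff)
 show ?thesis unfolding hyperplane_measure_def
  by (subst emeasure_distr) (use R I in \<open>auto simp: eq emeasure_PiM\<close>)
qed

text \<open>Lebesgue measure is determined by its values on boxes, and for the image measure these
  factor into the interval of coordinate \<open>i\<close> and the product over the other
  coordinates. For n = 1 the second factor is the unit mass on a one-point space.\<close>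

lemma lborel_hyperplane:
 fixes i :: "'n::finite"
 shows "(lborel :: (real^'n) measure) =
  distr (lborel \<Otimes>\<^sub>M PiM (UNIV - {i}) (%_::'n. lborel)) borel (%p. \<chi> j. if j = i then fst p else snd p j)"
proof (rule lborel_eqI)
 interpret product_sigma_finite "%_::'n. lborel :: real measure" by standard
 interpret S: sigma_finite_measure "PiM (UNIV - {i}) (%_::'n. lborel :: real measure)"
  by (rule sigma_finite) simp
 have meas: "(%p. \<chi> j. if j = i then fst p else snd p j) : borel_measurable (lborel \<Otimes>\<^sub>M PiM (UNIV - {i}) (%_::'n. lborel :: real measure))"
 proof (rule borel_measurable_euclidean_space[THEN iffD2], rule ballI)
  fix b :: "real^'n" assume "b : Basis"
  then obtain j where b: "b = axis j 1" using axis_inverse by blast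
  show "(%p. (\<chi> j. if j = i then fst p else snd p j) \<bullet> b) : borel_measurable (lborel \<Otimes>\<^sub>M PiM (UNIV - {i}) (%_::'n. lborel :: real measure))"
   by (cases "j = i") (simp_all add: b inner_axis)
 qed
 fix l u :: "real^'n" assume lu: "!!b. b : Basis ==> l \<bullet> b <= u \<bullet> b"
 have le: "l $ j <= u $ j" for j using lu[of "axis j 1"] by (simp add: inner_axis axis_in_Basis_iff)
 have mem: "(\<chi> j. if j = i then fst p else snd p j) : box l u \<longleftrightarrow>
   fst p : {l $ i<..<u $ i} & (ALL j:UNIV - {i}. snd p j : {l $ j<..<u $ j})" for p
 proof -
  have "(ALL j. P j) \<longleftrightarrow> P i & (ALL j:UNIV - {i}. P j)" for P :: "'n => bool" by auto
  from this[of "%j. l $ j < (if j = i then fst p else snd p j) & (if j = i then fst p else snd p j) < u $ j"]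
  show ?thesis by (simp add: mem_box_cart)
 qed
 have "(%p. \<chi> j. if j = i then fst p else snd p j) -` box l u \<inter> space (lborel \<Otimes>\<^sub>M PiM (UNIV - {i}) (%_::'n. lborel :: real measure))
  = {l $ i<..<u $ i} \<times> PiE (UNIV - {i}) (%j. {l $ j<..<u $ j})"
  unfolding set_eq_iff Int_iff vimage_eq mem by (auto simp: space_pair_measure space_PiM PiE_iff)
 then have "emeasure (distr (lborel \<Otimes>\<^sub>M PiM (UNIV - {i}) (%_::'n. lborel)) borel (%p. \<chi> j. if j = i then fst p else snd p j)) (box l u)
  = emeasure (lborel \<Otimes>\<^sub>M PiM (UNIV - {i}) (%_::'n. lborel :: real measure)) ({l $ i<..<u $ i} \<times> PiE (UNIV - {i}) (%j. {l $ j<..<u $ j}))"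
  by (subst emeasure_distr[OF meas]) auto
 also have "... = emeasure lborel {l $ i<..<u $ i} * emeasure (PiM (UNIV - {i}) (%_::'n. lborel :: real measure)) (PiE (UNIV - {i}) (%j. {l $ j<..<u $ j}))"
  by (rule S.emeasure_pair_measure_Times) (auto intro!: sets_PiM_I_finite)
 also have "... = ennreal (u $ i - l $ i) * (\<Prod>j\<in>UNIV - {i}. ennreal (u $ j - l $ j))"
  by (simp add: emeasure_PiM le)
 also have "... = (\<Prod>j\<in>UNIV. ennreal (u $ j - l $ j))" by (simp add: prod.remove[of UNIV i])
 also have "... = ennreal (\<Prod>j\<in>UNIV. u $ j - l $ j)" by (rule prod_ennreal) (simp add: le)
 also have "(\<Prod>j\<in>UNIV. u $ j - l $ j) = (\<Prod>b\<in>Basis. (u - l) \<bullet> b)"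
 proof -
  have B: "(Basis :: (real^'n) set) = (%j. axis j 1) ` UNIV" by (auto simp: Basis_vec_def)
  show ?thesis unfolding B by (subst prod.reindex) (auto simp: inj_on_def axis_eq_axis inner_axis)
 qed
 finally show "emeasure (distr (lborel \<Otimes>\<^sub>M PiM (UNIV - {i}) (%_::'n. lborel)) borel (%p. \<chi> j. if j = i then fst p else snd p j)) (box l u)
   = ennreal (\<Prod>b\<in>Basis. (u - l) \<bullet> b)" by simp
qed simp

text \<open>Fubini along the hyperplanes orthogonal to the axis \<open>i\<close>, each translated to
  the one through the origin, as in the definition of \<open>interaction\<close>.\<close>

lemma integral_lborel_hyperplane:
 fixes F :: "real^'n::finite => real"
 assumes F: "integrable lborel F"
 shows "integral\<^sup>L lborel F = (\<integral>r. (\<integral>y. F (y + r *\<^sub>R axis i 1) \<partial>hyperplane_measure i 0) \<partial>lborel)"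
proof -
 interpret product_sigma_finite "%_::'n. lborel :: real measure" by standard
 interpret S: sigma_finite_measure "PiM (UNIV - {i}) (%_::'n. lborel :: real measure)"
  by (rule sigma_finite) simp
 interpret P: pair_sigma_finite "lborel :: real measure" "PiM (UNIV - {i}) (%_::'n. lborel :: real measure)" ..
 define \<phi> where "\<phi> = (%p::real \<times> ('n => real). \<chi> j. if j = i then fst p else snd p j)"
 have meas: "\<phi> : borel_measurable (lborel \<Otimes>\<^sub>M PiM (UNIV - {i}) (%_::'n. lborel :: real measure))"
  unfolding \<phi>_def
 proof (rule borel_measurable_euclidean_space[THEN iffD2], rule ballI)
  fix b :: "real^'n" assume "b : Basis"
  then obtain j where b: "b = axis j 1" using axis_inverse by blast
  show "(%p. (\<chi> j. if j = i then fst p else snd p j) \<bullet> b) : borel_measurable (lborel \<Otimes>\<^sub>M PiM (UNIV - {i}) (%_::'n. lborel :: real measure))"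
   by (cases "j = i") (simp_all add: b inner_axis)
 qed
 have Fb: "F : borel_measurable borel" using borel_measurable_integrable[OF F] by simp
 have "integrable (lborel \<Otimes>\<^sub>M PiM (UNIV - {i}) (%_::'n. lborel :: real measure)) (%p. F (\<phi> p))"
  using F unfolding lborel_hyperplane[of i] \<phi>_def[symmetric] integrable_distr_eq[OF meas Fb] .
 note I = P.integral_fst'[OF this]
 have "integral\<^sup>L lborel F = integral\<^sup>L (lborel \<Otimes>\<^sub>M PiM (UNIV - {i}) (%_::'n. lborel :: real measure)) (%p. F (\<phi> p))"
  unfolding lborel_hyperplane[of i] \<phi>_def[symmetric] by (rule integral_distr[OF meas Fb])
 also have "... = (\<integral>r. (\<integral>y. F (\<phi> (r, y)) \<partial>PiM (UNIV - {i}) (%_::'n. lborel :: real measure)) \<partial>lborel)"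
  by (rule I[symmetric])
 also have "... = (\<integral>r. (\<integral>y. F (y + r *\<^sub>R axis i 1) \<partial>hyperplane_measure i 0) \<partial>lborel)"
 proof (rule Bochner_Integration.integral_cong[OF refl])
  fix r :: real
  have m: "(%x. F (x + r *\<^sub>R axis i 1)) : borel_measurable borel" using Fb by measurable
  have eq: "\<phi> (r, y) = (\<chi> j. if j = i then 0 else y j) + r *\<^sub>R axis i 1" for y
   by (auto simp: \<phi>_def vec_eq_iff axis_def)
  show "(\<integral>y. F (\<phi> (r, y)) \<partial>PiM (UNIV - {i}) (%_::'n. lborel :: real measure)) = (\<integral>y. F (y + r *\<^sub>R axis i 1) \<partial>hyperplane_measure i 0)"
   unfolding hyperplane_measure_def eq by (rule integral_distr[OF _ m, symmetric]) measurable
 qed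
 finally show ?thesis .
qed

context space_time_box
begin

abbreviation "hm \<equiv> hyperplane_measure i0 0"
abbreviation "e1 \<equiv> axis i0 (1::real)"

definition Oc where "Oc = cbox (- A) A"
definition Om' where "Om' = Omega' A i0"
definition Yc where "Yc = cbox (- bar i0 A) (bar i0 A)"
definition m' where "m' = measure hm Om'"

lemma mem_Oc: "x : Oc \<longleftrightarrow> (ALL i. - A $ i <= x $ i & x $ i <= A $ i)"
 by (auto simp: Oc_def mem_box_cart)

lemma mem_Yc: "y : Yc \<longleftrightarrow> y $ i0 = 0 & (ALL i. i ~= i0 --> - A $ i <= y $ i & y $ i <= A $ i)"
 by (auto simp: Yc_def mem_box_cart bar_def split: if_splits)

lemma compact_Yc [simp]: "compact Yc" and compact_Oc [simp]: "compact Oc" and compact_Q [simp]: "compact Q"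
 by (auto simp: Yc_def Oc_def Q_def)

lemma Om'_borel [simp]: "Om' : sets borel" "Om' : sets hm"
proof -
 have "Om' = {x. x $ i0 : {0}} \<inter> {x. ALL j:UNIV - {i0}. x $ j : {- A $ j<..<A $ j}}"
  by (auto simp: Om'_def Omega'_def)
 also have "... : sets borel" using rectangle_borel[of "%_. {0}" "{i0}"] by (intro sets.Int rectangle_borel) auto
 finally show "Om' : sets borel" "Om' : sets hm" by auto
qed

lemma mem_Om': "y : Om' \<longleftrightarrow> y $ i0 = 0 & (ALL i. i ~= i0 --> - A $ i < y $ i & y $ i < A $ i)"
 by (simp add: Om'_def Omega'_def)

lemma Om'_Yc: "Om' \<subseteq> Yc"
 unfolding subset_iff mem_Om' mem_Yc by (meson less_imp_le)

lemma Om'_finite [simp]: "emeasure hm Om' < \<infinity>"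
proof -
 have "emeasure hm Om' = (\<Prod>j\<in>UNIV - {i0}. emeasure lborel {- A $ j<..<A $ j})"
  by (rule emeasure_hyperplane_rectangle) (auto simp: mem_Om')
 also have "... = (\<Prod>j\<in>UNIV - {i0}. ennreal (2 * A $ j))"
  using A_pos by (intro prod.cong refl) (simp add: less_imp_le order_trans[of "- _" 0])
 also have "... = ennreal (\<Prod>j\<in>UNIV - {i0}. 2 * A $ j)"
  by (rule prod_ennreal) (simp add: A_pos less_imp_le)
 also have "... < \<infinity>" by simp
 finally show ?thesis .
qed

lemma m'_nonneg [simp]: "m' >= 0"
 by (simp add: m'_def)

lemma shift_Oc: "y : Yc ==> - A $ i0 <= r ==> r <= A $ i0 ==> y + r *\<^sub>R e1 : Oc"
 by (auto simp: mem_Yc mem_Oc axis_def)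

text \<open>Fubini for the closed box, but with the open cross-section \<open>Om'\<close> over which
  the interaction integrates. The boundary is negligible, so the proof goes through the open
  box.\<close>

lemma integral_Oc:
 fixes h :: "real^'n => real"
 assumes h: "continuous_on Oc h"
 shows "integral Oc h = integral {- A $ i0..A $ i0} (%r. LINT y:Om'|hm. h (y + r *\<^sub>R e1))"
  and "continuous_on {- A $ i0..A $ i0} (%r. LINT y:Om'|hm. h (y + r *\<^sub>R e1))"
proof -
 define a where "a = A $ i0"
 have kc: "continuous_on ({- a..a} \<times> Yc) (%p. h (snd p + fst p *\<^sub>R e1))"
  by (intro continuous_on_compose2[OF h] continuous_intros) (auto intro: shift_Oc simp: a_def)
 show c: "continuous_on {- A $ i0..A $ i0} (%r. LINT y:Om'|hm. h (y + r *\<^sub>R e1))"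
  using param_continuous[OF kc compact_Icc compact_Yc Om'_borel(2) Om'_Yc sets_hyperplane_measure Om'_finite] by (simp add: a_def)
 have "set_integrable lborel Oc h"
  using borel_integrable_compact[OF compact_Oc h] by (simp add: set_integrable_def)
 then have si: "set_integrable lborel (box (- A) A) h"
  by (rule set_integrable_subset) (auto simp: Oc_def box_subset_cbox)
 have "integral Oc h = (LINT x:box (- A) A|lborel. h x)"
  unfolding Oc_def set_borel_integral_eq_integral(2)[OF si] by (rule integral_open_interval[symmetric])
 also have "... = (\<integral>r. (\<integral>y. indicator (box (- A) A) (y + r *\<^sub>R e1) *\<^sub>R h (y + r *\<^sub>R e1) \<partial>hm) \<partial>lborel)"
  using integral_lborel_hyperplane[OF si[unfolded set_integrable_def], of i0] by (simp add: set_lebesgue_integral_def)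
 also have "... = (\<integral>r. indicator {- a<..<a} r *\<^sub>R (LINT y:Om'|hm. h (y + r *\<^sub>R e1)) \<partial>lborel)"
 proof (rule Bochner_Integration.integral_cong[OF refl])
  fix r :: real
  \<comment> \<open>The indicator of the box factors only on the hyperplane itself, which carries
    all of \<open>hm\<close>.\<close>
  have ae: "AE y in hm. y $ i0 = 0"
   unfolding hyperplane_measure_def by (subst AE_distr_iff) auto
  have hs: "(%x. indicator (box (- A) A) x *\<^sub>R h x) : borel_measurable borel"
   using borel_measurable_integrable[OF si[unfolded set_integrable_def]] by simp
  have ind: "indicator (box (- A) A) (y + r *\<^sub>R e1) = (indicator {- a<..<a} r * indicator Om' y :: real)" if "y $ i0 = 0" for y
   using that by (auto simp: indicator_def mem_box_cart mem_Om' axis_def a_def split: if_splits)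
  have m2: "(%y. indicator {- a<..<a} r *\<^sub>R (indicator Om' y *\<^sub>R h (y + r *\<^sub>R e1))) : borel_measurable hm"
  proof (cases "r : {- a<..<a}")
   case True
   have "continuous_on Om' (%y. h (y + r *\<^sub>R e1))"
    by (intro continuous_on_compose2[OF h] continuous_intros) (use True Om'_Yc in \<open>auto intro!: shift_Oc simp: a_def\<close>)
   then have "(%y. indicator Om' y *\<^sub>R h (y + r *\<^sub>R e1)) : borel_measurable borel"
    by (intro borel_measurable_continuous_on_indicator) auto
   then show ?thesis by (simp add: measurable_cong_sets[OF sets_hyperplane_measure refl])
  qed simp
  have "(\<integral>y. indicator (box (- A) A) (y + r *\<^sub>R e1) *\<^sub>R h (y + r *\<^sub>R e1) \<partial>hm)
   = (\<integral>y. indicator {- a<..<a} r *\<^sub>R (indicator Om' y *\<^sub>R h (y + r *\<^sub>R e1)) \<partial>hm)"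
  proof (rule integral_cong_AE[OF _ m2])
   show "(%y. indicator (box (- A) A) (y + r *\<^sub>R e1) *\<^sub>R h (y + r *\<^sub>R e1)) : borel_measurable hm"
    using measurable_compose[OF _ hs, of "%y. y + r *\<^sub>R e1"] by (simp add: measurable_cong_sets[OF sets_hyperplane_measure refl])
   show "AE y in hm. indicator (box (- A) A) (y + r *\<^sub>R e1) *\<^sub>R h (y + r *\<^sub>R e1) = indicator {- a<..<a} r *\<^sub>R (indicator Om' y *\<^sub>R h (y + r *\<^sub>R e1))"
    using ae by eventually_elim (simp add: ind)
  qed
  then show "(\<integral>y. indicator (box (- A) A) (y + r *\<^sub>R e1) *\<^sub>R h (y + r *\<^sub>R e1) \<partial>hm) = indicator {- a<..<a} r *\<^sub>R (LINT y:Om'|hm. h (y + r *\<^sub>R e1))"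
   by (simp add: set_lebesgue_integral_def)
 qed
 also have "... = (LINT r:{- a<..<a}|lborel. LINT y:Om'|hm. h (y + r *\<^sub>R e1))"
  by (simp add: set_lebesgue_integral_def)
 also have "... = integral {- a<..<a} (%r. LINT y:Om'|hm. h (y + r *\<^sub>R e1))"
 proof (rule set_borel_integral_eq_integral(2))
  show "set_integrable lborel {- a<..<a} (%r. LINT y:Om'|hm. h (y + r *\<^sub>R e1))"
   by (rule set_integrable_continuous_compact[OF c]) (auto simp: a_def simp del: infinity_ennreal_def intro!: emeasure_bounded_finite)
 qed
 finally show "integral Oc h = integral {- A $ i0..A $ i0} (%r. LINT y:Om'|hm. h (y + r *\<^sub>R e1))"
  by (simp add: integral_open_interval_real a_def)
qed


section \<open>Iterated regularity with uniform bounds\<close>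

definition R0 :: "real => ((real^'n) \<times> real => real) => bool" where "R0 B f \<longleftrightarrow> continuous_on Q f & (ALL z:Q. |f z| <= B)"

text \<open>Space derivatives up to order \<open>n\<close> exist, are continuous and are bounded by
  \<open>B\<close>. They are quantified existentially while the bound is a parameter, so that
  closure under products and quotients can be stated with a constant fixed before the functions.
  Time is left out because \<open>R\<close> serves only the end slices in
  \<open>time_multiplier\<close>.\<close>

primrec R :: "nat => real => ((real^'n) \<times> real => real) => bool" where
 "R 0 B f = R0 B f"
| "R (Suc n) B f = (R0 B f & (ALL i. EX fi. hpd Q (dx i) f fi & R n B fi))"

definition Ob where "Ob = cbox (- A, - A) (A, A)"

primrec KR :: "nat => real => ((real^'n) \<times> (real^'n) => real) => bool" where
 "KR 0 M K = (continuous_on Ob K & (ALL p:Ob. |K p| <= M))"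
| "KR (Suc n) M K = (continuous_on Ob K & (ALL p:Ob. |K p| <= M) & (ALL v:Basis. EX K'. hpd Ob v K K' & KR n M K'))"

lemma R_R0: "R n B f ==> R0 B f"
 by (cases n) auto

lemma KR_0: "KR n M K ==> continuous_on Ob K & (ALL p:Ob. |K p| <= M)"
 by (cases n) auto

lemma R_mono: "R n B f ==> B <= C ==> R n C f"
proof (induction n arbitrary: f)
 case 0 then show ?case by (force simp: R0_def)
next
 case (Suc n)
 have "R0 C f" using Suc.prems by (force simp: R0_def)
 moreover have "EX fi. hpd Q (dx i) f fi & R n C fi" for i
  using Suc.prems Suc.IH by (meson R.simps(2))
 ultimately show ?case by simp
qed

lemma R_Suc: "R (Suc n) B f ==> R n B f"
proof (induction n arbitrary: f)
 case (Suc n)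
 have "EX fi. hpd Q (dx i) f fi & R n B fi" for i
  using Suc.prems Suc.IH by (metis R.simps(2))
 then show ?case using Suc.prems by simp
qed simp

lemma KR_Suc: "KR (Suc n) M K ==> KR n M K"
proof (induction n arbitrary: K)
 case (Suc n)
 have "EX K'. hpd Ob v K K' & KR n M K'" if "v : Basis" for v
  using Suc.prems Suc.IH that by (metis KR.simps(2))
 then show ?case using Suc.prems by simp
qed simp

lemma R0_add: "R0 B f ==> R0 C g ==> R0 (B + C) (%z. f z + g z)"
 unfolding R0_def by (auto intro!: continuous_intros order_trans[OF abs_triangle_ineq] add_mono)

lemma R_add: "R n B f ==> R n C g ==> R n (B + C) (%z. f z + g z)"
proof (induction n arbitrary: f g)
 case (Suc n)
 have "EX h. hpd Q (dx i) (%z. f z + g z) h & R n (B + C) h" for i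
 proof -
  obtain fi gi where "hpd Q (dx i) f fi" "R n B fi" "hpd Q (dx i) g gi" "R n C gi"
   using Suc.prems by (metis R.simps(2))
  then show ?thesis using Suc.IH hpd_add by blast
 qed
 then show ?case using Suc.prems R0_add by simp
qed (simp add: R0_add)

lemma R_minus: "R n B f ==> R n B (%z. - f z)"
proof (induction n arbitrary: f)
 case (Suc n)
 have "EX h. hpd Q (dx i) (%z. - f z) h & R n B h" for i
  using Suc.prems Suc.IH hpd_minus by (metis R.simps(2))
 then show ?case using Suc.prems by (auto simp: R0_def intro!: continuous_intros)
qed (auto simp: R0_def intro!: continuous_intros)

lemma R0_mult:
 assumes "R0 B f" "R0 C g" shows "R0 ( |B| * |C| ) (%z. f z * g z)"
 unfolding R0_def
proof (intro conjI ballI)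
 show "continuous_on Q (%z. f z * g z)" using assms unfolding R0_def by (intro continuous_on_mult) auto
 fix z assume "z : Q"
 then have "|f z| <= |B|" "|g z| <= |C|" using assms unfolding R0_def by force+
 then show "|f z * g z| <= |B| * |C|" unfolding abs_mult by (intro mult_mono) auto
qed

lemma R_mult: "EX B'. ALL f g. R n B f & R n C g --> R n B' (%z. f z * g z)"
proof (induction n)
 case 0 then show ?case using R0_mult by fastforce
next
 case (Suc n)
 then obtain B' where B': "!!f g. R n B f ==> R n C g ==> R n B' (%z. f z * g z)" by blast
 define B'' where "B'' = max ( |B| * |C| ) (B' + B')"
 show ?case
 proof (intro exI[of _ B''] allI impI, elim conjE)
  fix f g assume fg: "R (Suc n) B f" "R (Suc n) C g"
  have "EX h. hpd Q (dx i) (%z. f z * g z) h & R n B'' h" for i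
  proof -
   obtain fi gi where d: "hpd Q (dx i) f fi" "R n B fi" "hpd Q (dx i) g gi" "R n C gi"
    using fg by (metis R.simps(2))
   have "R n (B' + B') (%z. fi z * g z + f z * gi z)"
    by (rule R_add[OF B'[OF d(2) R_Suc[OF fg(2)]] B'[OF R_Suc[OF fg(1)] d(4)]])
   then have "R n B'' (%z. fi z * g z + f z * gi z)" by (rule R_mono) (simp add: B''_def)
   then show ?thesis using hpd_mult[OF d(1,3)] by blast
  qed
  moreover have "R0 B'' (%z. f z * g z)"
   using R_mono[of 0 _ _ B''] R0_mult[OF R_R0[OF fg(1)] R_R0[OF fg(2)]] by (simp add: B''_def)
  ultimately show "R (Suc n) B'' (%z. f z * g z)" by simp
 qed
qed

text \<open>The derivative of \<open>1 / f\<close> is minus that of \<open>f\<close> times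
  \<open>(1 / f)^2\<close>. The induction hypothesis bounds \<open>1 / f\<close> to one order less,
  and \<open>R_mult\<close> supplies the constant for the product.\<close>

lemma R_inverse:
 assumes c: "c > 0"
 shows "EX B'. ALL f. R n B f & (ALL z:Q. |f z| >= c) --> R n B' (%z. 1 / f z)"
proof -
 have R0: "R0 (1 / c) (%z. 1 / f z)" if "R0 B f" "ALL z:Q. |f z| >= c" for f
  using that c unfolding R0_def by (force intro!: continuous_intros divide_left_mono simp: abs_divide)
 show ?thesis
 proof (induction n)
 case 0
 show ?case using R0 by auto
 next
 case (Suc n)
 then obtain B' where B': "!!f. R n B f ==> ALL z:Q. |f z| >= c ==> R n B' (%z. 1 / f z)" by blast
 obtain B2 where B2: "!!f g. R n B' f ==> R n B' g ==> R n B2 (%z. f z * g z)" using R_mult[of n B' B'] by blast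
 obtain B3 where B3: "!!f g. R n B f ==> R n B2 g ==> R n B3 (%z. f z * g z)" using R_mult[of n B B2] by blast
 define B'' where "B'' = max (1 / c) B3"
 show ?case
 proof (intro exI[of _ B''] allI impI, elim conjE)
  fix f assume f: "R (Suc n) B f" "ALL z:Q. |f z| >= c"
  have nz: "f z ~= 0" if "z : Q" for z using f(2) that c by force
  have "EX h. hpd Q (dx i) (%z. 1 / f z) h & R n B'' h" for i
  proof -
   obtain fi where d: "hpd Q (dx i) f fi" "R n B fi" using f by (metis R.simps(2))
   have "R n B3 (%z. - (fi z * ((1 / f z) * (1 / f z))))"
    by (rule R_minus[OF B3[OF d(2) B2[OF B'[OF R_Suc[OF f(1)] f(2)] B'[OF R_Suc[OF f(1)] f(2)]]]])
   then have "R n B'' (%z. - (fi z * ((1 / f z) * (1 / f z))))" by (rule R_mono) (simp add: B''_def)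
   moreover have "hpd Q (dx i) (%z. 1 / f z) (%z. - (fi z * ((1 / f z) * (1 / f z))))"
    by (rule hpd_cong1[OF hpd_divide[OF hpd_const d(1) nz]]) auto
   ultimately show ?thesis by blast
  qed
  moreover have "R0 B'' (%z. 1 / f z)"
   using R_mono[of 0 _ _ B''] R0[OF R_R0[OF f(1)] f(2)] by (simp add: B''_def)
  ultimately show "R (Suc n) B'' (%z. 1 / f z)" by simp
 qed
 qed
qed

lemma R0_slice:
 assumes f: "R0 B f" and t: "t : {0..T}"
 shows "R0 B (%z. f (fst z, t))"
proof -
 have "continuous_on Q (%z. f (fst z, t))"
 proof (rule continuous_on_compose2[of Q f])
  show "continuous_on Q f" using f by (simp add: R0_def)
  show "continuous_on Q (%z. (fst z, t))" by (intro continuous_intros)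
  show "(%z. (fst z, t)) ` Q \<subseteq> Q" using Q_time[OF _ t] by blast
 qed
 moreover have "|f (fst z, t)| <= B" if "z : Q" for z using f Q_time[OF that t] by (simp add: R0_def)
 ultimately show ?thesis by (simp add: R0_def)
qed

lemma R_slice: "R n B f ==> t : {0..T} ==> R n B (%z. f (fst z, t))"
proof (induction n arbitrary: f)
 case 0 then show ?case using R0_slice by simp
next
 case (Suc n)
 have "EX h. hpd Q (dx i) (%z. f (fst z, t)) h & R n B h" for i
 proof -
  obtain fi where d: "hpd Q (dx i) f fi" "R n B fi" using Suc.prems by (metis R.simps(2))
  have "hpd Q (dx i) (%z. f (fst z, t)) (%z. fi (fst z, t))"
   by (rule hpd_affine[OF d(1)]) (use Q_time[OF _ Suc.prems(2)] in \<open>auto simp: dx_def\<close>)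
  then show ?thesis using Suc.IH[OF d(2) Suc.prems(2)] by blast
 qed
 then show ?case using R0_slice Suc.prems by simp
qed

section \<open>The interaction term\<close>

text \<open>\<open>G3\<close> is the part of the interaction with the delta function and
  \<open>G2\<close> the part with the Heaviside function. \<open>Hr\<close> integrates over the
  slice y1 = r, so \<open>G3\<close> is \<open>Hr\<close> at r = x1 and \<open>G2\<close> is the
  integral of \<open>Hr\<close> over r from x1 to A1. All take a kernel on the whole of
  \<open>Ob\<close>; \<open>barK\<close> extends \<open>K1\<close> to one that is constant in both
  first coordinates.\<close>

definition G3 :: "((real^'n) \<times> (real^'n) => real) => ((real^'n) \<times> real => real) => (real^'n) \<times> real => real" where
 "G3 K m z = (LINT y:Om'|hm. K (fst z, y + (fst z $ i0) *\<^sub>R e1) * m (y + (fst z $ i0) *\<^sub>R e1, snd z))"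
definition Hr :: "((real^'n) \<times> (real^'n) => real) => ((real^'n) \<times> real => real) => ((real^'n) \<times> real) \<times> real => real" where
 "Hr K m p = (LINT y:Om'|hm. K (fst (fst p), y + snd p *\<^sub>R e1) * m (y + snd p *\<^sub>R e1, snd (fst p)))"
definition G2 :: "((real^'n) \<times> (real^'n) => real) => ((real^'n) \<times> real => real) => (real^'n) \<times> real => real" where
 "G2 K m z = (LINT r:{fst z $ i0..A $ i0}|lborel. Hr K m (z, r))"

lemma Ob_Times: "Ob = Oc \<times> Oc"
 by (simp add: Ob_def Oc_def cbox_Pair_eq)

lemma Q_Times': "Q = Oc \<times> {0..T}"
 by (simp add: Q_Times Oc_def)

lemma Q_coord: "z : Q ==> - A $ i <= fst z $ i" "z : Q ==> fst z $ i <= A $ i"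
 by (auto simp: mem_Q)

lemma shift_Q: "z : Q ==> y : Yc ==> - A $ i0 <= r ==> r <= A $ i0 ==> (y + r *\<^sub>R e1, snd z) : Q"
 "z : Q ==> y : Yc ==> - A $ i0 <= r ==> r <= A $ i0 ==> (fst z, y + r *\<^sub>R e1) : Ob"
 by (auto simp: Q_Times' Ob_Times intro: shift_Oc)

lemma shift_Qz: "z : Q ==> y : Yc ==> (y + (fst z $ i0) *\<^sub>R e1, snd z) : Q"
 "z : Q ==> y : Yc ==> (fst z, y + (fst z $ i0) *\<^sub>R e1) : Ob"
 by (rule shift_Q; simp add: Q_coord)+

lemma dx_dt_proj [simp]: "fst (dx i) = axis i 1" "snd (dx i) = 0" "fst dt = 0" "snd dt = 1"
 by (simp_all add: dx_def dt_def)

lemma axis_other: "i ~= j ==> axis i 1 $ j = 0"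
 by (simp add: axis_def)

abbreviation "barK K1 \<equiv> %p. K1 (bar i0 (fst p), bar i0 (snd p))"

lemma interaction_eq:
 "interaction A i0 K1 K2 m x t = G3 (barK K1) m (x, t) + G2 K2 m (x, t)"
proof -
 have b: "bar i0 (y + r *\<^sub>R e1) = y" if "y : Om'" for y r
  using that by (auto simp: bar_def mem_Om' vec_eq_iff axis_def)
 have "(LINT y:Om'|hm. K1 (bar i0 x, y) * m (y + x $ i0 *\<^sub>R e1, t)) =
   (LINT y:Om'|hm. K1 (bar i0 x, bar i0 (y + x $ i0 *\<^sub>R e1)) * m (y + x $ i0 *\<^sub>R e1, t))"
  by (rule set_lebesgue_integral_cong) (auto simp: b)
 then show ?thesis unfolding interaction_def G3_def G2_def Hr_def by (simp flip: Om'_def)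
qed

lemma integrand3_cont:
 fixes K :: "(real^'n) \<times> (real^'n) => real" and m :: "(real^'n) \<times> real => real"
 assumes "continuous_on Ob K" "continuous_on Q m"
 shows "continuous_on (Q \<times> Yc) (%p. K (fst (fst p), snd p + (fst (fst p) $ i0) *\<^sub>R e1) * m (snd p + (fst (fst p) $ i0) *\<^sub>R e1, snd (fst p)))"
proof (intro continuous_on_mult)
 show "continuous_on (Q \<times> Yc) (%p. K (fst (fst p), snd p + (fst (fst p) $ i0) *\<^sub>R e1))"
  by (rule continuous_on_compose2[OF assms(1)]) (auto intro!: continuous_intros shift_Qz(2)[of "(_, _)", simplified])
 show "continuous_on (Q \<times> Yc) (%p. m (snd p + (fst (fst p) $ i0) *\<^sub>R e1, snd (fst p)))"
  by (rule continuous_on_compose2[OF assms(2)]) (auto intro!: continuous_intros shift_Qz(1)[of "(_, _)", simplified])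
qed

lemmas hm_facts = compact_Yc Om'_borel(2) Om'_Yc sets_hyperplane_measure Om'_finite

lemma G3_cont:
 assumes "continuous_on Ob K" "continuous_on Q m"
 shows "continuous_on Q (G3 K m)"
 using param_continuous[OF integrand3_cont[OF assms] compact_Q hm_facts] by (simp add: G3_def[abs_def])

lemma G3_hpd:
 assumes K: "continuous_on Ob K" "continuous_on Ob K'" and m: "continuous_on Q m" "continuous_on Q md"
  and dK: "!!y. y : Yc ==> hpd Q v (%z. K (fst z, y + (fst z $ i0) *\<^sub>R e1)) (%z. K' (fst z, y + (fst z $ i0) *\<^sub>R e1))"
  and dm: "!!y. y : Yc ==> hpd Q v (%z. m (y + (fst z $ i0) *\<^sub>R e1, snd z)) (%z. md (y + (fst z $ i0) *\<^sub>R e1, snd z))"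
  and v: "v : Basis"
 shows "hpd Q v (G3 K m) (%z. G3 K' m z + G3 K md z)"
proof -
 have c: "continuous_on (Q \<times> Yc) (%p. K' (fst (fst p), snd p + (fst (fst p) $ i0) *\<^sub>R e1) * m (snd p + (fst (fst p) $ i0) *\<^sub>R e1, snd (fst p))
    + K (fst (fst p), snd p + (fst (fst p) $ i0) *\<^sub>R e1) * md (snd p + (fst (fst p) $ i0) *\<^sub>R e1, snd (fst p)))"
  by (intro continuous_on_add integrand3_cont K m)
 have "hpd Q v (G3 K m) (%z. LINT y:Om'|hm. K' (fst z, y + (fst z $ i0) *\<^sub>R e1) * m (y + (fst z $ i0) *\<^sub>R e1, snd z)
    + K (fst z, y + (fst z $ i0) *\<^sub>R e1) * md (y + (fst z $ i0) *\<^sub>R e1, snd z))"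
  unfolding G3_def[abs_def]
  using param_hpd[OF integrand3_cont[OF K(1) m(1), unfolded Q_def] c[unfolded Q_def] compact_Yc _ v Om'_borel(2) Om'_Yc sets_hyperplane_measure Om'_finite]
   hpd_mult[OF dK dm] by (simp add: Q_def)
 then show ?thesis
 proof (rule hpd_cong1)
  fix z assume z: "z : Q"
  note si = set_integrable_continuous_compact[OF slice_continuous[OF integrand3_cont _] hm_facts, of _ _ z]
  show "(LINT y:Om'|hm. K' (fst z, y + (fst z $ i0) *\<^sub>R e1) * m (y + (fst z $ i0) *\<^sub>R e1, snd z)
    + K (fst z, y + (fst z $ i0) *\<^sub>R e1) * md (y + (fst z $ i0) *\<^sub>R e1, snd z)) = G3 K' m z + G3 K md z"
   using set_integral_add(2)[OF si[OF K(2) m(1) z] si[OF K(1) m(2) z]] by (simp add: G3_def)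
 qed
qed

lemma G3_zero [simp]: "G3 (%_. 0) m z = 0" "G3 K (%_. 0) z = 0"
 by (simp_all add: G3_def)

lemma G3_dt:
 assumes "continuous_on Ob K" "continuous_on Q m" "continuous_on Q mt" "hpd Q dt m mt"
 shows "hpd Q dt (G3 K m) (G3 K mt)"
proof -
 have "hpd Q dt (G3 K m) (%z. G3 (%_. 0) m z + G3 K mt z)"
 proof (rule G3_hpd)
  show "hpd Q dt (%z. K (fst z, y + (fst z $ i0) *\<^sub>R e1)) (%z. 0)" for y
   by (rule hpd_trivial) simp
  show "hpd Q dt (%z. m (y + (fst z $ i0) *\<^sub>R e1, snd z)) (%z. mt (y + (fst z $ i0) *\<^sub>R e1, snd z))" if "y : Yc" for y
   by (rule hpd_affine[OF assms(4)]) (simp_all add: shift_Qz that, simp add: dt_def)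
 qed (use assms in auto)
 then show ?thesis by simp
qed

text \<open>For \<open>i = i0\<close> the coordinate x1 occurs in the first argument of
  \<open>K\<close>, in the shift of its second argument and in \<open>m\<close>. The two occurrences
  in \<open>K\<close> are treated as one derivative along a diagonal.\<close>

lemma G3_dx:
 assumes K: "continuous_on Ob K" "continuous_on Ob Kx" "continuous_on Ob Ky"
  and d: "hpd Ob (axis i 1, 0) K Kx" "hpd Ob (0, e1) K Ky"
  and m: "continuous_on Q m" "continuous_on Q m1" "hpd Q (dx i0) m m1"
 shows "hpd Q (dx i) (G3 K m) (%z. G3 Kx m z + (if i = i0 then G3 Ky m z + G3 K m1 z else 0))"
proof (cases "i = i0")
 case False
 have "hpd Q (dx i) (G3 K m) (%z. G3 Kx m z + G3 K (%_. 0) z)"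
 proof (rule G3_hpd)
  show "hpd Q (dx i) (%z. K (fst z, y + (fst z $ i0) *\<^sub>R e1)) (%z. Kx (fst z, y + (fst z $ i0) *\<^sub>R e1))" if "y : Yc" for y
   by (rule hpd_affine[OF d(1)]) (use False in \<open>simp_all add: shift_Qz that axis_other\<close>)
  show "hpd Q (dx i) (%z. m (y + (fst z $ i0) *\<^sub>R e1, snd z)) (%z. 0)" for y
   by (rule hpd_trivial) (use False in \<open>simp add: axis_other\<close>)
 qed (use K m in auto)
 then show ?thesis using False by simp
next
 case True
 have "hpd Ob ((e1, 0) + (0, e1)) K (%p. Kx p + Ky p)"
  unfolding Ob_def
  by (rule hpd_add_direction[OF d(1)[unfolded True Ob_def] d(2)[unfolded Ob_def]])
   (use K in \<open>auto simp: Ob_def Basis_prod_def axis_in_Basis_iff axis_eq_0_iff\<close>)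
 then have d': "hpd Ob (e1, e1) K (%p. Kx p + Ky p)" by simp
 have "hpd Q (dx i) (G3 K m) (%z. G3 (%p. Kx p + Ky p) m z + G3 K m1 z)"
 proof (rule G3_hpd)
  show "hpd Q (dx i) (%z. K (fst z, y + (fst z $ i0) *\<^sub>R e1)) (%z. Kx (fst z, y + (fst z $ i0) *\<^sub>R e1) + Ky (fst z, y + (fst z $ i0) *\<^sub>R e1))" if "y : Yc" for y
   by (rule hpd_affine[OF d']) (use True in \<open>simp_all add: shift_Qz that axis_nth scaleR_left_distrib add_ac\<close>)
  show "hpd Q (dx i) (%z. m (y + (fst z $ i0) *\<^sub>R e1, snd z)) (%z. m1 (y + (fst z $ i0) *\<^sub>R e1, snd z))" if "y : Yc" for y
   by (rule hpd_affine[OF m(3)]) (use True in \<open>simp_all add: shift_Qz that axis_nth scaleR_left_distrib add_ac, simp add: dx_def\<close>)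
 qed (use K m in \<open>auto intro!: continuous_intros\<close>)
 then show ?thesis
 proof (rule hpd_cong1)
  fix z assume z: "z : Q"
  note si = set_integrable_continuous_compact[OF slice_continuous[OF integrand3_cont _] hm_facts, of _ _ z]
  show "G3 (%p. Kx p + Ky p) m z + G3 K m1 z = G3 Kx m z + (if i = i0 then G3 Ky m z + G3 K m1 z else 0)"
   using set_integral_add(2)[OF si[OF K(2) m(1) z] si[OF K(3) m(1) z]] True by (simp add: G3_def distrib_right)
 qed
qed

lemma G3_R0:
 assumes "continuous_on Ob K" "!!p. p : Ob ==> |K p| <= M" "R0 B m" "M >= 0" "B >= 0"
 shows "R0 (M * B * m') (G3 K m)"
proof -
 have "|G3 K m z| <= M * B * measure hm Om'" if z: "z : Q" for z
  unfolding G3_def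
 proof (rule set_integral_bound)
  fix y assume "y : Om'"
  then have y: "y : Yc" using Om'_Yc by auto
  show "|K (fst z, y + fst z $ i0 *\<^sub>R e1) * m (y + fst z $ i0 *\<^sub>R e1, snd z)| <= M * B"
   unfolding abs_mult using assms(2)[OF shift_Q(2)[OF z y Q_coord(1)[OF z] Q_coord(2)[OF z]]]
    shift_Q(1)[OF z y Q_coord(1)[OF z] Q_coord(2)[OF z]] assms(3-5)
   by (intro mult_mono) (auto simp: R0_def)
 qed (use assms Om'_finite in auto)
 then show ?thesis using G3_cont[OF assms(1)] assms(3) by (auto simp: R0_def m'_def)
qed

lemma axis_Basis_Ob [simp]: "(axis i (1::real), 0 :: real^'n) : Basis" "(0 :: real^'n, axis i (1::real)) : Basis"
 unfolding Basis_prod_def by (intro UnI1 imageI UnI2; simp add: axis_in_Basis_iff)+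

text \<open>A space derivative of \<open>G3\<close> is a sum of at most three terms of the same
  kind, in which either the kernel or \<open>m\<close> has been differentiated once; so the bound
  follows by induction on the order.\<close>

lemma G3_R: "0 <= M ==> EX B'. ALL K m. KR n M K & R n M m --> R n B' (G3 K m)"
proof (induction n)
 case 0 then show ?case using G3_R0 by (intro exI[of _ "M * M * m'"]) auto
next
 case (Suc n)
 then obtain B' where B': "!!K m. KR n M K ==> R n M m ==> R n B' (G3 K m)" by blast
 define B'' where "B'' = max (M * M * m') ( |B'| + ( |B'| + |B'| ))"
 show ?case
 proof (intro exI[of _ B''] allI impI, elim conjE)
  fix K m assume K: "KR (Suc n) M K" and m: "R (Suc n) M m"
  have "R0 B'' (G3 K m)"
  proof -
   have "R0 (M * M * m') (G3 K m)" using KR_0[OF K] R_R0[OF m] Suc.prems by (intro G3_R0) auto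
   then show ?thesis using R_mono[of 0 _ _ B''] by (simp add: B''_def)
  qed
  moreover have "EX h. hpd Q (dx i) (G3 K m) h & R n B'' h" for i
  proof -
   have "EX Kx. hpd Ob (axis i 1, 0) K Kx & KR n M Kx" "EX Ky. hpd Ob (0, e1) K Ky & KR n M Ky"
    using K unfolding KR.simps using axis_Basis_Ob by blast+
   then obtain Kx Ky where Kx: "hpd Ob (axis i 1, 0) K Kx" "KR n M Kx" and Ky: "hpd Ob (0, e1) K Ky" "KR n M Ky" by blast
   obtain m1 where m1: "hpd Q (dx i0) m m1" "R n M m1" using m by (metis R.simps(2))
   have h: "hpd Q (dx i) (G3 K m) (%z. G3 Kx m z + (if i = i0 then G3 Ky m z + G3 K m1 z else 0))"
    using KR_0[OF K] KR_0[OF Kx(2)] KR_0[OF Ky(2)] R_R0[OF m] R_R0[OF m1(2)]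
    by (intro G3_dx Kx Ky m1) (auto simp: R0_def)
   have r: "R n |B'| (G3 Kx m)" "R n |B'| (G3 Ky m)" "R n |B'| (G3 K m1)"
    by (rule R_mono[OF B']; use Kx Ky m1 KR_Suc[OF K] R_Suc[OF m] in simp)+
   have "R n B'' (%z. G3 Kx m z + (if i = i0 then G3 Ky m z + G3 K m1 z else 0))"
   proof (cases "i = i0")
    case True
    have "R n ( |B'| + ( |B'| + |B'| )) (%z. G3 Kx m z + (G3 Ky m z + G3 K m1 z))" by (intro R_add r)
    then show ?thesis using True R_mono[of n _ _ B''] by (simp add: B''_def)
   next
    case False
    then show ?thesis using R_mono[OF r(1), of B''] by (simp add: B''_def)
   qed
   then show ?thesis using h by blast
  qed
  ultimately show "R (Suc n) B'' (G3 K m)" by simp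
 qed
qed

end

text \<open>A parameter that is constant along \<open>v\<close> may be frozen. It is applied to the
  lower limit x1 of \<open>G2\<close>, for derivatives in time and in the other coordinates.\<close>

lemma hpd_frozen:
 assumes "!!c. c : C ==> hpd S v (f c) (f' c)" "!!z. z : S ==> gam z : C"
  "!!z h. z : S ==> z + h *\<^sub>R v : S ==> gam (z + h *\<^sub>R v) = gam z"
 shows "hpd S v (%z. f (gam z) z) (%z. f' (gam z) z)"
 unfolding hpd_def
proof
 fix z assume z: "z : S"
 show "((%h. f (gam (z + h *\<^sub>R v)) (z + h *\<^sub>R v)) has_real_derivative f' (gam z) z) (at_line S v z)"
  using hpdD[OF assms(1)[OF assms(2)[OF z]] z]
  by (rule has_field_derivative_transform_within[where d=1]) (use z assms(3) in auto)
qed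

lemma hpd_real:
 fixes F :: "real => real"
 assumes "!!c. c : S ==> (F has_real_derivative f' c) (at c within S)" "c : S"
 shows "((%h. F (c + h)) has_real_derivative f' c) (at 0 within {h. c + h : S})"
proof -
 have "(+) c ` {h. c + h : S} = S" by (auto simp: image_iff) (metis add.commute diff_add_cancel)
 then show ?thesis using assms DERIV_at_within_shift[of F "f' c" c 0 "{h. c + h : S}"] by simp
qed

context space_time_box
begin

abbreviation "a1 \<equiv> A $ i0"

definition I1 where "I1 = {- a1..a1}"

lemma I1_props [simp]: "compact I1" "I1 : sets borel" "r : I1 \<longleftrightarrow> - a1 <= r & r <= a1"
 by (auto simp: I1_def)

lemma coord_I1: "z : Q ==> fst z $ i0 : I1"
 by (simp add: Q_coord)

lemma Hr_integrand_cont: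
 fixes K :: "(real^'n) \<times> (real^'n) => real" and m :: "(real^'n) \<times> real => real"
 assumes "continuous_on Ob K" "continuous_on Q m"
 shows "continuous_on ((Q \<times> I1) \<times> Yc)
  (%q. K (fst (fst (fst q)), snd q + snd (fst q) *\<^sub>R e1) * m (snd q + snd (fst q) *\<^sub>R e1, snd (fst (fst q))))"
proof (intro continuous_on_mult)
 show "continuous_on ((Q \<times> I1) \<times> Yc) (%q. K (fst (fst (fst q)), snd q + snd (fst q) *\<^sub>R e1))"
  by (rule continuous_on_compose2[OF assms(1)]) (auto intro!: continuous_intros shift_Q(2)[of "(_, _)", simplified])
 show "continuous_on ((Q \<times> I1) \<times> Yc) (%q. m (snd q + snd (fst q) *\<^sub>R e1, snd (fst (fst q))))"
  by (rule continuous_on_compose2[OF assms(2)]) (auto intro!: continuous_intros shift_Q(1)[of "(_, _)", simplified])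
qed

lemma Hr_cont:
 assumes "continuous_on Ob K" "continuous_on Q m"
 shows "continuous_on (Q \<times> I1) (Hr K m)"
 using param_continuous[OF Hr_integrand_cont[OF assms] compact_Times[OF compact_Q I1_props(1)] hm_facts]
 by (simp add: Hr_def[abs_def])

lemma Hr_slice:
 assumes "continuous_on Ob K" "continuous_on Q m" "z : Q"
 shows "continuous_on I1 (%r. Hr K m (z, r))"
 by (rule slice_continuous[OF Hr_cont[OF assms(1,2)] assms(3)])

lemma G3_eq_Hr: "G3 K m z = Hr K m (z, fst z $ i0)"
 by (simp add: G3_def Hr_def)

lemma Hr_hpd:
 fixes K K' :: "(real^'n) \<times> (real^'n) => real" and m md :: "(real^'n) \<times> real => real"
 assumes K: "continuous_on Ob K" "continuous_on Ob K'" and m: "continuous_on Q m" "continuous_on Q md"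
  and dK: "!!y. y : Yc ==> hpd Q v (%z. K (fst z, y + r *\<^sub>R e1)) (%z. K' (fst z, y + r *\<^sub>R e1))"
  and dm: "!!y. y : Yc ==> hpd Q v (%z. m (y + r *\<^sub>R e1, snd z)) (%z. md (y + r *\<^sub>R e1, snd z))"
  and v: "v : Basis" and r: "r : I1"
 shows "hpd Q v (%z. Hr K m (z, r)) (%z. Hr K' m (z, r) + Hr K md (z, r))"
proof -
 have sl: "continuous_on (Q \<times> Yc) (%p. K (fst (fst p), snd p + r *\<^sub>R e1) * m (snd p + r *\<^sub>R e1, snd (fst p)))"
  if "continuous_on Ob K" "continuous_on Q m" for K :: "(real^'n) \<times> (real^'n) => real" and m :: "(real^'n) \<times> real => real"
  by (rule continuous_on_compose2[OF Hr_integrand_cont[OF that], of "Q \<times> Yc" "%p. ((fst p, r), snd p)", simplified])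
   (use r in \<open>auto intro!: continuous_intros\<close>)
 have c: "continuous_on (Q \<times> Yc) (%p. K' (fst (fst p), snd p + r *\<^sub>R e1) * m (snd p + r *\<^sub>R e1, snd (fst p))
    + K (fst (fst p), snd p + r *\<^sub>R e1) * md (snd p + r *\<^sub>R e1, snd (fst p)))"
  by (intro continuous_on_add sl K m)
 have "hpd Q v (%z. Hr K m (z, r)) (%z. LINT y:Om'|hm. K' (fst z, y + r *\<^sub>R e1) * m (y + r *\<^sub>R e1, snd z)
    + K (fst z, y + r *\<^sub>R e1) * md (y + r *\<^sub>R e1, snd z))"
  unfolding Hr_def[abs_def]
  using param_hpd[OF sl[OF K(1) m(1), unfolded Q_def] c[unfolded Q_def] compact_Yc _ v Om'_borel(2) Om'_Yc sets_hyperplane_measure Om'_finite]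
   hpd_mult[OF dK dm] by (simp add: Q_def)
 then show ?thesis
 proof (rule hpd_cong1)
  fix z assume z: "z : Q"
  note si = set_integrable_continuous_compact[OF slice_continuous[OF sl _] hm_facts, of _ _ z]
  show "(LINT y:Om'|hm. K' (fst z, y + r *\<^sub>R e1) * m (y + r *\<^sub>R e1, snd z)
    + K (fst z, y + r *\<^sub>R e1) * md (y + r *\<^sub>R e1, snd z)) = Hr K' m (z, r) + Hr K md (z, r)"
   using set_integral_add(2)[OF si[OF K(2) m(1) z] si[OF K(1) m(2) z]] by (simp add: Hr_def)
 qed
qed

lemma Hr_zero [simp]: "Hr (%_. 0) m p = 0" "Hr K (%_. 0) p = 0"
 by (simp_all add: Hr_def)

lemma Hr_dt:
 assumes "continuous_on Ob K" "continuous_on Q m" "continuous_on Q mt" "hpd Q dt m mt" "r : I1"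
 shows "hpd Q dt (%z. Hr K m (z, r)) (%z. Hr K mt (z, r))"
proof -
 have "hpd Q dt (%z. Hr K m (z, r)) (%z. Hr (%_. 0) m (z, r) + Hr K mt (z, r))"
 proof (rule Hr_hpd)
  show "hpd Q dt (%z. K (fst z, y + r *\<^sub>R e1)) (%z. 0)" for y
   by (rule hpd_trivial) simp
  show "hpd Q dt (%z. m (y + r *\<^sub>R e1, snd z)) (%z. mt (y + r *\<^sub>R e1, snd z))" if "y : Yc" for y
   by (rule hpd_affine[OF assms(4)]) (use assms(5) in \<open>simp_all add: shift_Q that\<close>, simp add: dt_def)
 qed (use assms in auto)
 then show ?thesis by simp
qed

lemma Hr_dx:
 assumes "continuous_on Ob K" "continuous_on Ob Kx" "continuous_on Q m" "hpd Ob (axis i 1, 0) K Kx" "r : I1"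
 shows "hpd Q (dx i) (%z. Hr K m (z, r)) (%z. Hr Kx m (z, r))"
proof -
 have "hpd Q (dx i) (%z. Hr K m (z, r)) (%z. Hr Kx m (z, r) + Hr K (%_. 0) (z, r))"
 proof (rule Hr_hpd)
  show "hpd Q (dx i) (%z. K (fst z, y + r *\<^sub>R e1)) (%z. Kx (fst z, y + r *\<^sub>R e1))" if "y : Yc" for y
   by (rule hpd_affine[OF assms(4)]) (use assms(5) in \<open>simp_all add: shift_Q that\<close>)
  show "hpd Q (dx i) (%z. m (y + r *\<^sub>R e1, snd z)) (%z. 0)" for y
   by (rule hpd_trivial) simp
 qed (use assms in auto)
 then show ?thesis by simp
qed

lemma lborel_Icc_facts: "c : I1 ==> {c..a1} : sets lborel" "c : I1 ==> {c..a1} \<subseteq> I1"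
 "c : I1 ==> sets lborel = sets borel" "c : I1 ==> emeasure lborel {c..a1} < \<infinity>"
 by (auto simp: emeasure_lborel_Icc_eq)

lemma lint_Icc:
 assumes "continuous_on I1 f" "c : I1"
 shows "(LINT r:{c..a1}|lborel. f r) = integral {c..a1} (f :: real => real)"
 by (rule set_borel_integral_eq_integral(2)[OF set_integrable_continuous_compact[OF assms(1) I1_props(1) lborel_Icc_facts[OF assms(2)]]])

text \<open>The domain of integration varies with x1. Integrating \<open>Hr\<close> at the larger of
  r and x1 over the fixed interval from -A1 to A1 adds exactly x1 + A1 times \<open>G3\<close>,
  which is continuous and is subtracted.\<close>

lemma G2_cont:
 assumes K: "continuous_on Ob K" and m: "continuous_on Q m"
 shows "continuous_on Q (G2 K m)"
proof -
 have c: "continuous_on (Q \<times> I1) (%p. Hr K m (fst p, max (snd p) (fst (fst p) $ i0)))"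
  by (rule continuous_on_compose2[OF Hr_cont[OF assms]])
   (auto intro!: continuous_intros simp: Q_coord[of "(_, _)", simplified] le_max_iff_disj)
 have mI: "- a1 : I1" using A_pos[of i0] by simp
 have c1: "continuous_on Q (%z. LINT r:{- a1..a1}|lborel. Hr K m (z, max r (fst z $ i0)))"
  using param_continuous[OF c compact_Q I1_props(1) lborel_Icc_facts[OF mI]] by simp
 have "continuous_on Q (%z. (LINT r:{- a1..a1}|lborel. Hr K m (z, max r (fst z $ i0))) - (fst z $ i0 + a1) * G3 K m z)"
  by (intro continuous_intros c1 G3_cont assms)
 then show ?thesis
 proof (rule continuous_on_cong[THEN iffD1, rotated 2])
  fix z assume z: "z : Q"
  define s where "s = fst z $ i0"
  have s: "s : I1" using coord_I1[OF z] by (simp add: s_def)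
  have cs: "continuous_on I1 (%r. Hr K m (z, max r s))"
   by (rule continuous_on_compose2[OF Hr_slice[OF assms z]]) (use s in \<open>auto intro!: continuous_intros simp: le_max_iff_disj\<close>)
  have "(LINT r:{- a1..a1}|lborel. Hr K m (z, max r s)) = integral {- a1..a1} (%r. Hr K m (z, max r s))"
   by (rule lint_Icc[OF cs mI])
  also have "... = integral {- a1..s} (%r. Hr K m (z, max r s)) + integral {s..a1} (%r. Hr K m (z, max r s))"
   by (rule Henstock_Kurzweil_Integration.integral_combine[symmetric])
    (use s cs in \<open>auto intro!: integrable_continuous_interval simp: I1_def\<close>)
  also have "integral {- a1..s} (%r. Hr K m (z, max r s)) = integral {- a1..s} (%r. Hr K m (z, s))"
   by (rule integral_cong) (simp add: max_def)
  also have "... = (s + a1) * Hr K m (z, s)" using s by simp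
  also have "integral {s..a1} (%r. Hr K m (z, max r s)) = integral {s..a1} (%r. Hr K m (z, r))"
   by (rule integral_cong) (metis atLeastAtMost_iff max.absorb1)
  also have "... = G2 K m z" unfolding G2_def s_def[symmetric] by (rule lint_Icc[OF Hr_slice[OF assms z] s, symmetric])
  finally show "(LINT r:{- a1..a1}|lborel. Hr K m (z, max r (fst z $ i0))) - (fst z $ i0 + a1) * G3 K m z = G2 K m z"
   by (simp add: s_def G3_eq_Hr)
 qed simp
qed

lemma tail_hpd:
 assumes "continuous_on (Q \<times> I1) H" "continuous_on (Q \<times> I1) H'" "!!r. r : I1 ==> hpd Q v (%z. H (z, r)) (%z. H' (z, r))"
  "v : Basis" "c : I1"
 shows "hpd Q v (%z. LINT r:{c..a1}|lborel. H (z, r)) (%z. LINT r:{c..a1}|lborel. H' (z, r) :: real)"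
 using param_hpd[OF assms(1,2)[unfolded Q_def] I1_props(1) assms(3)[unfolded Q_def] assms(4) lborel_Icc_facts[OF assms(5)]]
 by (simp add: Q_def)

lemma G2_dt:
 assumes "continuous_on Ob K" "continuous_on Q m" "continuous_on Q mt" "hpd Q dt m mt"
 shows "hpd Q dt (G2 K m) (G2 K mt)"
proof -
 have t: "hpd Q dt (%z. LINT r:{c..a1}|lborel. Hr K m (z, r)) (%z. LINT r:{c..a1}|lborel. Hr K mt (z, r))" if "c : I1" for c
  by (rule tail_hpd) (use assms that in \<open>auto intro!: Hr_cont Hr_dt\<close>)
 show ?thesis
  unfolding G2_def[abs_def]
  using hpd_frozen[where C=I1 and gam="%z. fst z $ i0", OF t coord_I1] by simp
qed

text \<open>For \<open>i = i0\<close> the coordinate x1 is a parameter of the integrand as well as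
  the lower limit. The limit is made an independent variable, on the box \<open>QI\<close>, and the
  resulting function \<open>H\<close> is differentiated along a diagonal.\<close>

lemma G2_dx:
 assumes K: "continuous_on Ob K" "continuous_on Ob Kx" and m: "continuous_on Q m" and d: "hpd Ob (axis i 1, 0) K Kx"
 shows "hpd Q (dx i) (G2 K m) (%z. G2 Kx m z + (if i = i0 then - G3 K m z else 0))"
proof -
 have t: "hpd Q (dx i) (%z. LINT r:{c..a1}|lborel. Hr K m (z, r)) (%z. LINT r:{c..a1}|lborel. Hr Kx m (z, r))" if "c : I1" for c
  by (rule tail_hpd) (use K m d that in \<open>auto intro!: Hr_cont Hr_dx\<close>)
 show ?thesis
 proof (cases "i = i0")
  case False
  have "hpd Q (dx i) (G2 K m) (G2 Kx m)"
   unfolding G2_def[abs_def]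
   using hpd_frozen[where C=I1 and gam="%z. fst z $ i0", OF t coord_I1] False by (simp add: axis_other)
  then show ?thesis using False by simp
 next
  case True
  define QI where "QI = cbox ((- A, 0::real), - a1) ((A, T), a1)"
  have QI: "p : QI \<longleftrightarrow> fst p : Q & snd p : I1" for p
   by (cases p) (auto simp: QI_def Q_def cbox_Pair_eq)
  define H where "H p = (LINT r:{snd p..a1}|lborel. Hr K m (fst p, r))" for p
  have h1: "hpd QI (0, 1) H (%p. - Hr K m p)"
   unfolding hpd_def
  proof
   fix p assume p: "p : QI"
   define f where "f r = Hr K m (fst p, r)" for r
   have f: "continuous_on I1 f" unfolding f_def by (rule Hr_slice) (use K m p QI in auto)
   have D: "((%c. integral {c..a1} f) has_real_derivative - f c) (at c within I1)" if c: "c : I1" for c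
   proof -
    have "((%u. integral {- a1..u} f) has_real_derivative f c) (at c within I1)"
     using integral_has_real_derivative[of "- a1" a1 f c] f c by (simp add: I1_def)
    then have "((%u. integral {- a1..a1} f - integral {- a1..u} f) has_real_derivative 0 - f c) (at c within I1)"
     by (intro DERIV_diff) auto
    then have "((%u. integral {u..a1} f) has_real_derivative 0 - f c) (at c within I1)"
    proof (rule has_field_derivative_transform_within[where d=1])
     fix u assume u: "u : I1"
     show "integral {- a1..a1} f - integral {- a1..u} f = integral {u..a1} f"
      using Henstock_Kurzweil_Integration.integral_combine[of "- a1" u a1 f] u f
      by (simp add: integrable_continuous_interval I1_def)
    qed (use c in auto)
    then show ?thesis by simp
   qed
   have "((%h. integral {snd p + h..a1} f) has_real_derivative - f (snd p)) (at 0 within {h. snd p + h : I1})"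
    by (rule hpd_real[OF D]) (use p QI in auto)
   then have "((%h. H (p + h *\<^sub>R (0, 1))) has_real_derivative - f (snd p)) (at 0 within {h. snd p + h : I1})"
   proof (rule has_field_derivative_transform_within[where d=1])
    fix h assume "h : {h. snd p + h : I1}"
    then have h: "snd p + h : I1" by blast
    show "integral {snd p + h..a1} f = H (p + h *\<^sub>R (0, 1))"
     using lint_Icc[OF f h] by (simp add: H_def f_def)
   qed (use p QI in auto)
   moreover have "{h. p + h *\<^sub>R (0, 1) : QI} = {h. snd p + h : I1}" using p unfolding QI by simp
   ultimately show "((%h. H (p + h *\<^sub>R (0, 1))) has_real_derivative - Hr K m p) (at 0 within {h. p + h *\<^sub>R (0, 1) : QI})"
    by (simp add: f_def)
  qed
  have h2: "hpd QI (dx i, 0) H (%p. LINT r:{snd p..a1}|lborel. Hr Kx m (fst p, r))"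
  proof -
   have t': "hpd QI (dx i, 0) (%p. LINT r:{c..a1}|lborel. Hr K m (fst p, r)) (%p. LINT r:{c..a1}|lborel. Hr Kx m (fst p, r))" if "c : I1" for c
    by (rule hpd_affine[OF t[OF that]]) (auto simp: QI)
   show ?thesis unfolding H_def
    using hpd_frozen[where C=I1 and gam="snd", OF t'] by (simp add: QI)
  qed
  have b: "((0, 1) :: ((real^'n) \<times> real) \<times> real) : Basis" "(dx i, 0::real) : Basis"
   by (subst Basis_prod_def, rule UnI2, simp) (subst Basis_prod_def, rule UnI1, rule imageI, rule dx_Basis)
  have "hpd QI ((0, 1) + (dx i, 0)) H (%p. - Hr K m p + (LINT r:{snd p..a1}|lborel. Hr Kx m (fst p, r)))"
   unfolding QI_def
  proof (rule hpd_add_direction[OF h1[unfolded QI_def] h2[unfolded QI_def] b])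
   have "continuous_on QI (Hr K m)"
    by (rule continuous_on_subset[OF Hr_cont[OF K(1) m]]) (auto simp: QI)
   then show "continuous_on (cbox ((- A, 0), - a1) ((A, T), a1)) (%p. - Hr K m p)"
    unfolding QI_def by (intro continuous_intros)
  qed simp
  then have "hpd QI (dx i, 1) H (%p. - Hr K m p + (LINT r:{snd p..a1}|lborel. Hr Kx m (fst p, r)))" by simp
  from hpd_affine[OF this, of Q "%z. (z, fst z $ i0)" "dx i"]
  have "hpd Q (dx i) (%z. H (z, fst z $ i0)) (%z. - Hr K m (z, fst z $ i0) + (LINT r:{fst z $ i0..a1}|lborel. Hr Kx m (z, r)))"
   using True coord_I1 by (simp add: QI axis_nth)
  then show ?thesis
   by (rule hpd_cong) (simp_all add: H_def G2_def G3_eq_Hr True)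
 qed
qed

lemma G2_R0:
 assumes K: "continuous_on Ob K" "!!p. p : Ob ==> |K p| <= M" "R0 B m" "M >= 0" "B >= 0"
 shows "R0 (M * B * m' * (2 * a1)) (G2 K m)"
proof -
 have Hb: "|Hr K m (z, r)| <= M * B * m'" if z: "z : Q" and r: "r : I1" for z r
  unfolding Hr_def m'_def
 proof (rule set_integral_bound)
  fix y assume "y : Om'"
  then have y: "y : Yc" using Om'_Yc by auto
  show "|K (fst (fst (z, r)), y + snd (z, r) *\<^sub>R e1) * m (y + snd (z, r) *\<^sub>R e1, snd (fst (z, r)))| <= M * B"
   unfolding abs_mult using K(2)[OF shift_Q(2)[OF z y]] shift_Q(1)[OF z y] assms(3-5) r
   by (intro mult_mono) (auto simp: R0_def)
 qed (use assms Om'_finite in auto)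
 have "|G2 K m z| <= M * B * m' * (2 * a1)" if z: "z : Q" for z
 proof -
  define s where "s = fst z $ i0"
  have s: "s : I1" using coord_I1[OF z] by (simp add: s_def)
  have "|G2 K m z| <= M * B * m' * measure lborel {s..a1}"
   unfolding G2_def s_def[symmetric]
   by (rule set_integral_bound) (use Hb[OF z] s assms lborel_Icc_facts[OF s] in auto)
  also have "... <= M * B * m' * (2 * a1)" using s assms by (intro mult_left_mono) auto
  finally show ?thesis .
 qed
 then show ?thesis using G2_cont[OF K(1)] assms(3) by (auto simp: R0_def)
qed

lemma G2_R: assumes M: "0 <= M" shows "EX B'. ALL K m. KR n M K & R n M m --> R n B' (G2 K m)"
proof (induction n)
 case 0 then show ?case using G2_R0 M by (intro exI[of _ "M * M * m' * (2 * a1)"]) auto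
next
 case (Suc n)
 then obtain B' where B': "!!K m. KR n M K ==> R n M m ==> R n B' (G2 K m)" by blast
 obtain B3 where B3: "!!K m. KR n M K ==> R n M m ==> R n B3 (G3 K m)" using G3_R[OF M, of n] by blast
 define B'' where "B'' = max (M * M * m' * (2 * a1)) ( |B'| + |B3| )"
 show ?case
 proof (intro exI[of _ B''] allI impI, elim conjE)
  fix K m assume K: "KR (Suc n) M K" and m: "R (Suc n) M m"
  have "R0 B'' (G2 K m)"
  proof -
   have "R0 (M * M * m' * (2 * a1)) (G2 K m)" using KR_0[OF K] R_R0[OF m] M by (intro G2_R0) auto
   then show ?thesis using R_mono[of 0 _ _ B''] by (simp add: B''_def)
  qed
  moreover have "EX h. hpd Q (dx i) (G2 K m) h & R n B'' h" for i
  proof -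
   have "EX Kx. hpd Ob (axis i 1, 0) K Kx & KR n M Kx" using K unfolding KR.simps using axis_Basis_Ob by blast
   then obtain Kx where Kx: "hpd Ob (axis i 1, 0) K Kx" "KR n M Kx" by blast
   have h: "hpd Q (dx i) (G2 K m) (%z. G2 Kx m z + (if i = i0 then - G3 K m z else 0))"
    using KR_0[OF K] KR_0[OF Kx(2)] R_R0[OF m] by (intro G2_dx Kx) (auto simp: R0_def)
   have r1: "R n |B'| (G2 Kx m)" by (rule R_mono[OF B'[OF Kx(2) R_Suc[OF m]]]) simp
   have r2: "R n |B3| (%z. - G3 K m z)" by (rule R_minus[OF R_mono[OF B3[OF KR_Suc[OF K] R_Suc[OF m]]]]) simp
   have "R n B'' (%z. G2 Kx m z + (if i = i0 then - G3 K m z else 0))"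
   proof (cases "i = i0")
    case True
    then show ?thesis using R_mono[OF R_add[OF r1 r2], of B''] by (simp add: B''_def)
   next
    case False
    then show ?thesis using R_mono[OF r1, of B''] by (simp add: B''_def)
   qed
   then show ?thesis using h by blast
  qed
  ultimately show "R (Suc n) B'' (G2 K m)" by simp
 qed
qed

section \<open>Weighted bounds for the interaction term\<close>

lemma en_slices:
 assumes f: "continuous_on Q f"
 shows "en mu f = integral {0..T} (%t. integral Oc (%x. (E mu (x, t))^2 * (f (x, t))^2))"
  and "continuous_on {0..T} (%t. integral Oc (%x. (E mu (x, t))^2 * (f (x, t))^2))"
proof -
 have c: "continuous_on Q (%z. (E mu z)^2 * (f z)^2)" by (intro continuous_intros f)
 then have c': "continuous_on (cbox (- A, 0) (A, T)) (%(x, t). (E mu (x, t))^2 * (f (x, t))^2)"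
  by (simp add: Q_def case_prod_beta')
 show "en mu f = integral {0..T} (%t. integral Oc (%x. (E mu (x, t))^2 * (f (x, t))^2))"
  using integral_prod_continuous[OF c[unfolded Q_def]] integral_swap_continuous[OF c']
  unfolding en_def Q_def Oc_def by simp
 have sw: "continuous_on ({0..T} \<times> cbox (- A) A) (%(t, x). (E mu (x, t))^2 * (f (x, t))^2)"
 proof -
  have "(%p. (snd p, fst p)) ` ({0..T} \<times> cbox (- A) A) \<subseteq> Q" by (auto simp: Q_Times)
  then have "continuous_on ({0..T} \<times> cbox (- A) A) (%p. (E mu (snd p, fst p))^2 * (f (snd p, fst p))^2)"
   by (intro continuous_on_compose2[OF c, of _ "%p. (snd p, fst p)"] continuous_on_Pair continuous_on_fst continuous_on_snd continuous_on_id)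
  then show ?thesis by (simp add: case_prod_beta')
 qed
 show "continuous_on {0..T} (%t. integral Oc (%x. (E mu (x, t))^2 * (f (x, t))^2))"
  unfolding Oc_def by (rule integral_continuous_on_param[OF sw])
qed

definition es where "es mu r = (exp (mu * (r + a1 + 1)^2))^2"

lemma es_E: "(E mu z)^2 = es mu (fst z $ i0)"
 by (simp add: es_def E_def yw_def)

lemma es_pos [simp]: "es mu r >= 0"
 by (simp add: es_def)

lemma es_mono: "mu >= 0 ==> - a1 <= r ==> r <= r' ==> es mu r <= es mu r'"
 unfolding es_def by (intro power_mono) (auto intro!: mult_left_mono power_mono)

lemma continuous_on_es [continuous_intros]: "continuous_on S f ==> continuous_on S (%x. es mu (f x))"
 unfolding es_def by (intro continuous_intros)

text \<open>By Cauchy-Schwarz on a slice, \<open>Hr\<close> squared is bounded by a multiple of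
  \<open>J\<close>, the squared norm of \<open>w\<close> on that slice, and the weight is constant
  on slices. The constant does not depend on \<open>mu\<close> because weights are compared with
  each other and never estimated.\<close>

lemma en_interaction:
 assumes M: "M >= 0"
 shows "EX C>=0. ALL mu>=0. ALL K K' w. continuous_on Ob K & continuous_on Ob K' & (ALL p:Ob. |K p| <= M & |K' p| <= M) & continuous_on Q w
  --> en mu (%z. G3 K w z + G2 K' w z) <= C * en mu w"
proof -
 \<comment> \<open>In both constants \<open>m' * M^2\<close> comes from Cauchy-Schwarz on a slice.
   The other measure is that of the set over which a constant is integrated, and
   \<open>2 * a1\<close> comes from Cauchy-Schwarz in \<open>r\<close>.\<close>
 define C3 where "C3 = m' * M^2 * m'"
 define C2 where "C2 = 2 * a1 * (m' * M^2) * measure lborel Oc"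
 have a: "a1 > 0" by (rule A_pos)
 have C: "C3 >= 0" "C2 >= 0" unfolding C3_def C2_def using a by auto
 show ?thesis
 proof (intro exI[of _ "2 * (C3 + C2)"] conjI allI impI, use C in simp, elim conjE)
  fix mu :: real and K K' :: "(real^'n) \<times> (real^'n) => real" and w :: "(real^'n) \<times> real => real"
  assume mu: "mu >= 0" and K: "continuous_on Ob K" "continuous_on Ob K'" and bK: "ALL p:Ob. |K p| <= M & |K' p| <= M"
   and w: "continuous_on Q w"
  define J where "J r t = (LINT y:Om'|hm. (w (y + r *\<^sub>R e1, t))^2)" for r t
  define N where "N t = integral Oc (%x. es mu (x $ i0) * (w (x, t))^2)" for t
  have wt: "continuous_on Oc (%x. w (x, t))" if "t : {0..T}" for t
   by (rule continuous_on_compose2[OF w]) (use that in \<open>auto intro!: continuous_intros simp: Q_Times'\<close>)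
  have wy: "continuous_on Yc (%y. w (y + r *\<^sub>R e1, t))" if "t : {0..T}" "r : I1" for r t
   by (rule continuous_on_compose2[OF wt[OF that(1)]]) (use that in \<open>auto intro!: continuous_intros shift_Oc\<close>)
  have Jc: "continuous_on I1 (%r. J r t)" if t: "t : {0..T}" for t
   using integral_Oc(2)[of "%x. (w (x, t))^2"] wt[OF t] by (simp add: J_def I1_def continuous_intros)
  have J0: "J r t >= 0" for r t
   unfolding J_def set_lebesgue_integral_def by (intro integral_nonneg_AE) auto
  have idx: "(y + r *\<^sub>R e1) $ i0 = r" if "y : Om'" for y r using that by (simp add: mem_Om' axis_nth)
  have Neq: "N t = integral I1 (%r. es mu r * J r t)" if t: "t : {0..T}" for t
  proof -
   have "N t = integral I1 (%r. LINT y:Om'|hm. es mu ((y + r *\<^sub>R e1) $ i0) * (w (y + r *\<^sub>R e1, t))^2)"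
    unfolding N_def I1_def by (rule integral_Oc(1)) (intro continuous_intros wt[OF t])
   also have "... = integral I1 (%r. es mu r * J r t)"
   proof (rule integral_cong)
    fix r
    have "(LINT y:Om'|hm. es mu ((y + r *\<^sub>R e1) $ i0) * (w (y + r *\<^sub>R e1, t))^2) = (LINT y:Om'|hm. es mu r * (w (y + r *\<^sub>R e1, t))^2)"
     by (rule set_lebesgue_integral_cong) (auto simp: mem_Om' axis_nth)
    then show "(LINT y:Om'|hm. es mu ((y + r *\<^sub>R e1) $ i0) * (w (y + r *\<^sub>R e1, t))^2) = es mu r * J r t"
     by (simp add: J_def)
   qed
   finally show ?thesis .
  qed
  have NJ: "integral Oc (%x. es mu (x $ i0) * J (x $ i0) t) = m' * N t" if t: "t : {0..T}" for t
  proof -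
   have cJ: "continuous_on Oc (%x. J (x $ i0) t)"
    by (rule continuous_on_compose2[OF Jc[OF t]]) (auto intro!: continuous_intros simp: mem_Oc)
   have "integral Oc (%x. es mu (x $ i0) * J (x $ i0) t) = integral I1 (%r. LINT y:Om'|hm. es mu ((y + r *\<^sub>R e1) $ i0) * J ((y + r *\<^sub>R e1) $ i0) t)"
    unfolding I1_def by (rule integral_Oc(1)) (intro continuous_intros cJ)
   also have "... = integral I1 (%r. m' * (es mu r * J r t))"
   proof (rule integral_cong)
    fix r
    have "(LINT y:Om'|hm. es mu ((y + r *\<^sub>R e1) $ i0) * J ((y + r *\<^sub>R e1) $ i0) t) = (LINT y:Om'|hm. es mu r * J r t)"
     by (rule set_lebesgue_integral_cong) (auto simp: mem_Om' axis_nth)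
    also have "... = m' * (es mu r * J r t)" using Om'_finite by (simp add: set_lebesgue_integral_def m'_def)
    finally show "(LINT y:Om'|hm. es mu ((y + r *\<^sub>R e1) $ i0) * J ((y + r *\<^sub>R e1) $ i0) t) = m' * (es mu r * J r t)" .
   qed
   also have "... = m' * N t" by (simp add: Neq[OF t])
   finally show ?thesis .
  qed
  have Hsq: "(Hr L w ((x, t), r))^2 <= m' * M^2 * J r t"
   if L: "continuous_on Ob L" "ALL p:Ob. |L p| <= M" and x: "x : Oc" and t: "t : {0..T}" and r: "r : I1" for L x t r
  proof -
   have cL: "continuous_on Yc (%y. L (x, y + r *\<^sub>R e1))"
    by (rule continuous_on_compose2[OF L(1)]) (use x r in \<open>auto intro!: continuous_intros shift_Oc simp: Ob_Times\<close>)
   have "(Hr L w ((x, t), r))^2 <= m' * (LINT y:Om'|hm. (L (x, y + r *\<^sub>R e1) * w (y + r *\<^sub>R e1, t))^2)"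
    unfolding Hr_def m'_def fst_conv snd_conv
    by (rule set_integral_Cauchy_Schwarz[OF _ hm_facts]) (intro continuous_intros cL wy[OF t r])
   also have "... <= m' * (LINT y:Om'|hm. M^2 * (w (y + r *\<^sub>R e1, t))^2)"
   proof (intro mult_left_mono set_integral_mono)
    show "set_integrable hm Om' (%y. (L (x, y + r *\<^sub>R e1) * w (y + r *\<^sub>R e1, t))^2)"
     "set_integrable hm Om' (%y. M^2 * (w (y + r *\<^sub>R e1, t))^2)"
     by (rule set_integrable_continuous_compact[OF _ hm_facts]; intro continuous_intros cL wy[OF t r])+
    fix y assume "y : Om'"
    then have "(x, y + r *\<^sub>R e1) : Ob" using Om'_Yc x r by (auto simp: Ob_Times intro!: shift_Oc)
    then have "(L (x, y + r *\<^sub>R e1))^2 <= M^2" using L(2) M by (metis abs_le_square_iff abs_of_nonneg)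
    then show "(L (x, y + r *\<^sub>R e1) * w (y + r *\<^sub>R e1, t))^2 <= M^2 * (w (y + r *\<^sub>R e1, t))^2"
     unfolding power_mult_distrib by (rule mult_right_mono) simp
   qed simp
   also have "... = m' * M^2 * J r t" by (simp add: J_def)
   finally show ?thesis .
  qed
  have Nnn: "N t >= 0" for t
  proof (cases "(%x. es mu (x $ i0) * (w (x, t))^2) integrable_on Oc")
   case True then show ?thesis unfolding N_def by (intro integral_nonneg) auto
  next
   case False then show ?thesis unfolding N_def by (simp add: not_integrable_integral)
  qed
  have sl: "continuous_on Oc (%x. f (x, t))" if "continuous_on Q f" "t : {0..T}" for f :: "(real^'n) \<times> real => real" and t
   by (rule continuous_on_compose2[OF that(1)]) (use that in \<open>auto intro!: continuous_intros simp: Q_Times'\<close>)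
  have final: "en mu f <= c * en mu w" if f: "continuous_on Q f"
   and b: "!!t. t : {0..T} ==> integral Oc (%x. es mu (x $ i0) * (f (x, t))^2) <= c * N t" for f c
  proof -
   have "en mu f <= integral {0..T} (%t. c * N t)"
    unfolding en_slices(1)[OF f]
    by (rule integral_le) (use b en_slices(2)[OF f] en_slices(2)[OF w] in \<open>auto simp: es_E N_def intro!: integrable_continuous_interval continuous_intros\<close>)
   also have "... = c * en mu w" unfolding en_slices(1)[OF w] by (simp add: es_E N_def)
   finally show ?thesis .
  qed
  have g3: "en mu (G3 K w) <= C3 * en mu w"
  proof (rule final[OF G3_cont[OF K(1) w]])
   fix t assume t: "t : {0..T}"
   have cJ: "continuous_on Oc (%x. J (x $ i0) t)"
    by (rule continuous_on_compose2[OF Jc[OF t]]) (auto intro!: continuous_intros simp: mem_Oc)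
   have "integral Oc (%x. es mu (x $ i0) * (G3 K w (x, t))^2) <= integral Oc (%x. (m' * M^2) * (es mu (x $ i0) * J (x $ i0) t))"
   proof (rule integral_le)
    fix x assume x: "x : Oc"
    have "(G3 K w (x, t))^2 <= m' * M^2 * J (x $ i0) t"
     unfolding G3_eq_Hr fst_conv by (rule Hsq) (use K bK x t in \<open>auto simp: mem_Oc\<close>)
    then have "es mu (x $ i0) * (G3 K w (x, t))^2 <= es mu (x $ i0) * (m' * M^2 * J (x $ i0) t)" by (rule mult_left_mono) simp
    then show "es mu (x $ i0) * (G3 K w (x, t))^2 <= (m' * M^2) * (es mu (x $ i0) * J (x $ i0) t)" by (simp add: mult_ac)
   qed (auto simp: Oc_def intro!: integrable_continuous continuous_intros cJ[unfolded Oc_def] sl[OF G3_cont[OF K(1) w] t, unfolded Oc_def])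
   also have "... = C3 * N t" using NJ[OF t] by (simp add: C3_def)
   finally show "integral Oc (%x. es mu (x $ i0) * (G3 K w (x, t))^2) <= C3 * N t" .
  qed
  have g2: "en mu (G2 K' w) <= C2 * en mu w"
  proof (rule final[OF G2_cont[OF K(2) w]])
   fix t assume t: "t : {0..T}"
   have "integral Oc (%x. es mu (x $ i0) * (G2 K' w (x, t))^2) <= integral Oc (%x. 2 * a1 * (m' * M^2) * N t)"
   proof (rule integral_le)
    fix x assume x: "x : Oc"
    have z: "(x, t) : Q" using x t by (simp add: Q_Times')
    define s where "s = x $ i0"
    have s: "s : I1" using x by (simp add: s_def mem_Oc)
    note hc = Hr_slice[OF K(2) w z]
    have sub: "{s..a1} \<subseteq> I1" using s by auto
    have ig: "f integrable_on {s..a1}" if "continuous_on I1 f" for f :: "real => real"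
     by (rule integrable_continuous_interval[OF continuous_on_subset[OF that sub]])
    have "(G2 K' w (x, t))^2 <= measure lborel {s..a1} * (LINT r:{s..a1}|lborel. (Hr K' w ((x, t), r))^2)"
     unfolding G2_def fst_conv s_def[symmetric]
     by (rule set_integral_Cauchy_Schwarz[OF hc I1_props(1) lborel_Icc_facts[OF s]])
    also have "(LINT r:{s..a1}|lborel. (Hr K' w ((x, t), r))^2) = integral {s..a1} (%r. (Hr K' w ((x, t), r))^2)"
     by (rule lint_Icc[OF _ s]) (intro continuous_intros hc)
    also have "measure lborel {s..a1} * ... <= (2 * a1) * integral {s..a1} (%r. (Hr K' w ((x, t), r))^2)"
     using s hc by (intro mult_right_mono integral_nonneg ig continuous_intros) auto
    also have "... <= (2 * a1) * integral {s..a1} (%r. m' * M^2 * J r t)"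
     using a sub by (intro mult_left_mono integral_le ig continuous_intros hc Jc[OF t] Hsq) (use K bK x t in auto)
    finally have "es mu s * (G2 K' w (x, t))^2 <= es mu s * ((2 * a1) * (m' * M^2 * integral {s..a1} (%r. J r t)))"
     by (intro mult_left_mono) auto
    also have "... = (2 * a1 * (m' * M^2)) * integral {s..a1} (%r. es mu s * J r t)" by simp
    \<comment> \<open>The only comparison of weights at different places: \<open>es\<close>
      increases with x1 and \<open>r\<close> is at least \<open>s\<close>.\<close>
    also have "... <= (2 * a1 * (m' * M^2)) * integral {s..a1} (%r. es mu r * J r t)"
     using a s mu by (intro mult_left_mono integral_le ig continuous_intros Jc[OF t] mult_right_mono es_mono J0) auto
    also have "... <= (2 * a1 * (m' * M^2)) * integral I1 (%r. es mu r * J r t)"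
    proof (intro mult_left_mono integral_subset_le sub ig continuous_intros Jc[OF t])
     show "(%r. es mu r * J r t) integrable_on I1"
      unfolding I1_def by (rule integrable_continuous_interval) (intro continuous_intros Jc[OF t, unfolded I1_def])
    qed (use a J0 in auto)
    finally show "es mu (x $ i0) * (G2 K' w (x, t))^2 <= 2 * a1 * (m' * M^2) * N t"
     by (simp add: Neq[OF t] s_def)
   qed (auto simp: Oc_def intro!: integrable_continuous continuous_intros sl[OF G2_cont[OF K(2) w] t, unfolded Oc_def])
   also have "... = C2 * N t" by (simp add: Oc_def C2_def)
   finally show "integral Oc (%x. es mu (x $ i0) * (G2 K' w (x, t))^2) <= C2 * N t" .
  qed
  have "en mu (%z. G3 K w z + G2 K' w z) <= 1^2 * real (length [G3 K w, G2 K' w]) * (\<Sum>g\<leftarrow>[G3 K w, G2 K' w]. en mu g)"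
   by (rule en_le_list) (auto intro!: continuous_intros G3_cont G2_cont K w)
  also have "... = 2 * (en mu (G3 K w) + en mu (G2 K' w))" by simp
  also have "... <= 2 * (C3 + C2) * en mu w" using g3 g2 by (simp add: distrib_right)
  finally show "en mu (%z. G3 K w z + G2 K' w z) <= 2 * (C3 + C2) * en mu w" .
 qed
qed

end

lemma abs_sum_list_le: "(!!x. x : set xs ==> |x| <= P) ==> |sum_list xs| <= length xs * P" for P :: real
proof (induction xs)
 case (Cons x xs)
 then have "|sum_list xs| <= length xs * P" "|x| <= P" by auto
 then show ?case by (simp add: distrib_right)
qed simp

lemma le_sum_list: "x : set xs ==> (!!y. y : set xs ==> 0 <= y) ==> x <= sum_list xs" for x :: real
 by (induction xs) (auto simp: sum_list_nonneg intro: add_increasing add_increasing2)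

lemma abs_mult_le: "|x| <= p ==> |y| <= q ==> |x * y| <= p * q" for x :: real
 unfolding abs_mult by (intro mult_mono) auto

lemma seq_U_algebra:
 fixes ft :: real
 assumes "ft + fl - h * fs + b * jf + s * fm = 0" "gt + gl - h * gs + b' * jg + s * gm = 0" "j = jf - jg"
 shows "(ft - gt) + (fl - gl) = h * (fs - gs) - (b - b') * jg - b * j - s * (fm - gm)"
proof -
 have jf: "jf = j + jg" using assms(3) by simp
 show ?thesis using assms(1,2) unfolding jf by (simp add: algebra_simps)
qed

definition dif :: "('a list => 'a => real) => ('a list => 'a => real) => 'a list => 'a => real" where
 "dif F G vs z = F vs z - G vs z"

lemma dif_ext: "dif F G vs = (%z. F vs z - G vs z)"
 by (simp add: dif_def fun_eq_iff)

context space_time_box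
begin

section \<open>The difference of two solutions\<close>

abbreviation "fam6 \<equiv> fam Q Basis parabolic 6"

lemma fam_dt:
 assumes F: "fam Q Basis parabolic k F" and o: "okp k (dt # vs)"
 shows "hpd Q dt (F vs) (F (vs @ [dt]))"
proof (rule hpd_cong1[OF fam_hpd[OF F o]])
 show "F (dt # vs) z = F (vs @ [dt]) z" if "z : Q" for z
  by (rule fam_perm[OF F[unfolded Q_def] order_refl Q_nondegenerate o]) (use that in \<open>auto simp: Q_def\<close>)
qed

definition Iop where "Iop K L f z = G3 K f z + G2 L f z"

lemma Iop_cont: "continuous_on Ob K ==> continuous_on Ob L ==> continuous_on Q f ==> continuous_on Q (Iop K L f)"
 unfolding Iop_def[abs_def] by (intro continuous_intros G3_cont G2_cont)

lemma Iop_dt: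
 "continuous_on Ob K ==> continuous_on Ob L ==> continuous_on Q f ==> continuous_on Q ft ==> hpd Q dt f ft
 ==> hpd Q dt (Iop K L f) (Iop K L ft)"
 unfolding Iop_def[abs_def] by (intro hpd_add G3_dt G2_dt)

lemma Hr_diff:
 fixes K :: "(real^'n) \<times> (real^'n) => real" and f g :: "(real^'n) \<times> real => real"
 assumes K: "continuous_on Ob K" and f: "continuous_on Q f" and g: "continuous_on Q g" and p: "p : Q \<times> I1"
 shows "Hr K (%z. f z - g z) p = Hr K f p - Hr K g p"
proof -
 note si = set_integrable_continuous_compact[OF slice_continuous[OF Hr_integrand_cont[OF K] p] hm_facts]
 show ?thesis unfolding Hr_def using set_integral_diff(2)[OF si[OF f] si[OF g]] by (simp add: right_diff_distrib)
qed

lemma Iop_diff: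
 assumes K: "continuous_on Ob K" "continuous_on Ob L" and f: "continuous_on Q f" and g: "continuous_on Q g" and z: "z : Q"
 shows "Iop K L (%z. f z - g z) z = Iop K L f z - Iop K L g z"
proof -
 define s where "s = fst z $ i0"
 have s: "s : I1" using coord_I1[OF z] by (simp add: s_def)
 note si = set_integrable_continuous_compact[OF Hr_slice[OF K(2) _ z] I1_props(1) lborel_Icc_facts[OF s]]
 have "(LINT r:{s..a1}|lborel. Hr L (%z. f z - g z) (z, r)) = (LINT r:{s..a1}|lborel. Hr L f (z, r) - Hr L g (z, r))"
  using s by (intro set_lebesgue_integral_cong) (auto intro!: Hr_diff K f g z)
 also have "... = (LINT r:{s..a1}|lborel. Hr L f (z, r)) - (LINT r:{s..a1}|lborel. Hr L g (z, r))"
  by (rule set_integral_diff(2)[OF si[OF f] si[OF g]])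
 finally have "G2 L (%z. f z - g z) z = G2 L f z - G2 L g z" by (simp add: G2_def s_def)
 moreover have "G3 K (%z. f z - g z) z = G3 K f z - G3 K g z"
  unfolding G3_eq_Hr using s z by (intro Hr_diff K f g) (simp add: s_def)
 ultimately show ?thesis by (simp add: Iop_def)
qed

text \<open>The interaction at a time uses \<open>f\<close> at that time only, so smallness on the
  slice is enough. It is applied on the slices t = 0 and t = T.\<close>

lemma Iop_bound:
 assumes "continuous_on Ob K" "continuous_on Ob L" "!!p. p : Ob ==> |K p| <= M" "!!p. p : Ob ==> |L p| <= M"
  "continuous_on Q f" "M >= 0" "e >= 0" "z : Q" "!!z'. z' : Q ==> |f (fst z', snd z)| <= e"
 shows "|Iop K L f z| <= M * m' * (1 + 2 * a1) * e"
proof -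
 define f' where "f' z' = f (fst z', snd z)" for z' :: "(real^'n) \<times> real"
 have "continuous_on Q f'"
  unfolding f'_def by (rule continuous_on_compose2[OF assms(5)]) (use assms(8) in \<open>auto intro!: continuous_intros simp: Q_Times'\<close>)
 then have "R0 e f'" using assms(9) by (simp add: R0_def f'_def)
 then have "|G3 K f' z| <= M * e * m'" "|G2 L f' z| <= M * e * m' * (2 * a1)"
  using G3_R0[OF assms(1,3), of e f'] G2_R0[OF assms(2,4), of e f'] assms(6,7,8) unfolding R0_def by auto
 moreover have "Iop K L f z = G3 K f' z + G2 L f' z"
  by (simp add: Iop_def G3_def G2_def Hr_def f'_def)
 ultimately have "|Iop K L f z| <= M * e * m' + M * e * m' * (2 * a1)" by linarith
 then show ?thesis by (simp add: algebra_simps)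
qed

lemma okp_simps [simp]: "okp k [] " "okp k (dt # vs) \<longleftrightarrow> 2 <= k & okp (k - 2) vs" "okp k (dx j # vs) \<longleftrightarrow> 1 <= k & okp (k - 1) vs"
 by (auto simp: ok_def)

section \<open>The time multiplier\<close>

text \<open>The existential derivatives of \<open>R\<close> become families by choice. They are
  taken at time 0, so that they do not depend on time.\<close>

lemma static_R2:
 assumes "R (Suc (Suc 0)) B f"
 shows "EX D DD. (ALL i. hpd Q (dx i) (%z. f (fst z, 0)) (D i) & R0 B (D i) & (ALL z. D i z = D i (fst z, 0))) &
   (ALL i j. hpd Q (dx j) (D i) (DD i j) & R0 B (DD i j) & (ALL z. DD i j z = DD i j (fst z, 0)))"
proof -
 have 0: "(0::real) : {0..T}" using T_pos by simp
 have d: "hpd Q (dx i) (%z. f (fst z, 0)) (%z. f' (fst z, 0))" if "hpd Q (dx i) f f'" for f f' i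
  by (rule hpd_affine[OF that]) (use Q_time[OF _ 0] in \<open>auto simp: dx_def\<close>)
 have "ALL i. EX fi. hpd Q (dx i) f fi & R (Suc 0) B fi" using assms unfolding R.simps(2)[of "Suc 0"] by blast
 from choice[OF this] obtain fi where fi: "!!i. hpd Q (dx i) f (fi i)" "!!i. R (Suc 0) B (fi i)" by blast
 have "ALL p. EX fij. hpd Q (dx (snd p)) (fi (fst p)) fij & R0 B fij" using fi(2) unfolding R.simps by blast
 from choice[OF this] obtain fij0 where "ALL p. hpd Q (dx (snd p)) (fi (fst p)) (fij0 p) & R0 B (fij0 p)" by blast
 then have fij: "hpd Q (dx j) (fi i) (fij0 (i, j))" "R0 B (fij0 (i, j))" for i j by (metis fst_conv snd_conv)+
 show ?thesis
  by (rule exI[of _ "%i z. fi i (fst z, 0)"], rule exI[of _ "%i j z. fij0 (i, j) (fst z, 0)"])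
   (simp add: d[OF fi(1)] d[OF fij(1)] R0_slice[OF fij(2) 0] R0_slice[OF R_R0[OF fi(2)] 0])
qed

text \<open>On a segment in time direction \<open>g\<close> has no zero and therefore keeps its
  sign. If the quotient were negative, a factor interpolating between it and 1 would pass through
  0.\<close>

lemma same_sign:
 fixes g :: "(real^'n) \<times> real => real"
 assumes g: "continuous_on Q g" "!!z. z : Q ==> c <= |g z|" and c: "c > 0" and z: "z : Q"
 shows "g (fst z, 0) / g (fst z, T) > 0"
proof -
 have zt: "(fst z, t) : Q" if "t : {0..T}" for t by (rule Q_time[OF z that])
 have ct: "continuous_on {0..T} (%t. g (fst z, t))"
  by (rule continuous_on_compose2[OF g(1)]) (use zt in \<open>auto intro!: continuous_intros\<close>)
 have con: "connected ((%t. g (fst z, t)) ` {0..T})" by (rule connected_continuous_image[OF ct]) simp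
 have nz: "0 \<notin> (%t. g (fst z, t)) ` {0..T}" using g(2)[OF zt] c by force
 have m: "g (fst z, 0) : (%t. g (fst z, t)) ` {0..T}" "g (fst z, T) : (%t. g (fst z, t)) ` {0..T}" using T_pos by auto
 have "g (fst z, 0) > 0 \<longleftrightarrow> g (fst z, T) > 0"
  using connectedD_interval[OF con m(1) m(2), of 0] connectedD_interval[OF con m(2) m(1), of 0] nz by force
 moreover have "g (fst z, 0) ~= 0" "g (fst z, T) ~= 0" using m nz by metis+
 ultimately show ?thesis by (simp add: zero_less_divide_iff) linarith
qed

abbreviation multiplier where
 "multiplier B' g r rt ri rij rti \<equiv> c21 Q r rt ri rij rti &
  (ALL i j. ALL z:Q. 1 <= B' * |r z| & |r z| <= B' & |rt z| <= B' & |ri j z| <= B' & |rij i j z| <= B') &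
  (ALL z:Q. r (fst z, 0) = 1 & r (fst z, T) = g (fst z, 0) / g (fst z, T))"

text \<open>\<open>r\<close> is linear in time. Its end values 1 and \<open>\<kappa>\<close> are
  positive and bounded below, hence so is \<open>r\<close>, which gives the bound of its inverse.
  The bounds of \<open>ri\<close> and \<open>rij\<close> come from two space derivatives of
  \<open>g\<close>.\<close>

lemma time_multiplier:
 assumes c: "c > 0" and B: "B > 0"
 shows "EX B'>=1. ALL g. R (Suc (Suc 0)) B g & (ALL z:Q. c <= |g z| ) --> (EX r rt ri rij rti. multiplier B' g r rt ri rij rti)"
proof -
 obtain Bi where Bi: "!!f. R (Suc (Suc 0)) B f ==> ALL z:Q. c <= |f z| ==> R (Suc (Suc 0)) Bi (%z. 1 / f z)" using R_inverse[OF c, of "Suc (Suc 0)" B] by blast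
 obtain Bk where Bk: "!!f g. R (Suc (Suc 0)) B f ==> R (Suc (Suc 0)) Bi g ==> R (Suc (Suc 0)) Bk (%z. f z * g z)" using R_mult[of "Suc (Suc 0)" B Bi] by blast
 \<comment> \<open>\<open>1 + |Bk|\<close> bounds \<open>r\<close> and its space derivatives, the
   next summand bounds \<open>rt\<close>, and \<open>B / c\<close> bounds the inverse of
   \<open>\<kappa>\<close>.\<close>
 define B' where "B' = 1 + |Bk| + ( |Bk| + 1) / T + B / c"
 have B': "B' >= 1" "B' >= 1 + |Bk|" "B' >= ( |Bk| + 1) / T" "B' >= B / c" "B' >= |Bk|" using c B T_pos unfolding B'_def by auto
 show ?thesis
 proof (intro exI[of _ B'] conjI B' allI impI, elim conjE)
  fix g assume g: "R (Suc (Suc 0)) B g" "ALL z:Q. c <= |g z|"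
  define \<kappa> :: "(real^'n) \<times> real => real" where "\<kappa> z = g (fst z, 0) * (1 / g (fst z, T))" for z
  have T: "T : {0..T}" "0 : {0..T}" using T_pos by auto
  have gT: "ALL z:Q. c <= |g (fst z, T)|" using g(2) Q_time[OF _ T(1)] by blast
  have "R (Suc (Suc 0)) Bk \<kappa>"
   unfolding \<kappa>_def by (intro Bk Bi R_slice T g(1) gT)
  note k0 = R_R0[OF this] and k2 = static_R2[OF this]
  have "(%z. \<kappa> (fst z, 0)) = \<kappa>" by (simp add: \<kappa>_def[abs_def])
  then obtain D DD where D: "!!i. hpd Q (dx i) \<kappa> (D i)" "!!i. R0 Bk (D i)" "!!i z. D i z = D i (fst z, 0)"
   and DD: "!!i j. hpd Q (dx j) (D i) (DD i j)" "!!i j. R0 Bk (DD i j)" "!!i j z. DD i j z = DD i j (fst z, 0)"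
   using k2 by metis
  have pos: "\<kappa> z >= c / B" if z: "z : Q" for z
  proof -
   have "continuous_on Q g" using R_R0[OF g(1)] by (simp add: R0_def)
   then have p: "\<kappa> z > 0" using same_sign[OF _ _ c z] g(2) by (simp add: \<kappa>_def)
   have "c <= |g (fst z, 0)|" "|g (fst z, T)| <= B" "c <= |g (fst z, T)|"
    using g(2) R_R0[OF g(1)] Q_time[OF z T(1)] Q_time[OF z T(2)] by (auto simp: R0_def)
   then have "c / B <= |g (fst z, 0)| / |g (fst z, T)|" using c by (intro frac_le) auto
   then show ?thesis using p by (simp add: \<kappa>_def abs_divide flip: abs_of_pos)
  qed
  have kb: "|\<kappa> z| <= |Bk|" "|D i z| <= |Bk|" "|DD i j z| <= |Bk|" if "z : Q" for z i j
   using that k0 D(2)[of i] DD(2)[of i j] unfolding R0_def by force+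
  have kc: "continuous_on Q \<kappa>" "continuous_on Q (D i)" "continuous_on Q (DD i j)" for i j
   using k0 D(2)[of i] DD(2)[of i j] unfolding R0_def by auto
  have st: "hpd Q dt f (%_. 0)" if "!!z. f z = f (fst z, 0)" for f
  proof (rule hpd_trivial)
   fix z h show "f (z + h *\<^sub>R dt) = f z" using that[of "z + h *\<^sub>R dt"] that[of z] by simp
  qed
  have stk: "hpd Q dt \<kappa> (%_. 0)" by (rule st) (simp add: \<kappa>_def)
  define r where "r z = 1 + snd z * ((\<kappa> z - 1) / T)" for z
  define rt where "rt z = (\<kappa> z - 1) / T" for z
  define ri where "ri i z = snd z / T * D i z" for i z
  define rij where "rij i j z = snd z / T * DD i j z" for i j z
  define rti where "rti i z = D i z / T" for i z
  have sn: "hpd Q dt snd (%_. 1)" "hpd Q (dx i) snd (%_. 0)" for i by (rule hpd_dt_time, rule hpd_dx_time)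
  have dT: "hpd Q v (%z. f z / T) (%z. f' z / T)" if "hpd Q v f f'" for f f' v
   using hpd_cmult[OF that, of "1 / T"] by simp
  have c21: "c21 Q r rt ri rij rti"
   unfolding c21_def
  proof (intro conjI allI ballI)
   show "hpd Q dt r rt" unfolding r_def[abs_def]
    by (rule hpd_cong1[OF hpd_add[OF hpd_const hpd_mult[OF sn(1) dT[OF hpd_diff[OF stk hpd_const]]]]]) (simp add: rt_def)
   show "hpd Q (dx i) r (ri i)" for i unfolding r_def[abs_def]
    by (rule hpd_cong1[OF hpd_add[OF hpd_const hpd_mult[OF sn(2) dT[OF hpd_diff[OF D(1) hpd_const]]]]]) (simp add: ri_def)
   show "hpd Q (dx i) rt (rti i)" for i unfolding rt_def[abs_def]
    by (rule hpd_cong1[OF dT[OF hpd_diff[OF D(1) hpd_const]]]) (simp add: rti_def)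
   show "hpd Q dt (ri i) (rti i)" for i unfolding ri_def[abs_def]
    by (rule hpd_cong1[OF hpd_mult[OF dT[OF sn(1)] st[of "D i", OF D(3)]]]) (simp add: rti_def)
   show "hpd Q (dx j) (ri i) (rij i j)" for i j unfolding ri_def[abs_def]
    by (rule hpd_cong1[OF hpd_mult[OF dT[OF sn(2)] DD(1)]]) (simp add: rij_def)
   show "rij i j z = rij j i z" if z: "z : Q" for i j z
    using hpd_Schwarz[OF D(1)[unfolded Q_def, of i] D(1)[unfolded Q_def, of j] DD(1)[unfolded Q_def] DD(1)[unfolded Q_def]
      kc(3)[unfolded Q_def] kc(3)[unfolded Q_def] dx_Basis dx_Basis Q_nondegenerate[OF dx_Basis] Q_nondegenerate[OF dx_Basis] z[unfolded Q_def]]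
    by (simp add: rij_def)
  qed (use T_pos in \<open>auto simp: r_def[abs_def] rt_def[abs_def] ri_def[abs_def] rij_def[abs_def] rti_def[abs_def] intro!: continuous_intros kc\<close>)
  have bds: "1 <= B' * |r z| & |r z| <= B' & |rt z| <= B' & |ri j z| <= B' & |rij i j z| <= B'" if z: "z : Q" for z i j
  proof -
   define \<theta> where "\<theta> = snd z / T"
   have th: "0 <= \<theta>" "\<theta> <= 1" using z T_pos by (auto simp: \<theta>_def mem_Q)
   have rz: "r z = (1 - \<theta>) * 1 + \<theta> * \<kappa> z" using T_pos by (simp add: r_def \<theta>_def field_simps)
   have "1 / B' <= 1" "1 / B' <= \<kappa> z"
   proof -
    show "1 / B' <= 1" using B'(1) by simp
    have "1 / B' <= 1 / (B / c)" using B'(1,4) B c by (intro divide_left_mono) auto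
    then show "1 / B' <= \<kappa> z" using pos[OF z] by simp
   qed
   then have "(1 - \<theta>) * (1 / B') + \<theta> * (1 / B') <= r z" unfolding rz using th by (intro add_mono mult_left_mono) auto
   also have "(1 - \<theta>) * (1 / B') + \<theta> * (1 / B') = 1 / B'" by (simp only: distrib_right[symmetric]) simp
   finally have lo: "1 / B' <= r z" .
   moreover have "0 < 1 / B'" using B'(1) by simp
   ultimately have "0 < r z" by linarith
   then have 1: "1 <= B' * |r z|" using lo B'(1) by (simp add: pos_divide_le_eq mult.commute)
   have tb: "|\<theta> * x| <= |Bk|" if "|x| <= |Bk|" for x
    using abs_mult_le[of \<theta> 1 x "|Bk|"] th that by simp
   have "|1 - \<theta> + y| <= B'" if "|y| <= |Bk|" for y using that th B'(2) by linarith
   from this[OF tb[OF kb(1)[OF z]]] have "|r z| <= B'" unfolding rz by simp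
   moreover have "|rt z| <= ( |Bk| + 1) / T" unfolding rt_def abs_divide using kb(1)[OF z] T_pos by (intro frac_le) auto
   moreover have "|ri j z| <= |Bk|" "|rij i j z| <= |Bk|"
    unfolding ri_def rij_def \<theta>_def[symmetric] by (intro tb kb z)+
   ultimately show ?thesis using 1 B' by linarith
  qed
  show "EX r rt ri rij rti. multiplier B' g r rt ri rij rti"
  proof (rule exI[of _ r], rule exI[of _ rt], rule exI[of _ ri], rule exI[of _ rij], rule exI[of _ rti], intro conjI c21 allI ballI)
   fix z show "r (fst z, 0) = 1" "r (fst z, T) = g (fst z, 0) / g (fst z, T)" using T_pos by (simp_all add: r_def \<kappa>_def)
  qed (use bds in blast)+
 qed
qed

section \<open>Small data\<close>

definition LQ where "LQ = 2 * (SS i. A $ i) + T"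
definition lq where "lq = Min (insert T (range (%i. 2 * A $ i)))"
text \<open>The constant of \<open>hpd_interpolate\<close> for edges of length between
  \<open>l\<close> and \<open>LQ\<close>, enlarged by \<open>M\<close> for the case
  \<open>e > 1\<close>, where the a priori bound is good enough, and by 1 so that it is at least
  1.\<close>

definition Kst where "Kst l M = 4 / l + M * LQ + M + 1"

lemma LQ: "v : Basis ==> (A, T) \<bullet> v - (- A, 0) \<bullet> v <= LQ"
proof (erule Basis_cases)
 fix i assume "v = dx i"
 moreover have "A $ i <= (SS i. A $ i)" using A_pos by (intro member_le_sum) (auto intro: less_imp_le)
 ultimately show ?thesis using T_pos by (simp add: LQ_def inner_dx)
next
 assume "v = dt" then show ?thesis using A_pos by (simp add: LQ_def inner_dt sum_nonneg less_imp_le)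
qed

lemma lq: "lq > 0" "v : Basis ==> lq <= (A, T) \<bullet> v - (- A, 0) \<bullet> v"
proof -
 show "lq > 0" unfolding lq_def using A_pos T_pos by (subst Min_gr_iff) auto
 show "v : Basis ==> lq <= (A, T) \<bullet> v - (- A, 0) \<bullet> v"
 proof (erule Basis_cases)
  fix i assume "v = dx i"
  moreover have "lq <= 2 * A $ i" unfolding lq_def by (rule Min_le) auto
  ultimately show ?thesis by (simp add: inner_dx)
 next
  have "lq <= T" unfolding lq_def by (rule Min_le) auto
  moreover assume "v = dt"
  ultimately show ?thesis by (simp add: inner_dt)
 qed
qed

text \<open>Only the edge in direction \<open>v\<close> has to have positive length. The box may be
  flat in other directions, so that the lemma applies inside a lateral face or a time slice.\<close>

lemma interpolation:
 assumes f: "hpd Q v f f'" "hpd Q v f' f''" and b: "!!z. z : Q ==> |f' z| <= M" "!!z. z : Q ==> |f'' z| <= M"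
  and v: "v : Basis" and sub: "cbox p q \<subseteq> Q" and l: "0 < l" "l <= q \<bullet> v - p \<bullet> v"
  and e: "0 <= e" "!!z. z : cbox p q ==> |f z| <= e" and z: "z : cbox p q"
 shows "|f' z| <= Kst l M * sqrt e"
proof -
 have zQ: "z : Q" using z sub by blast
 have M: "M >= 0" using b(1)[OF zQ] by linarith
 have L: "q \<bullet> v - p \<bullet> v <= LQ"
 proof -
  have ne: "!!i. i : Basis ==> p \<bullet> i <= q \<bullet> i" using z unfolding mem_box by (meson order_trans)
  then have "p : Q" "q : Q" using sub unfolding subset_iff mem_box by blast+
  then have "(- A, 0) \<bullet> v <= p \<bullet> v" "q \<bullet> v <= (A, T) \<bullet> v" using v unfolding Q_def mem_box by blast+
  then show ?thesis using LQ[OF v] by linarith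
 qed
 have LQ0: "LQ > 0" using L l by linarith
 have K: "Kst l M >= M" "Kst l M >= 4 / l + M * LQ" unfolding Kst_def using M l LQ0 by auto
 show ?thesis
 proof (cases "e <= 1")
  case True
  have "|f' z| <= (4 / (q \<bullet> v - p \<bullet> v) + M * (q \<bullet> v - p \<bullet> v)) * sqrt e"
   by (rule hpd_interpolate[OF hpd_subset[OF f(1) sub] hpd_subset[OF f(2) sub] v _ e(1) True e(2) _ z]) (use l b(2) sub in auto)
  also have "... <= (4 / l + M * LQ) * sqrt e"
   using l L M e by (intro mult_right_mono add_mono mult_left_mono divide_left_mono) auto
  also have "... <= Kst l M * sqrt e" using K e by (intro mult_right_mono) auto
  finally show ?thesis .
 next
  case False
  then have "M * 1 <= Kst l M * sqrt e" using K M by (intro mult_mono) auto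
  then show ?thesis using b(1)[OF zQ] by simp
 qed
qed

lemma Kst_ge: "l > 0 ==> M >= 0 ==> Kst l M >= 1"
 unfolding Kst_def LQ_def using A_pos T_pos by (auto intro!: add_nonneg_nonneg mult_nonneg_nonneg sum_nonneg simp: less_imp_le)

abbreviation "bd6 F M \<equiv> ALL vs z. okp 6 vs --> z : Q --> |F vs z| <= M"

lemma interpolation_fam:
 assumes F: "fam6 F" "okp 6 (v # v # vs)" and b: "bd6 F M"
  and v: "v : Basis" and sub: "cbox p q \<subseteq> Q" and l: "0 < l" "l <= q \<bullet> v - p \<bullet> v"
  and e: "0 <= e" "!!z. z : cbox p q ==> |F vs z| <= e" and z: "z : cbox p q"
 shows "|F (v # vs) z| <= Kst l M * sqrt e"
 by (rule interpolation[OF fam_hpd[OF F(1) ok_Cons[OF F(2)]] fam_hpd[OF F] b[rule_format] b[rule_format] v sub l e z])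
  (use F(2) ok_Cons in auto)

text \<open>Three interpolations separate the data from the boundary values in the Carleman
  estimate: two lead from the end values of u to its second space derivatives, and one more to a
  gradient after the equation has been evaluated at the ends.\<close>

abbreviation "root8 e \<equiv> sqrt (sqrt (sqrt e))"

text \<open>The data in the form in which the estimates use them: pointwise and on closed sets.
  Second derivatives in space and derivatives tangential to a face follow by interpolation.\<close>

definition small where
 "small e F H \<longleftrightarrow> (ALL z:Q. |F [] (fst z, 0)| <= e & |F [] (fst z, T)| <= e & |H [] (fst z, 0)| <= e & |H [] (fst z, T)| <= e) &
  (ALL (i, sg):known_faces i0. ALL z:Q. fst z $ i = sg * A $ i -->
   |F [dt] z| <= e & |F [dx i, dt] z| <= e & |H [dt] z| <= e & |H [dx i, dt] z| <= e)"

text \<open>The face is a box that is flat in direction \<open>dx i\<close>. Derivatives in the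
  other directions, time included, come from interpolation inside it; the derivative in direction
  \<open>dx i\<close> is part of the data.\<close>

lemma small_faces:
 assumes F: "fam6 F" and b: "bd6 F M" and M: "M >= 0"
  and e: "0 <= e" "e <= 1" and i: "sg = 1 \<or> sg = -1"
  and s: "!!z. z : Q ==> fst z $ i = sg * A $ i ==> |F [dt] z| <= e & |F [dx i, dt] z| <= e"
  and z: "z : Q" "fst z $ i = sg * A $ i"
 shows "|F [dt] z| <= Kst lq M * sqrt e" "|F [dt, dt] z| <= Kst lq M * sqrt e" "|F [dx j, dt] z| <= Kst lq M * sqrt e"
proof -
 define p where "p = ((\<chi> k. if k = i then sg * A $ i else - A $ k), 0::real)"
 define q where "q = ((\<chi> k. if k = i then sg * A $ i else A $ k), T)"
 have pq: "x : cbox p q \<longleftrightarrow> x : Q & fst x $ i = sg * A $ i" for x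
 proof -
  define y where "y = fst x"
  have s: "- A $ i <= sg * A $ i" "sg * A $ i <= A $ i" using i A_pos[of i] by auto
  have "(ALL k. (if k = i then sg * A $ i else - A $ k) <= y $ k & y $ k <= (if k = i then sg * A $ i else A $ k)) \<longleftrightarrow>
   (ALL k. - A $ k <= y $ k & y $ k <= A $ k) & y $ i = sg * A $ i" (is "(ALL k. ?L k) \<longleftrightarrow> _")
  proof
   assume l: "ALL k. ?L k"
   have yi: "y $ i = sg * A $ i" using l[rule_format, of i] by simp
   moreover have "- A $ k <= y $ k & y $ k <= A $ k" for k using l[rule_format, of k] s yi by (cases "k = i") auto
   ultimately show "(ALL k. - A $ k <= y $ k & y $ k <= A $ k) & y $ i = sg * A $ i" by blast
  qed auto
  then show ?thesis
   by (cases x) (simp add: p_def q_def cbox_Pair_eq mem_box_cart mem_Q y_def conj_ac)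
 qed
 have sub: "cbox p q \<subseteq> Q" using pq by auto
 have len: "lq <= q \<bullet> dt - p \<bullet> dt" "j ~= i ==> lq <= q \<bullet> dx j - p \<bullet> dx j"
  using lq(2)[OF dt_Basis] lq(2)[OF dx_Basis[of j]] by (auto simp: p_def q_def inner_dx inner_dt)
 have es: "e <= sqrt e" using e by (metis abs_of_nonneg real_le_rsqrt power2_eq_square mult_left_le)
 have "sqrt e <= Kst lq M * sqrt e" using Kst_ge[OF lq(1) M] e by (simp add: mult_le_cancel_right1)
 then have eK: "e <= Kst lq M * sqrt e" using es by linarith
 have zpq: "z : cbox p q" using pq z by simp
 note st = interpolation_fam[OF F _ b _ sub lq(1) _ e(1) _ zpq]
 show "|F [dt] z| <= Kst lq M * sqrt e" using s[OF z] eK by linarith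
 show "|F [dt, dt] z| <= Kst lq M * sqrt e" by (rule st) (use s pq len dt_Basis in auto)
 show "|F [dx j, dt] z| <= Kst lq M * sqrt e"
 proof (cases "j = i")
  case True then show ?thesis using s[OF z] eK by auto
 next
  case False
  show ?thesis by (rule st) (use s pq len(2)[OF False] dx_Basis in auto)
 qed
qed

text \<open>The same device as on a face, with a box that is flat in time.\<close>

lemma slice_step:
 assumes F: "fam6 F" and b: "bd6 F M"
  and o: "okp 6 (dx j # dx j # vs)" and t: "t : {0..T}" and e: "0 <= e"
  and s: "!!z. z : Q ==> |F vs (fst z, t)| <= e" and z: "z : Q"
 shows "|F (dx j # vs) (fst z, t)| <= Kst lq M * sqrt e"
proof -
 have pq: "x : cbox (- A, t) (A, t) \<longleftrightarrow> x : Q & snd x = t" for x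
  using t by (cases x) (auto simp: cbox_Pair_eq Q_Times)
 have len: "lq <= (A, t) \<bullet> dx j - (- A, t) \<bullet> dx j" using lq(2)[OF dx_Basis[of j]] by (auto simp: inner_dx)
 have s': "|F vs x| <= e" if "x : cbox (- A, t) (A, t)" for x using s[of x] that unfolding pq by (cases x) auto
 show ?thesis
 proof (rule interpolation_fam[OF F o b dx_Basis _ lq(1) len e s'])
  show "cbox (- A, t) (A, t) \<subseteq> Q" using pq by blast
  show "(fst z, t) : cbox (- A, t) (A, t)" unfolding pq using Q_time[OF z t] by simp
 qed
qed


text \<open>Here \<open>FU, GU, FM, GM\<close> are the families of derivatives of \<open>u\<^sub>1, u\<^sub>2, m\<^sub>1, m\<^sub>2\<close>, \<open>ai j\<close> and \<open>st\<close>
  the derivatives of \<open>a\<close> in the direction \<open>j\<close> and of \<open>s\<close> in time; functions of \<open>x\<close> alone are regarded as functions of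
  \<open>(x, t)\<close>.\<close>

definition sys where
 "sys M c FU GU FM GM a ai s st b b' K L \<longleftrightarrow>
  (ALL F:{FU, GU, FM, GM}. fam6 F & (ALL vs. okp 6 vs --> (ALL z:Q. |F vs z| <= M))) &
  KR 2 M K & KR 2 M L & (ALL f:{a, s, st, b, b'} \<union> range ai. R0 M f) &
  (ALL f:{a, b, b'} \<union> range ai. ALL z. f z = f (fst z, 0)) & hpd Q dt s st &
  (ALL z:Q. c <= |Iop K L (GM []) z| ) &
  (ALL (F, H, b):{(FU, FM, b), (GU, GM, b')}. ALL z:Q.
   F [dt] z + (SS j. F [dx j, dx j] z) - a z / 2 * (SS j. (F [dx j] z)^2) + b z * Iop K L (H []) z + s z * H [] z = 0 &
   H [dt] z - (SS j. H [dx j, dx j] z) -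
    (SS j. ai j z * H [] z * F [dx j] z + a z * H [dx j] z * F [dx j] z + a z * H [] z * F [dx j, dx j] z) = 0)"

text \<open>\<open>CI\<close> bounds the interaction in the uniform norm. \<open>B1\<close> to
  \<open>B4\<close> belong to \<open>est_v\<close>, \<open>est_bt\<close>, \<open>est_w\<close> and
  \<open>est_m\<close>, in this order, and \<open>B5\<close> and \<open>B6\<close> to the two parts
  of \<open>slice_estimates\<close>. They are written out so that they visibly depend on
  \<open>M\<close> and the box only.\<close>

definition CI :: "real => real" where "CI M = M * m' * (1 + 2 * a1)"
definition B1 :: "real => real" where "B1 M = 2 * real CARD('n) * M^2 + CI M * M + 3 * M"
definition B2 :: "real => real" where "B2 M = 1 + real CARD('n) * M^2 + 2 * M"
definition B4 :: "real => real" where "B4 M = 1 + real CARD('n) * (6 * M^2)"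
definition B3 :: "real => real" where "B3 M = real CARD('n) * (10 * M^2) + M^2 * (B2 M + CI M * M) + M^2 * (B1 M + 1)"

definition KS :: "real => real" where "KS M = Kst lq (2 * M)"
definition B5 :: "real => real" where "B5 M = B2 M * (real CARD('n) * (KS M)^2 + real CARD('n) * KS M + CI M + 1)"
definition B6 :: "real => real" where "B6 M = B4 M * (2 * (real CARD('n) * (KS M)^2) + 2 * (real CARD('n) * KS M) + 1)"

lemma CI_nonneg: "M >= 0 ==> CI M >= 0"
 using A_pos[of i0] by (simp add: CI_def)

section \<open>Estimates for the differences of two solutions of the abstract system\<close>

context
 fixes M c FU GU FM GM a ai s st b b' K L
 assumes S: "sys M c FU GU FM GM a ai s st b b' K L" and M: "M >= 1" and c: "c > 0"
begin

abbreviation "sU \<equiv> dif FU GU"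
abbreviation "sm \<equiv> dif FM GM"
abbreviation "bt z \<equiv> b z - b' z"
abbreviation "J \<equiv> Iop K L"

lemma sfam: "fam6 FU" "fam6 GU" "fam6 FM" "fam6 GM"
 using S unfolding sys_def by auto

lemma sbound: assumes "okp 6 vs" "z : Q" shows "|FU vs z| <= M" "|GU vs z| <= M" "|FM vs z| <= M" "|GM vs z| <= M"
 using S assms unfolding sys_def by auto

lemma sdfam: "fam6 sU" "fam6 sm"
 unfolding dif_def[abs_def] by (intro fam_diff sfam)+

lemma sdbound: assumes "okp 6 vs" "z : Q" shows "|sU vs z| <= 2 * M" "|sm vs z| <= 2 * M"
 using sbound[OF assms] unfolding dif_def by linarith+

lemma sdb: "bd6 sU (2 * M)" "bd6 sm (2 * M)"
 using sdbound by blast+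

lemma sKR: "KR 2 M K" "KR 2 M L"
 using S unfolding sys_def by auto

lemma sK: "continuous_on Ob K" "continuous_on Ob L" "!!p. p : Ob ==> |K p| <= M" "!!p. p : Ob ==> |L p| <= M"
 using KR_0[OF sKR(1)] KR_0[OF sKR(2)] by auto

lemma sR0: "R0 M a" "R0 M s" "R0 M st" "R0 M b" "R0 M b'" "R0 M (ai j)"
 using S unfolding sys_def by auto

lemma scoef: assumes "z : Q" shows "|a z| <= M" "|s z| <= M" "|st z| <= M" "|b z| <= M" "|b' z| <= M" "|ai j z| <= M"
 using sR0 assms unfolding R0_def by blast+

lemma sstatic: "a z = a (fst z, 0)" "b z = b (fst z, 0)" "b' z = b' (fst z, 0)" "ai j z = ai j (fst z, 0)"
 using S unfolding sys_def by blast+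

lemma sst: "hpd Q dt s st" "!!z. z : Q ==> c <= |J (GM []) z|"
 using S unfolding sys_def by auto

lemma sstatic_hpd: "hpd Q dt a (%_. 0)" "hpd Q dt b (%_. 0)" "hpd Q dt b' (%_. 0)" "hpd Q dt (ai j) (%_. 0)"
proof -
 have st: "hpd Q dt f (%_. 0)" if "!!z. f z = f (fst z, 0)" for f
 proof (rule hpd_trivial)
  fix z h
  have "f (z + h *\<^sub>R dt) = f (fst (z + h *\<^sub>R dt), 0)" by (rule that)
  also have "fst (z + h *\<^sub>R dt) = fst z" by simp
  also have "f (fst z, 0) = f z" by (rule that[symmetric])
  finally show "f (z + h *\<^sub>R dt) = f z" .
 qed
 show "hpd Q dt a (%_. 0)" "hpd Q dt b (%_. 0)" "hpd Q dt b' (%_. 0)" "hpd Q dt (ai j) (%_. 0)"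
  by (rule st, rule sstatic)+
qed

lemma spde: assumes "z : Q"
 shows "FU [dt] z + (SS j. FU [dx j, dx j] z) - a z / 2 * (SS j. (FU [dx j] z)^2) + b z * J (FM []) z + s z * FM [] z = 0"
  "GU [dt] z + (SS j. GU [dx j, dx j] z) - a z / 2 * (SS j. (GU [dx j] z)^2) + b' z * J (GM []) z + s z * GM [] z = 0"
  "FM [dt] z - (SS j. FM [dx j, dx j] z) -
    (SS j. ai j z * FM [] z * FU [dx j] z + a z * FM [dx j] z * FU [dx j] z + a z * FM [] z * FU [dx j, dx j] z) = 0"
  "GM [dt] z - (SS j. GM [dx j, dx j] z) -
    (SS j. ai j z * GM [] z * GU [dx j] z + a z * GM [dx j] z * GU [dx j] z + a z * GM [] z * GU [dx j, dx j] z) = 0"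
 using S assms unfolding sys_def by auto

lemma scont: assumes "okp 6 vs"
 shows "continuous_on Q (FU vs)" "continuous_on Q (GU vs)" "continuous_on Q (FM vs)" "continuous_on Q (GM vs)" "continuous_on Q (sU vs)" "continuous_on Q (sm vs)"
 by (intro fam_cont[OF sfam(1)] fam_cont[OF sfam(2)] fam_cont[OF sfam(3)] fam_cont[OF sfam(4)] fam_cont[OF sdfam(1)] fam_cont[OF sdfam(2)] assms)+

lemma sJ_diff: "okp 6 vs ==> z : Q ==> J (sm vs) z = J (FM vs) z - J (GM vs) z"
 unfolding dif_ext by (intro Iop_diff sK scont)

text \<open>The difference of the squared gradients factors. The product of coefficient and
  interaction is split so that the unknown \<open>bt\<close> multiplies the interaction of the
  second solution, the one with the lower bound \<open>c\<close>.\<close>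

lemma seq_U:
 assumes z: "z : Q"
 shows "sU [dt] z + (SS j. sU [dx j, dx j] z) =
  a z / 2 * (SS j. sU [dx j] z * (FU [dx j] z + GU [dx j] z)) - bt z * J (GM []) z - b z * J (sm []) z - s z * sm [] z"
proof -
 have "(SS j. sU [dx j] z * (FU [dx j] z + GU [dx j] z)) = (SS j. (FU [dx j] z)^2) - (SS j. (GU [dx j] z)^2)"
  unfolding sum_subtractf[symmetric] by (rule sum.cong) (simp_all add: dif_def power2_eq_square algebra_simps)
 then show ?thesis using seq_U_algebra[OF spde(1,2)[OF z] sJ_diff[of "[]", OF _ z]]
  by (simp only: okp_simps dif_def sum_subtractf simp_thms)
qed

lemma seq_m:
 assumes z: "z : Q"
 shows "sm [dt] z - (SS j. sm [dx j, dx j] z) =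
  (SS j. ai j z * (sm [] z * FU [dx j] z + GM [] z * sU [dx j] z) + a z * (sm [dx j] z * FU [dx j] z + GM [dx j] z * sU [dx j] z)
    + a z * (sm [] z * FU [dx j, dx j] z + GM [] z * sU [dx j, dx j] z))"
proof -
 have "sm [dt] z - (SS j. sm [dx j, dx j] z) =
   (SS j. ai j z * FM [] z * FU [dx j] z + a z * FM [dx j] z * FU [dx j] z + a z * FM [] z * FU [dx j, dx j] z) -
   (SS j. ai j z * GM [] z * GU [dx j] z + a z * GM [dx j] z * GU [dx j] z + a z * GM [] z * GU [dx j, dx j] z)"
  using spde(3,4)[OF z] by (simp add: dif_def sum_subtractf algebra_simps)
 then show ?thesis
  unfolding sum_subtractf[symmetric] by (simp add: dif_def algebra_simps)
qed

lemma fam_dt':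
 assumes "okp 4 vs"
 shows "hpd Q dt (FU vs) (FU (vs @ [dt]))" "hpd Q dt (GU vs) (GU (vs @ [dt]))" "hpd Q dt (FM vs) (FM (vs @ [dt]))"
  "hpd Q dt (GM vs) (GM (vs @ [dt]))" "hpd Q dt (sU vs) (sU (vs @ [dt]))" "hpd Q dt (sm vs) (sm (vs @ [dt]))"
 by (intro fam_dt[OF sfam(1)] fam_dt[OF sfam(2)] fam_dt[OF sfam(3)] fam_dt[OF sfam(4)] fam_dt[OF sdfam(1)] fam_dt[OF sdfam(2)];
   use assms in simp)+

lemmas dts = fam_dt'[of "[]", simplified] fam_dt'[of "[dt]", simplified] fam_dt'[of "[dx i]" for i, simplified]
 fam_dt'[of "[dx i, dx j]" for i j, simplified]

text \<open>Differentiates an identity in time: each side is given its derivative separately, and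
  uniqueness identifies the two. \<open>seq_v\<close> and \<open>seq_w\<close> arise in this way
  from \<open>seq_U\<close> and \<open>seq_m\<close>.\<close>

lemma dt_unique: "hpd Q dt f f1 ==> hpd Q dt g g1 ==> (!!z. z : Q ==> f z = g z) ==> z : Q ==> f1 z = g1 z"
 by (rule hpd_unique[of "(- A, 0)" "(A, T)" dt g, folded Q_def]) (auto intro: hpd_cong simp: T_pos dt_Basis Q_nondegenerate)

lemma seq_v:
 assumes z: "z : Q"
 shows "sU [dt, dt] z + (SS j. sU [dx j, dx j, dt] z) =
  a z / 2 * (SS j. sU [dx j, dt] z * (FU [dx j] z + GU [dx j] z) + sU [dx j] z * (FU [dx j, dt] z + GU [dx j, dt] z))
  - bt z * J (GM [dt]) z - b z * J (sm [dt]) z - st z * sm [] z - s z * sm [dt] z"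
proof -
 have l: "hpd Q dt (%z. sU [dt] z + (SS j. sU [dx j, dx j] z)) (%z. sU [dt, dt] z + (SS j. sU [dx j, dx j, dt] z))"
  by (intro hpd_add hpd_sum dts)
 have J: "hpd Q dt (J (GM [])) (J (GM [dt]))" "hpd Q dt (J (sm [])) (J (sm [dt]))"
  by (intro Iop_dt sK scont dts; simp)+
 note r = hpd_diff[OF hpd_diff[OF hpd_diff[OF hpd_mult[OF hpd_cmult[OF sstatic_hpd(1), of "1/2"] hpd_sum[OF hpd_mult[OF _ hpd_add]]]
   hpd_mult[OF hpd_diff[OF sstatic_hpd(2,3)] J(1)]] hpd_mult[OF sstatic_hpd(2) J(2)]] hpd_mult[OF sst(1)]]
 have "hpd Q dt (%z. 1/2 * a z * (SS j. sU [dx j] z * (FU [dx j] z + GU [dx j] z)) - bt z * J (GM []) z - b z * J (sm []) z - s z * sm [] z)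
  (%z. 1/2 * 0 * (SS j. sU [dx j] z * (FU [dx j] z + GU [dx j] z)) +
   1/2 * a z * (SS j. sU [dx j, dt] z * (FU [dx j] z + GU [dx j] z) + sU [dx j] z * (FU [dx j, dt] z + GU [dx j, dt] z))
  - ((0 - 0) * J (GM []) z + bt z * J (GM [dt]) z) - (0 * J (sm []) z + b z * J (sm [dt]) z) - (st z * sm [] z + s z * sm [dt] z))"
  by (intro r hpd_add dts)
 from dt_unique[OF l this _ z] seq_U show ?thesis by (simp add: algebra_simps)
qed

lemma seq_w:
 assumes z: "z : Q"
 shows "sm [dt, dt] z - (SS j. sm [dx j, dx j, dt] z) =
  (SS j. ai j z * (sm [dt] z * FU [dx j] z + sm [] z * FU [dx j, dt] z + (GM [dt] z * sU [dx j] z + GM [] z * sU [dx j, dt] z))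
    + a z * (sm [dx j, dt] z * FU [dx j] z + sm [dx j] z * FU [dx j, dt] z + (GM [dx j, dt] z * sU [dx j] z + GM [dx j] z * sU [dx j, dt] z))
    + a z * (sm [dt] z * FU [dx j, dx j] z + sm [] z * FU [dx j, dx j, dt] z + (GM [dt] z * sU [dx j, dx j] z + GM [] z * sU [dx j, dx j, dt] z)))"
proof -
 have l: "hpd Q dt (%z. sm [dt] z - (SS j. sm [dx j, dx j] z)) (%z. sm [dt, dt] z - (SS j. sm [dx j, dx j, dt] z))"
  by (intro hpd_diff hpd_sum dts)
 have st: "hpd Q dt (%z. k z * f z) (%z. k z * g z)" if "hpd Q dt k (%_. 0)" "hpd Q dt f g" for k f g
  using hpd_mult[OF that] by simp
 have "hpd Q dt (%z. SS j. ai j z * (sm [] z * FU [dx j] z + GM [] z * sU [dx j] z) + a z * (sm [dx j] z * FU [dx j] z + GM [dx j] z * sU [dx j] z)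
    + a z * (sm [] z * FU [dx j, dx j] z + GM [] z * sU [dx j, dx j] z))
   (%z. (SS j. ai j z * (sm [dt] z * FU [dx j] z + sm [] z * FU [dx j, dt] z + (GM [dt] z * sU [dx j] z + GM [] z * sU [dx j, dt] z))
    + a z * (sm [dx j, dt] z * FU [dx j] z + sm [dx j] z * FU [dx j, dt] z + (GM [dx j, dt] z * sU [dx j] z + GM [dx j] z * sU [dx j, dt] z))
    + a z * (sm [dt] z * FU [dx j, dx j] z + sm [] z * FU [dx j, dx j, dt] z + (GM [dt] z * sU [dx j, dx j] z + GM [] z * sU [dx j, dx j, dt] z))))"
  by (intro hpd_sum hpd_add st sstatic_hpd hpd_mult dts)
 from dt_unique[OF l this _ z] seq_m show ?thesis by simp
qed

abbreviation "vx i \<equiv> sU [dx i, dt]"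
abbreviation "wx i \<equiv> sm [dx i, dt]"
abbreviation "Ux i \<equiv> sU [dx i]"
abbreviation "mx i \<equiv> sm [dx i]"
abbreviation "Sxx F z \<equiv> (SS j. |F [dx j, dx j] z| )"

lemma sJ_bound: "z : Q ==> okp 6 vs ==> |J (GM vs) z| <= CI M * M"
 unfolding CI_def using M by (intro Iop_bound sK scont sbound) (auto simp: Q_Times')

lemma sum_j_bound:
 fixes f :: "'n => real" and P :: real
 assumes "!!j. |f j| <= P"
 shows "|SS j. f j| <= CARD('n) * P"
 using sum_norm_bound[of UNIV f P] assms by simp

lemma sgrad_bound:
 fixes X Z p q :: "'n => real"
 assumes z: "z : Q" and S: "!!j. |X j| <= S" "!!j. |Z j| <= S"
  and p: "!!j. |p j| <= 2 * M" "!!j. |q j| <= 2 * M"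
 shows "|a z / 2 * (SS j. X j * p j + Z j * q j)| <= 2 * CARD('n) * M^2 * S"
  "|a z / 2 * (SS j. X j * p j)| <= CARD('n) * M^2 * S"
proof -
 have 1: "|X j * p j| <= S * (2 * M)" "|Z j * q j| <= S * (2 * M)" for j
  by (rule abs_mult_le[OF S(1) p(1)], rule abs_mult_le[OF S(2) p(2)])
 have "|X j * p j + Z j * q j| <= S * (2 * M) + S * (2 * M)" for j using 1[of j] by linarith
 note 2 = sum_j_bound[of "%j. X j * p j + Z j * q j", OF this] sum_j_bound[OF 1(1)]
 have h: "|a z / 2| <= M / 2" using scoef(1)[OF z] by simp
 show "|a z / 2 * (SS j. X j * p j + Z j * q j)| <= 2 * CARD('n) * M^2 * S"
  using abs_mult_le[OF h 2(1)] by (simp add: power2_eq_square mult_ac)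
 show "|a z / 2 * (SS j. X j * p j)| <= CARD('n) * M^2 * S"
  using abs_mult_le[OF h 2(2)] by (simp add: power2_eq_square mult_ac)
qed

lemma sFG_bound:
 assumes "z : Q" "okp 6 vs" shows "|FU vs z + GU vs z| <= 2 * M"
 using abs_triangle_ineq[of "FU vs z" "GU vs z"] sbound(1)[OF assms(2,1)] sbound(2)[OF assms(2,1)] by simp

lemma est_v:
 assumes z: "z : Q"
 shows "|sU [dt, dt] z + (SS j. sU [dx j, dx j, dt] z)| <= B1 M *
  ( |sU [dt] z| + gr vx z + gr Ux z + |J (sm [dt]) z| + |sm [dt] z| + |sm [] z| + |bt z| )"
proof -
 define S where "S = |sU [dt] z| + gr vx z + gr Ux z + |J (sm [dt]) z| + |sm [dt] z| + |sm [] z| + |bt z|"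
 have g: "|vx j z| <= gr vx z" "|Ux j z| <= gr Ux z" for j by (rule abs_le_gr)+
 have S: "|vx j z| <= S" "|Ux j z| <= S" for j
  using g[of j] gr_nonneg[of vx z] gr_nonneg[of Ux z] unfolding S_def by linarith+
 have S': "|bt z| <= S" "|J (sm [dt]) z| <= S" "|sm [] z| <= S" "|sm [dt] z| <= S"
  using gr_nonneg[of vx z] gr_nonneg[of Ux z] unfolding S_def by linarith+
 have 1: "|a z / 2 * (SS j. vx j z * (FU [dx j] z + GU [dx j] z) + Ux j z * (FU [dx j, dt] z + GU [dx j, dt] z))| <= 2 * CARD('n) * M^2 * S"
  by (intro sgrad_bound(1) S z sFG_bound) simp_all
 have 2: "|bt z * J (GM [dt]) z| <= S * (CI M * M)" "|b z * J (sm [dt]) z| <= M * S" "|st z * sm [] z| <= M * S" "|s z * sm [dt] z| <= M * S"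
  by (intro abs_mult_le S' sJ_bound z scoef; simp)+
 have "|x - y1 - y2 - y3 - y4| <= p + q1 + q2 + q3 + q4" if "|x| <= p" "|y1| <= q1" "|y2| <= q2" "|y3| <= q3" "|y4| <= q4"
  for x y1 y2 y3 y4 p q1 q2 q3 q4 :: real using that by linarith
 from this[OF 1 2] show ?thesis
  unfolding seq_v[OF z] S_def[symmetric] by (rule order_trans) (simp add: B1_def algebra_simps)
qed

text \<open>The equation for u before differentiation in time. It is meant for the slices t = 0 and
  t = T, where everything on the right is small.\<close>

lemma est_bt:
 assumes z: "z : Q"
 shows "|sU [dt] z + bt z * J (GM []) z| <= B2 M * (Sxx sU z + gr Ux z + |J (sm []) z| + |sm [] z| )"
proof -
 define S where "S = Sxx sU z + gr Ux z + |J (sm []) z| + |sm [] z|"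
 have Sx: "Sxx sU z >= 0" by (rule sum_nonneg) simp
 have g: "|Ux j z| <= gr Ux z" for j by (rule abs_le_gr)
 have S: "|Ux j z| <= S" for j using g[of j] Sx unfolding S_def by linarith
 have S': "Sxx sU z <= S" "|J (sm []) z| <= S" "|sm [] z| <= S"
  using Sx gr_nonneg[of Ux z] unfolding S_def by linarith+
 have 1: "|a z / 2 * (SS j. Ux j z * (FU [dx j] z + GU [dx j] z))| <= CARD('n) * M^2 * S"
  by (intro sgrad_bound(2)[where q="%_. 0" and Z="%j. Ux j z"] S z sFG_bound) (use M in simp_all)
 have 2: "|b z * J (sm []) z| <= M * S" "|s z * sm [] z| <= M * S"
  by (intro abs_mult_le S' z scoef; simp)+
 have 3: "|SS j. sU [dx j, dx j] z| <= S" using sum_abs[of "%j. sU [dx j, dx j] z" UNIV] S'(1) by linarith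
 have "|v + w| <= p + q1 + q2 + S" if "v + l = x - w - y1 - y2" "|x| <= p" "|y1| <= q1" "|y2| <= q2" "|l| <= S"
  for x y1 y2 p q1 q2 v w l :: real using that by linarith
 from this[OF seq_U[OF z] 1 2 3] show ?thesis
  unfolding S_def[symmetric] by (rule order_trans) (simp add: B2_def algebra_simps)
qed

lemma p3: "|x| <= M ==> |y| <= M ==> |z| <= P ==> |x * (y * z)| <= M^2 * P" for x y z P :: real
 using abs_mult_le[of x M "y * z" "M * P"] abs_mult_le[of y M z P] by (simp add: power2_eq_square mult.assoc)

lemma est_m:
 assumes z: "z : Q"
 shows "|sm [dt] z| <= B4 M * (Sxx sm z + gr mx z + |sm [] z| + gr Ux z + Sxx sU z)"
proof -
 define S where "S = Sxx sm z + gr mx z + |sm [] z| + gr Ux z + Sxx sU z"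
 have Sx: "Sxx sU z >= 0" "Sxx sm z >= 0" by (rule sum_nonneg; simp)+
 have g: "|Ux j z| <= gr Ux z" "|mx j z| <= gr mx z" for j by (rule abs_le_gr)+
 have h: "|sU [dx j, dx j] z| <= Sxx sU z" for j by (rule member_le_sum) auto
 have S: "|Ux j z| <= S" "|mx j z| <= S" "|sm [] z| <= S" "|sU [dx j, dx j] z| <= S" for j
  using g[of j] h[of j] gr_nonneg[of Ux z] gr_nonneg[of mx z] Sx unfolding S_def by linarith+
 have "|sum_list [ai j z * (FU [dx j] z * sm [] z), ai j z * (GM [] z * Ux j z), a z * (FU [dx j] z * mx j z), a z * (GM [dx j] z * Ux j z),
   a z * (FU [dx j, dx j] z * sm [] z), a z * (GM [] z * sU [dx j, dx j] z)]| <= 6 * (M^2 * S)" (is "|?X j| <= _") for j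
  by (rule order_trans[OF abs_sum_list_le[where P="M^2 * S"]]) (auto intro!: p3 scoef z sbound S)
 from sum_j_bound[of ?X, OF this] have "|sum ?X UNIV| <= CARD('n) * (6 * (M^2 * S))" .
 moreover have "sm [dt] z - (SS j. sm [dx j, dx j] z) = sum ?X UNIV"
  unfolding seq_m[OF z] by (rule sum.cong) (simp_all add: algebra_simps)
 moreover have "|SS j. sm [dx j, dx j] z| <= S"
  using sum_abs[of "%j. sm [dx j, dx j] z" UNIV] gr_nonneg[of Ux z] gr_nonneg[of mx z] Sx unfolding S_def by linarith
 ultimately have "|sm [dt] z| <= S + CARD('n) * (6 * (M^2 * S))" by linarith
 then show ?thesis unfolding S_def[symmetric] by (rule order_trans) (simp add: B4_def algebra_simps)
qed

lemma est_w:
 assumes z: "z : Q"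
 shows "|sm [dt, dt] z - (SS j. sm [dx j, dx j, dt] z)| <= B3 M *
  ( |sm [dt] z| + gr wx z + |sU [dt] z| + gr vx z + |sU [dt, dt] z| + |sU [] z| + gr Ux z + |sm [] z| + gr mx z
   + |J (sm [dt]) z| + |J (sm []) z| + |bt z| )"
proof -
 define xs where "xs = [ |sm [dt] z|, gr wx z, |sU [dt] z|, gr vx z, |sU [dt, dt] z|, |sU [] z|, gr Ux z, |sm [] z|, gr mx z,
   |J (sm [dt]) z|, |J (sm []) z|, |bt z| ]"
 define S where "S = sum_list xs"
 have Seq: "S = |sm [dt] z| + gr wx z + |sU [dt] z| + gr vx z + |sU [dt, dt] z| + |sU [] z| + gr Ux z + |sm [] z| + gr mx z
   + |J (sm [dt]) z| + |J (sm []) z| + |bt z|"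
  by (simp add: S_def xs_def)
 have mem: "x <= S" if "x : set xs" for x
  unfolding S_def by (rule le_sum_list[OF that]) (auto simp: xs_def)
 have S: "|Ux j z| <= S" "|mx j z| <= S" "|vx j z| <= S" "|wx j z| <= S" "|sm [] z| <= S" "|sm [dt] z| <= S" "|bt z| <= S"
  "|J (sm []) z| <= S" "|sU [dt] z| <= S" "|sU [dt, dt] z| <= S" for j
  by (rule order_trans[OF abs_le_gr[of Ux] mem] order_trans[OF abs_le_gr[of mx] mem] order_trans[OF abs_le_gr[of vx] mem]
    order_trans[OF abs_le_gr[of wx] mem] mem, simp add: xs_def)+
 have "|sum_list [ai j z * (FU [dx j] z * sm [dt] z), ai j z * (FU [dx j, dt] z * sm [] z), ai j z * (GM [dt] z * Ux j z), ai j z * (GM [] z * vx j z),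
   a z * (FU [dx j] z * wx j z), a z * (FU [dx j, dt] z * mx j z), a z * (GM [dx j, dt] z * Ux j z), a z * (GM [dx j] z * vx j z),
   a z * (FU [dx j, dx j] z * sm [dt] z), a z * (FU [dx j, dx j, dt] z * sm [] z)]| <= 10 * (M^2 * S)" (is "|?X j| <= _") for j
  by (rule order_trans[OF abs_sum_list_le[where P="M^2 * S"]]) (auto intro!: p3 scoef z sbound S)
 from sum_j_bound[of ?X, OF this] have X: "|sum ?X UNIV| <= CARD('n) * (10 * (M^2 * S))" .
 \<comment> \<open>The divergence term contains the Laplacians of the difference of u and of its
   time derivative, for which there is no energy. \<open>?LU\<close> is eliminated by
   \<open>seq_U\<close> and \<open>?LV\<close> by \<open>est_v\<close>; this is how the second time
   derivative of u gets to the right side.\<close>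
 let ?LU = "SS j. sU [dx j, dx j] z" and ?LV = "SS j. sU [dx j, dx j, dt] z"
 have eq: "sm [dt, dt] z - (SS j. sm [dx j, dx j, dt] z) = sum ?X UNIV + a z * (GM [dt] z * ?LU) + a z * (GM [] z * ?LV)"
  unfolding seq_w[OF z] sum_distrib_left sum.distrib[symmetric] by (rule sum.cong) (simp_all add: algebra_simps)
 have LU: "|?LU| <= (B2 M + CI M * M) * S"
 proof -
  have 1: "|a z / 2 * (SS j. Ux j z * (FU [dx j] z + GU [dx j] z))| <= CARD('n) * M^2 * S"
   by (intro sgrad_bound(2)[where q="%_. 0" and Z="%j. Ux j z"] S z sFG_bound) (use M in simp_all)
  have 2: "|bt z * J (GM []) z| <= S * (CI M * M)" "|b z * J (sm []) z| <= M * S" "|s z * sm [] z| <= M * S"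
   by (intro abs_mult_le S sJ_bound z scoef; simp)+
  have "|l| <= p + q + q1 + q2 + S" if "v + l = x - w - y1 - y2" "|x| <= p" "|w| <= q" "|y1| <= q1" "|y2| <= q2" "|v| <= S"
   for x y1 y2 p q q1 q2 v w l :: real using that by linarith
  from this[OF seq_U[OF z] 1 2 S(9)] show ?thesis by (rule order_trans) (simp add: B2_def algebra_simps)
 qed
 have LV: "|?LV| <= (B1 M + 1) * S"
 proof -
  have mono: "v + gv + gU + Jw + w + m + b <= w + gw + v + gv + vt + U + gU + m + gm + Jw + Jm + b"
   if "gw >= 0" "vt >= 0" "U >= 0" "gm >= 0" "Jm >= 0" for v gv gU Jw w m b gw vt U gm Jm :: real using that by linarith
  have "B1 M >= 0" unfolding B1_def using CI_nonneg[of M] M by (intro add_nonneg_nonneg mult_nonneg_nonneg) auto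
  then have "B1 M * ( |sU [dt] z| + gr vx z + gr Ux z + |J (sm [dt]) z| + |sm [dt] z| + |sm [] z| + |bt z| ) <= B1 M * S"
   unfolding Seq by (intro mult_left_mono mono) simp_all
  moreover have "|l| <= r + S" if "|t + l| <= q" "q <= r" "|t| <= S" for t l q r :: real using that by linarith
  ultimately show ?thesis using est_v[OF z] S(10) unfolding distrib_right mult_1_left by blast
 qed
 have "|x + y + w| <= p + q + q1" if "|x| <= p" "|y| <= q" "|w| <= q1" for x y w p q q1 :: real using that by linarith
 from this[OF X p3[OF scoef(1)[OF z] sbound(4)[of "[dt]", OF _ z] LU] p3[OF scoef(1)[OF z] sbound(4)[of "[]", OF _ z] LV]]
 show ?thesis unfolding eq Seq[symmetric] by (rule order_trans) (simp_all add: B3_def algebra_simps)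
qed

lemma KS: "KS M >= 1"
 unfolding KS_def using M by (intro Kst_ge lq) auto

lemma sqrt_KS: "0 <= x ==> KS M * sqrt (KS M * x) <= (KS M)^2 * sqrt x"
proof -
 assume x: "0 <= x"
 have "sqrt (KS M) <= KS M" using KS by (intro real_le_lsqrt) (auto simp: power2_eq_square mult_le_cancel_left1)
 then have "sqrt (KS M) * sqrt x <= KS M * sqrt x" using x by (intro mult_right_mono) auto
 then show ?thesis using KS by (simp add: real_sqrt_mult power2_eq_square mult.assoc)
qed

context
 fixes e assumes sml: "small e sU sm" and e: "0 <= e" "e <= 1"
begin

lemma e_sqrt: "e <= sqrt e" "sqrt e <= sqrt (sqrt e)" "sqrt (sqrt e) <= root8 e" "root8 e <= 1"
proof -
 have le: "x <= sqrt x" if "0 <= x" "x <= 1" for x :: real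
  using that by (intro real_le_rsqrt) (simp add: power2_eq_square mult_left_le)
 show "e <= sqrt e" "sqrt e <= sqrt (sqrt e)" "sqrt (sqrt e) <= root8 e" "root8 e <= 1"
  using e by (auto intro!: le)
qed

lemma slice_small:
 assumes z: "z : Q" and t: "t = 0 \<or> t = T"
 shows "|sU [] (fst z, t)| <= e" "|sm [] (fst z, t)| <= e" "|Ux j (fst z, t)| <= KS M * sqrt e" "|mx j (fst z, t)| <= KS M * sqrt e"
  "|sU [dx j, dx j] (fst z, t)| <= (KS M)^2 * sqrt (sqrt e)" "|sm [dx j, dx j] (fst z, t)| <= (KS M)^2 * sqrt (sqrt e)"
proof -
 have tT: "t : {0..T}" using t T_pos by auto
 have 1: "|sU [] (fst z, t)| <= e & |sm [] (fst z, t)| <= e" if "z : Q" for z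
  using sml that t unfolding small_def by blast
 then show "|sU [] (fst z, t)| <= e" "|sm [] (fst z, t)| <= e" using z by blast+
 note sU = slice_step[OF sdfam(1) sdb(1) _ tT, folded KS_def] and sm = slice_step[OF sdfam(2) sdb(2) _ tT, folded KS_def]
 have 2: "|Ux j (fst z, t)| <= KS M * sqrt e" "|mx j (fst z, t)| <= KS M * sqrt e" if "z : Q" for z j
  by (rule sU sm; use e 1 that in simp)+
 then show "|Ux j (fst z, t)| <= KS M * sqrt e" "|mx j (fst z, t)| <= KS M * sqrt e" using z by blast+
 have k: "0 <= KS M * sqrt e" using KS e by simp
 have "|sU [dx j, dx j] (fst z, t)| <= KS M * sqrt (KS M * sqrt e)" by (rule sU[OF _ k 2(1) z]) simp_all
 then show "|sU [dx j, dx j] (fst z, t)| <= (KS M)^2 * sqrt (sqrt e)" using sqrt_KS[of "sqrt e"] e by simp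
 have "|sm [dx j, dx j] (fst z, t)| <= KS M * sqrt (KS M * sqrt e)" by (rule sm[OF _ k 2(2) z]) simp_all
 then show "|sm [dx j, dx j] (fst z, t)| <= (KS M)^2 * sqrt (sqrt e)" using sqrt_KS[of "sqrt e"] e by simp
qed

lemma B_nonneg: "B2 M >= 1" "B4 M >= 1" "B5 M >= 1" "B6 M >= 1"
proof -
 show 1: "B2 M >= 1" "B4 M >= 1" unfolding B2_def B4_def using M by auto
 have "1 * 1 <= B5 M" "1 * 1 <= B6 M" unfolding B5_def B6_def using 1 KS CI_nonneg[of M] M by (intro mult_mono; simp)+
 then show "B5 M >= 1" "B6 M >= 1" by auto
qed

text \<open>At the two ends the undifferentiated equations turn small values and space derivatives
  of u and m into a small time derivative of m. For u only the combination with the unknown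
  \<open>bt\<close> becomes small.\<close>

lemma slice_estimates:
 assumes z: "z : Q" and t: "t = 0 \<or> t = T"
 shows "|sU [dt] (fst z, t) + bt (fst z, t) * J (GM []) (fst z, t)| <= B5 M * sqrt (sqrt e)"
  "|sm [dt] (fst z, t)| <= B6 M * sqrt (sqrt e)"
proof -
 define y where "y = (fst z, t)"
 have tT: "t : {0..T}" using t T_pos by auto
 have y: "y : Q" using Q_time[OF z tT] by (simp add: y_def)
 note s = slice_small[OF z t, folded y_def]
 define q where "q = sqrt (sqrt e)"
 have q: "e <= q" "sqrt e <= q" "0 <= q" using order_trans[OF e_sqrt(1,2)] e_sqrt(2) e unfolding q_def by auto
 have "Ux j y <= KS M * q & - Ux j y <= KS M * q & mx j y <= KS M * q & - mx j y <= KS M * q" for j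
  using s(3)[of j] s(4)[of j] mult_left_mono[OF q(2), of "KS M"] KS by linarith
 then have g: "gr Ux y <= CARD('n) * (KS M * q)" "gr mx y <= CARD('n) * (KS M * q)" by (intro gr_le; simp add: abs_le_iff)+
 have x: "Sxx sU y <= CARD('n) * ((KS M)^2 * q)" "Sxx sm y <= CARD('n) * ((KS M)^2 * q)"
  by (rule sum_bounded_above; use s(5,6) in \<open>simp add: q_def\<close>)+
 have J: "|J (sm []) y| <= CI M * e"
  unfolding CI_def by (rule Iop_bound[OF sK]) (use M e y in \<open>auto intro!: scont slice_small(2)[OF _ t] simp: y_def\<close>)
 also have "... <= CI M * q" using q CI_nonneg[of M] M by (intro mult_left_mono) auto
 finally have J: "|J (sm []) y| <= CI M * q" .
 have sm: "|sm [] y| <= q" using s(2) q by linarith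
 have "|sU [dt] y + bt y * J (GM []) y| <= B2 M * (Sxx sU y + gr Ux y + |J (sm []) y| + |sm [] y| )"
  by (rule est_bt[OF y])
 also have "... <= B2 M * (CARD('n) * ((KS M)^2 * q) + CARD('n) * (KS M * q) + CI M * q + q)"
  using B_nonneg(1) by (intro mult_left_mono add_mono x g J sm) auto
 also have "... = B5 M * q" by (simp add: B5_def algebra_simps)
 finally show "|sU [dt] (fst z, t) + bt (fst z, t) * J (GM []) (fst z, t)| <= B5 M * sqrt (sqrt e)" by (simp add: y_def q_def)
 have "|sm [dt] y| <= B4 M * (Sxx sm y + gr mx y + |sm [] y| + gr Ux y + Sxx sU y)" by (rule est_m[OF y])
 also have "... <= B4 M * (CARD('n) * ((KS M)^2 * q) + CARD('n) * (KS M * q) + q + CARD('n) * (KS M * q) + CARD('n) * ((KS M)^2 * q))"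
  using B_nonneg(2) by (intro mult_left_mono add_mono x g sm) auto
 also have "... = B6 M * q" by (simp add: B6_def algebra_simps)
 finally show "|sm [dt] (fst z, t)| <= B6 M * sqrt (sqrt e)" by (simp add: y_def q_def)
qed

lemma sqrt_const: "B >= 1 ==> sqrt (B * sqrt (sqrt e)) <= B * root8 e"
proof -
 assume B: "B >= 1"
 then have "sqrt B <= B" by (intro real_le_lsqrt) (auto simp: power2_eq_square mult_le_cancel_left1)
 then show ?thesis using e by (auto simp: real_sqrt_mult intro: mult_right_mono)
qed

lemma slice_wx:
 assumes z: "z : Q" and t: "t = 0 \<or> t = T"
 shows "|wx j (fst z, t)| <= KS M * (B6 M * root8 e)"
proof -
 have tT: "t : {0..T}" using t T_pos by auto
 have "|wx j (fst z, t)| <= KS M * sqrt (B6 M * sqrt (sqrt e))"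
  by (rule slice_step[OF sdfam(2) sdb(2) _ tT, folded KS_def]) (use e B_nonneg slice_estimates(2)[OF _ t] z in simp_all)
 also have "... <= KS M * (B6 M * root8 e)"
  using KS sqrt_const[OF B_nonneg(4)] by (intro mult_left_mono) auto
 finally show ?thesis .
qed

lemma face_small:
 assumes z: "z : Q" "known z"
 shows "|sU [dt] z| <= KS M * sqrt e" "|sU [dt, dt] z| <= KS M * sqrt e" "|vx j z| <= KS M * sqrt e"
  "|sm [dt] z| <= KS M * sqrt e" "|sm [dt, dt] z| <= KS M * sqrt e" "|wx j z| <= KS M * sqrt e"
proof -
 obtain i where i0: "fst z $ i = A $ i \<or> (i ~= i0 & fst z $ i = - A $ i)" using z(2) unfolding known_def by blast
 define sg :: real where "sg = (if fst z $ i = A $ i then 1 else - 1)"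
 have si: "sg = 1 \<or> sg = -1" by (simp add: sg_def)
 have i: "(i, sg) : known_faces i0" "fst z $ i = sg * A $ i"
  using i0 by (cases "fst z $ i = A $ i"; simp add: sg_def known_faces_def)+
 have s: "|sU [dt] z| <= e & |sU [dx i, dt] z| <= e" "|sm [dt] z| <= e & |sm [dx i, dt] z| <= e" if "z : Q" "fst z $ i = sg * A $ i" for z
  using bspec[OF conjunct2[OF sml[unfolded small_def]] i(1), unfolded prod.case] that by simp_all
 have M2: "2 * M >= 0" using M by simp
 note f = small_faces[OF sdfam(1) sdb(1) M2 e si s(1) z(1) i(2), folded KS_def]
  small_faces[OF sdfam(2) sdb(2) M2 e si s(2) z(1) i(2), folded KS_def]
 show "|sU [dt] z| <= KS M * sqrt e" "|sU [dt, dt] z| <= KS M * sqrt e" "|vx j z| <= KS M * sqrt e"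
  "|sm [dt] z| <= KS M * sqrt e" "|sm [dt, dt] z| <= KS M * sqrt e" "|wx j z| <= KS M * sqrt e"
  by (rule f; assumption?)+
qed

lemma c21_vw:
 "c21 Q (sU [dt]) (sU [dt, dt]) vx (%i j. sU [dx j, dx i, dt]) (%i. sU [dx i, dt, dt])"
 "c21 Q (sm [dt]) (sm [dt, dt]) wx (%i j. sm [dx j, dx i, dt]) (%i. sm [dx i, dt, dt])"
 using fam_c21[OF fam_shift[OF sdfam(1), of 2 "[dt]" 3]] fam_c21[OF fam_shift[OF sdfam(2), of 2 "[dt]" 3]] by simp_all

context
 fixes r rt ri rij rti B'
 assumes r: "c21 Q r rt ri rij rti" and B': "B' >= 1"
  and rb: "ALL i j. ALL z:Q. 1 <= B' * |r z| & |r z| <= B' & |rt z| <= B' & |ri j z| <= B' & |rij i j z| <= B'"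
  and rT: "ALL z:Q. r (fst z, 0) = 1 & r (fst z, T) = J (GM []) (fst z, 0) / J (GM []) (fst z, T)"
begin

definition \<Phi> where "\<Phi> z = sU [dt] (fst z, T) * r (fst z, T) - sU [dt] (fst z, 0) * r (fst z, 0)"

text \<open>At each end the time derivative of u is \<open>- bt\<close> times g up to a small error,
  where g is the interaction of the second solution and \<open>bt\<close> does not depend on time.
  Multiplication by the quotient of g at 0 and g at \<open>T\<close> makes the two main terms equal,
  so the unknown \<open>bt\<close> cancels.\<close>

lemma Phi_small: assumes z: "z : Q" shows "|\<Phi> z| <= (2 * B5 M * B') * sqrt (sqrt e)"
proof -
 have T: "T : {0..T}" "0 : {0..T}" using T_pos by auto
 let ?g = "J (GM [])" and ?v = "sU [dt]"
 have g: "?g (fst z, T) ~= 0" using sst(2)[OF Q_time[OF z T(1)]] c by auto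
 have b: "bt (fst z, T) = bt (fst z, 0)" using sstatic(2,3)[of "(fst z, T)"] by simp
 have 1: "|?v (fst z, T) + bt (fst z, T) * ?g (fst z, T)| <= B5 M * sqrt (sqrt e)" "|?v (fst z, 0) + bt (fst z, 0) * ?g (fst z, 0)| <= B5 M * sqrt (sqrt e)"
  by (rule slice_estimates[OF z]; simp)+
 have rr: "|r (fst z, T)| <= B'" using rb Q_time[OF z T(1)] by blast
 have "\<Phi> z = (?v (fst z, T) + bt (fst z, T) * ?g (fst z, T)) * r (fst z, T) - (?v (fst z, 0) + bt (fst z, 0) * ?g (fst z, 0))"
  unfolding \<Phi>_def b using rT z g by (simp add: field_simps)
 also have "|...| <= B5 M * sqrt (sqrt e) * B' + B5 M * sqrt (sqrt e)"
  using abs_mult_le[OF 1(1) rr] 1(2) abs_triangle_ineq4 by (meson add_mono order_trans)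
 finally have 2: "|\<Phi> z| <= B5 M * sqrt (sqrt e) * B' + B5 M * sqrt (sqrt e)" .
 have 3: "B5 M * sqrt (sqrt e) * 1 <= B5 M * sqrt (sqrt e) * B'" using B' B_nonneg(3) e by (intro mult_left_mono) auto
 have 4: "(2 * B5 M * B') * sqrt (sqrt e) = 2 * (B5 M * sqrt (sqrt e) * B')" by simp
 show ?thesis unfolding 4 using 2 3 by simp
qed

text \<open>No equation is differentiated in space: the gradient of \<open>\<Phi>\<close> is small
  because \<open>\<Phi>\<close> is and its second derivatives are bounded. This is the third of the
  square roots in \<open>root8\<close>.\<close>

lemma Phi_gradient: assumes z: "z : Q"
 shows "|(vx j (fst z, T) * r (fst z, T) + sU [dt] (fst z, T) * ri j (fst z, T)) - (vx j (fst z, 0) * r (fst z, 0) + sU [dt] (fst z, 0) * ri j (fst z, 0))|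
  <= Kst lq (16 * M * B') * (2 * B5 M * B' * root8 e)"
proof -
 have T: "T : {0..T}" "0 : {0..T}" using T_pos by auto
 note V = c21D[OF c21_mult[OF c21_vw(1) r]]
 have sl: "hpd Q (dx j) (%z. f (fst z, T) - f (fst z, 0)) (%z. f' (fst z, T) - f' (fst z, 0))" if "hpd Q (dx j) f f'" for f f'
  by (intro hpd_diff; rule hpd_affine[OF that]; use Q_time[OF _ T(1)] Q_time[OF _ T(2)] in \<open>auto simp: dx_def\<close>)
 have d1: "hpd Q (dx j) \<Phi> (%z. (vx j (fst z, T) * r (fst z, T) + sU [dt] (fst z, T) * ri j (fst z, T)) - (vx j (fst z, 0) * r (fst z, 0) + sU [dt] (fst z, 0) * ri j (fst z, 0)))"
  unfolding \<Phi>_def[abs_def] by (rule sl[OF V(2)])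
 note d2 = sl[OF V(5)[of j j]]
 have bd: "|p * q| <= 2 * M * B'" if "|p| <= 2 * M" "|q| <= B'" for p q by (rule abs_mult_le[OF that])
 have rb': "|r z| <= B'" "|ri j z| <= B'" "|rij j j z| <= B'" if "z : Q" for z using rb that by blast+
 have P: "2 * M * B' >= 0" using M B' by simp
 have 1: "|vx j z * r z + sU [dt] z * ri j z| <= 4 * (2 * M * B')" if z: "z : Q" for z
  using abs_triangle_ineq[of "vx j z * r z" "sU [dt] z * ri j z"] bd[OF sdbound(1)[OF _ z] rb'(1)[OF z], of "[dx j, dt]"]
   bd[OF sdbound(1)[OF _ z] rb'(2)[OF z], of "[dt]"] P by simp
 have 2: "|sU [dx j, dx j, dt] z * r z + vx j z * ri j z + vx j z * ri j z + sU [dt] z * rij j j z| <= 4 * (2 * M * B')" if z: "z : Q" for z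
 proof -
  have "|sum_list [sU [dx j, dx j, dt] z * r z, vx j z * ri j z, vx j z * ri j z, sU [dt] z * rij j j z]| <= 4 * (2 * M * B')"
   by (rule order_trans[OF abs_sum_list_le[where P="2 * M * B'"]]) (auto intro!: bd sdbound rb' z)
  then show ?thesis by (simp add: add.assoc)
 qed
 have diff: "|x - y| <= 16 * M * B'" if "|x| <= 4 * (2 * M * B')" "|y| <= 4 * (2 * M * B')" for x y
  using abs_triangle_ineq4[of x y] that by (simp add: mult.assoc)
 have "|(vx j (fst z, T) * r (fst z, T) + sU [dt] (fst z, T) * ri j (fst z, T)) - (vx j (fst z, 0) * r (fst z, 0) + sU [dt] (fst z, 0) * ri j (fst z, 0))|
  <= Kst lq (16 * M * B') * sqrt ((2 * B5 M * B') * sqrt (sqrt e))"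
 proof (rule interpolation[OF d1 d2 _ _ dx_Basis _ lq(1) lq(2)[OF dx_Basis]])
  show "cbox (- A, 0) (A, T) \<subseteq> Q" "z : cbox (- A, 0) (A, T)" using z by (simp_all add: Q_def)
  show "0 <= 2 * B5 M * B' * sqrt (sqrt e)" using B_nonneg(3) B' e by simp
  show "|\<Phi> z| <= 2 * B5 M * B' * sqrt (sqrt e)" if "z : cbox (- A, 0) (A, T)" for z
   using Phi_small that by (simp add: Q_def)
 qed (rule diff, (rule 1 2, erule Q_time[OF _ T(1)]), (rule 1 2, erule Q_time[OF _ T(2)]))+
 also have "... <= Kst lq (16 * M * B') * (2 * B5 M * B' * root8 e)"
 proof (intro mult_left_mono)
  have "1 * 1 <= (2 * B5 M) * B'" using B_nonneg(3) B' by (intro mult_mono) auto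
  then show "sqrt ((2 * B5 M * B') * sqrt (sqrt e)) <= 2 * B5 M * B' * root8 e" by (intro sqrt_const) simp
  show "0 <= Kst lq (16 * M * B')" using Kst_ge[OF lq(1), of "16 * M * B'"] M B' by simp
 qed
 finally show ?thesis .
qed

end

end

end


section \<open>Hoelder stability up to the known part of the boundary\<close>

lemma fam_R:
 assumes "fam6 F" "bd6 F M"
 shows "okp (6 - n) vs ==> n <= 6 ==> R n M (F vs)"
proof (induction n arbitrary: vs)
 case 0
 then have o: "okp 6 vs" by simp
 have "ALL z:Q. |F vs z| <= M" using assms(2) o by blast
 then show ?case using fam_cont[OF assms(1) o] by (simp only: R.simps R0_def)
next
 case (Suc n)
 have o: "okp (6 - n) (dx i # vs)" for i using Suc.prems by simp
 have o6: "okp 6 (dx i # vs)" for i using o[of i] by (auto simp: ok_def)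
 have "ALL z:Q. |F vs z| <= M" using assms(2) ok_Cons[OF o6] by blast
 then have "R0 M (F vs)" using fam_cont[OF assms(1) ok_Cons[OF o6]] by (simp only: R0_def)
 moreover have "hpd Q (dx i) (F vs) (F (dx i # vs)) & R n M (F (dx i # vs))" for i
  using fam_hpd[OF assms(1) o6] Suc.IH[OF o] Suc.prems by simp
 ultimately show ?case by auto
qed

text \<open>Here the hypotheses of \<open>energy_hyp\<close> are verified for two solutions with
  small data, the error being a multiple of \<open>root8 e\<close>. The pointwise bound for
  \<open>b z - b' z\<close> is kept because it is used again, in the uniform norm, after v has been
  estimated.\<close>

lemma energy_sys:
 assumes M: "M >= 1" and c: "c > 0"
 shows "EX C>0. EX mu0>=1. EX B>=1. ALL FU GU FM GM a ai s st b b' K L e mu.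
  sys M c FU GU FM GM a ai s st b b' K L & small e (dif FU GU) (dif FM GM) & 0 <= e & e <= 1 & mu >= mu0 -->
  en mu (dif FU GU [dt]) + en mu (dif FM GM [dt]) <= C * (mu * Rem mu (B * root8 e)) &
  (ALL z:Q. |b z - b' z| <= B * ( |dif FU GU [dt] (fst z, 0)| + root8 e))"
proof -
 have M0: "M >= 0" using M by simp
 obtain Bg1 where Bg1: "!!K m. KR (Suc (Suc 0)) M K ==> R (Suc (Suc 0)) M m ==> R (Suc (Suc 0)) Bg1 (G3 K m)" using G3_R[OF M0, of "Suc (Suc 0)"] by blast
 obtain Bg2 where Bg2: "!!K m. KR (Suc (Suc 0)) M K ==> R (Suc (Suc 0)) M m ==> R (Suc (Suc 0)) Bg2 (G2 K m)" using G2_R[OF M0, of "Suc (Suc 0)"] by blast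
 define Bg where "Bg = |Bg1 + Bg2| + 1"
 have Bg: "Bg > 0" by (simp add: Bg_def add_nonneg_pos)
 have Iop_R: "R (Suc (Suc 0)) Bg (Iop K L m)" if "KR (Suc (Suc 0)) M K" "KR (Suc (Suc 0)) M L" "R (Suc (Suc 0)) M m" for K L m
  unfolding Iop_def[abs_def] by (rule R_mono[OF R_add[OF Bg1 Bg2]]) (use that in \<open>simp_all only:\<close>, simp add: Bg_def)
 obtain B' where B': "B' >= 1" and tm: "!!g. R (Suc (Suc 0)) Bg g ==> ALL z:Q. c <= |g z| ==> EX r rt ri rij rti. multiplier B' g r rt ri rij rti"
  using time_multiplier[OF c Bg] by blast
 obtain CJ where CJ: "CJ >= 0" and enJ: "!!mu K L w. mu >= 0 ==> continuous_on Ob K ==> continuous_on Ob L ==>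
   ALL p:Ob. |K p| <= M & |L p| <= M ==> continuous_on Q w ==> en mu (Iop K L w) <= CJ * en mu w"
  using en_interaction[OF M0] unfolding Iop_def[abs_def] by blast
 define KP where "KP = Kst lq (16 * M * B') * (2 * B5 M * B')"
 have KS1: "KS M >= 1" unfolding KS_def using M by (intro Kst_ge lq) auto
 have Bn: "B1 M >= 0" "B2 M >= 1" "B3 M >= 0" "B4 M >= 1" "B5 M >= 1" "B6 M >= 1"
 proof -
  show 1: "B1 M >= 0" unfolding B1_def using CI_nonneg[of M] M by (intro add_nonneg_nonneg mult_nonneg_nonneg) auto
  show 2: "B2 M >= 1" "B4 M >= 1" unfolding B2_def B4_def using M by auto
  show "B3 M >= 0" unfolding B3_def using 1 2 CI_nonneg[of M] M by (intro add_nonneg_nonneg mult_nonneg_nonneg) auto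
  have "1 * 1 <= B5 M" "1 * 1 <= B6 M" unfolding B5_def B6_def using 2 KS1 CI_nonneg[of M] M by (intro mult_mono; simp)+
  then show "B5 M >= 1" "B6 M >= 1" by auto
 qed
 have KP0: "KP >= 0" unfolding KP_def using Kst_ge[OF lq(1), of "16 * M * B'"] M B' Bn by (intro mult_nonneg_nonneg) auto
 \<comment> \<open>At least as large as every constant in front of a root of \<open>e\<close> in the
   boundary values, and at least 1.\<close>
 define Be where "Be = KP + 2 * (KS M * B6 M) + 2 * B6 M + KS M + 2 * B5 M * B' + B5 M + 1"
 have pos: "KS M * B6 M >= 0" "2 * B5 M * B' >= 0" using KS1 Bn B' by auto
 have Be: "Be >= KP" "Be >= 2 * (KS M * B6 M)" "Be >= 2 * B6 M" "Be >= KS M" "Be >= 2 * B5 M * B'" "Be >= B5 M" "Be >= 1"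
  unfolding Be_def using KP0 KS1 Bn pos by linarith+
 define Mf where "Mf = 1 + 2 * M + B' + Be + CJ + B1 M + B3 M + 1 / c"
 have Mf: "Mf >= 1" "Mf >= 2 * M" "Mf >= B'" "Mf >= Be" "Mf >= CJ" "Mf >= B1 M" "Mf >= B3 M" "Mf >= 1 / c"
  unfolding Mf_def using M B' Be(7) CJ Bn c by (simp_all add: add_nonneg_nonneg)
 from energy_estimate[OF Mf(1)] obtain C mu0 where C: "C > 0" "mu0 >= 1" and main: "!!v vt vi vij vti w wt wi wij wti r rt ri rij rti U Ui m mi Jw Jm bt mu eps.
   energy_hyp Mf mu0 v vt vi vij vti w wt wi wij wti r rt ri rij rti U Ui m mi Jw Jm bt mu eps
   ==> en mu v + en mu w <= C * (mu * Rem mu eps)"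
  by (elim exE conjE) (rule that, assumption, assumption, elim allE impE, assumption+)
 show ?thesis
 proof (rule exI[of _ C], rule conjI[OF C(1)], rule exI[of _ mu0], rule conjI[OF C(2)], rule exI[of _ "max Be (Mf * Be)"], rule conjI,
   use Be(7) in simp, intro allI impI, elim conjE)
  fix FU GU FM GM a ai s st b b' K L e mu
  assume S: "sys M c FU GU FM GM a ai s st b b' K L" and sml: "small e (dif FU GU) (dif FM GM)" and e: "0 <= e" "e <= 1" and mu: "mu0 <= mu"
  let ?U = "dif FU GU" and ?m = "dif FM GM" and ?J = "Iop K L" and ?e8 = "root8 e"
  let ?eps = "Be * ?e8"
  note ctx = S M c
  note cs = S M c sml e
  have gR: "R (Suc (Suc 0)) Bg (?J (GM []))"
   using sKR[OF ctx] fam_R[OF sfam(4)[OF ctx], of M "Suc (Suc 0)" "[]"] sbound(4)[OF ctx]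
   by (intro Iop_R) (simp_all add: numeral_2_eq_2 del: R.simps KR.simps)
  have gc: "ALL z:Q. c <= |?J (GM []) z|" using sst(2)[OF ctx] by blast
  obtain r rt ri rij rti where r: "c21 Q r rt ri rij rti"
   and rb: "ALL i j. ALL z:Q. 1 <= B' * |r z| & |r z| <= B' & |rt z| <= B' & |ri j z| <= B' & |rij i j z| <= B'"
   and rT: "ALL z:Q. r (fst z, 0) = 1 & r (fst z, T) = ?J (GM []) (fst z, 0) / ?J (GM []) (fst z, T)"
   using tm[OF gR gc] by (elim exE conjE) (rule that)
  have e8: "0 <= ?e8" "?e8 <= 1" using e by auto
  have ee: "e <= ?e8" "sqrt e <= ?e8" "sqrt (sqrt e) <= ?e8"
   using e_sqrt[OF cs] by (meson order_trans)+
  have le: "x <= ?eps" if "x <= k * y" "k <= Be" "0 <= y" "y <= ?e8" for x k y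
  proof -
   have "k * y <= Be * ?e8" using that(2-4) Be(7) by (intro mult_mono) auto
   then show ?thesis using that(1) by linarith
  qed
  have eps: "0 <= ?eps" "?eps <= Mf"
   using Be(7) e8(1) order_trans[OF mult_left_mono[OF e8(2), of Be]] Mf(4) by simp_all
  have sq: "0 <= sqrt e" "0 <= sqrt (sqrt e)" using e by auto
  have h1: "ALL j. ALL z:Q. |?U [dt] z| <= Mf & |?U [dt, dt] z| <= Mf & |?U [dx j, dt] z| <= Mf & |?m [dt] z| <= Mf & |?m [dt, dt] z| <= Mf & |?m [dx j, dt] z| <= Mf"
   by (intro allI ballI conjI order_trans[OF sdbound(1)[OF ctx] Mf(2)] order_trans[OF sdbound(2)[OF ctx] Mf(2)]; simp)
  have h2: "ALL i j. ALL z:Q. 1 <= Mf * |r z| & |r z| <= Mf & |rt z| <= Mf & |ri j z| <= Mf & |rij i j z| <= Mf"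
  proof (intro allI ballI)
   fix i j z assume z: "z : Q"
   have "1 <= B' * |r z|" "B' * |r z| <= Mf * |r z|" using rb z Mf(3) by (blast, intro mult_right_mono) auto
   moreover have "|r z| <= B' & |rt z| <= B' & |ri j z| <= B' & |rij i j z| <= B'" using rb z by blast
   ultimately show "1 <= Mf * |r z| & |r z| <= Mf & |rt z| <= Mf & |ri j z| <= Mf & |rij i j z| <= Mf" using Mf(3) by linarith
  qed
  have h3: "ALL j. ALL z:Q. known z --> |?U [dt] z| <= ?eps & |?U [dt, dt] z| <= ?eps & |?U [dx j, dt] z| <= ?eps &
    |?m [dt] z| <= ?eps & |?m [dt, dt] z| <= ?eps & |?m [dx j, dt] z| <= ?eps"
   by (intro allI ballI impI conjI; rule le[OF _ Be(4) sq(1) ee(2)]; erule (1) face_small[OF cs])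
  have h4: "ALL j. ALL z:Q. |?U [dt] (fst z, T) * r (fst z, T) - ?U [dt] (fst z, 0) * r (fst z, 0)| <= ?eps &
    |(?U [dx j, dt] (fst z, T) * r (fst z, T) + ?U [dt] (fst z, T) * ri j (fst z, T)) -
     (?U [dx j, dt] (fst z, 0) * r (fst z, 0) + ?U [dt] (fst z, 0) * ri j (fst z, 0))| <= ?eps &
    |?m [dt] (fst z, T) - ?m [dt] (fst z, 0)| <= ?eps & |?m [dx j, dt] (fst z, T) - ?m [dx j, dt] (fst z, 0)| <= ?eps"
  proof (intro allI ballI conjI)
   fix j z assume z: "z : Q"
   show "|?U [dt] (fst z, T) * r (fst z, T) - ?U [dt] (fst z, 0) * r (fst z, 0)| <= ?eps"
    by (rule le[OF Phi_small[OF cs r B' rb rT z, unfolded \<Phi>_def[OF cs r B' rb rT]] Be(5) sq(2) ee(3)])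
   show "|(?U [dx j, dt] (fst z, T) * r (fst z, T) + ?U [dt] (fst z, T) * ri j (fst z, T)) -
     (?U [dx j, dt] (fst z, 0) * r (fst z, 0) + ?U [dt] (fst z, 0) * ri j (fst z, 0))| <= ?eps"
    by (rule le[OF _ Be(1) e8(1) order_refl], rule order_trans[OF Phi_gradient[OF cs r B' rb rT z]]) (simp add: KP_def)
   have diff: "|x - y| <= (2 * k) * q" if "|x| <= k * q" "|y| <= k * q" for x y k q :: real
    using abs_triangle_ineq4[of x y] that by simp
   show "|?m [dt] (fst z, T) - ?m [dt] (fst z, 0)| <= ?eps"
    by (rule le[OF diff[OF slice_estimates(2)[OF cs z] slice_estimates(2)[OF cs z]] Be(3) sq(2) ee(3)]) simp_all
   show "|?m [dx j, dt] (fst z, T) - ?m [dx j, dt] (fst z, 0)| <= ?eps"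
    by (rule le[OF diff[OF slice_wx[OF cs z, unfolded mult.assoc[symmetric]] slice_wx[OF cs z, unfolded mult.assoc[symmetric]]] Be(2) e8(1) order_refl]) simp_all
  qed
  note dt' = dts[OF ctx]
  have h5: "hpd Q dt (?U []) (?U [dt])" "hpd Q dt (?m []) (?m [dt])" "ALL j. hpd Q dt (?U [dx j]) (?U [dx j, dt]) & hpd Q dt (?m [dx j]) (?m [dx j, dt])"
   by (intro allI conjI dt')+
  have h6: "continuous_on Q (?U [])" "continuous_on Q (?m [])" "ALL j. continuous_on Q (?U [dx j]) & continuous_on Q (?m [dx j])"
   by (intro allI conjI scont[OF ctx]; simp)+
  have h7: "ALL j. ALL z:Q. |?U [] (fst z, 0)| <= ?eps & |?m [] (fst z, 0)| <= ?eps & |?U [dx j] (fst z, 0)| <= ?eps & |?m [dx j] (fst z, 0)| <= ?eps"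
  proof (intro allI ballI conjI)
   fix j z assume z: "z : Q"
   note s = slice_small[OF cs z, of 0]
   show "|?U [] (fst z, 0)| <= ?eps" "|?m [] (fst z, 0)| <= ?eps" by (rule le[OF _ Be(7) e(1) ee(1)]; use s(1,2) in simp)+
   show "|?U [dx j] (fst z, 0)| <= ?eps" "|?m [dx j] (fst z, 0)| <= ?eps" by (rule le[OF _ Be(4) sq(1) ee(2)]; use s(3,4) in simp)+
  qed
  have h8: "continuous_on Q (?J (?m [dt]))" "continuous_on Q (?J (?m []))" "continuous_on Q (%z. b z - b' z)"
   using sR0(4,5)[OF ctx] by (auto intro!: Iop_cont sK[OF ctx] scont[OF ctx] continuous_intros simp: R0_def)
  have h9: "en mu (?J f) <= Mf * en mu f" if "continuous_on Q f" for f
  proof -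
   have "en mu (?J f) <= CJ * en mu f" using mu C(2) sK[OF ctx] that by (intro enJ) auto
   also have "... <= Mf * en mu f" using Mf(5) by (intro mult_right_mono) auto
   finally show ?thesis .
  qed
  have h10: "ALL z:Q. |?U [dt, dt] z + (SS j. ?U [dx j, dx j, dt] z)| <=
    Mf * ( |?U [dt] z| + gr (%j. ?U [dx j, dt]) z + gr (%j. ?U [dx j]) z + |?J (?m [dt]) z| + |?m [dt] z| + |?m [] z| + |b z - b' z| )"
   by (rule ballI, rule order_trans[OF est_v[OF ctx]], assumption, intro mult_right_mono Mf(6) add_nonneg_nonneg) simp_all
  have h12: "ALL z:Q. |?m [dt, dt] z - (SS j. ?m [dx j, dx j, dt] z)| <= Mf * ( |?m [dt] z| + gr (%j. ?m [dx j, dt]) z + |?U [dt] z| + gr (%j. ?U [dx j, dt]) z + |?U [dt, dt] z| + |?U [] z| + gr (%j. ?U [dx j]) z + |?m [] z| + gr (%j. ?m [dx j]) z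
   + |?J (?m [dt]) z| + |?J (?m []) z| + |b z - b' z| )"
   by (rule ballI, rule order_trans[OF est_w[OF ctx]], assumption, intro mult_right_mono Mf(7) add_nonneg_nonneg) simp_all
  have h11: "ALL z:Q. |b z - b' z| <= Mf * ( |?U [dt] (fst z, 0)| + ?eps)"
  proof
   fix z assume z: "z : Q"
   let ?z = "(fst z, 0)" and ?g = "?J (GM [])"
   have z0: "?z : Q" using Q_time[OF z, of 0] T_pos by simp
   have "|?U [dt] ?z + (b ?z - b' ?z) * ?g ?z| <= ?eps"
    by (rule le[OF slice_estimates(1)[OF cs z] Be(6) sq(2) ee(3)]) simp
   then have 1: "|(b ?z - b' ?z) * ?g ?z| <= |?U [dt] ?z| + ?eps" by linarith
   have "c * |b z - b' z| = |b ?z - b' ?z| * c" using sstatic(2,3)[OF ctx, of z] by (simp add: mult.commute)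
   also have "... <= |b ?z - b' ?z| * |?g ?z|" using gc z0 by (intro mult_left_mono) auto
   finally have "c * |b z - b' z| <= |?U [dt] ?z| + ?eps" using 1 by (simp add: abs_mult)
   then have "|b z - b' z| <= 1 / c * ( |?U [dt] ?z| + ?eps)" using c by (simp add: field_simps)
   also have "... <= Mf * ( |?U [dt] ?z| + ?eps)" using Mf(8) eps(1) by (intro mult_right_mono) auto
   finally show "|b z - b' z| <= Mf * ( |?U [dt] ?z| + ?eps)" .
  qed
  have "en mu (?U [dt]) + en mu (?m [dt]) <= C * (mu * Rem mu ?eps)"
   by (rule main[of mu ?eps "?U [dt]" "?U [dt, dt]" "%i. ?U [dx i, dt]" "%i j. ?U [dx j, dx i, dt]" "%i. ?U [dx i, dt, dt]"
    "?m [dt]" "?m [dt, dt]" "%i. ?m [dx i, dt]" "%i j. ?m [dx j, dx i, dt]" "%i. ?m [dx i, dt, dt]" r rt ri rij rti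
    "?U []" "?m []" "%j. ?U [dx j]" "%j. ?m [dx j]" "?J (?m [dt])" "?J (?m [])" "%z. b z - b' z"])
    (intro conjI mu eps c21_vw[OF cs] r h1 h2 h3 h4 h5 h6 h7 h8 h9[OF scont(6)[OF ctx]] h10 h11 h12; simp)
  also have "... <= C * (mu * Rem mu (max Be (Mf * Be) * ?e8))"
   unfolding Rem_def using C mu e8(1) by (intro mult_left_mono add_left_mono mult_right_mono) auto
  finally have 1: "en mu (?U [dt]) + en mu (?m [dt]) <= C * (mu * Rem mu (max Be (Mf * Be) * ?e8))" .
  have 2: "|b z - b' z| <= max Be (Mf * Be) * ( |?U [dt] (fst z, 0)| + ?e8)" if z: "z : Q" for z
  proof -
   have "|b z - b' z| <= Mf * ( |?U [dt] (fst z, 0)| + ?eps)" using h11 z by blast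
   also have "... <= Mf * (Be * |?U [dt] (fst z, 0)| + ?eps)" using Mf(1) Be(7) by (intro mult_left_mono add_right_mono) (auto simp: mult_le_cancel_right1)
   also have "... = (Mf * Be) * ( |?U [dt] (fst z, 0)| + ?e8)" by (simp add: algebra_simps)
   also have "... <= max Be (Mf * Be) * ( |?U [dt] (fst z, 0)| + ?e8)" using e8(1) by (intro mult_right_mono) auto
   finally show ?thesis .
  qed
  show "en mu (?U [dt]) + en mu (?m [dt]) <= C * (mu * Rem mu (max Be (Mf * Be) * ?e8)) &
   (ALL z:Q. |b z - b' z| <= max Be (Mf * Be) * ( |?U [dt] (fst z, 0)| + ?e8))" using 1 2 by blast
 qed
qed

end

section \<open>Choice of the large parameter and uniform bounds away from the unknown face\<close>

text \<open>Supplies the pieces for \<open>sup_le_L2\<close>. A cube of side \<open>s\<close> fits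
  into the box next to \<open>z\<close>: in each coordinate it extends upward from \<open>z\<close>
  where there is room and downward otherwise. With \<open>s = \<rho> / d\<close> all its points are
  within \<open>\<rho>\<close> of \<open>z\<close>.\<close>

lemma box_density:
 fixes p q z :: "'a::euclidean_space"
 assumes l: "0 < l" "!!i. i : Basis ==> 2 * l <= q \<bullet> i - p \<bullet> i" and z: "z : cbox p q" and r: "0 < \<rho>" "\<rho> <= l"
 shows "EX U:sets lborel. U \<subseteq> box p q & (ALL z':U. dist z' z <= \<rho>) &
  1 / real DIM('a) ^ DIM('a) * \<rho> ^ DIM('a) <= measure lborel U & emeasure lborel U < \<infinity>"
proof -
 define d where "d = real DIM('a)"
 have d: "d >= 1" unfolding d_def using DIM_positive[where 'a='a] by linarith
 define s where "s = \<rho> / d"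
 have s: "0 < s" "s <= l" using r d by (auto simp: s_def divide_le_eq intro: order_trans[of _ l] mult_left_le mult_le_cancel_left1)
 define a where "a = (\<Sum>i\<in>Basis. (if z \<bullet> i + s <= q \<bullet> i then z \<bullet> i else z \<bullet> i - s) *\<^sub>R i)"
 have ai: "a \<bullet> i = (if z \<bullet> i + s <= q \<bullet> i then z \<bullet> i else z \<bullet> i - s)" if "i : Basis" for i using that by (simp add: a_def)
 define b where "b = a + (\<Sum>i\<in>Basis. s *\<^sub>R i)"
 have bi: "b \<bullet> i = a \<bullet> i + s" if "i : Basis" for i using that by (simp add: b_def inner_add_left)
 have bd: "p \<bullet> i <= a \<bullet> i" "b \<bullet> i <= q \<bullet> i" "a \<bullet> i <= z \<bullet> i" "z \<bullet> i <= b \<bullet> i" if i: "i : Basis" for i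
 proof -
  have "p \<bullet> i <= z \<bullet> i" "z \<bullet> i <= q \<bullet> i" using z i by (auto simp: mem_box)
  then show "p \<bullet> i <= a \<bullet> i" "b \<bullet> i <= q \<bullet> i" "a \<bullet> i <= z \<bullet> i" "z \<bullet> i <= b \<bullet> i"
   using s l(2)[OF i] unfolding bi[OF i] ai[OF i] by (auto split: if_splits)
 qed
 have sub: "box a b \<subseteq> box p q"
 proof
  fix x assume "x : box a b"
  then show "x : box p q" using bd(1,2) unfolding mem_box by (meson le_less_trans less_le_trans)
 qed
 have dist: "dist x z <= \<rho>" if x: "x : box a b" for x
 proof -
  have "|(x - z) \<bullet> i| <= s" if i: "i : Basis" for i
   using x bd(3,4)[OF i] i unfolding mem_box inner_diff_left abs_le_iff by (auto dest!: bspec[of _ _ i] simp: bi)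
  then have "norm (x - z) <= DIM('a) * s" using norm_le_l1[of "x - z"] sum_bounded_above[of Basis "%i. |(x - z) \<bullet> i|" s] by simp
  also have "... = \<rho>" using d by (simp add: s_def d_def)
  finally show ?thesis by (simp add: dist_norm)
 qed
 have "measure lborel (box a b) = (\<Prod>i\<in>Basis. (b - a) \<bullet> i)"
  using s by (intro measure_lborel_box) (simp add: bi)
 also have "... = (\<Prod>i\<in>(Basis::'a set). s)" by (rule prod.cong) (simp_all add: inner_diff_left bi)
 also have "... = 1 / d ^ DIM('a) * \<rho> ^ DIM('a)" by (simp add: s_def power_divide)
 finally show ?thesis
  by (intro bexI[of _ "box a b"]) (use sub dist in \<open>auto simp: d_def emeasure_lborel_box_eq\<close>)
qed

text \<open>One term of the exponential series, with 720 = 6!. The sixth power is the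
  \<open>mu^5\<close> of \<open>Rem\<close> together with the factor \<open>mu\<close> of the energy
  estimate.\<close>

lemma power6_le_exp: "0 <= x ==> x ^ 6 <= 720 * exp x" for x :: real
 using exp_lower_Taylor_quadratic[of x] sum_le_suminf[OF summable_exp[of x], of "{6}"]
 by (simp add: exp_def scaleR_conv_of_real inverse_eq_divide mult.commute fact_numeral)

lemma powr_root_le:
 fixes x K y :: real
 assumes "0 <= x" "x ^ n <= K * y" "0 < y" "K >= 1" "0 < n"
 shows "x <= K * y powr (1 / real n)"
proof -
 have y: "(y powr (1 / real n)) ^ n = y"
  using assms by (subst powr_realpow[symmetric]) (simp_all add: powr_powr)
 have "x ^ n <= K ^ n * y"
  using assms self_le_power[of K n] mult_right_mono[of K "K ^ n" y] by linarith
 also have "... = (K * y powr (1 / real n)) ^ n" by (simp add: power_mult_distrib y)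
 finally show ?thesis using assms by (subst (asm) power_mono_iff) auto
qed

context space_time_box
begin

text \<open>\<open>mu\<close> is so chosen that the data part of \<open>Rem\<close> becomes
  \<open>exp (- 2 * mu * Y^2)\<close> and falls below the part from the unknown face. What remains
  is \<open>exp (2 * mu)\<close> against the squared weight
  \<open>exp (2 * mu * (1 + gam)^2)\<close>, a gain of at least
  \<open>exp (- 4 * gam * mu)\<close>.\<close>

lemma decay:
 assumes g: "gam > 0" and C: "C > 0" and B: "B >= 1"
 shows "EX e0 K \<theta>. 0 < e0 & e0 <= 1 & K >= 1 & 0 < \<theta> & (ALL e. 0 < e & e <= e0 --> (EX mu>=mu0.
  exp (- (2 * mu * (1 + gam)^2)) * (C * (mu * Rem mu (B * root8 e))) <= K * e powr \<theta>))"
proof -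
 define mu1 where "mu1 = max mu0 0"
 have Yp: "Y >= 1" by (rule Y_ge)
 \<comment> \<open>Ensures that the \<open>mu\<close> belonging to \<open>e\<close> reaches
   \<open>mu1\<close>, and hence the threshold of the energy estimate.\<close>
 define e1 where "e1 = exp (- 4 * Y^2 * mu1) / B"
 have e1: "0 < e1" "e1 <= 1"
 proof -
  have "exp (- 4 * Y^2 * mu1) <= 1" by (simp add: mu1_def)
  then have "exp (- 4 * Y^2 * mu1) <= B" using B by linarith
  then show "0 < e1" "e1 <= 1" using B by (simp_all add: e1_def divide_le_eq)
 qed
 \<comment> \<open>The exponent for which \<open>exp (- 2 * gam * mu)\<close> equals
   \<open>eps powr \<theta>\<close>. It is divided by 8 in the conclusion because \<open>eps\<close>
   is a multiple of \<open>root8 e\<close>.\<close>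
 define \<theta> where "\<theta> = gam / (2 * Y^2)"
 have th: "\<theta> > 0" using g Yp by (simp add: \<theta>_def)
 define K1 where "K1 = 2 * C * (720 / (2 * gam) ^ 6) * B powr \<theta>"
 show ?thesis
 proof (rule exI[of _ "e1 ^ 8"], rule exI[of _ "1 + K1"], rule exI[of _ "\<theta> / 8"], intro conjI allI impI; (elim conjE)?)
  show "0 < e1 ^ 8" "e1 ^ 8 <= 1" "0 < \<theta> / 8" using e1 th by (auto intro: power_le_one)
  show "1 <= 1 + K1" using C g B by (simp add: K1_def)
  fix e assume e: "0 < e" "e <= e1 ^ 8"
  define q where "q = root8 e"
  have q0: "q > 0" using e by (simp add: q_def)
  have qe: "q = e powr (1/8)" using e by (simp add: q_def powr_half_sqrt[symmetric] powr_powr)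
  have "q ^ 8 = e" using e by (simp add: qe powr_realpow[symmetric] powr_powr)
  then have q: "q <= e1" using e e1 q0 power_mono_iff[of q e1 8] by simp
  define eps where "eps = B * q"
  have eps: "0 < eps" "eps <= exp (- 4 * Y^2 * mu1)" using q0 B q by (auto simp: eps_def e1_def field_simps)
  define mu where "mu = - ln eps / (4 * Y^2)"
  have "ln eps <= - 4 * Y^2 * mu1" using eps ln_le_cancel_iff[of eps "exp (- 4 * Y^2 * mu1)"] by simp
  then have mu: "mu >= mu1" using Yp by (simp add: mu_def field_simps)
  then have mu0: "mu >= mu0" "mu >= 0" by (auto simp: mu1_def)
  have e4: "eps = exp (- 4 * mu * Y^2)" using eps Yp by (simp add: mu_def)
  have "exp (2 * mu * Y^2) * eps = exp (- 2 * mu * Y^2)" unfolding e4 exp_add[symmetric] by simp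
  also have "... <= 1" using mu0 by simp
  also have "1 <= exp (2 * mu)" using mu0 by simp
  finally have Rem: "Rem mu eps <= mu ^ 5 * (2 * exp (2 * mu))"
   unfolding Rem_def using mu0 by (intro mult_left_mono) auto
  have "exp (- (2 * mu * (1 + gam)^2)) * (C * (mu * Rem mu eps)) <= exp (- (2 * mu * (1 + gam)^2)) * (C * (mu * (mu ^ 5 * (2 * exp (2 * mu)))))"
   using mu0 C Rem by (intro mult_left_mono) auto
  also have "... = 2 * C * mu ^ 6 * (exp (- (2 * mu * (1 + gam)^2)) * exp (2 * mu))" by (simp add: eval_nat_numeral)
  \<comment> \<open>The gain is split in two: one half is spent on \<open>mu ^ 6\<close>, the other
    becomes the power of \<open>e\<close>.\<close>
  also have "exp (- (2 * mu * (1 + gam)^2)) * exp (2 * mu) <= exp (- 2 * gam * mu) * exp (- 2 * gam * mu)"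
  proof -
   have "- (2 * mu * (1 + gam)^2) + 2 * mu = - 4 * gam * mu - 2 * mu * gam^2" by (simp add: power2_eq_square algebra_simps)
   also have "... <= - 2 * gam * mu + - 2 * gam * mu" using mu0 by simp
   finally show ?thesis unfolding exp_add[symmetric] exp_le_cancel_iff .
  qed
  then have "2 * C * mu ^ 6 * (exp (- (2 * mu * (1 + gam)^2)) * exp (2 * mu)) <= 2 * C * mu ^ 6 * (exp (- 2 * gam * mu) * exp (- 2 * gam * mu))"
   using C mu0 by (intro mult_left_mono) auto
  also have "... <= 2 * C * (720 / (2 * gam) ^ 6) * exp (- 2 * gam * mu)"
  proof -
   have "(2 * gam * mu) ^ 6 <= 720 * exp (2 * gam * mu)" using g mu0 by (intro power6_le_exp) simp
   then have "mu ^ 6 <= 720 / (2 * gam) ^ 6 * exp (2 * gam * mu)" using g by (simp add: power_mult_distrib field_simps)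
   then have "mu ^ 6 * exp (- 2 * gam * mu) <= 720 / (2 * gam) ^ 6 * exp (2 * gam * mu) * exp (- 2 * gam * mu)" by (rule mult_right_mono) simp
   also have "... = 720 / (2 * gam) ^ 6" by (simp add: exp_minus)
   finally have "2 * C * exp (- 2 * gam * mu) * (mu ^ 6 * exp (- 2 * gam * mu)) <= 2 * C * exp (- 2 * gam * mu) * (720 / (2 * gam) ^ 6)"
    using C by (intro mult_left_mono) auto
   then show ?thesis by (simp only: mult_ac)
  qed
  also have "exp (- 2 * gam * mu) = eps powr \<theta>"
   using eps(1) Yp by (simp add: powr_def \<theta>_def mu_def field_simps)
  also have "... = B powr \<theta> * e powr (\<theta> / 8)" using e B by (simp add: eps_def qe powr_mult powr_powr)
  also have "2 * C * (720 / (2 * gam) ^ 6) * (B powr \<theta> * e powr (\<theta> / 8)) <= (1 + K1) * e powr (\<theta> / 8)"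
   by (simp add: K1_def algebra_simps)
  finally show "EX mu>=mu0. exp (- (2 * mu * (1 + gam)^2)) * (C * (mu * Rem mu (B * root8 e))) <= (1 + K1) * e powr (\<theta> / 8)"
   using mu0(1) unfolding eps_def q_def by blast
 qed
qed

definition pg where "pg gam = ((\<chi> k. if k = i0 then - A $ i0 + gam else - A $ k), 0::real)"
definition Qg where "Qg gam = cbox (pg gam) (A, T)"

lemma mem_Qg: assumes "0 < gam" "gam < 2 * A $ i0" shows "z : Qg gam \<longleftrightarrow> z : Q & - A $ i0 + gam <= fst z $ i0"
proof -
 define y where "y = fst z"
 have "(ALL k. (if k = i0 then - A $ i0 + gam else - A $ k) <= y $ k & y $ k <= A $ k) \<longleftrightarrow>
   (ALL k. - A $ k <= y $ k & y $ k <= A $ k) & - A $ i0 + gam <= y $ i0" (is "(ALL k. ?L k) \<longleftrightarrow> _")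
 proof
  assume l: "ALL k. ?L k"
  have yi: "- A $ i0 + gam <= y $ i0" using l[rule_format, of i0] by simp
  moreover have "- A $ k <= y $ k & y $ k <= A $ k" for k using l[rule_format, of k] yi assms by (cases "k = i0") auto
  ultimately show "(ALL k. - A $ k <= y $ k & y $ k <= A $ k) & - A $ i0 + gam <= y $ i0" by blast
 qed auto
 then show ?thesis by (cases z) (simp add: Qg_def pg_def cbox_Pair_eq mem_box_cart mem_Q y_def conj_ac)
qed

lemma Qg_len: "v : Basis ==> min lq (2 * A $ i0 - gam) <= (A, T) \<bullet> v - pg gam \<bullet> v"
proof (erule Basis_cases)
 fix i assume v: "v = dx i"
 have "lq <= (A, T) \<bullet> dx i - (- A, 0) \<bullet> dx i" by (rule lq(2)[OF dx_Basis])
 then show ?thesis unfolding v by (cases "i = i0") (auto simp: pg_def inner_dx)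
next
 assume v: "v = dt"
 have "lq <= (A, T) \<bullet> dt - (- A, 0) \<bullet> dt" by (rule lq(2)[OF dt_Basis])
 then show ?thesis unfolding v by (auto simp: pg_def inner_dt)
qed

lemma L2_sq_Qg:
 assumes f: "continuous_on Q f" and mu: "mu >= 0" and g: "0 < gam" "gam < 2 * A $ i0"
 shows "L2_sq lborel (Qg gam) f <= exp (- (2 * mu * (1 + gam)^2)) * en mu f"
  "set_integrable lborel (Qg gam) (%z. (f z)^2)"
proof -
 have sub: "Qg gam \<subseteq> Q" using mem_Qg[OF g] by blast
 have fg: "continuous_on (Qg gam) (%z. (f z)^2)" by (intro continuous_intros continuous_on_subset[OF f sub])
 have cE: "continuous_on S (%z. (E mu z)^2)" for S by (intro continuous_intros)
 show si: "set_integrable lborel (Qg gam) (%z. (f z)^2)" using borel_integrable_compact[OF _ fg] by (simp add: set_integrable_def Qg_def)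
 have "exp (2 * mu * (1 + gam)^2) * L2_sq lborel (Qg gam) f = integral (Qg gam) (%z. exp (2 * mu * (1 + gam)^2) * (f z)^2)"
  unfolding L2_sq_def set_borel_integral_eq_integral(2)[OF si] by simp
 also have "... <= integral (Qg gam) (%z. (E mu z)^2 * (f z)^2)"
 proof (rule integral_le)
  show "(%z. exp (2 * mu * (1 + gam)^2) * (f z)^2) integrable_on Qg gam" "(%z. (E mu z)^2 * (f z)^2) integrable_on Qg gam"
   unfolding Qg_def by (intro integrable_continuous continuous_intros continuous_on_subset[OF f sub[unfolded Qg_def]])+
  fix z assume z: "z : Qg gam"
  have "(1 + gam)^2 <= (yw z)^2" using z g unfolding mem_Qg[OF g] yw_def by (intro power_mono) auto
  then have "exp (2 * mu * (1 + gam)^2) <= (E mu z)^2" unfolding E_def power2_eq_square exp_add[symmetric]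
   using mu mult_left_mono[of "(1 + gam) * (1 + gam)" "yw z * yw z" mu] by simp
  then show "exp (2 * mu * (1 + gam)^2) * (f z)^2 <= (E mu z)^2 * (f z)^2" by (rule mult_right_mono) simp
 qed
 also have "... <= en mu f" unfolding en_def
  by (rule integral_subset_le[OF sub]) (auto simp: Q_def Qg_def intro!: integrable_continuous continuous_intros continuous_on_subset[OF f sub, unfolded Qg_def] f[unfolded Q_def])
 finally have "exp (- (2 * mu * (1 + gam)^2)) * (exp (2 * mu * (1 + gam)^2) * L2_sq lborel (Qg gam) f) <= exp (- (2 * mu * (1 + gam)^2)) * en mu f"
  by (intro mult_left_mono) auto
 then show "L2_sq lborel (Qg gam) f <= exp (- (2 * mu * (1 + gam)^2)) * en mu f"
  by (simp add: mult.assoc[symmetric] exp_add[symmetric])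
qed

lemma sup_Qg:
 assumes g: "0 < gam" "gam < 2 * A $ i0" and M: "M >= 1"
 shows "EX K>=1. ALL F. fam6 F & bd6 F M -->
  (ALL z:Qg gam. |F [dt] z| ^ (DIM((real^'n) \<times> real) + 2) <= K * L2_sq lborel (Qg gam) (F [dt]))"
proof -
 define d where "d = DIM((real^'n) \<times> real)"
 define l where "l = min lq (2 * A $ i0 - gam) / 2"
 have l: "l > 0" using g lq(1) by (simp add: l_def)
 define \<kappa> where "\<kappa> = 1 / real d ^ d"
 have d: "d > 0" by (simp add: d_def)
 then have k: "\<kappa> > 0" by (simp add: \<kappa>_def)
 define K where "K = 4 / \<kappa> * (max (M / l) (2 * (M * d))) ^ d"
 show ?thesis
 proof (intro exI[of _ "max 1 K"] conjI allI impI ballI, simp, elim conjE)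
  fix F z assume F: "fam6 F" and b: "bd6 F M" and z: "z : Qg gam"
  have sub: "Qg gam \<subseteq> Q" using mem_Qg[OF g] by blast
  have o: "okp 6 [dt]" "!!i. i : Basis ==> okp 6 [i, dt]" by (auto simp: ok_def parabolic_def)
  have L2: "L2_sq lborel (Qg gam) (F [dt]) >= 0" unfolding L2_sq_def set_lebesgue_integral_def by (intro integral_nonneg_AE) auto
  have "|F [dt] z| ^ (d + 2) <= 4 / \<kappa> * (max (M / l) (2 * (M * d))) ^ d * L2_sq lborel (Qg gam) (F [dt])"
  proof (rule sup_le_L2[OF _ _ _ _ l k _ L2_sq_Qg(2)[OF fam_cont[OF F o(1)] order_refl g] z])
   show "|F [dt] z' - F [dt] z| <= M * real d * dist z' z" if "z : Qg gam" "z' : Qg gam" for z z'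
    unfolding d_def
   proof (rule hpd_Lipschitz[of "- (A, - 0)" "(A, T)" "F [dt]" "%i. F [i, dt]"])
    show "hpd (cbox (- (A, - 0)) (A, T)) i (F [dt]) (F [i, dt])" if "i : Basis" for i
     using fam_hpd[OF F o(2)[OF that]] by (simp add: Q_def)
   qed (use b o that sub in \<open>auto simp: Q_def[symmetric] simp del: okp_simps\<close>)
   show "|F [dt] z| <= M" if "z : Qg gam" for z using b o(1) that sub by blast
   show "0 <= M * real d" "0 < M" using M by auto
   fix z \<rho> assume "z : Qg gam" "0 < \<rho>" "\<rho> <= l"
   then have "EX U:sets lborel. U \<subseteq> box (pg gam) (A, T) & (ALL z':U. dist z' z <= \<rho>) &
     1 / real DIM((real^'n) \<times> real) ^ DIM((real^'n) \<times> real) * \<rho> ^ DIM((real^'n) \<times> real) <= measure lborel U & emeasure lborel U < \<infinity>"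
    using Qg_len[of _ gam] by (intro box_density[OF l]) (auto simp: l_def Qg_def)
   then obtain U where "U : sets lborel" "U \<subseteq> box (pg gam) (A, T)" "ALL z':U. dist z' z <= \<rho>" "\<kappa> * \<rho> ^ d <= measure lborel U" "emeasure lborel U < \<infinity>"
    by (elim bexE conjE) (rule that; simp only: \<kappa>_def d_def)
   then show "EX U:sets lborel. U \<subseteq> Qg gam & (ALL z':U. dist z' z <= \<rho>) & \<kappa> * \<rho> ^ d <= measure lborel U & emeasure lborel U < \<infinity>"
    using subset_trans[OF _ box_subset_cbox(1)[of "pg gam" "(A, T)", folded Qg_def]] by (intro bexI[of _ U] conjI) (assumption | fast)+
  qed
  also have "... <= max 1 K * L2_sq lborel (Qg gam) (F [dt])" using L2 unfolding K_def by (intro mult_right_mono) auto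
  finally show "|F [dt] z| ^ (DIM((real^'n) \<times> real) + 2) <= max 1 K * L2_sq lborel (Qg gam) (F [dt])" by (simp only: d_def)
 qed
qed

text \<open>A list of parabolic order 2 has at most two entries, so there are at most two
  interpolations, each of which halves the exponent. This explains the \<open>4 * \<beta>\<close> in
  the hypothesis.\<close>

lemma derivatives_Qg:
 assumes F: "fam6 F" and b: "bd6 F M" and M: "M >= 0"
  and g: "0 < gam" "gam < 2 * A $ i0" and ws: "okp 2 ws" and e: "0 <= e" and K: "K >= 1"
  and s: "!!z. z : Qg gam ==> |F ws z| <= K * e powr (4 * \<beta>)" and e1: "e <= 1" and be: "\<beta> > 0" and vs: "okp 2 vs" and z: "z : Qg gam"
 shows "|F (vs @ ws) z| <= (Kst (min lq (2 * A $ i0 - gam)) M)^2 * K * e powr \<beta>"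
proof -
 let ?l = "min lq (2 * A $ i0 - gam)"
 define k where "k = Kst ?l M"
 have l: "?l > 0" using g lq(1) by simp
 have k: "k >= 1" unfolding k_def by (rule Kst_ge[OF l M])
 have sub: "cbox (pg gam) (A, T) \<subseteq> Q" using mem_Qg[OF g] unfolding Qg_def by blast
 have sq: "sqrt x <= x" if "x >= 1" for x :: real using that by (intro real_le_lsqrt) (auto simp: power2_eq_square mult_le_cancel_left1)
 have st: "|F (v # us) z| <= k * C * e powr (\<beta>' / 2)"
  if v: "v : Basis" "okp 6 (v # v # us)" and us: "!!z. z : Qg gam ==> |F us z| <= C * e powr \<beta>'" and C: "C >= 1" and z: "z : Qg gam" for v us C \<beta>' z
 proof -
  have "|F (v # us) z| <= k * sqrt (C * e powr \<beta>')"
   unfolding k_def using C e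
   by (intro interpolation_fam[OF F v(2) b v(1) sub l Qg_len[OF v(1)] _ us[unfolded Qg_def] z[unfolded Qg_def]]) auto
  also have "... = k * (sqrt C * e powr (\<beta>' / 2))" using e by (simp add: real_sqrt_mult powr_half_sqrt_powr)
  also have "... <= k * (C * e powr (\<beta>' / 2))" using k sq[OF C] by (intro mult_left_mono mult_right_mono) auto
  finally show ?thesis by (simp add: mult.assoc)
 qed
 have up: "C * e powr \<beta>' <= k^2 * K * e powr \<beta>" if "C <= k^2 * K" "\<beta> <= \<beta>'" for C \<beta>'
 proof -
  have "e powr \<beta>' <= e powr \<beta>" using e e1 that be by (cases "e = 0") (auto intro: powr_mono')
  then show ?thesis using that k K by (intro mult_mono) auto
 qed
 have k2: "1 <= k * K" "k * K <= k^2 * K" "K <= k^2 * K"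
 proof -
  have "1 * 1 <= k * K" using k K by (intro mult_mono) auto
  then show "1 <= k * K" by simp
  have "1 * (k * K) <= k * (k * K)" "1 * K <= k * K" using k K by (intro mult_right_mono; simp)+
  then show "k * K <= k^2 * K" "K <= k^2 * K" by (auto simp: power2_eq_square mult.assoc)
 qed
 consider "vs = []" | v where "vs = [v]" "v : Basis" | v v' where "vs = [v, v']" "v : Basis" "v' : Basis" "parabolic v = 1" "parabolic v' = 1"
 proof -
  have B: "set vs \<subseteq> Basis" "(\<Sum>v\<leftarrow>vs. parabolic v) <= 2" using vs by (auto simp: ok_def)
  then show thesis
  proof (cases vs)
   case (Cons v us)
   show thesis
   proof (cases us)
    case Nil then show thesis using that(2) Cons B by simp
   next
    case (Cons v' us')
    then have "parabolic v + parabolic v' + (\<Sum>v\<leftarrow>us'. parabolic v) <= 2" using B \<open>vs = v # us\<close> by simp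
    moreover have "us' = []"
    proof (rule ccontr)
     assume "us' ~= []"
     then obtain x xs where "us' = x # xs" by (cases us') auto
     then show False using calculation parabolic_ge[of v] parabolic_ge[of v'] parabolic_ge[of x] by simp
    qed
    ultimately show thesis using that(3)[of v v'] Cons \<open>vs = v # us\<close> B parabolic_ge[of v] parabolic_ge[of v'] by simp
   qed
  qed (use that(1) in simp)
 qed
 then have "|F (vs @ ws) z| <= k^2 * K * e powr \<beta>"
 proof cases
  case 1 then show ?thesis using s[OF z] up[OF k2(3), of "4 * \<beta>"] be by simp
 next
  case (2 v)
  \<comment> \<open>With \<open>v = dt\<close> and \<open>ws = [dt]\<close> the third time
    derivative of the solutions enters, the highest one that the class C^{6,3} provides.\<close>
  have o: "okp 6 (v # v # ws)" using ws 2 vs unfolding ok_def by simp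
  show ?thesis using st[OF 2(2) o s K z] up[OF k2(2), of "4 * \<beta> / 2"] be 2 by simp
 next
  case (3 v v')
  have o: "okp 6 (v' # v' # ws)" "okp 6 (v # v # v' # ws)" using ws 3 unfolding ok_def by simp_all
  have 1: "|F (v' # ws) z| <= k * K * e powr (4 * \<beta> / 2)" if "z : Qg gam" for z by (rule st[OF 3(3) o(1) s K that])
  have "|F (v # v' # ws) z| <= k * (k * K) * e powr (4 * \<beta> / 2 / 2)" by (rule st[OF 3(2) o(2) 1 k2(1) z])
  then show ?thesis using 3 by (simp add: power2_eq_square mult.assoc)
 qed
 then show ?thesis by (simp only: k_def)
qed

abbreviation near where
 "near gam eps F H b b' \<equiv> ALL z:Qg gam. (ALL vs. okp 2 vs --> |F vs z| <= eps & |F (vs @ [dt]) z| <= eps & |H vs z| <= eps & |H (vs @ [dt]) z| <= eps) & |b z - b' z| <= eps"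

text \<open>The weighted estimate gives uniform bounds for the time derivatives; integration in time
  from the small initial values gives them for u and m, and interpolation for all further
  derivatives.\<close>

lemma sup_stability:
 assumes M: "M >= 1" and c: "c > 0" and g: "0 < gam" "gam < 2 * A $ i0"
 shows "EX e0 K \<alpha>. 0 < e0 & e0 <= 1 & K >= 1 & 0 < \<alpha> & \<alpha> < 1 & (ALL FU GU FM GM a ai s st b b' K1 L e.
  sys M c FU GU FM GM a ai s st b b' K1 L & small e (dif FU GU) (dif FM GM) & 0 < e & e <= e0 -->
  (near gam (K * e powr \<alpha>) (dif FU GU) (dif FM GM) b b'))"
proof -
 obtain C mu0 B where C: "C > 0" "mu0 >= 1" "B >= 1" and es: "!!FU GU FM GM a ai s st b b' K L e mu.
  sys M c FU GU FM GM a ai s st b b' K L & small e (dif FU GU) (dif FM GM) & 0 <= e & e <= 1 & mu >= mu0 ==>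
  en mu (dif FU GU [dt]) + en mu (dif FM GM [dt]) <= C * (mu * Rem mu (B * root8 e)) &
  (ALL z:Q. |b z - b' z| <= B * ( |dif FU GU [dt] (fst z, 0)| + root8 e))"
  using energy_sys[OF M c] by (elim exE conjE) (rule that, assumption, assumption, assumption, elim allE impE, assumption+)
 obtain e0 K0 \<theta> where e0: "0 < e0" "e0 <= 1" and K0: "K0 >= 1" and th: "0 < \<theta>" and dec: "!!e. 0 < e ==> e <= e0 ==> EX mu>=mu0.
  exp (- (2 * mu * (1 + gam)^2)) * (C * (mu * Rem mu (B * root8 e))) <= K0 * e powr \<theta>"
  using decay[OF g(1) C(1,3), of mu0] by (elim exE conjE) (rule that, assumption+, elim allE impE, rule conjI, assumption+)
 have M2: "2 * M >= 1" "2 * M >= 0" using M by auto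
 define n where "n = DIM((real^'n) \<times> real) + 2"
 have n: "0 < n" by (simp add: n_def)
 obtain K1 where K1: "K1 >= 1" and sup: "!!F z. fam6 F ==> bd6 F (2 * M) ==>
  z : Qg gam ==> |F [dt] z| ^ n <= K1 * L2_sq lborel (Qg gam) (F [dt])"
  using sup_Qg[OF g M2(1)] unfolding n_def by blast
 \<comment> \<open>\<open>\<theta> * (1 / n)\<close> comes from passing to the uniform norm, 1 from
   the initial values, which are bounded by \<open>e\<close> itself, and \<open>1 / 8\<close> from
   \<open>root8 e\<close> in the bound for b1 - b2. A quarter of the minimum survives two
   interpolations.\<close>
 define \<alpha>1 where "\<alpha>1 = min (min (\<theta> * (1 / n)) 1) (1 / 8)"
 have a1: "0 < \<alpha>1" "\<alpha>1 <= \<theta> * (1 / n)" "\<alpha>1 <= 1" "\<alpha>1 <= 1 / 8"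
 proof -
  show "0 < \<alpha>1" using th n by (simp add: \<alpha>1_def)
  show "\<alpha>1 <= \<theta> * (1 / n)" "\<alpha>1 <= 1" "\<alpha>1 <= 1 / 8" unfolding \<alpha>1_def by (meson min.cobounded1 min.cobounded2 order_trans)+
 qed
 define K2 where "K2 = 1 + (1 + T) * (K1 * K0)"
 define kk where "kk = (Kst (min lq (2 * A $ i0 - gam)) (2 * M))^2"
 define Kf where "Kf = kk * K2 + B * (K2 + 1)"
 have K10: "1 <= K1 * K0" using mult_mono[of 1 K1 1 K0] K1 K0 by simp
 have K2: "K2 >= 1" "K1 * K0 <= K2" "1 + T * (K1 * K0) <= K2" using K10 T_pos by (auto simp: K2_def distrib_right)
 have kk: "kk >= 1" unfolding kk_def using Kst_ge[of "min lq (2 * A $ i0 - gam)" "2 * M"] lq(1) g M2 by (intro one_le_power) auto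
 have kK: "1 <= kk * K2" using mult_mono[of 1 kk 1 K2] kk K2 by simp
 have Kf: "Kf >= 1" "kk * K2 <= Kf" "B * (K2 + 1) <= Kf" unfolding Kf_def using kK C(3) K2 by (auto intro: add_increasing2)
 show ?thesis
 proof (rule exI[of _ e0], rule exI[of _ Kf], rule exI[of _ "\<alpha>1 / 4"], intro conjI e0 Kf allI impI ballI; (elim conjE)?)
  show "0 < \<alpha>1 / 4" "\<alpha>1 / 4 < 1" using a1 by auto
  fix FU GU FM GM a ai s st b b' Kx L e
  assume S: "sys M c FU GU FM GM a ai s st b b' Kx L" and sml: "small e (dif FU GU) (dif FM GM)" and e: "0 < e" "e <= e0"
  have e1: "0 <= e" "e <= 1" using e e0 by auto
  note ctx = S M c
  note D = sdfam[OF ctx] sdb[OF ctx]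
  obtain mu where mu: "mu >= mu0" and de: "exp (- (2 * mu * (1 + gam)^2)) * (C * (mu * Rem mu (B * root8 e))) <= K0 * e powr \<theta>"
   using dec[OF e] by blast
  have mu0: "mu >= 0" using mu C(2) by simp
  note en = es[OF conjI[OF S conjI[OF sml conjI[OF e1(1) conjI[OF e1(2) mu]]]]]
  have pm: "e powr x <= e powr y" if "y <= x" for x y using that e e1 by (simp add: powr_mono')
  have first: "|F [dt] z| <= K1 * K0 * e powr \<alpha>1"
   if F: "fam6 F" "bd6 F (2 * M)" and enF: "en mu (F [dt]) <= C * (mu * Rem mu (B * root8 e))"
    and z: "z : Qg gam" for F z
  proof -
   have "|F [dt] z| ^ n <= K1 * L2_sq lborel (Qg gam) (F [dt])" by (rule sup[OF F z])
   also have "... <= K1 * (exp (- (2 * mu * (1 + gam)^2)) * en mu (F [dt]))"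
    using K1 by (intro mult_left_mono L2_sq_Qg(1) fam_cont[OF F(1)] mu0 g) auto
   also have "... <= K1 * (exp (- (2 * mu * (1 + gam)^2)) * (C * (mu * Rem mu (B * root8 e))))"
    using K1 enF by (intro mult_left_mono) auto
   also have "... <= K1 * (K0 * e powr \<theta>)" using K1 de by (intro mult_left_mono) auto
   finally have "|F [dt] z| ^ n <= (K1 * K0) * e powr \<theta>" by (simp add: mult.assoc)
   then have "|F [dt] z| <= K1 * K0 * (e powr \<theta>) powr (1 / real n)"
    using e K10 n by (intro powr_root_le) auto
   also have "... <= K1 * K0 * e powr \<alpha>1"
    unfolding powr_powr using pm[OF a1(2)] K10 by (intro mult_left_mono) auto
   finally show ?thesis .
  qed
  have v1: "|dif FU GU [dt] z| <= K1 * K0 * e powr \<alpha>1" "|dif FM GM [dt] z| <= K1 * K0 * e powr \<alpha>1" if "z : Qg gam" for z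
   using conjunct1[OF en] en_nonneg[of mu "dif FU GU [dt]"] en_nonneg[of mu "dif FM GM [dt]"]
   by (intro first D that; linarith)+
  have K2e: "K1 * K0 * e powr \<alpha>1 <= K2 * e powr \<alpha>1" using K2(2) by (intro mult_right_mono) auto
  have zero: "|F [] z| <= K2 * e powr \<alpha>1"
   if F: "fam6 F" and ini: "!!z. z : Q ==> |F [] (fst z, 0)| <= e"
    and v: "!!z. z : Qg gam ==> |F [dt] z| <= K1 * K0 * e powr \<alpha>1" and z: "z : Qg gam" for F z
  proof -
   have sub: "cbox (pg gam) (A, T) \<subseteq> Q" using mem_Qg[OF g] unfolding Qg_def by blast
   have zQ: "z : Q" "snd z : {0..T}" using z mem_Qg[OF g] by (auto simp: mem_Q)
   have "|F [] (upd dt 0 z) - F [] z| <= (K1 * K0 * e powr \<alpha>1) * |0 - z \<bullet> dt|"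
    by (rule hpd_Lipschitz_line[OF hpd_subset[OF fam_hpd[OF F] sub] dt_Basis z[unfolded Qg_def]])
     (use v[unfolded Qg_def] T_pos dt_Basis in \<open>auto simp: pg_def inner_dt\<close>)
   also have "upd dt 0 z = (fst z, 0)" by (rule upd_dt)
   also have "(K1 * K0 * e powr \<alpha>1) * |0 - z \<bullet> dt| <= (K1 * K0 * e powr \<alpha>1) * T"
    using zQ(2) K10 by (intro mult_left_mono) (auto simp: inner_dt)
   finally have "|F [] z| <= e + (K1 * K0 * e powr \<alpha>1) * T" using ini[OF zQ(1)] by linarith
   moreover have "e <= e powr \<alpha>1" using pm[OF a1(3)] e by simp
   ultimately have "|F [] z| <= e powr \<alpha>1 + (K1 * K0 * e powr \<alpha>1) * T" by linarith
   then have "|F [] z| <= (1 + T * (K1 * K0)) * e powr \<alpha>1" by (simp add: algebra_simps)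
   also have "... <= K2 * e powr \<alpha>1" using K2(3) by (intro mult_right_mono) auto
   finally show ?thesis .
  qed
  have ini: "|dif FU GU [] (fst z, 0)| <= e" "|dif FM GM [] (fst z, 0)| <= e" if "z : Q" for z
   using sml that unfolding small_def by blast+
  have four: "\<alpha>1 = 4 * (\<alpha>1 / 4)" by simp
  fix z assume z: "z : Qg gam"
  have fin: "|F (vs @ ws) z| <= Kf * e powr (\<alpha>1 / 4)"
   if F: "fam6 F" "bd6 F (2 * M)" and ws: "okp 2 ws"
    and s: "!!z. z : Qg gam ==> |F ws z| <= K2 * e powr \<alpha>1" and vs: "okp 2 vs" for F ws vs
  proof -
   have s': "|F ws z| <= K2 * e powr (4 * (\<alpha>1 / 4))" if "z : Qg gam" for z using s[OF that] by simp
   have "|F (vs @ ws) z| <= kk * K2 * e powr (\<alpha>1 / 4)"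
    unfolding kk_def by (rule derivatives_Qg[OF F M2(2) g ws e1(1) K2(1) s' e1(2) _ vs z]) (use a1 in auto)
   also have "... <= Kf * e powr (\<alpha>1 / 4)" using Kf(2) by (intro mult_right_mono) auto
   finally show ?thesis .
  qed
  have v2: "|dif FU GU [dt] z| <= K2 * e powr \<alpha>1" "|dif FM GM [dt] z| <= K2 * e powr \<alpha>1" if "z : Qg gam" for z
   using v1[OF that] K2e by linarith+
  have o: "okp 2 ([] :: ((real^'n) \<times> real) list)" "okp 2 [dt :: (real^'n) \<times> real]" by simp_all
  show "|dif FU GU vs z| <= Kf * e powr (\<alpha>1 / 4)" "|dif FU GU (vs @ [dt]) z| <= Kf * e powr (\<alpha>1 / 4)"
   "|dif FM GM vs z| <= Kf * e powr (\<alpha>1 / 4)" "|dif FM GM (vs @ [dt]) z| <= Kf * e powr (\<alpha>1 / 4)" if "okp 2 vs" for vs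
   using fin[OF D(1,3) o(1) zero[OF D(1) ini(1) v1(1)] that] fin[OF D(2,4) o(1) zero[OF D(2) ini(2) v1(2)] that]
   by (simp_all add: fin[OF D(1,3) o(2) v2(1) that] fin[OF D(2,4) o(2) v2(2) that])
  have zQ: "z : Q" "(fst z, 0) : Qg gam" using z Q_time[of z 0] T_pos unfolding mem_Qg[OF g] by auto
  have "|b z - b' z| <= B * ( |dif FU GU [dt] (fst z, 0)| + root8 e)" using conjunct2[OF en] zQ(1) by blast
  also have "... <= B * (K2 * e powr \<alpha>1 + e powr \<alpha>1)"
  proof (intro mult_left_mono add_mono v2 zQ)
   have "root8 e = e powr (1 / 8)" using e by (simp add: powr_half_sqrt[symmetric] powr_powr)
   then show "root8 e <= e powr \<alpha>1" using pm[OF a1(4)] by simp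
  qed (use C in auto)
  also have "... = B * (K2 + 1) * e powr \<alpha>1" by (simp add: algebra_simps)
  also have "... <= Kf * e powr (\<alpha>1 / 4)" using Kf pm[of "\<alpha>1 / 4" \<alpha>1] a1 by (intro mult_mono) auto
  finally show "|b z - b' z| <= Kf * e powr (\<alpha>1 / 4)" .
 qed
qed

end

section \<open>From the mean field games system to the abstract system\<close>

lemma approach_bound:
 fixes f :: "'a::topological_space => real" and \<phi> :: "real => 'a"
 assumes f: "continuous_on C f" and p: "continuous_on {0..1} \<phi>" "\<phi> ` {0..1} \<subseteq> C" "\<phi> 0 = z"
  and s: "!!t. 0 < t ==> t < 1 ==> |f (\<phi> t)| <= e"
 shows "|f z| <= e"
proof -
 have c: "continuous_on (closure {0<..<1}) (%t. |f (\<phi> t)| )"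
  using p by (auto intro!: continuous_on_compose2[OF f] continuous_intros)
 have "|f (\<phi> 0)| <= e" by (rule continuous_le_on_closure[OF c]) (use s in auto)
 then show ?thesis using p by simp
qed

context space_time_box
begin

lemma Omega_box: "Omega A = box (- A) A"
 by (auto simp: Omega_def mem_box_cart)

lemma closure_Omega: "closure (Omega A) = Oc"
proof -
 have "box (- A) A ~= {}" using A_pos by (auto simp: box_ne_empty Basis_vec_def inner_axis)
 then show ?thesis by (simp add: Omega_box Oc_def)
qed

lemma Yc_cbox: "Yc = cbox (- bar i0 A) (bar i0 A)"
 by (rule set_eqI) (auto simp: mem_Yc mem_box_cart bar_def split: if_splits)

lemma closure_Omega': "closure (Omega' A i0) = Yc"
proof
 show "closure (Omega' A i0) \<subseteq> Yc"
  using closure_mono[OF Om'_Yc] compact_imp_closed[OF compact_Yc] by (simp add: Om'_def closure_closed)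
 show "Yc \<subseteq> closure (Omega' A i0)"
 proof
  fix y assume y: "y : Yc"
  have "(%n. (1 - inverse (real (Suc n))) *\<^sub>R y) \<longlonglongrightarrow> (1 - 0) *\<^sub>R y"
   by (intro tendsto_intros LIMSEQ_inverse_real_of_nat)
  moreover have "(1 - inverse (real (Suc n))) *\<^sub>R y : Omega' A i0" for n
  proof -
   define r where "r = 1 - inverse (real (Suc n))"
   have r: "0 <= r" "r < 1" by (auto simp: r_def field_simps)
   have "|r * y $ i| < A $ i" if "i ~= i0" for i
   proof -
    have "|y $ i| <= A $ i" using y that by (auto simp: mem_Yc)
    then have "|r * y $ i| <= r * A $ i" using r by (simp add: abs_mult mult_left_mono)
    also have "... < A $ i" using r A_pos[of i] by simp
    finally show ?thesis .
   qed
   then show ?thesis using y unfolding r_def[symmetric] Omega'_def by (auto simp: mem_Yc abs_less_iff minus_less_iff)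
  qed
  ultimately show "y : closure (Omega' A i0)" unfolding closure_sequential by (intro exI[of _ "%n. (1 - inverse (real (Suc n))) *\<^sub>R y"]) auto
 qed
qed

lemma fam_KR:
 assumes "fam Ob Basis isotropic 4 F" "ALL vs. ok Basis isotropic 4 vs --> (ALL z:Ob. |F vs z| <= M)"
 shows "ok Basis isotropic (4 - n) vs ==> n <= 4 ==> KR n M (F vs)"
proof (induction n arbitrary: vs)
 case 0
 then show ?case using assms(2) fam_cont[OF assms(1)] by simp
next
 case (Suc n)
 have o: "ok Basis isotropic (4 - n) (v # vs)" "ok Basis isotropic 4 (v # vs)" if "v : Basis" for v
  using Suc.prems that by (auto simp: ok_def)
 have ov: "ok Basis isotropic 4 vs" using Suc.prems by (auto simp: ok_def)
 have "hpd Ob v (F vs) (F (v # vs)) & KR n M (F (v # vs))" if "v : Basis" for v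
  using fam_hpd[OF assms(1) o(2)[OF that]] Suc.IH[OF o(1)[OF that]] Suc.prems by simp
 moreover have "ALL p:Ob. |F vs p| <= M" using assms(2) ov by blast
 ultimately show ?case using fam_cont[OF assms(1) ov] by (simp only: KR.simps) blast
qed

lemma K2_KR:
 assumes "K2 : C_class (closure (Omega A) \<times> closure (Omega A)) Basis isotropic 4"
  "C_norm (closure (Omega A) \<times> closure (Omega A)) Basis isotropic 4 K2 < M"
 shows "KR 2 M K2"
proof -
 note K = assms[unfolded closure_Omega Ob_Times[symmetric]]
 have nd: "(- A, - A) \<bullet> i < (A, A) \<bullet> i" if "i : Basis" for i :: "(real^'n) \<times> (real^'n)"
  using that A_pos by (auto simp: Basis_prod_def Basis_vec_def inner_axis)
 have "KR 2 M (pds Ob [] K2)"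
  by (rule fam_KR[OF C_class_fam[OF K(1)], where n=2])
   (use C_norm_bound[OF K(1)[unfolded Ob_def] order_refl nd _ K(2)[unfolded Ob_def]] in \<open>auto simp: Ob_def ok_def\<close>)
 then show ?thesis by (simp add: pds_def)
qed

text \<open>\<open>K1\<close> has derivatives only in the directions of \<open>K1_dirs\<close>. Its
  extension is constant in the two other directions, so a family on \<open>Ob\<close> arises by
  assigning 0 to every list that contains one of these.\<close>

lemma K1_KR:
 assumes "K1 : C_class (closure (Omega' A i0) \<times> closure (Omega' A i0)) (K1_dirs i0) isotropic 4"
  "C_norm (closure (Omega' A i0) \<times> closure (Omega' A i0)) (K1_dirs i0) isotropic 4 K1 < M"
 shows "KR 2 M (barK K1)"
proof -
 define S where "S = cbox (- bar i0 A, - bar i0 A) (bar i0 A, bar i0 A)"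
 have S: "closure (Omega' A i0) \<times> closure (Omega' A i0) = S"
  by (simp add: closure_Omega' Yc_cbox S_def cbox_Pair_eq)
 note K = assms[unfolded S]
 have nd: "(- bar i0 A, - bar i0 A) \<bullet> i < (bar i0 A, bar i0 A) \<bullet> i" if "i : K1_dirs i0" for i
 proof -
  have ax: "axis j (1::real) $ i0 = (if j = i0 then 1 else 0)" for j by (simp add: axis_def)
  show ?thesis using that A_pos by (auto simp: K1_dirs_def Basis_prod_def Basis_vec_def inner_axis bar_def ax split: if_splits)
 qed
 have D: "K1_dirs i0 \<subseteq> Basis" by (auto simp: K1_dirs_def)
 note F = C_class_fam[OF K(1)] and bd = C_norm_bound[OF K(1)[unfolded S_def] D nd _ K(2)[unfolded S_def], folded S_def]
 define \<pi> where "\<pi> p = (bar i0 (fst p), bar i0 (snd p))" for p :: "(real^'n) \<times> (real^'n)"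
 define G where "G vs p = (if set vs \<subseteq> K1_dirs i0 then pds S vs K1 (\<pi> p) else 0)" for vs p
 have pi: "\<pi> p : S" if "p : Ob" for p
  using that by (auto simp: \<pi>_def S_def Ob_def cbox_Pair_eq mem_box_cart bar_def)
 have cb: "continuous_on X (%p. bar i0 (f p))" if "continuous_on X f" for X :: "((real^'n) \<times> (real^'n)) set" and f
  unfolding bar_def
 proof (rule continuous_on_vec_lambda)
  show "continuous_on X (%x. if i = i0 then 0 else f x $ i)" for i
   using that by (cases "i = i0") (auto intro!: continuous_intros)
 qed
 have pc: "continuous_on Ob \<pi>" unfolding \<pi>_def[abs_def] by (intro continuous_intros cb)
 have ok: "ok (K1_dirs i0) isotropic 4 vs" if "ok Basis isotropic 4 vs" "set vs \<subseteq> K1_dirs i0" for vs using that by (auto simp: ok_def)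
 have famG: "fam Ob Basis isotropic 4 G"
  unfolding fam_def
 proof (intro conjI allI impI)
  fix v :: "(real^'n) \<times> (real^'n)" and vs assume o: "ok Basis isotropic 4 (v # vs)"
  then have v: "v : Basis" by (simp add: ok_def)
  have bl: "bar i0 (x + h *\<^sub>R y) = bar i0 x + h *\<^sub>R bar i0 y" for x y h by (simp add: bar_def vec_eq_iff)
  show "hpd Ob v (G vs) (G (v # vs))"
  proof (cases "v : K1_dirs i0")
   case True
   then have bv: "bar i0 (fst v) = fst v" "bar i0 (snd v) = snd v" by (auto simp: K1_dirs_def bar_def vec_eq_iff)
   show ?thesis
   proof (cases "set vs \<subseteq> K1_dirs i0")
    case vs: True
    have "hpd S v (pds S vs K1) (pds S (v # vs) K1)" by (rule fam_hpd[OF F ok[OF o]]) (use True vs in auto)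
    then have "hpd Ob v (%p. pds S vs K1 (\<pi> p)) (%p. pds S (v # vs) K1 (\<pi> p))"
     by (rule hpd_affine) (simp_all add: pi bl bv, simp add: \<pi>_def bl bv prod_eq_iff)
    then show ?thesis using True vs by (simp add: G_def[abs_def])
   next
    case False then show ?thesis by (simp add: G_def[abs_def])
   qed
  next
   case False
   have "fst v $ i0 ~= 0 \<or> snd v $ i0 ~= 0" using False v by (simp add: K1_dirs_def)
   then have bv: "bar i0 (fst v) = 0" "bar i0 (snd v) = 0"
    using v by (auto simp: Basis_prod_def Basis_vec_def bar_def vec_eq_iff axis_def split: if_splits)
   have "hpd Ob v (G vs) (%_. 0)" by (rule hpd_trivial) (simp add: G_def \<pi>_def bl bv)
   then show ?thesis using False by (simp add: G_def[abs_def])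
  qed
 next
  fix vs assume o: "ok Basis isotropic 4 (vs :: ((real^'n) \<times> (real^'n)) list)"
  show "continuous_on Ob (G vs)"
  proof (cases "set vs \<subseteq> K1_dirs i0")
   case True
   have "continuous_on Ob (%p. pds S vs K1 (\<pi> p))"
    by (rule continuous_on_compose2[OF fam_cont[OF F ok[OF o True]] pc]) (use pi in auto)
   then show ?thesis using True by (simp add: G_def[abs_def])
  qed (simp add: G_def[abs_def])
 qed
 have bG: "ALL vs. ok Basis isotropic 4 vs --> (ALL z:Ob. |G vs z| <= M)"
 proof (intro allI impI ballI)
  fix vs z assume o: "ok Basis isotropic 4 (vs :: ((real^'n) \<times> (real^'n)) list)" and z: "z : Ob"
  show "|G vs z| <= M"
  proof (cases "set vs \<subseteq> K1_dirs i0")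
   case True then show ?thesis using bd[OF _ _ ok[OF o True] pi[OF z]] by (simp add: G_def)
  next
   case False
   \<comment> \<open>The bound of \<open>K1\<close> itself shows that \<open>M\<close> is
     nonnegative, as the zero functions require.\<close>
   have "ok (K1_dirs i0) isotropic 4 []" by (simp add: ok_def)
   then have "|pds S [] K1 (\<pi> z)| <= M" using bd[OF _ _ _ pi[OF z]] by simp
   then show ?thesis using False by (simp add: G_def)
  qed
 qed
 have "KR 2 M (G [])" by (rule fam_KR[OF famG bG]) (simp_all add: ok_def)
 then show ?thesis by (simp add: G_def[abs_def] pds_def \<pi>_def)
qed

lemma C_class_Q:
 assumes "f : C_class (closure (Q_T A T)) Basis parabolic k" "C_norm (closure (Q_T A T)) Basis parabolic k f < M"
 shows "fam Q Basis parabolic k (%vs. pds Q vs f)" "!!vs z. okp k vs ==> z : Q ==> |pds Q vs f z| <= M"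
 using C_class_fam[OF assms(1)] C_norm_bound[OF assms(1)[unfolded closure_Q_T Q_def] order_refl Q_nondegenerate parabolic_ge assms(2)[unfolded closure_Q_T Q_def]]
 by (simp_all add: closure_Q_T Q_def)

lemma C_class_Oc:
 assumes "f : C_class (closure (Omega A)) Basis isotropic k" "C_norm (closure (Omega A)) Basis isotropic k f < M"
 shows "fam Oc Basis isotropic k (%vs. pds Oc vs f)" "!!vs z. ok Basis isotropic k vs ==> z : Oc ==> |pds Oc vs f z| <= M"
proof -
 have nd: "(- A) \<bullet> i < A \<bullet> i" if "i : Basis" for i
  using that A_pos by (auto simp: Basis_vec_def inner_axis)
 show "fam Oc Basis isotropic k (%vs. pds Oc vs f)" "!!vs z. ok Basis isotropic k vs ==> z : Oc ==> |pds Oc vs f z| <= M"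
  using C_class_fam[OF assms(1)] C_norm_bound[OF assms(1)[unfolded closure_Omega Oc_def] order_refl nd _ assms(2)[unfolded closure_Omega Oc_def]]
  by (simp_all add: closure_Omega Oc_def)
qed

lemma static_R0:
 assumes "fam Oc Basis isotropic k F" "!!z. z : Oc ==> |F vs z| <= M" "ok Basis isotropic k vs"
 shows "R0 M (%z. F vs (fst z))"
 unfolding R0_def using assms(2) fam_cont[OF assms(1,3)]
 by (auto simp: Q_Times' intro!: continuous_on_compose2[OF fam_cont[OF assms(1,3)]] continuous_intros)

lemma open_Q_T: "open (Q_T A T)" "Q_T A T \<subseteq> Q"
 using closure_subset[of "Q_T A T"] closure_Q_T by (auto simp: Q_T_def Omega_box intro: open_Times)

lemma interaction_Iop: "interaction A i0 K1 K2 m x t = Iop (barK K1) K2 m (x, t)"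
 by (simp add: interaction_eq Iop_def)

lemma zero_on_Q:
 assumes "continuous_on Q f" "!!z. z : Q_T A T ==> f z = (0::real)" "z : Q"
 shows "f z = 0"
 using continuous_constant_on_closure[of "Q_T A T" f 0 z] assms closure_Q_T by simp

text \<open>The system is assumed in the open cylinder, with derivatives relative to it. It is
  evaluated at t = 0 and t = T, so it is extended by continuity to the closed box, with one-sided
  derivatives.\<close>

lemma MFGS_on_Q:
 fixes K1 K2 a s b u m
 defines "FU \<equiv> %vs. pds Q vs u" and "FM \<equiv> %vs. pds Q vs m" and "K \<equiv> %p. K1 (bar i0 (fst p), bar i0 (snd p))"
 assumes fam: "fam6 FU" "fam6 FM" "fam Oc Basis isotropic 3 (%vs. pds Oc vs a)"
  and co: "continuous_on Oc b" "continuous_on Q s" "continuous_on Ob K" "continuous_on Ob K2"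
  and sol: "solves_MFGS A T i0 K1 K2 a s b u m" and z: "z : Q"
 shows "FU [dt] z + (SS j. FU [dx j, dx j] z) - a (fst z) / 2 * (SS j. (FU [dx j] z)^2)
   + b (fst z) * Iop K K2 (FM []) z + s z * FM [] z = 0"
  "FM [dt] z - (SS j. FM [dx j, dx j] z) -
   (SS j. pds Oc [axis j 1] a (fst z) * FM [] z * FU [dx j] z + a (fst z) * FM [dx j] z * FU [dx j] z + a (fst z) * FM [] z * FU [dx j, dx j] z) = 0"
proof -
 note op = open_Q_T
 have oa: "ok Basis isotropic 3 []" "ok Basis isotropic 3 [axis j 1 :: real^'n]" for j by (auto simp: ok_def)
 have n: "pds Q [] f = f" "pds Oc [] a = a" for f by (simp_all add: pds_def)
 have mU: "FU [] = u" and mM: "FM [] = m" by (simp_all add: FU_def FM_def n)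
 have comp: "continuous_on Q (%z. f (fst z))" if "continuous_on Oc f" for f :: "real^'n => real"
  by (rule continuous_on_compose2[OF that]) (auto simp: Q_Times' intro!: continuous_intros)
 have ca: "continuous_on Q (%z. a (fst z))" "continuous_on Q (%z. pds Oc [axis j 1] a (fst z))" for j
  using comp[OF fam_cont[OF fam(3) oa(1)]] comp[OF fam_cont[OF fam(3) oa(2)]] by (simp_all add: n)
 have cU: "continuous_on Q (FU vs)" "continuous_on Q (FM vs)" if "okp 6 vs" for vs
  using fam_cont[OF fam(1) that] fam_cont[OF fam(2) that] by auto
 have dF: "pd (Q_T A T) dt f z = pds Q [dt] f z" "pd (Q_T A T) (dx i) (pd (Q_T A T) (dx j) f) z = pds Q [dx i, dx j] f z"
  "pd (Q_T A T) (dx i) f z = pds Q [dx i] f z"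
  if "fam6 (%vs. pds Q vs f)" "z : Q_T A T" for f z i j
  using pds_fam[OF that(1) op, of f "[dt]" z] pds_fam[OF that(1) op, of f "[dx i, dx j]" z] pds_fam[OF that(1) op, of f "[dx i]" z] that(2)
  by (simp_all add: pds_def)
 have da: "hpd Q (dx i) (%z. a (fst z)) (%z. pds Oc [axis i 1] a (fst z))" for i
 proof -
  have "hpd Oc (axis i 1) a (pds Oc [axis i 1] a)" using fam_hpd[OF fam(3) oa(2)] by (simp add: n)
  then show ?thesis by (rule hpd_affine) (auto simp: Q_Times')
 qed
 have dv: "pd (Q_T A T) (dx i) (%z. a (fst z) * m z * pd (Q_T A T) (dx i) u z) z =
   pds Oc [axis i 1] a (fst z) * FM [] z * FU [dx i] z + a (fst z) * FM [dx i] z * FU [dx i] z + a (fst z) * FM [] z * FU [dx i, dx i] z"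
  if z: "z : Q_T A T" for z i
 proof -
  have h: "hpd Q (dx i) m (FM [dx i])" "hpd Q (dx i) (FU [dx i]) (FU [dx i, dx i])"
   using fam_hpd[OF fam(2), of "dx i" "[]"] fam_hpd[OF fam(1), of "dx i" "[dx i]"] by (simp_all add: mM)
  have "pd (Q_T A T) (dx i) (%z. a (fst z) * m z * pd (Q_T A T) (dx i) u z) z = pd (Q_T A T) (dx i) (%z. a (fst z) * m z * FU [dx i] z) z"
   by (rule pd_cong) (use dF(3)[OF fam(1)[unfolded FU_def]] z in \<open>auto simp: FU_def\<close>)
  also have "... = (pds Oc [axis i 1] a (fst z) * m z + a (fst z) * FM [dx i] z) * FU [dx i] z + a (fst z) * m z * FU [dx i, dx i] z"
   by (rule pd_hpd[OF hpd_subset[OF hpd_mult[OF hpd_mult[OF da h(1)] h(2)] op(2)] z open_islimpt[OF op(1) z]])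
  finally show ?thesis by (simp add: mM algebra_simps)
 qed
 note sol' = sol[unfolded solves_MFGS_def Let_def]
 have c1: "continuous_on Q (%z. FU [dt] z + (SS j. FU [dx j, dx j] z) - a (fst z) / 2 * (SS j. (FU [dx j] z)^2)
   + b (fst z) * Iop K K2 (FM []) z + s z * FM [] z)"
  by (intro continuous_intros ca cU co comp Iop_cont) (auto simp: ok_def)
 show "FU [dt] z + (SS j. FU [dx j, dx j] z) - a (fst z) / 2 * (SS j. (FU [dx j] z)^2)
   + b (fst z) * Iop K K2 (FM []) z + s z * FM [] z = 0"
 proof (rule zero_on_Q[OF c1 _ z])
  fix z assume z: "z : Q_T A T"
  show "FU [dt] z + (SS j. FU [dx j, dx j] z) - a (fst z) / 2 * (SS j. (FU [dx j] z)^2)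
   + b (fst z) * Iop K K2 (FM []) z + s z * FM [] z = 0"
   using bspec[OF sol' z] dF[OF fam(1)[unfolded FU_def] z]
   by (cases z) (simp add: FU_def mM interaction_Iop K_def)
 qed
 have c2: "continuous_on Q (%z. FM [dt] z - (SS j. FM [dx j, dx j] z) -
   (SS j. pds Oc [axis j 1] a (fst z) * FM [] z * FU [dx j] z + a (fst z) * FM [dx j] z * FU [dx j] z + a (fst z) * FM [] z * FU [dx j, dx j] z))"
  by (intro continuous_intros ca cU) simp_all
 show "FM [dt] z - (SS j. FM [dx j, dx j] z) -
   (SS j. pds Oc [axis j 1] a (fst z) * FM [] z * FU [dx j] z + a (fst z) * FM [dx j] z * FU [dx j] z + a (fst z) * FM [] z * FU [dx j, dx j] z) = 0"
 proof (rule zero_on_Q[OF c2 _ z])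
  fix z assume z: "z : Q_T A T"
  show "FM [dt] z - (SS j. FM [dx j, dx j] z) -
   (SS j. pds Oc [axis j 1] a (fst z) * FM [] z * FU [dx j] z + a (fst z) * FM [dx j] z * FU [dx j] z + a (fst z) * FM [] z * FU [dx j, dx j] z) = 0"
   using bspec[OF sol' z] dF[OF fam(2)[unfolded FM_def] z] dv[OF z]
   by (cases z) (simp add: FM_def)
 qed
qed

section \<open>Reduction of the theorem\<close>

definition config where
 "config M c K1 K2 a s u m b \<longleftrightarrow> admissible_coefficients A T i0 M K1 K2 a s &
  (ALL i:{1, 2::nat}. (u i, m i) : Y1 A T M & b i : Y2 A M & solves_MFGS A T i0 K1 K2 a s (b i) (u i) (m i)) &
  (ALL (x, t):closure (Q_T A T). c <= |interaction A i0 K1 K2 (m 2) x t| )"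

abbreviation "Fu u i \<equiv> (%vs. pds Q vs (u (i::nat)))"

abbreviation "Fd u \<equiv> dif (Fu u 1) (Fu u 2)"

text \<open>The bound is raised because the estimates assume one that is at least 1, while the
  theorem has only \<open>M > 0\<close>; the lemma is used with \<open>M + 1\<close>.\<close>

lemma config_sys:
 assumes cf: "config M c K1 K2 a s u m b" and M': "M < M'"
 shows "sys M' c (Fu u 1) (Fu u 2) (Fu m 1) (Fu m 2) (%z. a (fst z)) (%j z. pds Oc [axis j 1] a (fst z)) s (pds Q [dt] s)
  (%z. b 1 (fst z)) (%z. b 2 (fst z)) (barK K1) K2"
proof -
 note adm = cf[unfolded config_def admissible_coefficients_def]
 have K: "KR 2 M' (barK K1)" "KR 2 M' K2"
  by (rule K1_KR, use adm in blast, rule less_trans[OF _ M'], use adm in blast,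
    rule K2_KR, use adm in blast, rule less_trans[OF _ M'], use adm in blast)
 have aC: "a : C_class (closure (Omega A)) Basis isotropic 3" "C_norm (closure (Omega A)) Basis isotropic 3 a < M'"
  and sC: "s : C_class (closure (Q_T A T)) Basis parabolic 2" "C_norm (closure (Q_T A T)) Basis parabolic 2 s < M'" using adm less_trans[OF _ M'] by blast+
 have i: "u i : C_class (closure (Q_T A T)) Basis parabolic 6" "C_norm (closure (Q_T A T)) Basis parabolic 6 (u i) < M'"
  "m i : C_class (closure (Q_T A T)) Basis parabolic 6" "C_norm (closure (Q_T A T)) Basis parabolic 6 (m i) < M'"
  "b i : C_class (closure (Omega A)) Basis isotropic 4" "C_norm (closure (Omega A)) Basis isotropic 4 (b i) < M'"
  "solves_MFGS A T i0 K1 K2 a s (b i) (u i) (m i)" if "i : {1, 2}" for i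
 proof -
  have 0: "(u i, m i) : Y1 A T M" "b i : Y2 A M" "solves_MFGS A T i0 K1 K2 a s (b i) (u i) (m i)"
   using cf that unfolding config_def by blast+
  note 1 = 0(1)[unfolded Y1_def mem_Collect_eq prod.case] 0(2)[unfolded Y2_def mem_Collect_eq]
  show "u i : C_class (closure (Q_T A T)) Basis parabolic 6" "C_norm (closure (Q_T A T)) Basis parabolic 6 (u i) < M'"
   "m i : C_class (closure (Q_T A T)) Basis parabolic 6" "C_norm (closure (Q_T A T)) Basis parabolic 6 (m i) < M'"
   "b i : C_class (closure (Omega A)) Basis isotropic 4" "C_norm (closure (Omega A)) Basis isotropic 4 (b i) < M'"
   "solves_MFGS A T i0 K1 K2 a s (b i) (u i) (m i)"
   using 1 0(3) less_trans[OF _ M'] by blast+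
 qed
 note aF = C_class_Oc[OF aC] and sF = C_class_Q[OF sC]
 note uF = C_class_Q[OF i(1,2)] and mF = C_class_Q[OF i(3,4)] and bF = C_class_Oc[OF i(5,6)]
 have n: "pds S [] f = f" for S and f :: "'z::real_normed_vector => real" by (simp add: pds_def)
 have st: "R0 M' (%z. f (fst z))" if "fam Oc Basis isotropic k (%vs. pds Oc vs f)" "!!vs z. ok Basis isotropic k vs ==> z : Oc ==> |pds Oc vs f z| <= M'" for f k
  using static_R0[OF that(1), of "[]" M'] that(2)[of "[]"] by (simp add: n ok_def)
 have a': "R0 M' (%z. pds Oc [axis j 1] a (fst z))" for j
  by (rule static_R0[OF aF(1)]) (use aF(2) in \<open>auto simp: ok_def\<close>)
 have s': "R0 M' s" "R0 M' (pds Q [dt] s)"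
  using sF(2)[of "[]"] sF(2)[of "[dt]"] fam_cont[OF sF(1), of "[]"] fam_cont[OF sF(1), of "[dt]"] by (simp_all add: n R0_def)
 have bR: "R0 M' (%z. b i (fst z))" if "i : {1, 2}" for i by (rule st[OF bF[OF that that]])
 have cb: "continuous_on Oc (b i)" if "i : {1, 2}" for i using fam_cont[OF bF(1)[OF that that], of "[]"] by (simp add: n ok_def)
 have cs: "continuous_on Q s" using s'(1) by (simp add: R0_def)
 have pde: "ALL z:Q. Fu u i [dt] z + (SS j. Fu u i [dx j, dx j] z) - a (fst z) / 2 * (SS j. (Fu u i [dx j] z)^2)
   + b i (fst z) * Iop (barK K1) K2 (Fu m i []) z + s z * Fu m i [] z = 0 &
  Fu m i [dt] z - (SS j. Fu m i [dx j, dx j] z) - (SS j. pds Oc [axis j 1] a (fst z) * Fu m i [] z * Fu u i [dx j] z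
   + a (fst z) * Fu m i [dx j] z * Fu u i [dx j] z + a (fst z) * Fu m i [] z * Fu u i [dx j, dx j] z) = 0" if "i : {1, 2}" for i
  by (intro ballI conjI MFGS_on_Q[OF uF(1)[OF that that] mF(1)[OF that that] aF(1) cb[OF that] cs _ _ i(7)[OF that]])
   (use KR_0[OF K(1)] KR_0[OF K(2)] in auto)
 have c: "ALL z:Q. c <= |Iop (barK K1) K2 (Fu m 2 []) z|"
  using cf unfolding config_def interaction_Iop closure_Q_T by (auto simp: n)
 have hs: "hpd Q dt s (pds Q [dt] s)" using fam_hpd[OF sF(1), of dt "[]"] by (simp add: n)
 have one: "(1::nat) : {1, 2}" "(2::nat) : {1, 2}" by auto
 note f12 = uF[OF one(1) one(1)] uF[OF one(2) one(2)] mF[OF one(1) one(1)] mF[OF one(2) one(2)]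
 have h1: "ALL F:{Fu u 1, Fu u 2, Fu m 1, Fu m 2}. fam6 F & (ALL vs. okp 6 vs --> (ALL z:Q. |F vs z| <= M'))"
  using f12 by blast
 have h2: "ALL f:{%z. a (fst z), s, pds Q [dt] s, %z. b 1 (fst z), %z. b 2 (fst z)} \<union> range (%j z. pds Oc [axis j 1] a (fst z)). R0 M' f"
  using st[OF aF] s' bR[OF one(1)] bR[OF one(2)] a' by blast
 have h3: "ALL f:{%z. a (fst z), %z. b 1 (fst z), %z. b 2 (fst z)} \<union> range (%j z. pds Oc [axis j 1] a (fst z)). ALL z. f z = f (fst z, 0)"
  by auto
 show ?thesis
  unfolding sys_def
 proof (intro conjI K hs c h1 h2 h3, rule ballI)
  fix p assume "p : {(Fu u 1, Fu m 1, %z::(real^'n) \<times> real. b 1 (fst z)), (Fu u 2, Fu m 2, %z::(real^'n) \<times> real. b 2 (fst z))}"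
  then consider "p = (Fu u 1, Fu m 1, %z::(real^'n) \<times> real. b 1 (fst z))" | "p = (Fu u 2, Fu m 2, %z::(real^'n) \<times> real. b 2 (fst z))" by blast
  then show "case p of (F, H, b) => ALL z:Q. F [dt] z + (SS j. F [dx j, dx j] z) - a (fst z) / 2 * (SS j. (F [dx j] z)^2)
    + b z * Iop (barK K1) K2 (H []) z + s z * H [] z = 0 &
   H [dt] z - (SS j. H [dx j, dx j] z) - (SS j. pds Oc [axis j 1] a (fst z) * H [] z * F [dx j] z
    + a (fst z) * H [dx j] z * F [dx j] z + a (fst z) * H [] z * F [dx j, dx j] z) = 0"
  proof cases
   case 1 show ?thesis unfolding 1 prod.case by (rule pde[OF one(1)])
  next
   case 2 show ?thesis unfolding 2 prod.case by (rule pde[OF one(2)])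
  qed
 qed
qed

subsection \<open>From \<open>L\<^sub>2\<close> data to uniformly small data\<close>

lemma fam_Lipschitz:
 assumes F: "fam6 F" "bd6 F M" and o: "okp 4 vs" and z: "z : Q" "z' : Q"
 shows "|F vs z' - F vs z| <= M * DIM((real^'n) \<times> real) * dist z' z"
proof -
 have o': "okp 6 (i # vs)" if "i : Basis" for i using o that unfolding ok_def by (auto simp: parabolic_def)
 show ?thesis
  by (rule hpd_Lipschitz[of "(- A, 0)" "(A, T)" "F vs" "%i. F (i # vs)", folded Q_def])
   (use fam_hpd[OF F(1) o'] F(2) o' z in auto)
qed

lemma sup_Omega:
 assumes M: "M >= 1"
 shows "EX K>=1. ALL F t. fam6 F & bd6 F M & t : {0..T} -->
  (ALL x:Omega A. |F [] (x, t)| ^ (CARD('n) + 2) <= K * L2_sq lborel (Omega A) (%x. F [] (x, t)))"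
proof -
 define d where "d = DIM(real^'n)"
 define D where "D = real DIM((real^'n) \<times> real)"
 define l where "l = lq / 2"
 define \<kappa> where "\<kappa> = 1 / real d ^ d"
 have l: "l > 0" using lq(1) by (simp add: l_def)
 have k: "\<kappa> > 0" by (simp add: \<kappa>_def d_def)
 define K where "K = 4 / \<kappa> * (max (M / l) (2 * (M * D))) ^ d"
 show ?thesis
 proof (intro exI[of _ "max 1 K"] conjI allI impI ballI, simp, elim conjE)
  fix F t x assume F: "fam6 F" "bd6 F M" and t: "t : {0..T}" and x: "x : Omega A"
  have xQ: "(x, t) : Q" if "x : Omega A" for x using that t closure_subset[of "Omega A"] by (auto simp: Q_Times' closure_Omega)
  have c: "continuous_on Oc (%x. (F [] (x, t))^2)"
   using t by (intro continuous_intros continuous_on_compose2[OF fam_cont[OF F(1), of "[]"]]) (auto simp: Q_Times')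
  have "|F [] (x, t)| ^ (d + 2) <= 4 / \<kappa> * (max (M / l) (2 * (M * D))) ^ d * L2_sq lborel (Omega A) (%x. F [] (x, t))"
  proof (rule sup_le_L2[OF _ _ _ _ l k _ _ x])
   show "|F [] (z', t) - F [] (z, t)| <= M * D * dist z' z" if "z : Omega A" "z' : Omega A" for z z'
    using fam_Lipschitz[OF F, of "[]" "(z, t)" "(z', t)"] xQ that by (simp add: D_def dist_Pair_Pair)
   show "|F [] (z, t)| <= M" if "z : Omega A" for z using F(2) xQ[OF that] by simp
   show "0 <= M * D" "0 < M" using M by (auto simp: D_def)
   show "set_integrable lborel (Omega A) (%x. (F [] (x, t))^2)"
    by (rule set_integrable_continuous_compact[OF c])
     (use closure_subset[of "Omega A"] closure_Omega in \<open>auto simp: Oc_def Omega_box emeasure_lborel_box_eq\<close>)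
   fix z \<rho> assume z: "z : Omega A" and r: "0 < \<rho>" "\<rho> <= l"
   have side: "2 * l <= A \<bullet> i - (- A) \<bullet> i" if "i : Basis" for i
   proof -
    have "(i, 0::real) : Basis" using that by (simp add: Basis_prod_def)
    from lq(2)[OF this] show ?thesis by (simp add: l_def)
   qed
   have zc: "z : cbox (- A) A" using z unfolding Omega_box using box_subset_cbox by blast
   show "EX U:sets lborel. U \<subseteq> Omega A & (ALL z':U. dist z' z <= \<rho>) & \<kappa> * \<rho> ^ d <= measure lborel U & emeasure lborel U < \<infinity>"
    unfolding \<kappa>_def d_def Omega_box by (rule box_density[OF l side zc r])
  qed
  also have "... <= max 1 K * L2_sq lborel (Omega A) (%x. F [] (x, t))"
   unfolding K_def L2_sq_def set_lebesgue_integral_def by (intro mult_right_mono integral_nonneg_AE) auto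
  finally show "|F [] (x, t)| ^ (CARD('n) + 2) <= max 1 K * L2_sq lborel (Omega A) (%x. F [] (x, t))" by (simp add: d_def)
 qed
qed

abbreviation "faceM i sg \<equiv> hyperplane_measure i (sg * A $ i) \<Otimes>\<^sub>M (lborel :: real measure)"

text \<open>On a face with fixed x_i the slot \<open>i\<close> of \<open>lo\<close> and
  \<open>hi\<close> is free and carries the time interval. A box in the face is thus given by n
  intervals, and its measure is a single product over all indices.\<close>

definition facebox where
 "facebox i sg lo hi = {x::real^'n. ALL j:UNIV. x $ j : (if j = i then {sg * A $ i} else {lo j<..<hi j})} \<times> {fst (lo, hi) i<..<hi i}" for lo hi :: "'n => real"

lemma faceM_rectangle:
 fixes lo hi :: "'n => real"
 assumes "!!j. lo j <= hi j"
 shows "facebox i sg lo hi : sets (faceM i sg)" "emeasure (faceM i sg) (facebox i sg lo hi) = ennreal (\<Prod>j\<in>UNIV. hi j - lo j)"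
proof -
 let ?R = "{x::real^'n. ALL j:UNIV. x $ j : (if j = i then {sg * A $ i} else {lo j<..<hi j})}"
 have R: "?R : sets borel" by (rule rectangle_borel) auto
 then show "facebox i sg lo hi : sets (faceM i sg)" unfolding facebox_def by (intro pair_measureI) auto
 have "emeasure (hyperplane_measure i (sg * A $ i)) ?R = (\<Prod>j\<in>UNIV - {i}. emeasure lborel {lo j<..<hi j})"
  by (rule emeasure_hyperplane_rectangle[OF _ R]) auto
 also have "... = ennreal (\<Prod>j\<in>UNIV - {i}. hi j - lo j)" using assms by (simp add: prod_ennreal)
 finally have "emeasure (faceM i sg) (facebox i sg lo hi) = ennreal (\<Prod>j\<in>UNIV - {i}. hi j - lo j) * ennreal (hi i - lo i)"
  unfolding facebox_def using R assms by (subst lborel.emeasure_pair_measure_Times) auto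
 also have "... = ennreal ((hi i - lo i) * (\<Prod>j\<in>UNIV - {i}. hi j - lo j))"
  using assms by (simp add: ennreal_mult' mult.commute)
 also have "(hi i - lo i) * (\<Prod>j\<in>UNIV - {i}. hi j - lo j) = (\<Prod>j\<in>UNIV. hi j - lo j)" by (rule prod.remove[symmetric]) auto
 finally show "emeasure (faceM i sg) (facebox i sg lo hi) = ennreal (\<Prod>j\<in>UNIV. hi j - lo j)" .
qed

abbreviation "flo i j \<equiv> if j = i then 0 else - A $ j"
abbreviation "fhi i j \<equiv> if j = i then T else A $ j"
abbreviation "fco i z j \<equiv> if j = i then snd z else fst z $ j"

lemma mem_facebox: "z : facebox i sg lo hi \<longleftrightarrow> fst z $ i = sg * A $ i & (ALL j. lo j < fco i z j & fco i z j < hi j)"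
proof -
 have "(ALL j. fst z $ j : (if j = i then {sg * A $ i} else {lo j<..<hi j})) & lo i < snd z & snd z < hi i \<longleftrightarrow>
  fst z $ i = sg * A $ i & (ALL j. lo j < fco i z j & fco i z j < hi j)" (is "?L \<longleftrightarrow> ?R")
 proof
  assume L: ?L
  have "lo j < fco i z j & fco i z j < hi j" for j using L by (cases "j = i") (auto dest: spec[of _ j])
  moreover have "fst z $ i = sg * A $ i" using L by (auto dest: spec[of _ i])
  ultimately show ?R by blast
 next
  assume R: ?R
  have "fst z $ j : (if j = i then {sg * A $ i} else {lo j<..<hi j})" for j using R by (cases "j = i") (auto dest: spec[of _ j])
  moreover have "lo i < snd z & snd z < hi i" using R by (auto dest: spec[of _ i])
  ultimately show ?L by blast
 qed
 then show ?thesis by (cases z) (simp add: facebox_def)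
qed

lemma face_facebox: "face_T A T i sg = facebox i sg (flo i) (fhi i)"
proof (rule set_eqI)
 fix z
 have "(ALL j. flo i j < fco i z j & fco i z j < fhi i j) \<longleftrightarrow> (0 < snd z & snd z < T) & (ALL j. j ~= i --> - A $ j < fst z $ j & fst z $ j < A $ j)"
  (is "(ALL j. ?P j) \<longleftrightarrow> ?t & (ALL j. ?R j)")
 proof
  assume l: "ALL j. ?P j"
  have "?t" using l[rule_format, of i] by simp
  moreover have "?R j" for j using l[rule_format, of j] by (cases "j = i") simp_all
  ultimately show "?t & (ALL j. ?R j)" by blast
 next
  assume r: "?t & (ALL j. ?R j)"
  have "?P j" for j using r by (cases "j = i") simp_all
  then show "ALL j. ?P j" by blast
 qed
 then show "z : face_T A T i sg \<longleftrightarrow> z : facebox i sg (flo i) (fhi i)"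
  unfolding mem_facebox by (cases z) (auto simp: face_T_def)
qed

lemma face_Q:
 assumes "sg = 1 \<or> sg = -1" shows "face_T A T i sg \<subseteq> Q"
proof
 fix z assume z: "z : face_T A T i sg"
 have "- A $ j <= fst z $ j & fst z $ j <= A $ j" for j
  using z assms A_pos[of i] by (cases "j = i") (auto simp: face_T_def less_imp_le)
 then show "z : Q" using z by (auto simp: face_T_def mem_Q)
qed

text \<open>The counterpart of \<open>box_density\<close> on a lateral face, which has n - 1
  dimensions in space and one in time. The denominator \<open>CARD('n) + 1\<close> counts the space
  coordinates and time in the triangle inequality for the distance to \<open>z\<close>.\<close>

lemma face_density:
 assumes z: "z : face_T A T i sg" and r: "0 < \<rho>" "\<rho> <= lq / 2"
 shows "EX U:sets (faceM i sg). U \<subseteq> face_T A T i sg & (ALL z':U. dist z' z <= \<rho>) &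
  1 / (real CARD('n) + 1) ^ CARD('n) * \<rho> ^ CARD('n) <= measure (faceM i sg) U & emeasure (faceM i sg) U < \<infinity>"
proof -
 define s where "s = \<rho> / (real CARD('n) + 1)"
 have "\<rho> * 1 <= \<rho> * (real CARD('n) + 1)" using r by (intro mult_left_mono) auto
 then have "0 < s" "s <= \<rho>" using r by (simp_all add: s_def divide_le_eq)
 then have s: "0 < s" "s <= lq / 2" using r by simp_all
 define X where "X j = fco i z j" for j
 define l0 where "l0 j = flo i j" for j
 define h0 where "h0 j = fhi i j" for j
 define lo where "lo j = (if X j + s <= h0 j then X j else X j - s)" for j
 define hi where "hi j = lo j + s" for j
 have zz: "fst z $ i = sg * A $ i" "l0 j < X j" "X j < h0 j" for j
  using z unfolding face_facebox mem_facebox X_def l0_def h0_def by blast+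
 have side: "lq <= h0 j - l0 j" for j
  using lq(2)[OF dt_Basis] lq(2)[OF dx_Basis[of j]] by (simp add: inner_dx inner_dt h0_def l0_def)
 have bd: "l0 j <= lo j" "hi j <= h0 j" "lo j <= X j" "X j <= hi j" for j
  using side[of j] s zz(2,3)[of j] unfolding hi_def lo_def by (auto split: if_splits)
 let ?U = "facebox i sg lo hi"
 have le: "lo j <= hi j" for j using s by (simp add: hi_def)
 note U = faceM_rectangle[OF le, of i sg]
 have Us: "(\<Prod>j\<in>UNIV. hi j - lo j) = s ^ CARD('n)" by (simp add: hi_def)
 have dist: "dist z' z <= \<rho>" if z': "z' : ?U" for z'
 proof -
  have c: "|fco i z' j - fco i z j| <= s" for j
  proof -
   have "lo j < fco i z' j" "fco i z' j < hi j" using z' unfolding mem_facebox by blast+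
   then show ?thesis using bd(3,4)[of j] unfolding hi_def X_def[symmetric] by linarith
  qed
  have "|(fst z' - fst z) $ j| <= s" for j
   using c[of j] z' zz(1) s unfolding mem_facebox by (cases "j = i") auto
  then have "norm (fst z' - fst z) <= CARD('n) * s" using norm_le_l1_cart[of "fst z' - fst z"] sum_bounded_above[of UNIV "%j. |(fst z' - fst z) $ j|" s] by simp
  moreover have "|snd z' - snd z| <= s" using c[of i] by simp
  ultimately have "norm (z' - z) <= CARD('n) * s + s" using norm_Pair_le[of "fst z' - fst z" "snd z' - snd z"] by (simp add: prod_eq_iff minus_prod_def)
  also have "... = (real CARD('n) + 1) * s" by (simp add: distrib_right)
  also have "... = \<rho>" by (simp add: s_def add_nonneg_eq_0_iff)
  finally show ?thesis by (simp add: dist_norm)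
 qed
 show ?thesis
 proof (intro bexI[of _ ?U] conjI ballI U(1) dist)
  show "?U \<subseteq> face_T A T i sg"
  proof
   fix y assume y: "y : ?U"
   then have "flo i j < fco i y j & fco i y j < fhi i j" for j using bd(1,2)[of j] unfolding mem_facebox l0_def[symmetric] h0_def[symmetric] by (meson le_less_trans less_le_trans)
   then show "y : face_T A T i sg" using y unfolding face_facebox mem_facebox by blast
  qed
  show "1 / (real CARD('n) + 1) ^ CARD('n) * \<rho> ^ CARD('n) <= measure (faceM i sg) ?U"
  proof -
   have "measure (faceM i sg) ?U = s ^ CARD('n)"
    unfolding measure_def U(2) Us by (rule enn2real_ennreal) (use s in simp)
   then show ?thesis by (simp add: s_def power_divide)
  qed
  show "emeasure (faceM i sg) ?U < \<infinity>" unfolding U(2) by simp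
 qed
qed

lemma sup_face:
 assumes M: "M >= 1"
 shows "EX K>=1. ALL F vs i sg. fam6 F & bd6 F M & okp 4 vs & (sg = 1 \<or> sg = -1) -->
  (ALL z:face_T A T i sg. |F vs z| ^ (CARD('n) + 2) <= K * L2_sq (faceM i sg) (face_T A T i sg) (F vs))"
proof -
 define D where "D = real DIM((real^'n) \<times> real)"
 define l where "l = lq / 2"
 define \<kappa> where "\<kappa> = 1 / (real CARD('n) + 1) ^ CARD('n)"
 have l: "l > 0" using lq(1) by (simp add: l_def)
 have k: "\<kappa> > 0" by (simp add: \<kappa>_def add_nonneg_pos)
 define K where "K = 4 / \<kappa> * (max (M / l) (2 * (M * D))) ^ CARD('n)"
 show ?thesis
 proof (intro exI[of _ "max 1 K"] conjI allI impI ballI, simp, elim conjE)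
  fix F i sg z and vs :: "((real^'n) \<times> real) list" assume F: "fam6 F" "bd6 F M" and o: "okp 4 vs"
   and s: "sg = 1 \<or> sg = -1" and z: "z : face_T A T i sg"
  have o6: "okp 6 vs" using o by (auto simp: ok_def)
  note sub = face_Q[OF s, of i]
  have le: "flo i j <= fhi i j" for j using A_pos[of j] T_pos by auto
  note fm = faceM_rectangle[of "flo i" "fhi i" i sg, OF le, folded face_facebox]
  have c: "continuous_on Q (%z. (F vs z)^2)" by (intro continuous_intros fam_cont[OF F(1) o6])
  have "|F vs z| ^ (CARD('n) + 2) <= 4 / \<kappa> * (max (M / l) (2 * (M * D))) ^ CARD('n) * L2_sq (faceM i sg) (face_T A T i sg) (F vs)"
  proof (rule sup_le_L2[OF _ _ _ _ l k _ _ z])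
   show "|F vs z' - F vs z| <= M * D * dist z' z" if "z : face_T A T i sg" "z' : face_T A T i sg" for z z'
    using fam_Lipschitz[OF F o, of z z'] sub that by (auto simp: D_def)
   show "|F vs z| <= M" if "z : face_T A T i sg" for z using F(2) o6 sub that by blast
   show "0 <= M * D" "0 < M" using M by (auto simp: D_def)
   show "set_integrable (faceM i sg) (face_T A T i sg) (%z. (F vs z)^2)"
   proof (rule set_integrable_continuous_compact[OF c compact_Q fm(1) sub])
    show "sets (faceM i sg) = sets borel" by (simp add: borel_prod[symmetric] cong: sets_pair_measure_cong)
    show "emeasure (faceM i sg) (face_T A T i sg) < \<infinity>" unfolding fm(2) by simp
   qed
  qed (unfold \<kappa>_def l_def, rule face_density)
  also have "... <= max 1 K * L2_sq (faceM i sg) (face_T A T i sg) (F vs)"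
   unfolding K_def L2_sq_def set_lebesgue_integral_def by (intro mult_right_mono integral_nonneg_AE) auto
  finally show "|F vs z| ^ (CARD('n) + 2) <= max 1 K * L2_sq (faceM i sg) (face_T A T i sg) (F vs)" .
 qed
qed

text \<open>The data are given on open sets and on faces without edges; continuity carries the
  bounds to the closed sets in \<open>small\<close>. On a face, \<open>z\<close> is approached along
  a curve that contracts time and all coordinates except the i-th towards the centre of the
  face.\<close>

lemma small_from_open:
 fixes F H :: "((real^'n) \<times> real) list => (real^'n) \<times> real => real"
 assumes F: "!!vs. okp 6 vs ==> continuous_on Q (F vs)" and H: "!!vs. okp 6 vs ==> continuous_on Q (H vs)"
  and O: "!!x t. x : Omega A ==> t : {0, T} ==> |F [] (x, t)| <= e & |H [] (x, t)| <= e"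
  and f: "!!i sg z. (i, sg) : known_faces i0 ==> z : face_T A T i sg ==>
   |F [dt] z| <= e & |F [dx i, dt] z| <= e & |H [dt] z| <= e & |H [dx i, dt] z| <= e"
 shows "small e F H"
proof -
 have 1: "|G (fst z, t)| <= e" if G: "continuous_on Q G" "!!x. x : Omega A ==> |G (x, t)| <= e" and z: "z : Q" and t: "t : {0, T}" for G :: "(real^'n) \<times> real => real" and z t
 proof -
  have "continuous_on (closure (Omega A)) (%x. |G (x, t)| )"
   unfolding closure_Omega
   by (rule continuous_on_rabs, rule continuous_on_compose2[OF G(1), of Oc "%x. (x, t)"])
    (use t T_pos in \<open>auto simp: Q_Times' intro!: continuous_intros\<close>)
  from continuous_le_on_closure[OF this _ G(2), of "fst z"] z show ?thesis by (auto simp: closure_Omega Q_Times')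
 qed
 have 2: "|G z| <= e" if G: "continuous_on Q G" "!!z. z : face_T A T i sg ==> |G z| <= e" and z: "z : Q" "fst z $ i = sg * A $ i" and s: "sg = 1 \<or> sg = -1" for G :: "(real^'n) \<times> real => real" and z i sg
 proof -
  define \<phi> where "\<phi> t = ((\<chi> j. (if j = i then 1 else 1 - t) * fst z $ j), (1 - t) * snd z + t * (T / 2))" for t :: real
  have in_face: "\<phi> t : face_T A T i sg" if t: "0 < t" "t < 1" for t
  proof -
   have "|(1 - t) * fst z $ j| < A $ j" for j
   proof -
    have "|fst z $ j| <= A $ j" using z(1) by (auto simp: mem_Q abs_le_iff minus_le_iff)
    then have "|(1 - t) * fst z $ j| <= (1 - t) * A $ j" using t by (simp add: abs_mult mult_left_mono)
    also have "... < A $ j" using t A_pos[of j] by simp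
    finally show ?thesis .
   qed
   then have x: "- A $ j < (1 - t) * fst z $ j" "(1 - t) * fst z $ j < A $ j" for j by (simp_all add: abs_less_iff minus_less_iff)
   have zt: "0 <= snd z" "snd z <= T" using z(1) by (auto simp: mem_Q)
   have "0 <= (1 - t) * snd z" "(1 - t) * snd z <= (1 - t) * T" "0 < t * (T / 2)" using t zt T_pos by (auto intro: mult_left_mono)
   moreover have "(1 - t) * T + t * (T / 2) < T" using t T_pos by (simp add: algebra_simps)
   ultimately show ?thesis using x z(2) unfolding \<phi>_def face_T_def by auto
  qed
  have p0: "\<phi> 0 = z" by (simp add: \<phi>_def vec_eq_iff prod_eq_iff)
  have "continuous_on {0..1} (%x::real. if j = i then 1 else 1 - x)" for j by (cases "j = i") (auto intro!: continuous_intros)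
  then have pc: "continuous_on {0..1} \<phi>" unfolding \<phi>_def
   by (intro continuous_on_Pair continuous_on_vec_lambda continuous_intros)
  have "\<phi> t : Q" if "t : {0..<1}" for t
   using that in_face[of t] face_Q[OF s, of i] p0 z(1) by (cases "t = 0") auto
  then have sub: "\<phi> ` {0..<1} \<subseteq> Q" by blast
  have "\<phi> ` closure {0..<1} \<subseteq> Q"
   by (rule image_closure_subset) (simp_all add: pc sub compact_imp_closed[OF compact_Q])
  then have "\<phi> ` {0..1} \<subseteq> Q" by simp
  then show ?thesis by (rule approach_bound[OF G(1) pc _ p0]) (use G(2) in_face in blast)
 qed
 have ks: "sg = 1 \<or> sg = -1" if "(i, sg) : known_faces i0" for i sg using that by (auto simp: known_faces_def)
 have o: "okp 6 ([] :: ((real^'n) \<times> real) list)" "okp 6 [dt :: (real^'n) \<times> real]" "okp 6 [dx i, dt]" for i :: 'n by auto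
 show ?thesis
  unfolding small_def
 proof (intro conjI ballI)
  fix z assume z: "z : Q"
  show "|F [] (fst z, 0)| <= e" "|F [] (fst z, T)| <= e" "|H [] (fst z, 0)| <= e" "|H [] (fst z, T)| <= e"
   by (rule 1[OF F[OF o(1)] _ z], use O in blast, blast)+ (rule 1[OF H[OF o(1)] _ z], use O in blast, blast)+
 next
  fix p assume p: "p : known_faces i0"
  obtain i sg where pi: "p = (i, sg)" by (cases p)
  note p' = p[unfolded pi]
  show "case p of (i, sg) => ALL z:Q. fst z $ i = sg * A $ i --> |F [dt] z| <= e & |F [dx i, dt] z| <= e & |H [dt] z| <= e & |H [dx i, dt] z| <= e"
   unfolding pi prod.case
   by (intro ballI impI conjI; rule 2[of _ i sg, OF F[OF o(2)] _ _ _ ks[OF p']] 2[of _ i sg, OF F[OF o(3)] _ _ _ ks[OF p']]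
    2[of _ i sg, OF H[OF o(2)] _ _ _ ks[OF p']] 2[of _ i sg, OF H[OF o(3)] _ _ _ ks[OF p']]; (assumption | use f[OF p'] in blast))
 qed
qed

end

lemma L2_sq_cong: "(!!z. z : S ==> (f z)^2 = (g z)^2) ==> S : sets mu ==> L2_sq mu S f = L2_sq mu S g"
 unfolding L2_sq_def by (rule set_lebesgue_integral_cong) auto

lemma L2_sq_nonneg: "L2_sq mu S f >= 0"
 unfolding L2_sq_def set_lebesgue_integral_def by (intro integral_nonneg_AE) auto

lemma le_square_of_sqrt: "sqrt x < \<delta> ==> 0 <= x ==> x <= \<delta>^2" for x :: real
 by (metis less_imp_le real_sqrt_ge_zero real_sqrt_pow2 power_mono)

lemma L2_sq_le_H_norm:
 fixes f :: "'a::euclidean_space => real"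
 assumes "H_norm S isotropic k f < \<delta>"
 shows "L2_sq lborel S f <= \<delta>^2"
proof -
 let ?X = "multi_indices (Basis :: 'a set) isotropic k"
 have fin: "finite ?X" by (rule finite_multi_indices) auto
 have mem: "{#} : ?X" by (simp add: multi_indices_def)
 obtain vs where "mset vs = {#}" "mpd S {#} f = pds S vs f" using mpd_eq_pds[of "{#}" S f] by blast
 then have m: "mpd S {#} f = f" by (simp add: pds_def)
 have "L2_sq lborel S (mpd S {#} f) <= (\<Sum>\<alpha>\<in>?X. L2_sq lborel S (mpd S \<alpha> f))"
  by (rule member_le_sum[OF mem _ fin]) (rule L2_sq_nonneg)
 also have "... <= \<delta>^2"
  using assms unfolding H_norm_def by (rule le_square_of_sqrt) (intro sum_nonneg L2_sq_nonneg)
 finally show ?thesis by (simp add: m)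
qed

context space_time_box
begin

lemma finite_known: "finite (known_faces i0)"
 by (simp add: known_faces_def)

lemma L2_sq_le_dirichlet:
 assumes "dirichlet_t_dist A T i0 v1 v2 < \<delta>" and i: "(i, sg) : known_faces i0"
 shows "L2_sq (faceM i sg) (face_T A T i sg) (%z. pd Q dt v1 z - pd Q dt v2 z) <= \<delta>^2"
proof -
 let ?v = "%z. pd Q dt v1 z - pd Q dt v2 z"
 have nn: "0 <= (\<Sum>x\<in>X. case x of (j, s) => L2_sq mu S (h j s))" for X mu S and h :: "'n => 'n => (real^'n) \<times> real => real"
  by (rule sum_nonneg) (auto simp: L2_sq_nonneg)
 have n2: "0 <= (\<Sum>j\<in>X. L2_sq mu S (h j))" for X mu S and h :: "'n => (real^'n) \<times> real => real"
  by (rule sum_nonneg) (auto simp: L2_sq_nonneg)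
 have H: "L2_sq (faceM i sg) (face_T A T i sg) v <= H21_face_sq A T i sg v" "0 <= H21_face_sq A T i sg v" for v i sg
  unfolding H21_face_sq_def Let_def using nn n2 L2_sq_nonneg[of "faceM i sg" "face_T A T i sg"]
  by (simp_all add: add_nonneg_nonneg add_increasing)
 have "H21_face_sq A T i sg ?v <= (\<Sum>p\<in>known_faces i0. case p of (i, sg) => H21_face_sq A T i sg ?v)"
  using member_le_sum[OF i, of "%p. case p of (i, sg) => H21_face_sq A T i sg ?v"] H(2) finite_known by (auto split: prod.split)
 also have "... <= \<delta>^2"
  using assms(1) unfolding dirichlet_t_dist_def Let_def closure_Q_T by (rule le_square_of_sqrt) (rule sum_nonneg, auto intro: H)
 finally show ?thesis by (rule order_trans[OF H(1)])
qed

lemma L2_sq_le_neumann: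
 assumes "neumann_t_dist A T i0 g1 g2 < \<delta>" and i: "(i, sg) : known_faces i0"
 shows "L2_sq (faceM i sg) (face_T A T i sg) (%z. pd (face_T A T i sg) dt g1 z - pd (face_T A T i sg) dt g2 z) <= \<delta>^2"
proof -
 let ?v = "%i sg z. pd (face_T A T i sg) dt g1 z - pd (face_T A T i sg) dt g2 z"
 have n2: "0 <= (\<Sum>j\<in>X. L2_sq mu S (h j))" for X mu S and h :: "'n => (real^'n) \<times> real => real"
  by (rule sum_nonneg) (auto simp: L2_sq_nonneg)
 have H: "L2_sq (faceM i sg) (face_T A T i sg) v <= H10_face_sq A T i sg v" "0 <= H10_face_sq A T i sg v" for v i sg
  unfolding H10_face_sq_def Let_def using n2 L2_sq_nonneg[of "faceM i sg" "face_T A T i sg"]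
  by (simp_all add: add_nonneg_nonneg add_increasing)
 have "H10_face_sq A T i sg (?v i sg) <= (\<Sum>p\<in>known_faces i0. case p of (i, sg) => H10_face_sq A T i sg (?v i sg))"
  using member_le_sum[OF i, of "%p. case p of (i, sg) => H10_face_sq A T i sg (?v i sg)"] H(2) finite_known by (auto split: prod.split)
 also have "... <= \<delta>^2"
  using assms(1) unfolding neumann_t_dist_def by (rule le_square_of_sqrt) (rule sum_nonneg, auto intro: H)
 finally show ?thesis by (rule order_trans[OF H(1)])
qed

text \<open>Neumann data are defined on the face only and are differentiated in time there. The
  result agrees with the time derivative, in \<open>Q\<close>, of the function that they
  represent.\<close>

lemma face_dt:
 assumes G: "hpd Q dt G G'" and s: "sg = 1 \<or> sg = -1" and z: "z : face_T A T i sg" and f: "!!z. z : face_T A T i sg ==> f z = k * G z"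
 shows "pd (face_T A T i sg) dt f z = k * G' z"
proof -
 have eq: "{h. z + h *\<^sub>R dt : face_T A T i sg} = {- snd z<..<T - snd z}"
  using z by (cases z) (auto simp: face_T_def dt_def)
 have "0 : interior {- snd z<..<T - snd z}" using z by (auto simp: face_T_def)
 then have il: "0 islimpt {h. z + h *\<^sub>R dt : face_T A T i sg}" unfolding eq by (rule interior_limit_point)
 have "pd (face_T A T i sg) dt f z = pd (face_T A T i sg) dt (%z. k * G z) z" by (rule pd_cong) (use f z in auto)
 also have "... = k * G' z" by (rule pd_hpd[OF hpd_subset[OF hpd_cmult[OF G] face_Q[OF s]] z il])
 finally show ?thesis .
qed

lemma face_zero:
 assumes "hpd Q dt G G'" "sg = 1 \<or> sg = -1" "z : face_T A T i sg" "!!z. z : face_T A T i sg ==> G z = 0"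
 shows "G' z = 0"
 using face_dt[OF assms(1-3), of "%_. 0" 1] face_dt[OF hpd_const assms(2,3), of "%_. 0" 1 0] assms(4) by simp

text \<open>Both the domain and a lateral face times the time interval have dimension n, hence the
  common exponent \<open>1 / (n + 2)\<close> from \<open>sup_le_L2\<close>, applied to the squared
  norms, which are at most \<open>\<delta>^2\<close>.\<close>

lemma data_small:
 assumes M: "M >= 1"
 shows "EX K>=1. ALL v p P f0 f1 \<delta> k k'. (ALL i:{1, 2}. fam6 (Fu v i) & bd6 (Fu v i) M &
   has_data A T (v i) (p i) (P i) (f0 i) (f1 i)) & 0 < \<delta> &
  H_norm (Omega A) isotropic k (%x. p 1 x - p 2 x) < \<delta> & H_norm (Omega A) isotropic k' (%x. P 1 x - P 2 x) < \<delta> &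
  dirichlet_t_dist A T i0 (v 1) (v 2) < \<delta> & neumann_t_dist A T i0 (f1 1) (f1 2) < \<delta> -->
  (ALL x t. x : Omega A --> t : {0, T} --> |Fd v [] (x, t)| <= K * (\<delta>^2) powr (1 / real (CARD('n) + 2))) &
  (ALL i sg z. (i, sg) : known_faces i0 --> z : face_T A T i sg -->
   |Fd v [dt] z| <= K * (\<delta>^2) powr (1 / real (CARD('n) + 2)) &
   |Fd v [dx i, dt] z| <= K * (\<delta>^2) powr (1 / real (CARD('n) + 2)))"
proof -
 have M2: "2 * M >= 1" using M by simp
 obtain K1 where K1: "K1 >= 1" and so: "!!F t x. fam6 F ==> bd6 F (2 * M) ==> t : {0..T} ==>
  x : Omega A ==> |F [] (x, t)| ^ (CARD('n) + 2) <= K1 * L2_sq lborel (Omega A) (%x. F [] (x, t))"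
  using sup_Omega[OF M2] by blast
 obtain K2 where K2: "K2 >= 1" and sf0: "!!F vs i sg. fam6 F & bd6 F (2 * M) & okp 4 vs & (sg = 1 \<or> sg = -1) ==>
  ALL z:face_T A T i sg. |F vs z| ^ (CARD('n) + 2) <= K2 * L2_sq (faceM i sg) (face_T A T i sg) (F vs)"
  using sup_face[OF M2] by (elim exE conjE) (rule that, assumption, elim allE impE, assumption+)
 define K where "K = max K1 K2"
 have K: "K >= 1" "K1 <= K" "K2 <= K" using K1 by (auto simp: K_def)
 show ?thesis
 proof (rule exI[of _ K], rule conjI[OF K(1)], intro allI impI, elim conjE)
  fix v p P f0 f1 \<delta> k k'
  assume v: "ALL i:{1, 2}. fam6 (Fu v i) & bd6 (Fu v i) M & has_data A T (v i) (p i) (P i) (f0 i) (f1 i)"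
   and d: "0 < \<delta>" and H: "H_norm (Omega A) isotropic k (%x. p 1 x - p 2 x) < \<delta>" "H_norm (Omega A) isotropic k' (%x. P 1 x - P 2 x) < \<delta>"
   and D: "dirichlet_t_dist A T i0 (v 1) (v 2) < \<delta>" and N: "neumann_t_dist A T i0 (f1 1) (f1 2) < \<delta>"
  define F where "F = Fd v"
  let ?e = "K * (\<delta>^2) powr (1 / real (CARD('n) + 2))"
  have v': "fam6 (Fu v i)" "okp 6 vs ==> z : Q ==> |Fu v i vs z| <= M" "has_data A T (v i) (p i) (P i) (f0 i) (f1 i)"
   if "i = 1 \<or> i = 2" for i vs z using v that by blast+
  have one: "(1::nat) = 1 \<or> (1::nat) = 2" "(2::nat) = 1 \<or> (2::nat) = 2" by auto
  have F: "fam6 F" unfolding F_def dif_def[abs_def] using v'(1) by (intro fam_diff) auto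
  have b: "bd6 F (2 * M)"
  proof (intro allI impI)
   fix vs :: "((real^'n) \<times> real) list" and z assume "okp 6 vs" "z : Q"
   from v'(2)[OF one(1) this] v'(2)[OF one(2) this] show "|F vs z| <= 2 * M" unfolding F_def dif_def by linarith
  qed
  have sf: "|F vs z| ^ (CARD('n) + 2) <= K2 * L2_sq (faceM i sg) (face_T A T i sg) (F vs)"
   if "okp 4 vs" "sg = 1 \<or> sg = -1" "z : face_T A T i sg" for vs i sg z
   by (rule bspec[OF sf0[OF conjI[OF F conjI[OF b conjI[OF that(1,2)]]]] that(3)])
  have root: "|x| <= ?e" if "|x| ^ (CARD('n) + 2) <= C * y" "y <= \<delta>^2" "0 <= C" "C <= K" "0 <= y" for x C y
  proof (rule powr_root_le)
   have "C * y <= K * \<delta>^2" using that K by (intro mult_mono) auto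
   then show "|x| ^ (CARD('n) + 2) <= K * \<delta>^2" using that(1) by linarith
  qed (use K d in auto)
  have SO: "Omega A : sets lborel" by (simp add: Omega_box)
  have Om: "F [] (x, 0) = p 1 x - p 2 x" "F [] (x, T) = P 1 x - P 2 x" if "x : Omega A" for x
   using v'(3)[OF one(1)] v'(3)[OF one(2)] that unfolding has_data_def by (simp_all add: F_def dif_def pds_def)
  have 1: "|F [] (x, t)| <= ?e" if x: "x : Omega A" and t: "t : {0, T}" for x t
  proof -
   have "L2_sq lborel (Omega A) (%x. F [] (x, t)) <= \<delta>^2"
   proof (cases "t = 0")
    case True
    have "L2_sq lborel (Omega A) (%x. F [] (x, t)) = L2_sq lborel (Omega A) (%x. p 1 x - p 2 x)"
     by (rule L2_sq_cong[OF _ SO]) (simp add: True Om)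
    then show ?thesis using L2_sq_le_H_norm[OF H(1)] by simp
   next
    case False
    then have "L2_sq lborel (Omega A) (%x. F [] (x, t)) = L2_sq lborel (Omega A) (%x. P 1 x - P 2 x)"
     using t by (intro L2_sq_cong[OF _ SO]) (simp add: Om)
    then show ?thesis using L2_sq_le_H_norm[OF H(2)] by simp
   qed
   then show ?thesis using so[OF F b _ x, of t] t T_pos K1 K(2) L2_sq_nonneg by (intro root) auto
  qed
  have 2: "|F [dt] z| <= ?e & |F [dx i, dt] z| <= ?e" if i: "(i, sg) : known_faces i0" and z: "z : face_T A T i sg" for i sg z
  proof -
   have s: "sg = 1 \<or> sg = -1" using i by (auto simp: known_faces_def)
   have le: "flo i j <= fhi i j" for j using A_pos[of j] T_pos by auto
   have SF: "face_T A T i sg : sets (faceM i sg)" using faceM_rectangle(1)[of "flo i" "fhi i" i sg, OF le] by (simp only: face_facebox)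
   have "F [dt] = (%z. pd Q dt (v 1) z - pd Q dt (v 2) z)" by (simp add: F_def dif_def[abs_def] pds_def)
   then have "L2_sq (faceM i sg) (face_T A T i sg) (F [dt]) <= \<delta>^2" using L2_sq_le_dirichlet[OF D i] by simp
   then have a: "|F [dt] z| <= ?e" using sf[OF _ s z, of "[dt]"] K2 K(3) L2_sq_nonneg by (intro root) auto
   have f1: "pd (face_T A T i sg) dt (f1 k) z = sg * Fu v k [dx i, dt] z" if k: "k = 1 \<or> k = 2" and z: "z : face_T A T i sg" for k z
   proof (rule face_dt[OF _ s z])
    show "hpd Q dt (Fu v k [dx i]) (Fu v k [dx i, dt])" using fam_dt[OF v'(1)[OF k], of "[dx i]"] by simp
    show "f1 k z = sg * Fu v k [dx i] z" if "z : face_T A T i sg" for z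
     using v'(3)[OF k] that s unfolding has_data_def closure_Q_T by (auto simp: pds_def)
   qed
   have "L2_sq (faceM i sg) (face_T A T i sg) (F [dx i, dt]) = L2_sq (faceM i sg) (face_T A T i sg) (%z. pd (face_T A T i sg) dt (f1 1) z - pd (face_T A T i sg) dt (f1 2) z)"
   proof (rule L2_sq_cong[OF _ SF])
    fix z assume z: "z : face_T A T i sg"
    have "pd (face_T A T i sg) dt (f1 1) z - pd (face_T A T i sg) dt (f1 2) z = sg * F [dx i, dt] z"
     using f1[OF one(1) z] f1[OF one(2) z] by (simp add: F_def dif_def right_diff_distrib)
    then show "(F [dx i, dt] z)^2 = (pd (face_T A T i sg) dt (f1 1) z - pd (face_T A T i sg) dt (f1 2) z)^2" using s by auto
   qed
   also have "... <= \<delta>^2" by (rule L2_sq_le_neumann[OF N i])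
   finally have "|F [dx i, dt] z| <= ?e" using sf[OF _ s z, of "[dx i, dt]"] K2 K(3) L2_sq_nonneg by (intro root) auto
   then show ?thesis using a by blast
  qed
  show "(ALL x t. x : Omega A --> t : {0, T} --> |Fd v [] (x, t)| <= ?e) &
   (ALL i sg z. (i, sg) : known_faces i0 --> z : face_T A T i sg -->
   |Fd v [dt] z| <= ?e & |Fd v [dx i, dt] z| <= ?e)"
   using 1 2 unfolding F_def by blast
 qed
qed

text \<open>For uniqueness the data coincide pointwise and norms are not involved. The time
  derivatives vanish on a face because the functions vanish along the whole time interval.\<close>

lemma data_zero:
 assumes v: "!!i. i : {1, 2} ==> fam6 (Fu v i) & has_data A T (v i) (p i) (P i) (f0 i) (f1 i)"
  and eq: "!!x. x : Omega A ==> p 1 x = p 2 x & P 1 x = P 2 x" "!!z. z : S_T A T - Gamma_minus_T A i0 T ==> f0 1 z = f0 2 z"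
   "!!i sg z. (i, sg) : known_faces i0 ==> z : face_T A T i sg ==> f1 1 z = f1 2 z"
 shows "x : Omega A ==> t : {0, T} ==> Fd v [] (x, t) = 0"
  "(i, sg) : known_faces i0 ==> z : face_T A T i sg ==> Fd v [dt] z = 0 & Fd v [dx i, dt] z = 0"
proof -
 define F where "F = Fd v"
 have d: "has_data A T (v 1) (p 1) (P 1) (f0 1) (f1 1)" "has_data A T (v 2) (p 2) (P 2) (f0 2) (f1 2)" using v by auto
 show "x : Omega A ==> t : {0, T} ==> Fd v [] (x, t) = 0"
  using d eq(1) unfolding has_data_def by (auto simp: dif_def pds_def)
 have F: "fam6 F" unfolding F_def dif_def[abs_def] using v by (intro fam_diff) auto
 assume i: "(i, sg) : known_faces i0" and z: "z : face_T A T i sg"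
 have s: "sg = 1 \<or> sg = -1" using i by (auto simp: known_faces_def)
 have ST: "z : S_T A T - Gamma_minus_T A i0 T" if z: "z : face_T A T i sg" for z
 proof -
  have "fst z : Oc" "snd z : {0<..<T}" "fst z $ i = sg * A $ i"
   using subsetD[OF face_Q[OF s] z] z by (auto simp: Q_Times' face_T_def)
  moreover have "fst z \<notin> Omega A" using calculation(3) s by (auto simp: Omega_def intro!: exI[of _ i])
  moreover have "open (Omega A)" by (simp only: Omega_box open_box)
  ultimately have "fst z : frontier (Omega A)" "snd z : {0<..<T}" by (auto simp: frontier_def closure_Omega interior_open)
  moreover have "fst z $ i0 ~= - A $ i0"
  proof (cases "i = i0")
   case True then show ?thesis using z i A_pos[of i0] by (auto simp: face_T_def known_faces_def)
  next
   case False then show ?thesis using z by (force simp: face_T_def)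
  qed
  ultimately show ?thesis by (cases z) (auto simp: S_T_def Gamma_minus_T_def)
 qed
 have 1: "F [] z = 0" if "z : face_T A T i sg" for z
  using d eq(2)[OF ST[OF that]] ST[OF that] unfolding has_data_def by (auto simp: F_def dif_def pds_def)
 have 2: "F [dx i] z = 0" if z: "z : face_T A T i sg" for z
 proof -
  have "sg : {-1, 1}" using s by auto
  then have "sg * pd Q (dx i) (v 1) z = f1 1 z" "sg * pd Q (dx i) (v 2) z = f1 2 z"
   using d z unfolding has_data_def closure_Q_T by blast+
  then have "sg * pd Q (dx i) (v 1) z = sg * pd Q (dx i) (v 2) z" using eq(3)[OF i z] by simp
  then show ?thesis using s by (auto simp: F_def dif_def pds_def)
 qed
 have "F [dt] z = 0" using fam_dt[OF F, of "[]"] by (intro face_zero[OF _ s z 1]) auto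
 moreover have "F [dx i, dt] z = 0" using fam_dt[OF F, of "[dx i]"] by (intro face_zero[OF _ s z 2]) auto
 ultimately show "Fd v [dt] z = 0 & Fd v [dx i, dt] z = 0" by (simp add: F_def)
qed


lemma H_norm_le:
 assumes F: "fam Q Basis parabolic 2 F" and f: "!!z. z : Q ==> f z = F [] z" and S: "open S" "S \<subseteq> Q" "emeasure lborel S < \<infinity>"
  and e: "0 <= e" "!!vs z. okp 2 vs ==> z : S ==> |F vs z| <= e"
 shows "H_norm S parabolic 2 f <= sqrt (card (multi_indices (Basis :: ((real^'n) \<times> real) set) parabolic 2) * measure lborel S) * e"
proof -
 let ?X = "multi_indices (Basis :: ((real^'n) \<times> real) set) parabolic 2"
 have "L2_sq lborel S (mpd S \<alpha> f) <= e^2 * measure lborel S" if a: "\<alpha> : ?X" for \<alpha>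
 proof -
  obtain vs where vs: "mset vs = \<alpha>" "mpd S \<alpha> f = pds S vs f" using mpd_eq_pds[of \<alpha> S f] by blast
  have o: "okp 2 vs" using a multi_indices_ok[of vs Basis parabolic 2] by (simp only: vs(1))
  have b: "|(pds S vs f z)^2| <= e^2" if z: "z : S" for z
  proof -
   have "pds S vs f z = F vs z" by (rule pds_fam[OF F S(1,2) _ o z]) (use f S(2) in blast)
   then show ?thesis using e(2)[OF o z] by (simp add: abs_le_square_iff[symmetric])
  qed
  have "|L2_sq lborel S (pds S vs f)| <= e^2 * measure lborel S"
   unfolding L2_sq_def by (rule set_integral_bound[OF _ S(3) b]) (use S(1) in auto)
  then show ?thesis unfolding vs(2) by linarith
 qed
 then have "(\<Sum>\<alpha>\<in>?X. L2_sq lborel S (mpd S \<alpha> f)) <= card ?X * (e^2 * measure lborel S)" by (rule sum_bounded_above)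
 then have "H_norm S parabolic 2 f <= sqrt (card ?X * measure lborel S * e^2)" unfolding H_norm_def by (simp add: mult_ac)
 also have "... = sqrt (card ?X * measure lborel S) * e" using e(1) by (simp add: real_sqrt_mult)
 finally show ?thesis .
qed

lemma Q_gammaT_facts:
 assumes g: "0 < gam" "gam < 2 * A $ i0"
 shows "open (Q_gammaT A i0 gam T)" "Q_gammaT A i0 gam T \<subseteq> Qg gam" "Q_gammaT A i0 gam T \<subseteq> Q" "emeasure lborel (Q_gammaT A i0 gam T) < \<infinity>"
  "Omega_gamma A i0 gam : sets lborel" "emeasure lborel (Omega_gamma A i0 gam) < \<infinity>"
  "!!x. x : Omega_gamma A i0 gam ==> (x, 0) : Qg gam"
proof -
 have eq: "Omega_gamma A i0 gam = box (- A) A \<inter> {x. - A $ i0 + gam < x $ i0}"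
  by (auto simp: Omega_gamma_def Omega_def mem_box_cart)
 have op: "open (Omega_gamma A i0 gam)" unfolding eq
  by (intro open_Int open_box open_Collect_less continuous_intros)
 then show "open (Q_gammaT A i0 gam T)" "Omega_gamma A i0 gam : sets lborel" unfolding Q_gammaT_def by (auto intro: open_Times)
 have Oc: "x : Oc & - A $ i0 + gam < x $ i0" if "x : Omega_gamma A i0 gam" for x
  using that closure_subset[of "Omega A"] unfolding closure_Omega by (auto simp: Omega_gamma_def)
 then show sub: "Q_gammaT A i0 gam T \<subseteq> Qg gam" unfolding Q_gammaT_def using mem_Qg[OF g] by (force simp: Q_Times')
 show subQ: "Q_gammaT A i0 gam T \<subseteq> Q" using sub mem_Qg[OF g] by blast
 show "(x, 0) : Qg gam" if "x : Omega_gamma A i0 gam" for x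
  using Oc[OF that] T_pos unfolding mem_Qg[OF g] by (auto simp: Q_Times')
 have "emeasure lborel (Q_gammaT A i0 gam T) <= emeasure lborel Q" by (rule emeasure_mono[OF subQ]) (simp add: Q_def)
 then show "emeasure lborel (Q_gammaT A i0 gam T) < \<infinity>" using emeasure_lborel_cbox_finite[of "(- A, 0)" "(A, T)"] by (simp add: Q_def le_less_trans)
 have "emeasure lborel (Omega_gamma A i0 gam) <= emeasure lborel Oc" by (rule emeasure_mono) (use Oc in \<open>auto simp: Oc_def\<close>)
 then show "emeasure lborel (Omega_gamma A i0 gam) < \<infinity>" using emeasure_lborel_cbox_finite[of "- A" A] by (simp add: Oc_def le_less_trans)
qed

lemma config_fam:
 assumes cf: "config M c K1 K2 a s u m b" and M: "0 < M" and i: "i : {1, 2}"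
 shows "fam6 (Fu u i)" "bd6 (Fu u i) (M + 1)"
  "fam6 (Fu m i)" "bd6 (Fu m i) (M + 1)"
proof -
 have "sys (M + 1) c (Fu u 1) (Fu u 2) (Fu m 1) (Fu m 2) (%z. a (fst z)) (%j z. pds Oc [axis j 1] a (fst z)) s (pds Q [dt] s)
  (%z. b 1 (fst z)) (%z. b 2 (fst z)) (barK K1) K2" by (rule config_sys[OF cf]) simp
 note b = bspec[OF conjunct1[OF this[unfolded sys_def]]]
 have "Fu u i : {Fu u 1, Fu u 2, Fu m 1, Fu m 2}" "Fu m i : {Fu u 1, Fu u 2, Fu m 1, Fu m 2}" using i by auto
 note b = b[OF this(1)] b[OF this(2)]
 show "fam6 (Fu u i)" "fam6 (Fu m i)" by (rule conjunct1[OF b(1)], rule conjunct1[OF b(2)])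
 show "bd6 (Fu u i) (M + 1)" using conjunct2[OF b(1)] by blast
 show "bd6 (Fu m i) (M + 1)" using conjunct2[OF b(2)] by blast
qed

lemma conclusion:
 assumes g: "0 < gam" "gam < 2 * A $ i0" and M: "0 < M" and cf: "config M c K1 K2 a s u m b" and e: "0 <= e"
  and d: "near gam e (Fd u) (Fd m) (%z. b 1 (fst z)) (%z. b 2 (fst z))"
  and B: "sqrt (card (multi_indices (Basis :: ((real^'n) \<times> real) set) parabolic 2) * measure lborel (Q_gammaT A i0 gam T)) <= B"
   "sqrt (measure lborel (Omega_gamma A i0 gam)) <= B"
 shows "let Dt = pd (closure (Q_T A T)) dt in
   (ALL j:{0, 1}. H_norm (Q_gammaT A i0 gam T) parabolic 2 (%z. (Dt ^^ j) (u 1) z - (Dt ^^ j) (u 2) z) <= B * e &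
    H_norm (Q_gammaT A i0 gam T) parabolic 2 (%z. (Dt ^^ j) (m 1) z - (Dt ^^ j) (m 2) z) <= B * e) &
   L2_norm (Omega_gamma A i0 gam) (%x. b 1 x - b 2 x) <= B * e"
proof -
 note S = Q_gammaT_facts[OF g]
 have one: "(1::nat) : {1, 2}" "(2::nat) : {1, 2}" by auto
 have H: "H_norm (Q_gammaT A i0 gam T) parabolic 2 f <= B * e"
  if F: "fam6 F" and ws: "ws = [] \<or> ws = [dt]" and f: "f = F ws" and b: "!!z vs. z : Qg gam ==> okp 2 vs ==> |F (vs @ ws) z| <= e" for F ws f
 proof -
  have F': "fam Q Basis parabolic 2 (%vs. F (vs @ ws))"
   by (rule fam_shift[OF F, of 2]) (use ws in auto)
  have "H_norm (Q_gammaT A i0 gam T) parabolic 2 f <= sqrt (card (multi_indices (Basis :: ((real^'n) \<times> real) set) parabolic 2) * measure lborel (Q_gammaT A i0 gam T)) * e"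
   by (rule H_norm_le[OF F' _ S(1,3,4) e]) (use f b S(2) in auto)
  also have "... <= B * e" using B(1) e by (rule mult_right_mono)
  finally show ?thesis .
 qed
 have D: "fam6 (Fd v)" if "!!i. i : {1, 2} ==> fam6 (Fu v i)" for v
  unfolding dif_def[abs_def] by (intro fam_diff that one)
 have eq: "(%z. v 1 z - v 2 z) = Fd v []" "(%z. pd Q dt (v 1) z - pd Q dt (v 2) z) = Fd v [dt]" for v :: "nat => _"
  by (simp_all add: dif_def[abs_def] pds_def)
 note du = D[OF config_fam(1)[OF cf M]] and dm = D[OF config_fam(3)[OF cf M]]
 have d': "|Fd u (vs @ []) z| <= e" "|Fd u (vs @ [dt]) z| <= e"
  "|Fd m (vs @ []) z| <= e" "|Fd m (vs @ [dt]) z| <= e" if "z : Qg gam" "okp 2 vs" for z vs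
  using conjunct1[OF bspec[OF d that(1)]] that(2) unfolding append_Nil2 by blast+
 have h: "H_norm (Q_gammaT A i0 gam T) parabolic 2 (%z. u 1 z - u 2 z) <= B * e" "H_norm (Q_gammaT A i0 gam T) parabolic 2 (%z. m 1 z - m 2 z) <= B * e"
  "H_norm (Q_gammaT A i0 gam T) parabolic 2 (%z. pd Q dt (u 1) z - pd Q dt (u 2) z) <= B * e" "H_norm (Q_gammaT A i0 gam T) parabolic 2 (%z. pd Q dt (m 1) z - pd Q dt (m 2) z) <= B * e"
  by (rule H[OF du disjI1[OF refl] eq(1) d'(1)], assumption+, rule H[OF dm disjI1[OF refl] eq(1) d'(3)], assumption+,
    rule H[OF du disjI2[OF refl] eq(2) d'(2)], assumption+, rule H[OF dm disjI2[OF refl] eq(2) d'(4)], assumption+)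
 have "|L2_sq lborel (Omega_gamma A i0 gam) (%x. b 1 x - b 2 x)| <= e^2 * measure lborel (Omega_gamma A i0 gam)"
  unfolding L2_sq_def
 proof (rule set_integral_bound[OF S(5,6)])
  fix x assume "x : Omega_gamma A i0 gam"
  from bspec[OF d S(7)[OF this]] have "|b 1 x - b 2 x| <= e" by simp
  then show "|(b 1 x - b 2 x)^2| <= e^2" using e by (simp add: abs_le_square_iff[symmetric])
 qed simp
 then have "L2_norm (Omega_gamma A i0 gam) (%x. b 1 x - b 2 x) <= sqrt (e^2 * measure lborel (Omega_gamma A i0 gam))"
  unfolding L2_norm_def by (intro real_sqrt_le_mono) linarith
 also have "... = sqrt (measure lborel (Omega_gamma A i0 gam)) * e" using e by (simp add: real_sqrt_mult)
 also have "... <= B * e" using B(2) e by (rule mult_right_mono)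
 finally have "L2_norm (Omega_gamma A i0 gam) (%x. b 1 x - b 2 x) <= B * e" .
 with h show ?thesis unfolding Let_def closure_Q_T by simp
qed

end

theorem theorem4p4:
  fixes A :: "real^'n::finite" and T M c \<gamma> :: real and \<iota> :: 'n
  assumes "\<forall>i. A$i > 0" and "T > 0" and "M > 0" and "c > 0" and "0 < \<gamma>" and "\<gamma> < 2 * A$\<iota>"
  shows
    "(\<exists>\<delta>\<^sub>0 B \<alpha>. 0 < \<delta>\<^sub>0 \<and> \<delta>\<^sub>0 < 1 \<and> 0 < B \<and> 0 < \<alpha> \<and> \<alpha> < (1::real) \<and>
       (\<forall>K1 K2 a s (u :: nat \<Rightarrow> _) (m :: nat \<Rightarrow> _) (b :: nat \<Rightarrow> _)
          (p :: nat \<Rightarrow> _) (q :: nat \<Rightarrow> _) (F :: nat \<Rightarrow> _) (G :: nat \<Rightarrow> _)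
          (f0 :: nat \<Rightarrow> _) (f1 :: nat \<Rightarrow> _) (g0 :: nat \<Rightarrow> _) (g1 :: nat \<Rightarrow> _) \<delta>.
          admissible_coefficients A T \<iota> M K1 K2 a s \<longrightarrow>
          (\<forall>i\<in>{1, 2}. (u i, m i) \<in> Y1 A T M \<and> b i \<in> Y2 A M \<and>
             solves_MFGS A T \<iota> K1 K2 a s (b i) (u i) (m i) \<and>
             has_data A T (u i) (p i) (F i) (f0 i) (f1 i) \<and>
             has_data A T (m i) (q i) (G i) (g0 i) (g1 i)) \<longrightarrow>
          (\<forall>(x, t)\<in>closure (Q_T A T). \<bar>interaction A \<iota> K1 K2 (m 2) x t\<bar> \<ge> c) \<longrightarrow>
          0 < \<delta> \<longrightarrow> \<delta> < \<delta>\<^sub>0 \<longrightarrow>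
          H_norm (Omega A) isotropic 4 (\<lambda>x. p 1 x - p 2 x) < \<delta> \<longrightarrow>
          H_norm (Omega A) isotropic 3 (\<lambda>x. q 1 x - q 2 x) < \<delta> \<longrightarrow>
          H_norm (Omega A) isotropic 4 (\<lambda>x. F 1 x - F 2 x) < \<delta> \<longrightarrow>
          H_norm (Omega A) isotropic 3 (\<lambda>x. G 1 x - G 2 x) < \<delta> \<longrightarrow>
          dirichlet_t_dist A T \<iota> (u 1) (u 2) < \<delta> \<longrightarrow>
          neumann_t_dist A T \<iota> (f1 1) (f1 2) < \<delta> \<longrightarrow>
          dirichlet_t_dist A T \<iota> (m 1) (m 2) < \<delta> \<longrightarrow>
          neumann_t_dist A T \<iota> (g1 1) (g1 2) < \<delta> \<longrightarrow>
          (let Dt = pd (closure (Q_T A T)) dt in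
             (\<forall>j\<in>{0, 1}.
                H_norm (Q_gammaT A \<iota> \<gamma> T) parabolic 2
                  (\<lambda>z. (Dt ^^ j) (u 1) z - (Dt ^^ j) (u 2) z) \<le> B * \<delta> powr \<alpha> \<and>
                H_norm (Q_gammaT A \<iota> \<gamma> T) parabolic 2
                  (\<lambda>z. (Dt ^^ j) (m 1) z - (Dt ^^ j) (m 2) z) \<le> B * \<delta> powr \<alpha>) \<and>
             L2_norm (Omega_gamma A \<iota> \<gamma>) (\<lambda>x. b 1 x - b 2 x) \<le> B * \<delta> powr \<alpha>)))
     \<and>
     (\<forall>K1 K2 a s (u :: nat \<Rightarrow> _) (m :: nat \<Rightarrow> _) (b :: nat \<Rightarrow> _)
          (p :: nat \<Rightarrow> _) (q :: nat \<Rightarrow> _) (F :: nat \<Rightarrow> _) (G :: nat \<Rightarrow> _)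
          (f0 :: nat \<Rightarrow> _) (f1 :: nat \<Rightarrow> _) (g0 :: nat \<Rightarrow> _) (g1 :: nat \<Rightarrow> _).
          admissible_coefficients A T \<iota> M K1 K2 a s \<longrightarrow>
          (\<forall>i\<in>{1, 2}. (u i, m i) \<in> Y1 A T M \<and> b i \<in> Y2 A M \<and>
             solves_MFGS A T \<iota> K1 K2 a s (b i) (u i) (m i) \<and>
             has_data A T (u i) (p i) (F i) (f0 i) (f1 i) \<and>
             has_data A T (m i) (q i) (G i) (g0 i) (g1 i)) \<longrightarrow>
          (\<forall>(x, t)\<in>closure (Q_T A T). \<bar>interaction A \<iota> K1 K2 (m 2) x t\<bar> \<ge> c) \<longrightarrow>
          (\<forall>x\<in>Omega A. p 1 x = p 2 x \<and> q 1 x = q 2 x \<and> F 1 x = F 2 x \<and> G 1 x = G 2 x) \<longrightarrow>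
          (\<forall>z\<in>S_T A T - Gamma_minus_T A \<iota> T. f0 1 z = f0 2 z \<and> g0 1 z = g0 2 z) \<longrightarrow>
          (\<forall>(i, \<sigma>)\<in>known_faces \<iota>. \<forall>z\<in>face_T A T i \<sigma>. f1 1 z = f1 2 z \<and> g1 1 z = g1 2 z) \<longrightarrow>
          (\<forall>x\<in>Omega A. b 1 x = b 2 x))"
    (is "?stability & ?uniqueness")
proof -
 interpret space_time_box A T \<iota> by standard (use assms in auto)
 note M = assms(3) and c = assms(4) and g = assms(5,6)
 have M1: "M + 1 >= 1" using M by simp
 \<comment> \<open>Stated for every admissible distance from the unknown face: stability uses the
   given one, uniqueness one that depends on the point.\<close>
 have sup: "EX e0 K \<alpha>. 0 < e0 & e0 <= 1 & K >= 1 & 0 < \<alpha> & \<alpha> < (1::real) & (ALL K1 K2 a s u m b e.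
  config M c K1 K2 a s u m b & small e (Fd u) (Fd m) & 0 < e & e <= e0 -->
  (near \<gamma> (K * e powr \<alpha>) (Fd u) (Fd m) (%z. b 1 (fst z)) (%z. b 2 (fst z))))"
  if g: "0 < \<gamma>" "\<gamma> < 2 * A $ \<iota>" for \<gamma>
 proof -
  from sup_stability[OF M1 c g] obtain e0 K \<alpha> where 1: "0 < e0" "e0 <= 1" "K >= 1" "0 < \<alpha>" "\<alpha> < (1::real)"
   and 2: "!!FU GU FM GM a ai s st b b' K1 L e. sys (M + 1) c FU GU FM GM a ai s st b b' K1 L & small e (dif FU GU) (dif FM GM) & 0 < e & e <= e0 ==>
    near \<gamma> (K * e powr \<alpha>) (dif FU GU) (dif FM GM) b b'"
   by (elim exE conjE) (rule that, assumption, assumption, assumption, assumption, assumption, elim allE impE, assumption+)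
  show ?thesis
   by (rule exI[of _ e0], rule exI[of _ K], rule exI[of _ \<alpha>], intro conjI 1 allI impI, elim conjE, rule 2, intro conjI,
     rule config_sys, assumption, rule less_add_one, assumption+)
 qed
 have "?stability"
 proof -
  obtain e0 K \<alpha> where 1: "0 < e0" "e0 <= 1" "K >= 1" "0 < \<alpha>" "\<alpha> < (1::real)" and st: "!!K1 K2 a s u m b e.
   config M c K1 K2 a s u m b & small e (Fd u) (Fd m) & 0 < e & e <= e0 ==>
   near \<gamma> (K * e powr \<alpha>) (Fd u) (Fd m) (%z. b 1 (fst z)) (%z. b 2 (fst z))"
   using sup[OF g] by (elim exE conjE) (rule that, assumption, assumption, assumption, assumption, assumption, elim allE impE, assumption+)
  define r where "r = 1 / real (CARD('n) + 2)"
  obtain Kd where Kd: "Kd >= 1" and ds: "!!v p P f0 f1 \<delta> k k'. (ALL i:{1, 2}. fam6 (Fu v i) & bd6 (Fu v i) (M + 1) &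
    has_data A T (v i) (p i) (P i) (f0 i) (f1 i)) & 0 < \<delta> &
   H_norm (Omega A) isotropic k (%x. p 1 x - p 2 x) < \<delta> & H_norm (Omega A) isotropic k' (%x. P 1 x - P 2 x) < \<delta> &
   dirichlet_t_dist A T \<iota> (v 1) (v 2) < \<delta> & neumann_t_dist A T \<iota> (f1 1) (f1 2) < \<delta> ==>
   (ALL x t. x : Omega A --> t : {0, T} --> |Fd v [] (x, t)| <= Kd * (\<delta>^2) powr r) &
   (ALL i \<sigma> z. (i, \<sigma>) : known_faces \<iota> --> z : face_T A T i \<sigma> -->
    |Fd v [dt] z| <= Kd * (\<delta>^2) powr r & |Fd v [dx i, dt] z| <= Kd * (\<delta>^2) powr r)"
   using data_small[OF M1] unfolding r_def[symmetric] by (elim exE conjE) (rule that, assumption, elim allE impE, assumption+)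
  have r: "0 < r" "2 * r < 1" by (auto simp: r_def field_simps)
  define \<delta>0 where "\<delta>0 = min (1 / 2) ((e0 / Kd) powr (1 / (2 * r)))"
  define B0 where "B0 = sqrt (card (multi_indices (Basis :: ((real^'n) \<times> real) set) parabolic 2) * measure lborel (Q_gammaT A \<iota> \<gamma> T)) + sqrt (measure lborel (Omega_gamma A \<iota> \<gamma>)) + 1"
  define B where "B = B0 * (K * Kd powr \<alpha>)"
  have B0: "B0 >= 1" by (simp add: B0_def)
  have al: "0 < 2 * r * \<alpha>" "2 * r * \<alpha> < 1" using r 1 mult_strict_mono[of "2 * r" 1 \<alpha> 1] by auto
  have d0: "0 < \<delta>0" "\<delta>0 < 1" using 1 Kd by (auto simp: \<delta>0_def min_less_iff_disj)
  have B: "0 < B" using B0 1 Kd by (auto simp: B_def)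
  show ?thesis
  proof (rule exI[of _ \<delta>0], rule exI[of _ B], rule exI[of _ "2 * r * \<alpha>"], intro conjI d0 B al allI impI)
   fix K1 K2 a s and u m b p q F G f0 f1 g0 g1 :: "nat => _" and \<delta>
   assume adm: "admissible_coefficients A T \<iota> M K1 K2 a s"
    and sol: "ALL i:{1, 2}. (u i, m i) : Y1 A T M & b i : Y2 A M & solves_MFGS A T \<iota> K1 K2 a s (b i) (u i) (m i) &
     has_data A T (u i) (p i) (F i) (f0 i) (f1 i) & has_data A T (m i) (q i) (G i) (g0 i) (g1 i)"
    and low: "ALL (x, t):closure (Q_T A T). |interaction A \<iota> K1 K2 (m 2) x t| >= c" and d: "0 < \<delta>" "\<delta> < \<delta>0"
    and nu: "H_norm (Omega A) isotropic 4 (%x. p 1 x - p 2 x) < \<delta>" and nm: "H_norm (Omega A) isotropic 3 (%x. q 1 x - q 2 x) < \<delta>"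
    and nu2: "H_norm (Omega A) isotropic 4 (%x. F 1 x - F 2 x) < \<delta>" and nm2: "H_norm (Omega A) isotropic 3 (%x. G 1 x - G 2 x) < \<delta>"
    and bu: "dirichlet_t_dist A T \<iota> (u 1) (u 2) < \<delta>" "neumann_t_dist A T \<iota> (f1 1) (f1 2) < \<delta>"
    and bm: "dirichlet_t_dist A T \<iota> (m 1) (m 2) < \<delta>" "neumann_t_dist A T \<iota> (g1 1) (g1 2) < \<delta>"
   have cf: "config M c K1 K2 a s u m b" unfolding config_def using adm sol low by blast
   define e where "e = Kd * (\<delta>^2) powr r"
   have ee: "e = Kd * \<delta> powr (2 * r)" using d(1) by (simp add: e_def powr_powr flip: powr_numeral)
   have e: "0 < e" "e <= e0"
   proof -
    show "0 < e" using d Kd by (simp add: ee)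
    have "\<delta> powr (2 * r) <= ((e0 / Kd) powr (1 / (2 * r))) powr (2 * r)"
     using d r by (intro powr_mono2) (auto simp: \<delta>0_def)
    also have "... = e0 / Kd" using r 1 Kd by (simp add: powr_powr)
    finally show "e <= e0" using Kd by (simp add: ee field_simps)
   qed
   have u: "ALL i:{1, 2}. fam6 (Fu u i) & bd6 (Fu u i) (M + 1) & has_data A T (u i) (p i) (F i) (f0 i) (f1 i)"
    and m: "ALL i:{1, 2}. fam6 (Fu m i) & bd6 (Fu m i) (M + 1) & has_data A T (m i) (q i) (G i) (g0 i) (g1 i)"
    using sol by (intro ballI conjI config_fam[OF cf M]; blast)+
   note du = ds[OF conjI[OF u conjI[OF d(1) conjI[OF nu conjI[OF nu2 conjI[OF bu]]]]], folded e_def]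
   note dm = ds[OF conjI[OF m conjI[OF d(1) conjI[OF nm conjI[OF nm2 conjI[OF bm]]]]], folded e_def]
   have one: "(1::nat) : {1, 2}" "(2::nat) : {1, 2}" by auto
   have cD: "continuous_on Q (Fd v vs)" if "okp 6 vs" "ALL i:{1, 2}. fam6 (Fu v i) & X i" for v vs X
    unfolding dif_ext using that one by (intro continuous_on_diff fam_cont) blast+
   have "small e (Fd u) (Fd m)"
    by (rule small_from_open) (use cD[OF _ u] cD[OF _ m] du dm in blast)+
   note res = st[OF conjI[OF cf conjI[OF this conjI[OF e]]]]
   have "B0 * (K * e powr \<alpha>) = B * \<delta> powr (2 * r * \<alpha>)"
    using Kd d by (simp add: ee B_def powr_mult powr_powr)
   moreover have "0 <= K * e powr \<alpha>" using 1 by simp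
   ultimately show "let Dt = pd (closure (Q_T A T)) dt in
    (ALL j:{0, 1}. H_norm (Q_gammaT A \<iota> \<gamma> T) parabolic 2 (%z. (Dt ^^ j) (u 1) z - (Dt ^^ j) (u 2) z) <= B * \<delta> powr (2 * r * \<alpha>) &
      H_norm (Q_gammaT A \<iota> \<gamma> T) parabolic 2 (%z. (Dt ^^ j) (m 1) z - (Dt ^^ j) (m 2) z) <= B * \<delta> powr (2 * r * \<alpha>)) &
    L2_norm (Omega_gamma A \<iota> \<gamma>) (%x. b 1 x - b 2 x) <= B * \<delta> powr (2 * r * \<alpha>)"
    using conclusion[OF g M cf _ res, of B0] by (simp add: B0_def)
  qed
 qed
 moreover have "?uniqueness"
 proof (intro allI impI ballI)
  fix K1 K2 a s and u m b p q F G f0 f1 g0 g1 :: "nat => _" and x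
  assume adm: "admissible_coefficients A T \<iota> M K1 K2 a s"
   and sol: "ALL i:{1, 2}. (u i, m i) : Y1 A T M & b i : Y2 A M & solves_MFGS A T \<iota> K1 K2 a s (b i) (u i) (m i) &
    has_data A T (u i) (p i) (F i) (f0 i) (f1 i) & has_data A T (m i) (q i) (G i) (g0 i) (g1 i)"
   and low: "ALL (x, t):closure (Q_T A T). |interaction A \<iota> K1 K2 (m 2) x t| >= c"
   and e1: "ALL x:Omega A. p 1 x = p 2 x & q 1 x = q 2 x & F 1 x = F 2 x & G 1 x = G 2 x"
   and e2: "ALL z:S_T A T - Gamma_minus_T A \<iota> T. f0 1 z = f0 2 z & g0 1 z = g0 2 z"
   and e3: "ALL (i, \<sigma>):known_faces \<iota>. ALL z:face_T A T i \<sigma>. f1 1 z = f1 2 z & g1 1 z = g1 2 z"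
   and x: "x : Omega A"
  have cf: "config M c K1 K2 a s u m b" unfolding config_def using adm sol low by blast
  have u: "fam6 (Fu u i) & has_data A T (u i) (p i) (F i) (f0 i) (f1 i)"
   and m: "fam6 (Fu m i) & has_data A T (m i) (q i) (G i) (g0 i) (g1 i)" if "i : {1, 2}" for i
   using config_fam(1,3)[OF cf M that] sol that by blast+
  have e3': "f1 1 z = f1 2 z" "g1 1 z = g1 2 z" if "(i, \<sigma>) : known_faces \<iota>" "z : face_T A T i \<sigma>" for i \<sigma> z
   using bspec[OF e3 that(1), unfolded prod.case] that(2) by blast+
  have zu: "Fd u [] (x, t) = 0" "Fd m [] (x, t) = 0" if "x : Omega A" "t : {0, T}" for x t
   by (rule data_zero(1)[of u p F f0 f1, OF u _ _ e3'(1) that] data_zero(1)[of m q G g0 g1, OF m _ _ e3'(2) that]; use e1 e2 in blast)+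
  have zf: "Fd u [dt] z = 0 & Fd u [dx i, dt] z = 0" "Fd m [dt] z = 0 & Fd m [dx i, dt] z = 0"
   if "(i, \<sigma>) : known_faces \<iota>" "z : face_T A T i \<sigma>" for i \<sigma> z
   by (rule data_zero(2)[of u p F f0 f1, OF u _ _ e3'(1) that] data_zero(2)[of m q G g0 g1, OF m _ _ e3'(2) that]; use e1 e2 in blast)+
  have cD: "continuous_on Q (Fd v vs)" if "okp 6 vs" "!!i. i : {1, 2} ==> fam6 (Fu v i)" for v vs
   unfolding dif_ext using that by (intro continuous_on_diff fam_cont) auto
  \<comment> \<open>Coinciding data are small at every level \<open>e\<close>, so the pointwise
    bound for b1 - b2 is available with \<open>e\<close> tending to 0.\<close>
  have sml: "small e (Fd u) (Fd m)" if "0 < e" for e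
   by (rule small_from_open) (use cD u m zu zf that in auto)
  \<comment> \<open>Half the distance of \<open>x\<close> from the unknown face, so that
    \<open>x\<close> lies in the region covered by the estimate.\<close>
  define \<gamma>' where "\<gamma>' = (x $ \<iota> + A $ \<iota>) / 2"
  have "- A $ \<iota> < x $ \<iota>" "x $ \<iota> < A $ \<iota>" using x unfolding Omega_def by blast+
  then have g': "0 < \<gamma>'" "\<gamma>' < 2 * A $ \<iota>" "- A $ \<iota> + \<gamma>' <= x $ \<iota>" by (simp_all add: \<gamma>'_def)
  have z: "(x, 0) : Qg \<gamma>'"
   using x closure_subset[of "Omega A"] g'(3) T_pos unfolding mem_Qg[OF g'(1,2)] closure_Omega by (auto simp: Q_Times')
  obtain e0 K \<alpha> where 1: "0 < e0" "K >= 1" "0 < \<alpha>" and st: "!!e. 0 < e ==> e <= e0 ==> |b 1 x - b 2 x| <= K * e powr \<alpha>"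
  proof -
   from sup[OF g'(1,2)] obtain e0 K \<alpha> where 1: "0 < e0" "K >= 1" "0 < \<alpha>" and st: "!!K1 K2 a s u m b e.
    config M c K1 K2 a s u m b & small e (Fd u) (Fd m) & 0 < e & e <= e0 ==>
    near \<gamma>' (K * e powr \<alpha>) (Fd u) (Fd m) (%z. b 1 (fst z)) (%z. b 2 (fst z))"
    by (elim exE conjE) (rule that, assumption, assumption, assumption, elim allE impE, assumption+)
   have "|b 1 x - b 2 x| <= K * e powr \<alpha>" if e: "0 < e" "e <= e0" for e
    using conjunct2[OF bspec[OF st[OF conjI[OF cf conjI[OF sml[OF e(1)] conjI[OF e]]]] z]] by simp
   then show thesis using that 1 by blast
  qed
  show "b 1 x = b 2 x"
  proof (rule ccontr)
   define d where "d = |b 1 x - b 2 x|"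
   assume "b 1 x ~= b 2 x"
   then have d: "d > 0" by (simp add: d_def)
   \<comment> \<open>So small that the bound is at most half of the supposed difference
     \<open>d\<close>.\<close>
   define e where "e = min e0 ((d / (2 * K)) powr (1 / \<alpha>))"
   have e: "0 < e" "e <= e0" using 1 d by (auto simp: e_def)
   have "e powr \<alpha> <= ((d / (2 * K)) powr (1 / \<alpha>)) powr \<alpha>"
    using e 1 by (intro powr_mono2) (auto simp: e_def)
   also have "... = d / (2 * K)" using 1 d by (simp add: powr_powr)
   finally have "K * e powr \<alpha> <= d / 2" using 1 by (simp add: field_simps)
   then show False using st[OF e] d by (simp add: d_def)
  qed
 qed
 ultimately show ?thesis by blast
qed

end
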